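(* Let $\mathcal{D}=(G,\chi,g,0)$ and $\mathcal{D}'=(G,\chi',g,0)$ be two group data of nilpotent type, and let $n\ge 2$ be the order of $\chi(g)$. Put $G_k=\{h\in G\mid h^2=g^{-k}\}$, and let $$\vartheta=\sum_{k=0}^{n-1}\sum_{h\in G_k}(-1)^k h^{-k}g^{-\frac{k(1+k)}{2}}\in\Bbbk G.$$ Suppose that $\chi(\vartheta)\ne\chi'(\vartheta)$ and that there is an automorphism $\delta$ of the Green ring $r(\Bbbk G)$ such that $\delta(a)=a'$, where $a=[V_{\chi^{-1}}]$ and $a'=[V_{\chi'^{-1}}]$. Then the representation categories of the Hopf algebras $H_{\mathcal D}$ and $H_{\mathcal D'}$ are not tensor equivalent, but the Green rings $r(H_{\mathcal D})$ and $r(H_{\mathcal D'})$ are isomorphic.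
   Context: $\Bbbk$ is an algebraically closed field of characteristic zero; modules are finite dimensional left modules; $\otimes=\otimes_{\Bbbk}$. A group datum of nilpotent type of the form $(G,\psi,g,0)$ consists of a finite group $G$, an element $g$ of the center of $G$, and a $\Bbbk$-linear character $\psi$ of $G$ (extended linearly to $\Bbbk G$). Let $n_\psi$ be the order of $\psi(g)$. The Hopf algebra attached to $(G,\psi,g,0)$ is the $\Bbbk$-algebra generated by $y$ and the elements $h\in G$, containing $\Bbbk G$ as a subalgebra, with relations $y^{n_\psi}=0$ and $yh=\psi(h)hy$ for $h\in G$; it has basis $\{y^ih\mid h\in G,\ 0\le i\le n_\psi-1\}$. Its Hopf structure is given by $\Delta(y)=y\otimes g+1\otimes y$, $\varepsilon(y)=0$, $S(y)=-yg^{-1}$, and $\Delta(h)=h\otimes h$, $\varepsilon(h)=1$, $S(h)=h^{-1}$ for $h\in G$. $H_{\mathcal D}$ and $H_{\mathcal D'}$ are the Hopf algebras attached in this way to $\mathcal D$ (with $\psi=\chi$, $n_\chi=n$) and $\mathcal D'$ (with $\psi=\chi'$). $V_{\chi^{-1}}$ is the one-dimensional $\Bbbk G$-module with character $\chi^{-1}$, and similarly $V_{\chi'^{-1}}$ for $\chi'^{-1}$. The Green ring $r(A)$ of a Hopf algebra $A$ is the free abelian group on isomorphism classes $[V]$ of finite dimensional $A$-modules modulo the relations $[M\oplus N]=[M]+[N]$, with product $[M][N]=[M\otimes N]$; automorphisms and isomorphisms of Green rings are ring automorphisms and isomorphisms. The representation category of a Hopf algebra is the tensor category of its finite dimensional 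modules.
   Formalization: The formal statement additionally assumes that χ'(g) also has order n; without it the claim is false, since if the orders of χ(g) and χ'(g) differ, the Green rings of the two Hopf algebras have different ranks and cannot be isomorphic. *)

theory Defs
  imports
    "HOL-Algebra.QuotRing"
    "HOL-Algebra.Free_Abelian_Groups"
    "HOL-Computational_Algebra.Polynomial"
    "Jordan_Normal_Form.Matrix"
begin

section \<open>Finite dimensional Hopf algebras and their modules\<close>

text \<open>
  A finite dimensional Hopf algebra is given by its structure constants with respect to a finite
  basis: an element is a coefficient function on \<open>basis\<close>, and an element of the tensor square is a
  coefficient function on \<open>basis \<times> basis\<close>. The record holds the values of the structure maps on basis
  elements.
\<close>

record ('b, 'k) hopf =
  basis :: "'b set"
  prd :: "'b \<Rightarrow> 'b \<Rightarrow> 'b \<Rightarrow> 'k"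
  unt :: "'b \<Rightarrow> 'k"
  coprd :: "'b \<Rightarrow> 'b \<times> 'b \<Rightarrow> 'k"
  counit :: "'b \<Rightarrow> 'k"
  antipode :: "'b \<Rightarrow> 'b \<Rightarrow> 'k"

definition bilin :: "'b set \<Rightarrow> ('b \<Rightarrow> 'b \<Rightarrow> 'b \<Rightarrow> 'k::field) \<Rightarrow> ('b \<Rightarrow> 'k) \<Rightarrow> ('b \<Rightarrow> 'k) \<Rightarrow> 'b \<Rightarrow> 'k"
  where "bilin B m x y = (\<lambda>c. \<Sum>a\<in>B. \<Sum>b\<in>B. x a * y b * m a b c)"

definition apow :: "'b set \<Rightarrow> ('b \<Rightarrow> 'b \<Rightarrow> 'b \<Rightarrow> 'k::field) \<Rightarrow> ('b \<Rightarrow> 'k) \<Rightarrow> ('b \<Rightarrow> 'k) \<Rightarrow> nat \<Rightarrow> 'b \<Rightarrow> 'k"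
  where "apow B m e x i = (bilin B m x ^^ i) e"

definition tens :: "('b \<Rightarrow> 'k::field) \<Rightarrow> ('b \<Rightarrow> 'k) \<Rightarrow> 'b \<times> 'b \<Rightarrow> 'k"
  where "tens x y = (\<lambda>(p, q). x p * y q)"

definition tens_prd ::
    "('b \<Rightarrow> 'b \<Rightarrow> 'b \<Rightarrow> 'k::field) \<Rightarrow> 'b \<times> 'b \<Rightarrow> 'b \<times> 'b \<Rightarrow> 'b \<times> 'b \<Rightarrow> 'k"
  where "tens_prd m p q = tens (m (fst p) (fst q)) (m (snd p) (snd q))"

text \<open>
  A finite dimensional left module is a module structure on the column space \<open>k^rdim\<close>; \<open>rmat M b\<close> is
  the matrix by which the basis element \<open>b\<close> acts. Every finite dimensional module is isomorphic to
  one of these. Module maps are matrices.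
\<close>

record ('b, 'k) rep =
  rdim :: nat
  rmat :: "'b \<Rightarrow> 'k mat"

definition act :: "('b, 'k::field) hopf \<Rightarrow> ('b, 'k) rep \<Rightarrow> ('b \<Rightarrow> 'k) \<Rightarrow> 'k mat"
  where "act H M x = mat (rdim M) (rdim M) (\<lambda>ij. \<Sum>b\<in>basis H. x b * rmat M b $$ ij)"

definition reps :: "('b, 'k::field) hopf \<Rightarrow> ('b, 'k) rep set"
  where "reps H = {M. rmat M \<in> basis H \<rightarrow>\<^sub>E carrier_mat (rdim M) (rdim M)
    \<and> act H M (unt H) = 1\<^sub>m (rdim M)
    \<and> (\<forall>b\<in>basis H. \<forall>c\<in>basis H. act H M (prd H b c) = rmat M b * rmat M c)}"

definition rep_hom :: "('b, 'k::field) hopf \<Rightarrow> ('b, 'k) rep \<Rightarrow> ('b, 'k) rep \<Rightarrow> 'k mat set"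
  where "rep_hom H M N = {f \<in> carrier_mat (rdim N) (rdim M). \<forall>b\<in>basis H. rmat N b * f = f * rmat M b}"

definition rep_iso :: "('b, 'k::field) hopf \<Rightarrow> ('b, 'k) rep \<Rightarrow> ('b, 'k) rep \<Rightarrow> bool"
  where "rep_iso H M N \<longleftrightarrow> (\<exists>f\<in>rep_hom H M N. \<exists>g\<in>rep_hom H N M.
    g * f = 1\<^sub>m (rdim M) \<and> f * g = 1\<^sub>m (rdim N))"

definition rep_sum :: "('b, 'k::field) hopf \<Rightarrow> ('b, 'k) rep \<Rightarrow> ('b, 'k) rep \<Rightarrow> ('b, 'k) rep"
  where "rep_sum H M N = \<lparr>rdim = rdim M + rdim N,
    rmat = (\<lambda>b\<in>basis H. four_block_mat (rmat M b) (0\<^sub>m (rdim M) (rdim N))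
                                        (0\<^sub>m (rdim N) (rdim M)) (rmat N b))\<rparr>"

text \<open>
  The tensor product of the standard basis vectors \<open>e_i\<close> of \<open>k^m\<close> and \<open>e_j\<close> of \<open>k^n\<close> is the basis
  vector \<open>e_(i * n + j)\<close> of \<open>k^(m * n)\<close>.
\<close>

definition kron :: "'k::field mat \<Rightarrow> 'k mat \<Rightarrow> 'k mat"
  where "kron A B = mat (dim_row A * dim_row B) (dim_col A * dim_col B)
    (\<lambda>(i, j). A $$ (i div dim_row B, j div dim_col B) * B $$ (i mod dim_row B, j mod dim_col B))"

definition rep_tensor :: "('b, 'k::field) hopf \<Rightarrow> ('b, 'k) rep \<Rightarrow> ('b, 'k) rep \<Rightarrow> ('b, 'k) rep"
  where "rep_tensor H M N = \<lparr>rdim = rdim M * rdim N,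
    rmat = (\<lambda>b\<in>basis H. mat (rdim M * rdim N) (rdim M * rdim N)
      (\<lambda>ij. \<Sum>p\<in>basis H \<times> basis H. coprd H b p * kron (rmat M (fst p)) (rmat N (snd p)) $$ ij))\<rparr>"

definition rep_unit :: "('b, 'k::field) hopf \<Rightarrow> ('b, 'k) rep"
  where "rep_unit H = \<lparr>rdim = 1, rmat = (\<lambda>b\<in>basis H. mat 1 1 (\<lambda>_. counit H b))\<rparr>"


section \<open>The Green ring\<close>

definition iso_class :: "('b, 'k::field) hopf \<Rightarrow> ('b, 'k) rep \<Rightarrow> ('b, 'k) rep set"
  where "iso_class H M = {N \<in> reps H. rep_iso H M N}"

definition class_tensor ::
    "('b, 'k::field) hopf \<Rightarrow> ('b, 'k) rep set \<Rightarrow> ('b, 'k) rep set \<Rightarrow> ('b, 'k) rep set"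
  where "class_tensor H X Y = {P. \<exists>M\<in>X. \<exists>N\<in>Y. P \<in> iso_class H (rep_tensor H M N)}"

abbreviation sgl :: "('b, 'k::field) hopf \<Rightarrow> ('b, 'k) rep \<Rightarrow> ('b, 'k) rep set \<Rightarrow>\<^sub>0 int"
  where "sgl H M \<equiv> Poly_Mapping.single (iso_class H M) 1"

text \<open>
  The free abelian group on isomorphism classes with the bilinear extension of the tensor product.
\<close>

definition free_green :: "('b, 'k::field) hopf \<Rightarrow> (('b, 'k) rep set \<Rightarrow>\<^sub>0 int) ring"
  where "free_green H = \<lparr>
    carrier = carrier (free_Abelian_group (iso_class H ` reps H)),
    monoid.mult = (\<lambda>f g. \<Sum>X\<in>Poly_Mapping.keys f. \<Sum>Y\<in>Poly_Mapping.keys g.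
      Poly_Mapping.single (class_tensor H X Y) (Poly_Mapping.lookup f X * Poly_Mapping.lookup g Y)),
    one = sgl H (rep_unit H),
    ring.zero = 0,
    ring.add = (+)\<rparr>"

definition green_rel :: "('b, 'k::field) hopf \<Rightarrow> (('b, 'k) rep set \<Rightarrow>\<^sub>0 int) set"
  where "green_rel H = generate (add_monoid (free_green H))
    {sgl H (rep_sum H M N) - (sgl H M + sgl H N) | M N. M \<in> reps H \<and> N \<in> reps H}"

definition green_ring :: "('b, 'k::field) hopf \<Rightarrow> (('b, 'k) rep set \<Rightarrow>\<^sub>0 int) set ring"
  where "green_ring H = free_green H Quot green_rel H"

definition green_class :: "('b, 'k::field) hopf \<Rightarrow> ('b, 'k) rep \<Rightarrow> (('b, 'k) rep set \<Rightarrow>\<^sub>0 int) set"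
  where "green_class H M = green_rel H +>\<^bsub>free_green H\<^esub> sgl H M"


section \<open>Tensor categories and tensor equivalence\<close>

text \<open>
  The data of a \<open>k\<close>-linear monoidal category. A morphism value may belong to several hom sets, so
  functors act on morphisms together with their source and target.
\<close>

record ('o, 'm, 'k) tensor_cat =
  Obj :: "'o set"
  Hom :: "'o \<Rightarrow> 'o \<Rightarrow> 'm set"
  Ident :: "'o \<Rightarrow> 'm"
  Comp :: "'m \<Rightarrow> 'm \<Rightarrow> 'm"
  Plus :: "'m \<Rightarrow> 'm \<Rightarrow> 'm"
  Scale :: "'k \<Rightarrow> 'm \<Rightarrow> 'm"
  TObj :: "'o \<Rightarrow> 'o \<Rightarrow> 'o"
  TMor :: "'m \<Rightarrow> 'm \<Rightarrow> 'm"
  TUnit :: "'o"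
  Assoc :: "'o \<Rightarrow> 'o \<Rightarrow> 'o \<Rightarrow> 'm"
  LUnit :: "'o \<Rightarrow> 'm"
  RUnit :: "'o \<Rightarrow> 'm"

definition is_iso :: "('o, 'm, 'k) tensor_cat \<Rightarrow> 'o \<Rightarrow> 'o \<Rightarrow> 'm \<Rightarrow> bool"
  where "is_iso C X Y f \<longleftrightarrow> f \<in> Hom C X Y
    \<and> (\<exists>g\<in>Hom C Y X. Comp C g f = Ident C X \<and> Comp C f g = Ident C Y)"

definition linear_functor ::
    "('o1, 'm1, 'k) tensor_cat \<Rightarrow> ('o2, 'm2, 'k) tensor_cat \<Rightarrow>
     ('o1 \<Rightarrow> 'o2) \<Rightarrow> ('o1 \<Rightarrow> 'o1 \<Rightarrow> 'm1 \<Rightarrow> 'm2) \<Rightarrow> bool"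
  where "linear_functor C D F0 F1 \<longleftrightarrow>
    (\<forall>X\<in>Obj C. F0 X \<in> Obj D)
    \<and> (\<forall>X\<in>Obj C. \<forall>Y\<in>Obj C. \<forall>f\<in>Hom C X Y. F1 X Y f \<in> Hom D (F0 X) (F0 Y))
    \<and> (\<forall>X\<in>Obj C. F1 X X (Ident C X) = Ident D (F0 X))
    \<and> (\<forall>X\<in>Obj C. \<forall>Y\<in>Obj C. \<forall>Z\<in>Obj C. \<forall>f\<in>Hom C X Y. \<forall>g\<in>Hom C Y Z.
         F1 X Z (Comp C g f) = Comp D (F1 Y Z g) (F1 X Y f))
    \<and> (\<forall>X\<in>Obj C. \<forall>Y\<in>Obj C. \<forall>f\<in>Hom C X Y. \<forall>g\<in>Hom C X Y.
         F1 X Y (Plus C f g) = Plus D (F1 X Y f) (F1 X Y g))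
    \<and> (\<forall>X\<in>Obj C. \<forall>Y\<in>Obj C. \<forall>f\<in>Hom C X Y. \<forall>c.
         F1 X Y (Scale C c f) = Scale D c (F1 X Y f))"

definition natural_iso ::
    "('o1, 'm1, 'k) tensor_cat \<Rightarrow> ('o2, 'm2, 'k) tensor_cat \<Rightarrow>
     ('o1 \<Rightarrow> 'o2) \<Rightarrow> ('o1 \<Rightarrow> 'o1 \<Rightarrow> 'm1 \<Rightarrow> 'm2) \<Rightarrow>
     ('o1 \<Rightarrow> 'o2) \<Rightarrow> ('o1 \<Rightarrow> 'o1 \<Rightarrow> 'm1 \<Rightarrow> 'm2) \<Rightarrow> ('o1 \<Rightarrow> 'm2) \<Rightarrow> bool"
  where "natural_iso C D F0 F1 G0 G1 \<eta> \<longleftrightarrow>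
    (\<forall>X\<in>Obj C. is_iso D (F0 X) (G0 X) (\<eta> X))
    \<and> (\<forall>X\<in>Obj C. \<forall>Y\<in>Obj C. \<forall>f\<in>Hom C X Y. Comp D (\<eta> Y) (F1 X Y f) = Comp D (G1 X Y f) (\<eta> X))"

definition equivalence_functor ::
    "('o1, 'm1, 'k) tensor_cat \<Rightarrow> ('o2, 'm2, 'k) tensor_cat \<Rightarrow>
     ('o1 \<Rightarrow> 'o2) \<Rightarrow> ('o1 \<Rightarrow> 'o1 \<Rightarrow> 'm1 \<Rightarrow> 'm2) \<Rightarrow> bool"
  where "equivalence_functor C D F0 F1 \<longleftrightarrow> linear_functor C D F0 F1
    \<and> (\<exists>G0 G1 \<eta> \<epsilon>. linear_functor D C G0 G1
        \<and> natural_iso C C (\<lambda>X. X) (\<lambda>X Y f. f) (\<lambda>X. G0 (F0 X)) (\<lambda>X Y f. G1 (F0 X) (F0 Y) (F1 X Y f)) \<eta>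
        \<and> natural_iso D D (\<lambda>X. F0 (G0 X)) (\<lambda>X Y f. F1 (G0 X) (G0 Y) (G1 X Y f)) (\<lambda>X. X) (\<lambda>X Y f. f) \<epsilon>)"

text \<open>A tensor structure consists of \<open>J X Y : F X \<otimes> F Y \<rightarrow> F (X \<otimes> Y)\<close> and \<open>\<phi> : 1 \<rightarrow> F 1\<close>.\<close>

definition tensor_structure ::
    "('o1, 'm1, 'k) tensor_cat \<Rightarrow> ('o2, 'm2, 'k) tensor_cat \<Rightarrow>
     ('o1 \<Rightarrow> 'o2) \<Rightarrow> ('o1 \<Rightarrow> 'o1 \<Rightarrow> 'm1 \<Rightarrow> 'm2) \<Rightarrow> ('o1 \<Rightarrow> 'o1 \<Rightarrow> 'm2) \<Rightarrow> 'm2 \<Rightarrow> bool"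
  where "tensor_structure C D F0 F1 J \<phi> \<longleftrightarrow>
    (\<forall>X\<in>Obj C. \<forall>Y\<in>Obj C. is_iso D (TObj D (F0 X) (F0 Y)) (F0 (TObj C X Y)) (J X Y))
    \<and> (\<forall>X\<in>Obj C. \<forall>X'\<in>Obj C. \<forall>Y\<in>Obj C. \<forall>Y'\<in>Obj C. \<forall>f\<in>Hom C X X'. \<forall>g\<in>Hom C Y Y'.
         Comp D (J X' Y') (TMor D (F1 X X' f) (F1 Y Y' g))
         = Comp D (F1 (TObj C X Y) (TObj C X' Y') (TMor C f g)) (J X Y))
    \<and> is_iso D (TUnit D) (F0 (TUnit C)) \<phi>
    \<and> (\<forall>X\<in>Obj C. \<forall>Y\<in>Obj C. \<forall>Z\<in>Obj C.
         Comp D (F1 (TObj C (TObj C X Y) Z) (TObj C X (TObj C Y Z)) (Assoc C X Y Z))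
           (Comp D (J (TObj C X Y) Z) (TMor D (J X Y) (Ident D (F0 Z))))
         = Comp D (J X (TObj C Y Z))
             (Comp D (TMor D (Ident D (F0 X)) (J Y Z)) (Assoc D (F0 X) (F0 Y) (F0 Z))))
    \<and> (\<forall>X\<in>Obj C.
         Comp D (F1 (TObj C (TUnit C) X) X (LUnit C X))
           (Comp D (J (TUnit C) X) (TMor D \<phi> (Ident D (F0 X)))) = LUnit D (F0 X))
    \<and> (\<forall>X\<in>Obj C.
         Comp D (F1 (TObj C X (TUnit C)) X (RUnit C X))
           (Comp D (J X (TUnit C)) (TMor D (Ident D (F0 X)) \<phi>)) = RUnit D (F0 X))"

definition tensor_equivalent :: "('o1, 'm1, 'k) tensor_cat \<Rightarrow> ('o2, 'm2, 'k) tensor_cat \<Rightarrow> bool"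
  where "tensor_equivalent C D \<longleftrightarrow>
    (\<exists>F0 F1 J \<phi>. equivalence_functor C D F0 F1 \<and> tensor_structure C D F0 F1 J \<phi>)"

text \<open>
  With the basis ordering used in \<^const>\<open>kron\<close>, the associativity isomorphism
  \<open>(x \<otimes> y) \<otimes> z \<mapsto> x \<otimes> (y \<otimes> z)\<close> and the unit isomorphisms \<open>1 \<otimes> x \<mapsto> x\<close>, \<open>x \<otimes> 1 \<mapsto> x\<close> are given by
  identity matrices.
\<close>

definition rep_cat :: "('b, 'k::field) hopf \<Rightarrow> (('b, 'k) rep, 'k mat, 'k) tensor_cat"
  where "rep_cat H = \<lparr>
    Obj = reps H,
    Hom = rep_hom H,
    Ident = (\<lambda>M. 1\<^sub>m (rdim M)),
    Comp = (*),
    Plus = (+),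
    Scale = smult_mat,
    TObj = rep_tensor H,
    TMor = kron,
    TUnit = rep_unit H,
    Assoc = (\<lambda>M N P. 1\<^sub>m (rdim M * rdim N * rdim P)),
    LUnit = (\<lambda>M. 1\<^sub>m (rdim M)),
    RUnit = (\<lambda>M. 1\<^sub>m (rdim M))\<rparr>"


section \<open>Group data of nilpotent type and the attached Hopf algebras\<close>

definition lin_character :: "('g, 'm) monoid_scheme \<Rightarrow> ('g \<Rightarrow> 'k::field) \<Rightarrow> bool"
  where "lin_character G \<psi> \<longleftrightarrow> (\<forall>x\<in>carrier G. \<psi> x \<noteq> 0)
    \<and> (\<forall>x\<in>carrier G. \<forall>y\<in>carrier G. \<psi> (x \<otimes>\<^bsub>G\<^esub> y) = \<psi> x * \<psi> y)"

text \<open>The group datum \<open>(G, \<psi>, g, 0)\<close> of nilpotent type; the scalar \<open>0\<close> is left implicit.\<close>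

definition nilpotent_group_datum :: "('g, 'm) monoid_scheme \<Rightarrow> ('g \<Rightarrow> 'k::field) \<Rightarrow> 'g \<Rightarrow> bool"
  where "nilpotent_group_datum G \<psi> g \<longleftrightarrow> group G \<and> finite (carrier G)
    \<and> g \<in> carrier G \<and> (\<forall>h\<in>carrier G. g \<otimes>\<^bsub>G\<^esub> h = h \<otimes>\<^bsub>G\<^esub> g)
    \<and> lin_character G \<psi>"

definition mult_order :: "'k::field \<Rightarrow> nat"
  where "mult_order x = (LEAST m. 0 < m \<and> x ^ m = 1)"

definition group_algebra :: "('g, 'm) monoid_scheme \<Rightarrow> ('g, 'k::field) hopf"
  where "group_algebra G = \<lparr>
    basis = carrier G,
    prd = (\<lambda>h l x. of_bool (x = h \<otimes>\<^bsub>G\<^esub> l)),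
    unt = (\<lambda>x. of_bool (x = \<one>\<^bsub>G\<^esub>)),
    coprd = (\<lambda>h p. of_bool (p = (h, h))),
    counit = (\<lambda>_. 1),
    antipode = (\<lambda>h x. of_bool (x = inv\<^bsub>G\<^esub> h))\<rparr>"

definition char_rep :: "('g, 'm) monoid_scheme \<Rightarrow> ('g \<Rightarrow> 'k::field) \<Rightarrow> ('g, 'k) rep"
  where "char_rep G \<psi> = \<lparr>rdim = 1, rmat = (\<lambda>h\<in>carrier G. mat 1 1 (\<lambda>_. \<psi> h))\<rparr>"

text \<open>\<open>ymon n i h\<close> is the element \<open>y^i h\<close>; it vanishes for \<open>i \<ge> n\<close> because \<open>y^n = 0\<close>.\<close>

definition ymon :: "nat \<Rightarrow> nat \<Rightarrow> 'g \<Rightarrow> nat \<times> 'g \<Rightarrow> 'k::field"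
  where "ymon n i h = (\<lambda>p. of_bool (i < n \<and> p = (i, h)))"

text \<open>
  The Hopf algebra attached to \<open>(G, \<psi>, g, 0)\<close>; the index \<open>(i, h)\<close> stands for the basis element
  \<open>y^i h\<close>. The relation \<open>y h = \<psi>(h) h y\<close> gives \<open>(y^i h) (y^j l) = \<psi>(h)^(-j) y^(i+j) (h l)\<close>. The
  comultiplication is the multiplicative extension \<open>\<Delta>(y^i h) = \<Delta>(y)^i \<Delta>(h)\<close>, computed in the tensor
  square algebra, and the antipode is the antimultiplicative extension \<open>S(y^i h) = S(h) S(y)^i\<close>.
\<close>

definition datum_basis :: "('g, 'm) monoid_scheme \<Rightarrow> ('g \<Rightarrow> 'k::field) \<Rightarrow> 'g \<Rightarrow> (nat \<times> 'g) set"
  where "datum_basis G \<psi> g = {..<mult_order (\<psi> g)} \<times> carrier G"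

definition datum_prd ::
    "('g, 'm) monoid_scheme \<Rightarrow> ('g \<Rightarrow> 'k::field) \<Rightarrow> 'g \<Rightarrow> nat \<times> 'g \<Rightarrow> nat \<times> 'g \<Rightarrow> nat \<times> 'g \<Rightarrow> 'k"
  where "datum_prd G \<psi> g = (\<lambda>(i, h) (j, l) p.
    inverse (\<psi> h) ^ j * ymon (mult_order (\<psi> g)) (i + j) (h \<otimes>\<^bsub>G\<^esub> l) p)"

definition datum_coprd_y ::
    "('g, 'm) monoid_scheme \<Rightarrow> ('g \<Rightarrow> 'k::field) \<Rightarrow> 'g \<Rightarrow> (nat \<times> 'g) \<times> (nat \<times> 'g) \<Rightarrow> 'k"
  where "datum_coprd_y G \<psi> g = (let n = mult_order (\<psi> g) in
    (\<lambda>p. tens (ymon n 1 \<one>\<^bsub>G\<^esub>) (ymon n 0 g) p + tens (ymon n 0 \<one>\<^bsub>G\<^esub>) (ymon n 1 \<one>\<^bsub>G\<^esub>) p))"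

definition datum_antipode_y :: "('g, 'm) monoid_scheme \<Rightarrow> ('g \<Rightarrow> 'k::field) \<Rightarrow> 'g \<Rightarrow> nat \<times> 'g \<Rightarrow> 'k"
  where "datum_antipode_y G \<psi> g = (\<lambda>p. - ymon (mult_order (\<psi> g)) 1 (inv\<^bsub>G\<^esub> g) p)"

definition datum_hopf :: "('g, 'm) monoid_scheme \<Rightarrow> ('g \<Rightarrow> 'k::field) \<Rightarrow> 'g \<Rightarrow> (nat \<times> 'g, 'k) hopf"
  where "datum_hopf G \<psi> g = (let
      n = mult_order (\<psi> g);
      B = datum_basis G \<psi> g;
      m = datum_prd G \<psi> g;
      e = ymon n 0 \<one>\<^bsub>G\<^esub>
    in \<lparr>
      basis = B,
      prd = m,
      unt = e,
      coprd = (\<lambda>(i, h). bilin (B \<times> B) (tens_prd m)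
        (apow (B \<times> B) (tens_prd m) (tens e e) (datum_coprd_y G \<psi> g) i)
        (tens (ymon n 0 h) (ymon n 0 h))),
      counit = (\<lambda>(i, h). of_bool (i = 0)),
      antipode = (\<lambda>(i, h). bilin B m (ymon n 0 (inv\<^bsub>G\<^esub> h)) (apow B m e (datum_antipode_y G \<psi> g) i))\<rparr>)"

text \<open>The element \<open>\<vartheta>\<close> of the group algebra and the linear extension of a character.\<close>

definition root_set :: "('g, 'm) monoid_scheme \<Rightarrow> 'g \<Rightarrow> nat \<Rightarrow> 'g set"
  where "root_set G g k = {h \<in> carrier G. h [^]\<^bsub>G\<^esub> (2::nat) = g [^]\<^bsub>G\<^esub> (- int k)}"

definition theta :: "('g, 'm) monoid_scheme \<Rightarrow> 'g \<Rightarrow> nat \<Rightarrow> 'g \<Rightarrow> 'k::field"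
  where "theta G g n = (\<lambda>x. \<Sum>k=0..n-1. \<Sum>h\<in>root_set G g k.
    (-1) ^ k * of_bool (x = h [^]\<^bsub>G\<^esub> (- int k) \<otimes>\<^bsub>G\<^esub> g [^]\<^bsub>G\<^esub> (- int (k * (1 + k) div 2))))"

definition char_lin :: "('g, 'm) monoid_scheme \<Rightarrow> ('g \<Rightarrow> 'k::field) \<Rightarrow> ('g \<Rightarrow> 'k) \<Rightarrow> 'k"
  where "char_lin G \<psi> u = (\<Sum>x\<in>carrier G. u x * \<psi> x)"

end

theory Submission
  imports Defs "Jordan_Normal_Form.Determinant" "HOL-Algebra.Multiplicative_Group"
begin

text \<open>
  A module over \<open>H = H(G, \<chi>, g, 0)\<close> is a \<open>G\<close>-module with a nilpotent operator \<open>y\<close>. Every such module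
  is a direct sum of modules \<open>V \<otimes> M\<^sub>j\<close>, where \<open>V\<close> is a \<open>G\<close>-module and \<open>M\<^sub>j\<close> is uniserial of length
  \<open>j \<le> n\<close>, and it is determined up to isomorphism by the characters of the quotients \<open>M / ker y\<^sup>i\<close>.
  Hence \<open>r(H)\<close> is a free left \<open>r(kG)\<close>-module on the classes \<open>e\<^sub>j = [M\<^sub>j]\<close>, with
  \<open>e\<^sub>2 e\<^sub>j = e\<^sub>j\<^sub>+\<^sub>1 + a e\<^sub>j\<^sub>-\<^sub>1\<close> for \<open>j < n\<close> and \<open>e\<^sub>2 e\<^sub>n = (1 + a) e\<^sub>n\<close>. These formulas involve only
  \<open>a = [V\<^bsub>\<chi>\<^sup>-\<^sup>1\<^esub>]\<close>, so applying \<open>\<delta>\<close> to the coefficients is a ring isomorphism.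

  The representation categories are distinguished by the trace of the antipode, which equals
  \<open>\<chi>(\<vartheta>)\<close>. A tensor equivalence \<open>F\<close> sends the regular module to the regular module, because both
  absorb tensor factors; this gives natural linear isomorphisms \<open>V \<cong> F V\<close> and transports
  evaluation and coevaluation to elements \<open>q\<close> and \<open>b\<close> of \<open>H\<close> with \<open>b q = 1\<close>. The antipode of the
  second algebra then corresponds to \<open>x \<mapsto> b S(x) q\<close>. The trace of this map depends only on the
  group-like parts of \<open>b\<close> and \<open>q\<close>, and comparing the traces of the endomorphisms of \<open>kG\<close> with the
  scalars obtained from evaluation and coevaluation shows that it equals the trace of \<open>S\<close>.
\<close>

section \<open>Matrices\<close>

text \<open>The antipode S sends y^k h to a multiple of y^k h^{-1} g^{-k}, so its trace only sees
  the h with h^2 = g^{-k}; the scalars on these fixed lines are the values of \<chi> on the terms of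
  \<open>theta\<close>. The obstacle is that this trace is not visibly an invariant of the tensor
  category: an equivalence need not respect underlying vector spaces, and its tensor structure
  alters the antipode by elements b and q that need not be central. For group elements l and l', the
  trace of x \<mapsto> l S(x) l' depends only on the conjugacy class of l'^{-1} l. Right
  translations of kG have trace |G| at 1 and 0 elsewhere; transported by the equivalence, this says
  that the coefficients of b and q are distributed over the classes like those of the unit. kG is
  the test module because it equals its own dual, so that evaluation can be composed with
  coevaluation. On the side of Green rings, modules are compared through additive characters, so
  that cancelling a direct summand is a subtraction of functions. The ring r(H) is generated by e_2
  and the coefficients, so multiplicativity has to be checked only for these.\<close>

lemma mult_assoc_dim:
  "dim_col A = dim_row B \<Longrightarrow> dim_col B = dim_row C \<Longrightarrow> A * B * C = A * (B * (C :: 'a::semiring_0 mat))"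
  by (rule assoc_mult_mat[of _ "dim_row A" "dim_row B" _ "dim_row C" _ "dim_col C"]) auto

text \<open>The premises are equations between dimensions, in place of membership in
  \<open>carrier_mat\<close> with explicit sizes: simp proves them from the dimension rules of each
  construction, so these laws apply to nested products without instantiation.\<close>

lemma add_mult_dim:
  "dim_row A = dim_row B \<Longrightarrow> dim_col A = dim_col B \<Longrightarrow> dim_col A = dim_row C \<Longrightarrow>
    (A + B) * C = A * C + B * (C :: 'a::semiring_0 mat)"
  by (rule add_mult_distrib_mat[of _ "dim_row A" "dim_col A"]) auto

lemma mult_add_dim:
  "dim_row B = dim_row C \<Longrightarrow> dim_col B = dim_col C \<Longrightarrow> dim_col A = dim_row B \<Longrightarrow>
    A * (B + C) = A * B + A * (C :: 'a::semiring_0 mat)"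
  by (rule mult_add_distrib_mat[of _ "dim_row A" "dim_col A" _ "dim_col B"]) auto

lemma minus_mult_dim:
  "dim_row A = dim_row B \<Longrightarrow> dim_col A = dim_col B \<Longrightarrow> dim_col A = dim_row C \<Longrightarrow>
    (A - B) * C = A * C - B * (C :: 'a::ring mat)"
  by (rule minus_mult_distrib_mat[of _ "dim_row A" "dim_col A"]) auto

lemma mult_minus_dim:
  "dim_row B = dim_row C \<Longrightarrow> dim_col B = dim_col C \<Longrightarrow> dim_col A = dim_row B \<Longrightarrow>
    A * (B - C) = A * B - A * (C :: 'a::ring mat)"
  by (rule mult_minus_distrib_mat[of _ "dim_row A" "dim_col A" _ "dim_col B"]) auto

lemma smult_mult_dim:
  "dim_col A = dim_row B \<Longrightarrow> (k \<cdot>\<^sub>m A) * B = k \<cdot>\<^sub>m (A * (B :: 'a::comm_semiring_0 mat))"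
  by (rule mult_smult_assoc_mat[of _ "dim_row A" "dim_col A"]) auto

lemma mult_smult_dim:
  "dim_col A = dim_row B \<Longrightarrow> A * (k \<cdot>\<^sub>m B) = k \<cdot>\<^sub>m (A * (B :: 'a::comm_semiring_0 mat))"
  by (rule mult_smult_distrib[of _ "dim_row A" "dim_col A" _ "dim_col B"]) auto

lemma transpose_mult_dim:
  "dim_col A = dim_row B \<Longrightarrow> (A * B)\<^sup>T = B\<^sup>T * (A :: 'a::comm_semiring_0 mat)\<^sup>T"
  by (rule transpose_mult) auto

lemma smult_smult_mat: "a \<cdot>\<^sub>m (b \<cdot>\<^sub>m A) = (a * b) \<cdot>\<^sub>m (A :: 'a::semigroup_mult mat)"
  by (rule eq_matI) (auto simp: mult.assoc)

lemma smult_one_mat [simp]: "1 \<cdot>\<^sub>m A = (A :: 'a::monoid_mult mat)"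
  by (rule eq_matI) auto

lemma mult_cancel_left: "f * g = 1\<^sub>m n \<Longrightarrow> dim_col f = dim_row g \<Longrightarrow> dim_col g = dim_row A \<Longrightarrow>
    dim_row A = n \<Longrightarrow> f * (g * A) = (A :: 'a::semiring_1 mat)"
  by (subst mult_assoc_dim[symmetric]) auto

lemma mult_mat_index: "i < dim_row A \<Longrightarrow> j < dim_col B \<Longrightarrow> dim_col A = dim_row B \<Longrightarrow>
   (A * B) $$ (i, j) = (\<Sum>k<dim_row B. A $$ (i, k) * (B :: 'a::semiring_0 mat) $$ (k, j))"
  by (simp add: scalar_prod_def lessThan_atLeast0)

text \<open>Row and column numbers of a Kronecker product encode a pair (i, j) as i * n + j; sums
  over codes have to be taken apart again.\<close>

lemma sum_divmod:
  "(\<Sum>k<m * n. f (k div n) (k mod n)) = (\<Sum>i<m. \<Sum>j<n. f i (j::nat))" if "n > 0" for n :: nat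
proof -
  have "(\<Sum>i<m. \<Sum>j<n. f i j) = (\<Sum>p\<in>{..<m} \<times> {..<n}. f (fst p) (snd p))"
    by (simp add: sum.cartesian_product split_def)
  also have "\<dots> = (\<Sum>k<m * n. f (k div n) (k mod n))"
  proof (rule sum.reindex_bij_witness[of _ "\<lambda>k. (k div n, k mod n)" "\<lambda>p. fst p * n + snd p"])
    fix p assume "p \<in> {..<m} \<times> {..<n}"
    then have p: "fst p < m" "snd p < n" by auto
    have "fst p * n + snd p < Suc (fst p) * n" using p by simp
    also have "\<dots> \<le> m * n" using p by (intro mult_le_mono1) simp
    finally show "fst p * n + snd p \<in> {..<m * n}" by simp
  qed (use that in \<open>auto simp: less_mult_imp_div_less\<close>)
  finally show ?thesis by simp
qed

lemma div_less_of_mult: "i < m * n \<Longrightarrow> i div n < m" for i :: nat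
  by (rule less_mult_imp_div_less)

lemma mod_less_of_mult: "i < m * n \<Longrightarrow> i mod n < n" for i :: nat
  by (cases "n = 0") auto

lemma pair_index_less: "i < m \<Longrightarrow> j < n \<Longrightarrow> i * n + j < m * n" for i :: nat
proof -
  assume a: "i < m" "j < n"
  have "i * n + j < Suc i * n" using a by simp
  also have "\<dots> \<le> m * n" using a by (intro mult_le_mono1) simp
  finally show ?thesis .
qed

lemma smult_add_dim: "dim_row A = dim_row B \<Longrightarrow> dim_col A = dim_col B \<Longrightarrow>
    k \<cdot>\<^sub>m (A + B) = k \<cdot>\<^sub>m A + k \<cdot>\<^sub>m (B :: 'a::semiring mat)"
  by (rule add_smult_distrib_left_mat[of _ "dim_row A" "dim_col A"]) auto

lemma add_assoc_dim: "dim_row A = dim_row B \<Longrightarrow> dim_col A = dim_col B \<Longrightarrow> dim_row B = dim_row C \<Longrightarrow>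
    dim_col B = dim_col C \<Longrightarrow> A + B + C = A + (B + (C :: 'a::monoid_add mat))"
  by (rule assoc_add_mat[of _ "dim_row A" "dim_col A"]) auto

lemma zero_add_dim [simp]: "dim_row A = m \<Longrightarrow> dim_col A = n \<Longrightarrow> 0\<^sub>m m n + A = (A :: 'a::monoid_add mat)"
  by (rule left_add_zero_mat) auto

lemma add_zero_dim [simp]: "dim_row A = m \<Longrightarrow> dim_col A = n \<Longrightarrow> A + 0\<^sub>m m n = (A :: 'a::monoid_add mat)"
  by (rule right_add_zero_mat) auto

lemma pow_mat_add: "dim_row A = dim_col A \<Longrightarrow> A ^\<^sub>m (i + j) = A ^\<^sub>m i * (A ^\<^sub>m j :: 'a::semiring_1 mat)"
  by (induction j) (auto simp: mult_assoc_dim)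

lemma pow_mat_Suc_left: "dim_row A = dim_col A \<Longrightarrow> A ^\<^sub>m Suc i = A * (A ^\<^sub>m i :: 'a::semiring_1 mat)"
  using pow_mat_add[of A 1 i] by simp

lemma pow_mat_zero_mono: "dim_row A = dim_col A \<Longrightarrow> A ^\<^sub>m i = 0\<^sub>m (dim_col A) (dim_col A) \<Longrightarrow> i \<le> j \<Longrightarrow>
    A ^\<^sub>m j = (0\<^sub>m (dim_col A) (dim_col A) :: 'a::semiring_1 mat)"
  using pow_mat_add[of A i "j - i"] by simp

subsection \<open>Kronecker products\<close>

lemma dim_kron [simp]: "dim_row (kron A B) = dim_row A * dim_row B" "dim_col (kron A B) = dim_col A * dim_col B"
  by (simp_all add: kron_def)

lemma kron_index: "i < dim_row A * dim_row B \<Longrightarrow> j < dim_col A * dim_col B \<Longrightarrow>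
  kron A B $$ (i, j) = A $$ (i div dim_row B, j div dim_col B) * B $$ (i mod dim_row B, j mod dim_col B)"
  by (simp add: kron_def)

lemma kron_mult:
  assumes "dim_col A = dim_row C" "dim_col B = dim_row D"
  shows "kron A B * kron C D = kron (A * C) (B * (D :: 'k::field mat))"
proof (rule eq_matI)
  fix i j assume ij: "i < dim_row (kron (A * C) (B * D))" "j < dim_col (kron (A * C) (B * D))"
  let ?c = "dim_row D"
  have i: "i div dim_row B < dim_row A" "i mod dim_row B < dim_row B"
    and j: "j div dim_col D < dim_col C" "j mod dim_col D < dim_col D"
    using ij by (auto intro: div_less_of_mult mod_less_of_mult)
  show "(kron A B * kron C D) $$ (i, j) = kron (A * C) (B * D) $$ (i, j)"
  proof (cases "?c = 0")
    case True
    then show ?thesis using ij i j assms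
      by (subst mult_mat_index) (auto simp: kron_index mult_mat_index simp del: index_mult_mat(1))
  next
    case False
    have "(kron A B * kron C D) $$ (i, j) = (\<Sum>k<dim_row C * ?c.
      (A $$ (i div dim_row B, k div ?c) * C $$ (k div ?c, j div dim_col D)) *
      (B $$ (i mod dim_row B, k mod ?c) * D $$ (k mod ?c, j mod dim_col D)))"
      using ij assms by (subst mult_mat_index) (auto simp: kron_index intro!: sum.cong)
    also have "\<dots> = (\<Sum>k<dim_row C. \<Sum>l<?c. (A $$ (i div dim_row B, k) * C $$ (k, j div dim_col D)) *
      (B $$ (i mod dim_row B, l) * D $$ (l, j mod dim_col D)))"
      using False by (subst sum_divmod[symmetric]) auto
    also have "\<dots> = kron (A * C) (B * D) $$ (i, j)"
      using ij i j assms by (simp add: kron_index mult_mat_index sum_product del: index_mult_mat(1))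
    finally show ?thesis .
  qed
qed (use assms in auto)

lemma kron_one [simp]: "kron (1\<^sub>m m) (1\<^sub>m n) = (1\<^sub>m (m * n) :: 'k::field mat)"
proof (rule eq_matI)
  fix i j assume ij: "i < dim_row (1\<^sub>m (m * n) :: 'k mat)" "j < dim_col (1\<^sub>m (m * n) :: 'k mat)"
  then have "i div n < m" "j div n < m" "i mod n < n" "j mod n < n"
    by (auto intro: div_less_of_mult mod_less_of_mult)
  moreover have "i = j \<longleftrightarrow> i div n = j div n \<and> i mod n = j mod n"
    by (metis div_mult_mod_eq)
  ultimately show "kron (1\<^sub>m m) (1\<^sub>m n) $$ (i, j) = (1\<^sub>m (m * n) :: 'k mat) $$ (i, j)"
    using ij by (auto simp: kron_index)
qed auto

text \<open>An equality rather than an isomorphism, because both sides number triples in the same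
  lexicographic order. It is the reason why tensor products of modules are strictly
  associative.\<close>

lemma kron_assoc: "kron (kron A B) C = kron A (kron B (C :: 'k::field mat))"
proof (rule eq_matI)
  fix i j assume ij: "i < dim_row (kron A (kron B C))" "j < dim_col (kron A (kron B C))"
  define a b c a' b' c' where d: "a = dim_row A" "b = dim_row B" "c = dim_row C"
    "a' = dim_col A" "b' = dim_col B" "c' = dim_col C"
  have i: "i < a * (b * c)" "i < (a * b) * c" and j: "j < a' * (b' * c')" "j < (a' * b') * c'"
    using ij by (auto simp: d ac_simps)
  have i2: "i div c < a * b" "i mod (b * c) < b * c"
    using i div_less_of_mult mod_less_of_mult by blast+
  have j2: "j div c' < a' * b'" "j mod (b' * c') < b' * c'"
    using j div_less_of_mult mod_less_of_mult by blast+
  \<comment> \<open>Both bracketings read the same three digits of the index: leading, middle and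
    last.\<close>
  have e: "i div c div b = i div (b * c)" "i div c mod b = (i mod (b * c)) div c"
    "i mod (b * c) mod c = i mod c" for i b c :: nat
  proof -
    show "i div c div b = i div (b * c)" by (simp add: div_mult2_eq[symmetric] mult.commute)
    show "i div c mod b = (i mod (b * c)) div c"
      by (cases "c = 0") (simp_all add: mod_mult2_eq mult.commute[of b c])
    show "i mod (b * c) mod c = i mod c" by (simp add: mod_mod_cancel)
  qed
  have "kron (kron A B) C $$ (i, j) = kron A B $$ (i div c, j div c') * C $$ (i mod c, j mod c')"
    using i j by (subst kron_index) (auto simp: d ac_simps)
  also have "\<dots> = A $$ (i div c div b, j div c' div b') * B $$ (i div c mod b, j div c' mod b')
      * C $$ (i mod c, j mod c')"
    using i2 j2 by (subst kron_index) (auto simp: d)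
  also have "\<dots> = A $$ (i div (b * c), j div (b' * c')) * (B $$ (i mod (b * c) div c, j mod (b' * c') div c')
      * C $$ (i mod (b * c) mod c, j mod (b' * c') mod c'))"
    by (simp add: e mult.assoc)
  also have "\<dots> = A $$ (i div (b * c), j div (b' * c')) * kron B C $$ (i mod (b * c), j mod (b' * c'))"
    using i2 j2 by (subst kron_index) (auto simp: d)
  also have "\<dots> = kron A (kron B C) $$ (i, j)"
    using i j by (subst (2) kron_index) (auto simp: d)
  finally show "kron (kron A B) C $$ (i, j) = kron A (kron B C) $$ (i, j)" .
qed auto

lemma kron_add_left: "dim_row A = dim_row B \<Longrightarrow> dim_col A = dim_col B \<Longrightarrow>
   kron (A + B) C = kron A C + kron B (C :: 'k::field mat)"
  by (rule eq_matI) (auto simp: kron_index div_less_of_mult mod_less_of_mult distrib_right)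

lemma kron_add_right: "dim_row B = dim_row C \<Longrightarrow> dim_col B = dim_col C \<Longrightarrow>
   kron A (B + C) = kron A B + kron A (C :: 'k::field mat)"
  by (rule eq_matI) (auto simp: kron_index div_less_of_mult mod_less_of_mult distrib_left)

lemma kron_smult_left: "kron (c \<cdot>\<^sub>m A) B = c \<cdot>\<^sub>m kron A (B :: 'k::field mat)"
  by (rule eq_matI) (auto simp: kron_index div_less_of_mult mod_less_of_mult)

lemma kron_smult_right: "kron A (c \<cdot>\<^sub>m B) = c \<cdot>\<^sub>m kron A (B :: 'k::field mat)"
  by (rule eq_matI) (auto simp: kron_index div_less_of_mult mod_less_of_mult)

lemma kron_zero_left [simp]: "kron (0\<^sub>m m n) B = (0\<^sub>m (m * dim_row B) (n * dim_col B) :: 'k::field mat)"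
  by (rule eq_matI) (auto simp: kron_index div_less_of_mult mod_less_of_mult)

lemma kron_zero_right [simp]: "kron B (0\<^sub>m m n) = (0\<^sub>m (dim_row B * m) (dim_col B * n) :: 'k::field mat)"
  by (rule eq_matI) (auto simp: kron_index div_less_of_mult mod_less_of_mult)

lemma kron_transpose: "(kron A B)\<^sup>T = kron A\<^sup>T (B\<^sup>T :: 'k::field mat)"
  by (rule eq_matI) (auto simp: kron_index div_less_of_mult mod_less_of_mult)

text \<open>Written with \<open>Suc 0\<close>, the form to which simp brings the dimension
  1.\<close>

lemma kron_one_1_left [simp]: "kron (1\<^sub>m (Suc 0)) A = (A :: 'k::field mat)"
  by (rule eq_matI) (auto simp: kron_index div_less_of_mult mod_less_of_mult)

lemma kron_one_1_right [simp]: "kron A (1\<^sub>m (Suc 0)) = (A :: 'k::field mat)"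
  by (rule eq_matI) (auto simp: kron_index div_less_of_mult mod_less_of_mult)

lemma kron_pow: "dim_row A = dim_col A \<Longrightarrow> dim_row B = dim_col B \<Longrightarrow>
    kron A B ^\<^sub>m k = kron (A ^\<^sub>m k) (B ^\<^sub>m k :: 'k::field mat)"
  by (induction k) (auto simp: kron_mult)

subsection \<open>Block matrices\<close>

text \<open>The zero blocks take their sizes from the arguments, so that identities for direct sums
  need no size parameters.\<close>

definition bdiag :: "'k::zero mat \<Rightarrow> 'k mat \<Rightarrow> 'k mat"
  where "bdiag A B = four_block_mat A (0\<^sub>m (dim_row A) (dim_col B)) (0\<^sub>m (dim_row B) (dim_col A)) B"

lemma dim_bdiag [simp]: "dim_row (bdiag A B) = dim_row A + dim_row B" "dim_col (bdiag A B) = dim_col A + dim_col B"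
  by (simp_all add: bdiag_def)

lemma bdiag_index: "i < dim_row A + dim_row B \<Longrightarrow> j < dim_col A + dim_col B \<Longrightarrow> bdiag A B $$ (i, j) =
    (if i < dim_row A then if j < dim_col A then A $$ (i, j) else 0
     else if j < dim_col A then 0 else B $$ (i - dim_row A, j - dim_col A))"
  by (simp add: bdiag_def)

text \<open>\<open>hcat\<close> assembles a map out of a direct sum from its components, and
  \<open>vcat\<close> a map into one.\<close>

definition hcat :: "'k::zero mat \<Rightarrow> 'k mat \<Rightarrow> 'k mat"
  where "hcat A B = mat (dim_row A) (dim_col A + dim_col B)
    (\<lambda>(i, j). if j < dim_col A then A $$ (i, j) else B $$ (i, j - dim_col A))"

definition vcat :: "'k::zero mat \<Rightarrow> 'k mat \<Rightarrow> 'k mat"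
  where "vcat A B = mat (dim_row A + dim_row B) (dim_col A)
    (\<lambda>(i, j). if i < dim_row A then A $$ (i, j) else B $$ (i - dim_row A, j))"

lemma dim_hcat [simp]: "dim_row (hcat A B) = dim_row A" "dim_col (hcat A B) = dim_col A + dim_col B"
  by (simp_all add: hcat_def)

lemma dim_vcat [simp]: "dim_row (vcat A B) = dim_row A + dim_row B" "dim_col (vcat A B) = dim_col A"
  by (simp_all add: vcat_def)

lemma sum_lessThan_add: "(\<Sum>k<m + n. f k) = (\<Sum>k<m. f k) + (\<Sum>k<n. f (m + k))" for m n :: nat
  and f :: "nat \<Rightarrow> 'a::comm_monoid_add"
  by (induction n) (auto simp: ac_simps)

lemma hcat_vcat: "dim_row A = dim_row B \<Longrightarrow> dim_col C = dim_col D \<Longrightarrow> dim_col A = dim_row C \<Longrightarrow>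
   dim_col B = dim_row D \<Longrightarrow> hcat A B * vcat C D = A * C + B * (D :: 'k::semiring_0 mat)"
  by (rule eq_matI) (auto simp: mult_mat_index sum_lessThan_add hcat_def vcat_def simp del: index_mult_mat(1))

lemma vcat_hcat: "dim_row C = dim_row D \<Longrightarrow> dim_col A = dim_col B \<Longrightarrow> dim_col A = dim_row C \<Longrightarrow>
   vcat A B * hcat C D = four_block_mat (A * C) (A * D) (B * C) (B * (D :: 'k::semiring_0 mat))"
  by (rule eq_matI) (auto simp: mult_mat_index hcat_def vcat_def simp del: index_mult_mat(1))

lemma mult_hcat: "dim_col A = dim_row B \<Longrightarrow> dim_row B = dim_row C \<Longrightarrow>
    A * hcat B C = hcat (A * B) (A * (C :: 'k::semiring_0 mat))"
  by (rule eq_matI) (auto simp: mult_mat_index hcat_def simp del: index_mult_mat(1))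

lemma vcat_mult: "dim_col A = dim_row C \<Longrightarrow> dim_col A = dim_col B \<Longrightarrow>
    vcat A B * C = vcat (A * C) (B * (C :: 'k::semiring_0 mat))"
  by (rule eq_matI) (auto simp: mult_mat_index vcat_def simp del: index_mult_mat(1))

lemma hcat_bdiag: "dim_row A = dim_row B \<Longrightarrow> dim_col A = dim_row C \<Longrightarrow> dim_col B = dim_row D \<Longrightarrow>
   hcat A B * bdiag C D = hcat (A * C) (B * (D :: 'k::semiring_0 mat))"
  by (rule eq_matI) (auto simp: bdiag_index mult_mat_index hcat_def sum_lessThan_add simp del: index_mult_mat(1))

lemma bdiag_vcat: "dim_col A = dim_col B \<Longrightarrow> dim_col C = dim_row A \<Longrightarrow> dim_col D = dim_row B \<Longrightarrow>
   bdiag C D * vcat A B = vcat (C * A) (D * (B :: 'k::semiring_0 mat))"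
  by (rule eq_matI) (auto simp: bdiag_index mult_mat_index vcat_def sum_lessThan_add simp del: index_mult_mat(1))

lemma bdiag_mult: "dim_col A = dim_row C \<Longrightarrow> dim_col B = dim_row D \<Longrightarrow>
   bdiag A B * bdiag C D = bdiag (A * C) (B * (D :: 'k::semiring_0 mat))"
  by (rule eq_matI) (auto simp: bdiag_index mult_mat_index sum_lessThan_add simp del: index_mult_mat(1))

lemma bdiag_one [simp]: "bdiag (1\<^sub>m m) (1\<^sub>m n) = 1\<^sub>m (m + n)"
  by (simp add: bdiag_def)

lemma dim_pow_mat [simp]:
  "dim_row A = dim_col A \<Longrightarrow> dim_row (A ^\<^sub>m k) = dim_col A"
  "dim_row A = dim_col A \<Longrightarrow> dim_col (A ^\<^sub>m k) = dim_col A"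
  by (cases k; simp; fail)+

lemma bdiag_pow:
  assumes "dim_row A = dim_col A" "dim_row B = dim_col B"
  shows "bdiag A B ^\<^sub>m k = bdiag (A ^\<^sub>m k) (B ^\<^sub>m k :: 'k::semiring_1 mat)"
proof -
  have "A \<in> carrier_mat (dim_col A) (dim_col A)" "B \<in> carrier_mat (dim_col B) (dim_col B)"
    using assms by (intro carrier_matI; simp)+
  from pow_four_block_mat[OF this, of k] show ?thesis by (simp add: bdiag_def assms)
qed

subsection \<open>Linear combinations of matrices\<close>

text \<open>The sizes are arguments because the index set may be empty, where the value is a zero
  matrix. Actions of algebra elements, tensor products of modules and averages over the group are
  all of this form.\<close>

definition lincomb :: "nat \<Rightarrow> nat \<Rightarrow> 'i set \<Rightarrow> ('i \<Rightarrow> 'k::comm_semiring_0) \<Rightarrow> ('i \<Rightarrow> 'k mat) \<Rightarrow> 'k mat"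
  where "lincomb r c I x A = mat r c (\<lambda>ij. \<Sum>p\<in>I. x p * A p $$ ij)"

lemma dim_lincomb [simp]: "dim_row (lincomb r c I x A) = r" "dim_col (lincomb r c I x A) = c"
  by (simp_all add: lincomb_def)

lemma lincomb_index: "i < r \<Longrightarrow> j < c \<Longrightarrow> lincomb r c I x A $$ (i, j) = (\<Sum>p\<in>I. x p * A p $$ (i, j))"
  by (simp add: lincomb_def)

lemma lincomb_cong:
  "(\<And>p. p \<in> I \<Longrightarrow> x p = y p) \<Longrightarrow> (\<And>p i j. p \<in> I \<Longrightarrow> i < r \<Longrightarrow> j < c \<Longrightarrow> A p $$ (i, j) = B p $$ (i, j)) \<Longrightarrow>
   lincomb r c I x A = lincomb r c I y B"
  by (rule eq_matI) (auto simp: lincomb_index intro!: sum.cong)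

lemma mult_lincomb:
  assumes "dim_col B = r" "\<And>p. p \<in> I \<Longrightarrow> dim_row (A p) = r \<and> dim_col (A p) = c"
  shows "B * lincomb r c I x A = lincomb (dim_row B) c I x (\<lambda>p. B * A p)"
proof (rule eq_matI)
  fix i j assume ij: "i < dim_row (lincomb (dim_row B) c I x (\<lambda>p. B * A p))"
    "j < dim_col (lincomb (dim_row B) c I x (\<lambda>p. B * A p))"
  have "(B * lincomb r c I x A) $$ (i, j) = (\<Sum>k<r. \<Sum>p\<in>I. B $$ (i, k) * (x p * A p $$ (k, j)))"
    using ij assms by (simp add: mult_mat_index lincomb_index sum_distrib_left del: index_mult_mat(1))
  also have "\<dots> = (\<Sum>p\<in>I. \<Sum>k<r. B $$ (i, k) * (x p * A p $$ (k, j)))" by (rule sum.swap)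
  also have "\<dots> = (\<Sum>p\<in>I. x p * (B * A p) $$ (i, j))"
    using ij assms by (intro sum.cong refl) (simp add: mult_mat_index sum_distrib_left ac_simps del: index_mult_mat(1))
  finally show "(B * lincomb r c I x A) $$ (i, j) = lincomb (dim_row B) c I x (\<lambda>p. B * A p) $$ (i, j)"
    using ij by (simp add: lincomb_index)
qed (use assms in auto)

lemma lincomb_mult:
  assumes "dim_row B = c" "\<And>p. p \<in> I \<Longrightarrow> dim_row (A p) = r \<and> dim_col (A p) = c"
  shows "lincomb r c I x A * B = lincomb r (dim_col B) I x (\<lambda>p. A p * B)"
proof (rule eq_matI)
  fix i j assume ij: "i < dim_row (lincomb r (dim_col B) I x (\<lambda>p. A p * B))"
    "j < dim_col (lincomb r (dim_col B) I x (\<lambda>p. A p * B))"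
  have "(lincomb r c I x A * B) $$ (i, j) = (\<Sum>k<c. \<Sum>p\<in>I. x p * A p $$ (i, k) * B $$ (k, j))"
    using ij assms by (simp add: mult_mat_index lincomb_index sum_distrib_right del: index_mult_mat(1))
  also have "\<dots> = (\<Sum>p\<in>I. \<Sum>k<c. x p * A p $$ (i, k) * B $$ (k, j))" by (rule sum.swap)
  also have "\<dots> = (\<Sum>p\<in>I. x p * (A p * B) $$ (i, j))"
    using ij assms by (intro sum.cong refl) (simp add: mult_mat_index sum_distrib_left ac_simps del: index_mult_mat(1))
  finally show "(lincomb r c I x A * B) $$ (i, j) = lincomb r (dim_col B) I x (\<lambda>p. A p * B) $$ (i, j)"
    using ij by (simp add: lincomb_index)
qed (use assms in auto)

lemma lincomb_delta:
  assumes "finite I" "q \<in> I" "dim_row (A q) = r" "dim_col (A q) = c"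
  shows "lincomb r c I (\<lambda>p. a * of_bool (p = q)) A = a \<cdot>\<^sub>m (A q :: 'k::field mat)"
proof (rule eq_matI)
  fix i j assume "i < dim_row (a \<cdot>\<^sub>m A q)" "j < dim_col (a \<cdot>\<^sub>m A q)"
  moreover have "(\<Sum>p\<in>I. a * of_bool (p = q) * A p $$ (i, j)) = a * A q $$ (i, j)"
    using sum.delta[OF assms(1), of q "\<lambda>p. a * A p $$ (i, j)"] assms(2)
    by (simp add: of_bool_def if_distrib if_distribR cong: if_cong)
  ultimately show "lincomb r c I (\<lambda>p. a * of_bool (p = q)) A $$ (i, j) = (a \<cdot>\<^sub>m A q) $$ (i, j)"
    using assms by (simp add: lincomb_index)
qed (use assms in auto)

lemma lincomb_delta_1:
  assumes "finite I" "q \<in> I" "dim_row (A q) = r" "dim_col (A q) = c"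
  shows "lincomb r c I (\<lambda>p. of_bool (p = q)) A = (A q :: 'k::field mat)"
  using lincomb_delta[of I q A r c 1] assms by simp

lemma lincomb_add: "lincomb r c I (\<lambda>p. x p + y p) A = lincomb r c I x A + lincomb r c I y A"
  by (rule eq_matI) (auto simp: lincomb_index sum.distrib distrib_right)

lemma lincomb_sum:
  "lincomb r c I (\<lambda>p. \<Sum>a\<in>J. x a * z a p) A = lincomb r c J x (\<lambda>a. lincomb r c I (z a) A)"
proof (rule eq_matI)
  fix i j assume "i < dim_row (lincomb r c J x (\<lambda>a. lincomb r c I (z a) A))" "j < dim_col (lincomb r c J x (\<lambda>a. lincomb r c I (z a) A))"
  then show "lincomb r c I (\<lambda>p. \<Sum>a\<in>J. x a * z a p) A $$ (i, j) = lincomb r c J x (\<lambda>a. lincomb r c I (z a) A) $$ (i, j)"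
    by (simp add: lincomb_index sum_distrib_left sum_distrib_right mult.assoc sum.swap[of _ I])
qed auto

lemma lincomb_mat_cong: "(\<And>p. p \<in> I \<Longrightarrow> A p = B p) \<Longrightarrow> lincomb r c I x A = lincomb r c I x B"
  by (rule lincomb_cong) auto

lemma lincomb_smult: "lincomb r c I (\<lambda>p. a * x p) A = a \<cdot>\<^sub>m lincomb r c I x A"
  by (rule eq_matI) (auto simp: lincomb_index sum_distrib_left mult.assoc)

subsection \<open>The trace\<close>

definition tr :: "'k::comm_semiring_0 mat \<Rightarrow> 'k"
  where "tr A = (\<Sum>i<dim_row A. A $$ (i, i))"

lemma tr_mult: "dim_row A = dim_col B \<Longrightarrow> dim_col A = dim_row B \<Longrightarrow>
   tr (A * B) = (\<Sum>i<dim_row A. \<Sum>k<dim_row B. A $$ (i, k) * B $$ (k, i))"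
  by (simp add: tr_def mult_mat_index del: index_mult_mat(1))

lemma tr_mult_comm: "dim_row A = dim_col B \<Longrightarrow> dim_col A = dim_row B \<Longrightarrow> tr (A * B) = tr (B * A)"
  by (simp add: tr_mult sum.swap[of _ "{..<dim_row B}"] mult.commute)

lemma tr_one [simp]: "tr (1\<^sub>m n :: 'k::comm_semiring_1 mat) = of_nat n"
  by (simp add: tr_def)

lemma tr_zero [simp]: "tr (0\<^sub>m m m) = 0"
  by (simp add: tr_def)

lemma tr_transpose: "dim_row A = dim_col A \<Longrightarrow> tr A\<^sup>T = tr A"
  by (simp add: tr_def)

lemma tr_bdiag: "dim_row A = dim_col A \<Longrightarrow> dim_row B = dim_col B \<Longrightarrow> tr (bdiag A B) = tr A + tr B"
  by (simp add: tr_def sum_lessThan_add bdiag_index)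

lemma tr_kron:
  assumes "dim_row A = dim_col A" "dim_row B = dim_col B"
  shows "tr (kron A B) = tr A * tr (B :: 'k::field mat)"
proof (cases "dim_row B = 0")
  case False
  have "tr (kron A B) = (\<Sum>i<dim_row A * dim_row B. A $$ (i div dim_row B, i div dim_row B)
      * B $$ (i mod dim_row B, i mod dim_row B))"
    using assms by (auto simp: tr_def kron_index intro!: sum.cong)
  also have "\<dots> = tr A * tr B"
    using False by (subst sum_divmod[of _ "\<lambda>i j. A $$ (i, i) * B $$ (j, j)"]) (auto simp: tr_def sum_product)
  finally show ?thesis .
qed (simp add: tr_def)

lemma tr_lincomb:
  assumes "\<And>p. p \<in> I \<Longrightarrow> dim_row (A p) = r"
  shows "tr (lincomb r r I x A) = (\<Sum>p\<in>I. x p * tr (A p))"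
proof -
  have "tr (lincomb r r I x A) = (\<Sum>i<r. \<Sum>p\<in>I. x p * A p $$ (i, i))"
    by (simp add: tr_def lincomb_index)
  also have "\<dots> = (\<Sum>p\<in>I. \<Sum>i<r. x p * A p $$ (i, i))" by (rule sum.swap)
  also have "\<dots> = (\<Sum>p\<in>I. x p * tr (A p))"
    using assms by (intro sum.cong refl) (simp add: tr_def sum_distrib_left)
  finally show ?thesis .
qed

text \<open>The traces of f g and g f agree, and in characteristic zero the equality of m and n in
  the field is an equality of numbers.\<close>

lemma inverse_mats_same_dim:
  fixes f :: "'k::field_char_0 mat"
  assumes "f * g = 1\<^sub>m m" "g * f = 1\<^sub>m n" "dim_col f = dim_row g" "dim_row f = dim_col g"
  shows "m = n"
proof -
  have "tr (f * g) = tr (g * f)" using assms by (intro tr_mult_comm) auto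
  then show ?thesis using assms by simp
qed

subsection \<open>Rank factorization\<close>

lemma square_inverse_comm: "A * B = 1\<^sub>m n \<Longrightarrow> dim_row A = n \<Longrightarrow> dim_col A = n \<Longrightarrow> dim_row B = n \<Longrightarrow> dim_col B = n \<Longrightarrow>
    B * A = (1\<^sub>m n :: 'k::field mat)"
  by (rule mat_mult_left_right_inverse[of A n B]) auto

lemma rank_factorization:
  fixes A :: "'k::field mat"
  obtains C D C' D' r where "A = C * D" "C' * C = 1\<^sub>m r" "D * D' = 1\<^sub>m r"
    "dim_row C = dim_row A" "dim_col C = r" "dim_row D = r" "dim_col D = dim_col A"
    "dim_row C' = r" "dim_col C' = dim_row A" "dim_row D' = dim_col A" "dim_col D' = r"
proof -
  have "\<exists>C D C' D' r. A = C * D \<and> C' * C = 1\<^sub>m r \<and> D * D' = 1\<^sub>m r \<and>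
    dim_row C = dim_row A \<and> dim_col C = r \<and> dim_row D = r \<and> dim_col D = dim_col A \<and>
    dim_row C' = r \<and> dim_col C' = dim_row A \<and> dim_row D' = dim_col A \<and> dim_col D' = r"
  proof (induction "dim_col A" arbitrary: A)
    case 0
    then show ?case
      by (intro exI[of _ "0\<^sub>m (dim_row A) 0"] exI[of _ "0\<^sub>m 0 (dim_row A)"] exI[of _ "0\<^sub>m 0 0"] exI[of _ 0]) auto
  next
    case (Suc n)
    define A0 where "A0 = mat (dim_row A) n (\<lambda>ij. A $$ ij)"
    define v where "v = mat (dim_row A) 1 (\<lambda>(i, j). A $$ (i, n))"
    have A: "A = hcat A0 v" using Suc(2) by (intro eq_matI) (auto simp: A0_def v_def hcat_def dest: less_antisym)
    have dA0 [simp]: "dim_row A0 = dim_row A" "dim_col A0 = n" "dim_row v = dim_row A" "dim_col v = 1"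
      by (auto simp: A0_def v_def)
    obtain C D C' D' r where C: "A0 = C * D" "C' * C = 1\<^sub>m r" "D * D' = 1\<^sub>m r" and
      dims [simp]: "dim_row C = dim_row A" "dim_col C = r" "dim_row D = r" "dim_col D = n"
      "dim_row C' = r" "dim_col C' = dim_row A" "dim_row D' = n" "dim_col D' = r"
      using Suc(1)[of A0] by auto
    \<comment> \<open>\<open>C * C'\<close> projects onto the column space of C, so w is the part of
      the new column v outside it.\<close>
    define w where "w = v - C * (C' * v)"
    have [simp]: "dim_row w = dim_row A" "dim_col w = 1" by (auto simp: w_def)
    have C'w: "C' * w = 0\<^sub>m r 1"
      unfolding w_def by (subst mult_minus_dim) (auto simp: mult_cancel_left[OF C(2)] intro!: eq_matI)
    show ?case
    proof (cases "w = 0\<^sub>m (dim_row A) 1")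
      case True
      have v: "v = C * (C' * v)"
      proof (rule eq_matI)
        fix i j assume ij: "i < dim_row (C * (C' * v))" "j < dim_col (C * (C' * v))"
        then have "w $$ (i, j) = 0" by (subst True) simp
        then show "v $$ (i, j) = (C * (C' * v)) $$ (i, j)"
          unfolding w_def using ij by (subst (asm) index_minus_mat) auto
      qed simp_all
      have f1: "A = C * hcat D (C' * v)"
        by (subst mult_hcat) (simp_all only: C(1)[symmetric] v[symmetric] A dims dA0 index_mult_mat(2))
      have f2: "hcat D (C' * v) * vcat D' (0\<^sub>m 1 r) = 1\<^sub>m r"
        by (subst hcat_vcat) (auto simp: C)
      show ?thesis
        by (intro exI[of _ C] exI[of _ "hcat D (C' * v)"] exI[of _ C'] exI[of _ "vcat D' (0\<^sub>m 1 r)"] exI[of _ r] conjI;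
            (rule f1 f2 C(2))?; simp add: Suc(2)[symmetric])
    next
      case False
      then obtain i where i: "i < dim_row A" "w $$ (i, 0) \<noteq> 0"
        by (metis (no_types, lifting) \<open>dim_col w = 1\<close> \<open>dim_row w = dim_row A\<close> eq_matI index_zero_mat(1,2,3) less_one)
      define e where "e = mat 1 (dim_row A) (\<lambda>(a, j). if j = i then inverse (w $$ (i, 0)) else 0)"
      \<comment> \<open>Correcting e by its values on the column space of C gives a functional that
        vanishes on C and still takes the value 1 on w.\<close>
      define l where "l = e - e * (C * C')"
      have [simp]: "dim_row e = 1" "dim_col e = dim_row A" "dim_row l = 1" "dim_col l = dim_row A"
        by (auto simp: e_def l_def)
      have ew: "e * w = 1\<^sub>m 1"
        using i by (intro eq_matI) (auto simp: mult_mat_index e_def if_distrib if_distribR cong: if_cong simp del: index_mult_mat(1))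
      have lC: "l * C = 0\<^sub>m 1 r"
        unfolding l_def by (subst minus_mult_dim) (auto simp: mult_assoc_dim C(2))
      have lw: "l * w = 1\<^sub>m 1"
        unfolding l_def by (subst minus_mult_dim) (auto simp: mult_assoc_dim C'w ew)
      have v: "C * (C' * v) + w = v" unfolding w_def by (rule eq_matI) auto
      have f1: "A = hcat C w * four_block_mat D (C' * v) (0\<^sub>m 1 n) (1\<^sub>m 1)"
        by (subst A, subst v[symmetric], subst C(1))
           (rule eq_matI; auto simp: hcat_def mult_mat_index sum_lessThan_add simp del: index_mult_mat(1))
      have f2: "vcat C' l * hcat C w = 1\<^sub>m (r + 1)"
        by (subst vcat_hcat) (auto simp: C C'w lC lw)
      have f3: "four_block_mat D (C' * v) (0\<^sub>m 1 n) (1\<^sub>m 1) * four_block_mat D' (- (D' * (C' * v))) (0\<^sub>m 1 r) (1\<^sub>m 1) = 1\<^sub>m (r + 1)"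
      proof -
        have "D * (- (D' * (C' * v))) = - (C' * v)"
          by (subst uminus_mult_right_mat[symmetric]) (auto simp: mult_cancel_left[OF C(3)])
        then have "D * (- (D' * (C' * v))) + C' * v = 0\<^sub>m r 1"
          by (auto intro!: eq_matI)
        then show ?thesis
          by (subst mult_four_block_mat[of D r n "C' * v" 1 "0\<^sub>m 1 n" 1 "1\<^sub>m 1" D' r "- (D' * (C' * v))" 1]) (auto simp: C)
      qed
      show ?thesis
        by (intro exI[of _ "hcat C w"] exI[of _ "four_block_mat D (C' * v) (0\<^sub>m 1 n) (1\<^sub>m 1)"] exI[of _ "vcat C' l"]
            exI[of _ "four_block_mat D' (- (D' * (C' * v))) (0\<^sub>m 1 r) (1\<^sub>m 1)"] exI[of _ "r + 1"] conjI;
            (rule f1 f2 f3)?; simp add: Suc(2)[symmetric])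
    qed
  qed
  then show ?thesis using that by blast
qed

section \<open>Modules over a Hopf algebra\<close>

lemma act_lincomb: "act H M x = lincomb (rdim M) (rdim M) (basis H) x (rmat M)"
  by (simp add: act_def lincomb_def)

lemma reps_dim [simp]:
  assumes "M \<in> reps H" "b \<in> basis H"
  shows "dim_row (rmat M b) = rdim M" "dim_col (rmat M b) = rdim M"
  using assms by (auto simp: reps_def PiE_iff)

lemma rep_eqI:
  assumes "M \<in> reps H" "N \<in> reps H" "rdim M = rdim N" "\<And>b. b \<in> basis H \<Longrightarrow> rmat M b = rmat N b"
  shows "M = N"
proof -
  have "rmat M = rmat N"
    using assms by (intro extensionalityI[of _ "basis H"]) (auto simp: reps_def PiE_iff)
  then show ?thesis using assms(3) by (cases M; cases N) simp
qed

lemma rep_homI: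
  assumes "dim_row f = rdim N" "dim_col f = rdim M" "\<And>b. b \<in> basis H \<Longrightarrow> rmat N b * f = f * rmat M b"
  shows "f \<in> rep_hom H M N"
  using assms by (auto simp: rep_hom_def)

lemma rep_hom_dim [simp]:
  assumes "f \<in> rep_hom H M N"
  shows "dim_row f = rdim N" "dim_col f = rdim M"
  using assms by (auto simp: rep_hom_def)

lemma rep_homD: "f \<in> rep_hom H M N \<Longrightarrow> b \<in> basis H \<Longrightarrow> rmat N b * f = f * rmat M b"
  by (auto simp: rep_hom_def)

lemma rep_hom_one: "M \<in> reps H \<Longrightarrow> 1\<^sub>m (rdim M) \<in> rep_hom H M M"
  by (rule rep_homI) auto

lemma rep_hom_zero: "M \<in> reps H \<Longrightarrow> N \<in> reps H \<Longrightarrow> 0\<^sub>m (rdim N) (rdim M) \<in> rep_hom H M N"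
  by (rule rep_homI) auto

lemma rep_hom_comp:
  assumes "M \<in> reps H" "N \<in> reps H" "P \<in> reps H" "f \<in> rep_hom H M N" "g \<in> rep_hom H N P"
  shows "g * f \<in> rep_hom H M P"
proof (rule rep_homI)
  fix b assume b: "b \<in> basis H"
  have "rmat P b * (g * f) = (rmat P b * g) * f" using assms b by (simp add: mult_assoc_dim)
  also have "\<dots> = g * (rmat N b * f)" using assms b by (simp add: rep_homD[of g] mult_assoc_dim)
  also have "\<dots> = (g * f) * rmat M b" using assms b by (simp add: rep_homD[of f] mult_assoc_dim)
  finally show "rmat P b * (g * f) = g * f * rmat M b" .
qed (use assms in auto)

lemma rep_hom_add:
  assumes "M \<in> reps H" "N \<in> reps H" "f \<in> rep_hom H M N" "g \<in> rep_hom H M N"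
  shows "f + g \<in> rep_hom H M N"
  by (rule rep_homI) (use assms in \<open>auto simp: mult_add_dim add_mult_dim rep_homD\<close>)

lemma rep_hom_smult:
  assumes "M \<in> reps H" "N \<in> reps H" "f \<in> rep_hom H M N"
  shows "c \<cdot>\<^sub>m f \<in> rep_hom H M N"
  by (rule rep_homI) (use assms in \<open>auto simp: mult_smult_dim smult_mult_dim rep_homD\<close>)

lemma rep_hom_minus:
  assumes "M \<in> reps H" "N \<in> reps H" "f \<in> rep_hom H M N" "g \<in> rep_hom H M N"
  shows "f - g \<in> rep_hom H M N"
  by (rule rep_homI) (use assms in \<open>auto simp: mult_minus_dim minus_mult_dim rep_homD\<close>)

lemma rep_hom_inverse:
  assumes "M \<in> reps H" "N \<in> reps H" "f \<in> rep_hom H M N"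
    and "g * f = 1\<^sub>m (rdim M)" "f * g = 1\<^sub>m (rdim N)" "dim_row g = rdim M" "dim_col g = rdim N"
  shows "g \<in> rep_hom H N M"
proof (rule rep_homI)
  fix b assume b: "b \<in> basis H"
  have "rmat M b * g = g * (f * (rmat M b * g))"
    using assms(1-3,6,7) b by (simp add: mult_cancel_left[OF assms(4)])
  also have "\<dots> = g * ((rmat N b * f) * g)" using assms b by (simp add: rep_homD mult_assoc_dim)
  also have "\<dots> = g * rmat N b" using assms b by (simp add: mult_assoc_dim)
  finally show "rmat M b * g = g * rmat N b" .
qed (use assms in auto)

lemma rep_isoI:
  assumes "f \<in> rep_hom H M N" "g \<in> rep_hom H N M" "g * f = 1\<^sub>m (rdim M)" "f * g = 1\<^sub>m (rdim N)"
  shows "rep_iso H M N"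
  using assms by (auto simp: rep_iso_def)

lemma rep_isoI_hom:
  assumes "M \<in> reps H" "N \<in> reps H" "f \<in> rep_hom H M N" "g * f = 1\<^sub>m (rdim M)" "f * g = 1\<^sub>m (rdim N)"
    "dim_row g = rdim M" "dim_col g = rdim N"
  shows "rep_iso H M N"
  by (rule rep_isoI[OF assms(3) rep_hom_inverse[OF assms] assms(4,5)])

lemma rep_iso_refl: "M \<in> reps H \<Longrightarrow> rep_iso H M M"
  by (rule rep_isoI[of "1\<^sub>m (rdim M)" _ _ _ "1\<^sub>m (rdim M)"]) (auto intro: rep_hom_one)

lemma rep_iso_sym: "rep_iso H M N \<Longrightarrow> rep_iso H N M"
  by (auto simp: rep_iso_def)

lemma rep_iso_trans:
  assumes "M \<in> reps H" "N \<in> reps H" "P \<in> reps H" "rep_iso H M N" "rep_iso H N P"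
  shows "rep_iso H M P"
proof -
  obtain f g where fg: "f \<in> rep_hom H M N" "g \<in> rep_hom H N M" "g * f = 1\<^sub>m (rdim M)" "f * g = 1\<^sub>m (rdim N)"
    using assms by (auto simp: rep_iso_def)
  obtain f' g' where fg': "f' \<in> rep_hom H N P" "g' \<in> rep_hom H P N" "g' * f' = 1\<^sub>m (rdim N)" "f' * g' = 1\<^sub>m (rdim P)"
    using assms by (auto simp: rep_iso_def)
  show ?thesis
  proof (rule rep_isoI[of "f' * f" _ _ _ "g * g'"])
    show "g * g' * (f' * f) = 1\<^sub>m (rdim M)" "f' * f * (g * g') = 1\<^sub>m (rdim P)"
      using fg fg' by (simp_all add: mult_assoc_dim mult_cancel_left[OF fg'(3)] mult_cancel_left[OF fg(4)])
  qed (use assms fg fg' in \<open>auto intro: rep_hom_comp\<close>)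
qed

lemma rep_iso_dim:
  fixes M :: "('b, 'k::field_char_0) rep"
  shows "rep_iso H M N \<Longrightarrow> rdim M = rdim N"
  unfolding rep_iso_def by (auto intro: inverse_mats_same_dim)

subsection \<open>Direct sums\<close>

lemma rdim_sum [simp]: "rdim (rep_sum H M N) = rdim M + rdim N"
  by (simp add: rep_sum_def)

lemma rmat_sum: "M \<in> reps H \<Longrightarrow> N \<in> reps H \<Longrightarrow> b \<in> basis H \<Longrightarrow>
    rmat (rep_sum H M N) b = bdiag (rmat M b) (rmat N b)"
  by (simp add: rep_sum_def bdiag_def)

lemma rep_sum_rep:
  assumes MN: "M \<in> reps H" "N \<in> reps H"
  shows "rep_sum H M N \<in> reps H"
proof -
  let ?S = "rep_sum H M N"
  have act: "act H ?S x = bdiag (act H M x) (act H N x)" for x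
    using MN by (intro eq_matI) (auto simp: act_def rmat_sum bdiag_index cong: sum.cong)
  have "rmat ?S \<in> basis H \<rightarrow>\<^sub>E carrier_mat (rdim ?S) (rdim ?S)"
    using MN by (auto simp: rep_sum_def intro!: carrier_matI)
  moreover have "act H ?S (unt H) = 1\<^sub>m (rdim ?S)"
    using MN by (simp add: act reps_def)
  moreover have "act H ?S (prd H b c) = rmat ?S b * rmat ?S c" if "b \<in> basis H" "c \<in> basis H" for b c
  proof -
    have "act H M (prd H b c) = rmat M b * rmat M c" "act H N (prd H b c) = rmat N b * rmat N c"
      using MN that by (auto simp: reps_def)
    then show ?thesis using MN that by (subst act) (simp add: rmat_sum bdiag_mult)
  qed
  ultimately show ?thesis by (auto simp: reps_def)
qed

definition zero_rep :: "('b, 'k::field) hopf \<Rightarrow> ('b, 'k) rep"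
  where "zero_rep H = \<lparr>rdim = 0, rmat = (\<lambda>b\<in>basis H. 0\<^sub>m 0 0)\<rparr>"

lemma zero_rep [simp]: "zero_rep H \<in> reps H" "rdim (zero_rep H) = 0"
  by (auto simp: zero_rep_def reps_def act_def)

lemma rep_dim0_eq: "M \<in> reps H \<Longrightarrow> rdim M = 0 \<Longrightarrow> M = zero_rep H"
  by (rule rep_eqI) (auto, auto simp: zero_rep_def intro!: eq_matI)

text \<open>These equations survive every additive operation on homomorphisms. Distributivity of the
  tensor product and additivity of linear functors are proved by applying the operation to the
  equations of a direct sum.\<close>

lemma rep_iso_sumI:
  assumes reps: "M \<in> reps H" "N \<in> reps H" "S \<in> reps H"
    and "i1 \<in> rep_hom H M S" "i2 \<in> rep_hom H N S" "p1 \<in> rep_hom H S M" "p2 \<in> rep_hom H S N"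
    and "p1 * i1 = 1\<^sub>m (rdim M)" "p2 * i2 = 1\<^sub>m (rdim N)"
    and "p1 * i2 = 0\<^sub>m (rdim M) (rdim N)" "p2 * i1 = 0\<^sub>m (rdim N) (rdim M)"
    and "i1 * p1 + i2 * p2 = 1\<^sub>m (rdim S)"
  shows "rep_iso H S (rep_sum H M N)"
proof (rule rep_isoI[of "vcat p1 p2" _ _ _ "hcat i1 i2"])
  note [simp] = rep_hom_dim[OF assms(4)] rep_hom_dim[OF assms(5)] rep_hom_dim[OF assms(6)] rep_hom_dim[OF assms(7)]
  show "vcat p1 p2 \<in> rep_hom H S (rep_sum H M N)"
    by (rule rep_homI) (use reps in \<open>auto simp: rmat_sum bdiag_vcat vcat_mult rep_homD[OF assms(6)] rep_homD[OF assms(7)]\<close>)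
  show "hcat i1 i2 \<in> rep_hom H (rep_sum H M N) S"
    by (rule rep_homI) (use reps in \<open>auto simp: rmat_sum hcat_bdiag mult_hcat rep_homD[OF assms(4)] rep_homD[OF assms(5)]\<close>)
  show "hcat i1 i2 * vcat p1 p2 = 1\<^sub>m (rdim S)" by (simp add: hcat_vcat assms)
  show "vcat p1 p2 * hcat i1 i2 = 1\<^sub>m (rdim (rep_sum H M N))"
    by (simp add: vcat_hcat assms)
qed

lemma rep_sum_biproduct:
  fixes H :: "('b, 'k::field) hopf"
  assumes "M \<in> reps H" "N \<in> reps H"
  obtains i1 i2 p1 p2 where
    "i1 \<in> rep_hom H M (rep_sum H M N)" "i2 \<in> rep_hom H N (rep_sum H M N)"
    "p1 \<in> rep_hom H (rep_sum H M N) M" "p2 \<in> rep_hom H (rep_sum H M N) N"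
    "p1 * i1 = 1\<^sub>m (rdim M)" "p2 * i2 = 1\<^sub>m (rdim N)"
    "p1 * i2 = 0\<^sub>m (rdim M) (rdim N)" "p2 * i1 = 0\<^sub>m (rdim N) (rdim M)"
    "i1 * p1 + i2 * p2 = 1\<^sub>m (rdim (rep_sum H M N))"
proof
  let ?m = "rdim M" and ?n = "rdim N"
  show "vcat (1\<^sub>m ?m) (0\<^sub>m ?n ?m) \<in> rep_hom H M (rep_sum H M N)"
    by (rule rep_homI) (use assms in \<open>auto simp: rmat_sum bdiag_vcat vcat_mult\<close>)
  show "vcat (0\<^sub>m ?m ?n) (1\<^sub>m ?n) \<in> rep_hom H N (rep_sum H M N)"
    by (rule rep_homI) (use assms in \<open>auto simp: rmat_sum bdiag_vcat vcat_mult\<close>)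
  show "hcat (1\<^sub>m ?m) (0\<^sub>m ?m ?n) \<in> rep_hom H (rep_sum H M N) M"
    by (rule rep_homI) (use assms in \<open>auto simp: rmat_sum hcat_bdiag mult_hcat\<close>)
  show "hcat (0\<^sub>m ?n ?m) (1\<^sub>m ?n) \<in> rep_hom H (rep_sum H M N) N"
    by (rule rep_homI) (use assms in \<open>auto simp: rmat_sum hcat_bdiag mult_hcat\<close>)
  show "vcat (1\<^sub>m ?m) (0\<^sub>m ?n ?m) * hcat (1\<^sub>m ?m) (0\<^sub>m ?m ?n) + vcat (0\<^sub>m ?m ?n) (1\<^sub>m ?n) * hcat (0\<^sub>m ?n ?m) (1\<^sub>m ?n)
    = (1\<^sub>m (rdim (rep_sum H M N)) :: 'k mat)"
    by (simp add: vcat_hcat) (rule eq_matI; auto)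
qed (simp_all add: hcat_vcat)

lemma rep_iso_sum_cong:
  assumes "M \<in> reps H" "N \<in> reps H" "M' \<in> reps H" "N' \<in> reps H" "rep_iso H M M'" "rep_iso H N N'"
  shows "rep_iso H (rep_sum H M N) (rep_sum H M' N')"
proof -
  obtain f g where fg: "f \<in> rep_hom H M M'" "g \<in> rep_hom H M' M" "g * f = 1\<^sub>m (rdim M)" "f * g = 1\<^sub>m (rdim M')"
    using assms by (auto simp: rep_iso_def)
  obtain f' g' where fg': "f' \<in> rep_hom H N N'" "g' \<in> rep_hom H N' N" "g' * f' = 1\<^sub>m (rdim N)" "f' * g' = 1\<^sub>m (rdim N')"
    using assms by (auto simp: rep_iso_def)
  show ?thesis
  proof (rule rep_isoI[of "bdiag f f'" _ _ _ "bdiag g g'"])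
    show "bdiag f f' \<in> rep_hom H (rep_sum H M N) (rep_sum H M' N')"
    proof (rule rep_homI)
      fix b assume "b \<in> basis H"
      then show "rmat (rep_sum H M' N') b * bdiag f f' = bdiag f f' * rmat (rep_sum H M N) b"
        using assms fg fg' by (subst (1 2) rmat_sum) (auto simp only: bdiag_mult rep_hom_dim reps_dim rep_homD)
    qed (use fg fg' in auto)
    show "bdiag g g' \<in> rep_hom H (rep_sum H M' N') (rep_sum H M N)"
    proof (rule rep_homI)
      fix b assume "b \<in> basis H"
      then show "rmat (rep_sum H M N) b * bdiag g g' = bdiag g g' * rmat (rep_sum H M' N') b"
        using assms fg fg' by (subst (1 2) rmat_sum) (auto simp only: bdiag_mult rep_hom_dim reps_dim rep_homD)
    qed (use fg fg' in auto)
    show "bdiag g g' * bdiag f f' = 1\<^sub>m (rdim (rep_sum H M N))"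
      using fg fg' by (subst bdiag_mult) auto
    show "bdiag f f' * bdiag g g' = 1\<^sub>m (rdim (rep_sum H M' N'))"
      using fg fg' by (subst bdiag_mult) auto
  qed
qed

text \<open>The complement of the image of \<open>a\<close> is the image of the idempotent \<open>1 - a b\<close>.\<close>

lemma rep_split:
  fixes H :: "('b, 'k::field) hopf"
  assumes M: "M \<in> reps H" and X: "X \<in> reps H" and a: "a \<in> rep_hom H X M" and b: "b \<in> rep_hom H M X"
    and ba: "b * a = 1\<^sub>m (rdim X)"
  obtains N where "N \<in> reps H" "rep_iso H M (rep_sum H X N)"
proof -
  note [simp] = rep_hom_dim[OF a] rep_hom_dim[OF b] reps_dim[OF M] reps_dim[OF X]
  let ?m = "rdim M"
  define e where "e = 1\<^sub>m ?m - a * b"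
  have e_hom: "e \<in> rep_hom H M M"
    unfolding e_def using assms by (intro rep_hom_minus rep_hom_one rep_hom_comp[of M H X]) auto
  note [simp] = rep_hom_dim[OF e_hom]
  have ea: "e * a = 0\<^sub>m ?m (rdim X)" unfolding e_def
    by (subst minus_mult_dim) (auto simp: mult_assoc_dim ba)
  have be: "b * e = 0\<^sub>m (rdim X) ?m" unfolding e_def
    by (subst mult_minus_dim) (auto simp: mult_cancel_left[OF ba])
  have ee: "e * e = e"
  proof -
    have "e * e = e - a * (b * e)"
      by (subst (1) e_def, subst minus_mult_dim) (auto simp: mult_assoc_dim)
    then show ?thesis by (auto simp: be intro!: eq_matI)
  qed
  obtain C D C' D' r where e: "e = C * D" and C: "C' * C = 1\<^sub>m r" and D: "D * D' = 1\<^sub>m r"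
    and dims0: "dim_row C = dim_row e" "dim_col C = r" "dim_row D = r" "dim_col D = dim_col e"
    "dim_row C' = r" "dim_col C' = dim_row e" "dim_row D' = dim_col e" "dim_col D' = r"
    by (rule rank_factorization[of e])
  note dims [simp] = dims0[unfolded rep_hom_dim[OF e_hom]]
  have C1: "C' * e = D" by (simp add: e mult_cancel_left[OF C])
  have D1: "e * D' = C" by (simp add: e mult_assoc_dim D)
  have eC: "e * C = C" using ee by (simp flip: D1 add: mult_assoc_dim[symmetric])
  have De: "D * e = D" using ee by (simp flip: C1 add: mult_assoc_dim)
  \<comment> \<open>\<open>C' * e = D\<close> gives D C = C' e C = C' C = 1; hence x acts on the
    image of e by D x C.\<close>
  have DC: "D * C = 1\<^sub>m r"
    using eC C by (metis C1 D1 De D mult_assoc_dim e_hom dims rep_hom_dim)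
  have act_e: "rmat M x * e = e * rmat M x" if "x \<in> basis H" for x
    using rep_homD[OF e_hom that] .
  define N where "N = \<lparr>rdim = r, rmat = (\<lambda>x\<in>basis H. D * rmat M x * C)\<rparr>"
  have rN: "rmat N x = D * (rmat M x * C)" if "x \<in> basis H" for x
    using that by (simp add: N_def mult_assoc_dim)
  have [simp]: "rdim N = r" by (simp add: N_def)
  have CN: "C * rmat N x = rmat M x * C" if "x \<in> basis H" for x
  proof -
    have "C * rmat N x = e * (rmat M x * C)" using that by (simp add: rN e mult_assoc_dim)
    also have "\<dots> = rmat M x * (e * C)" using that by (simp add: mult_assoc_dim[symmetric] act_e)
    finally show ?thesis by (simp add: eC)
  qed
  have DN: "rmat N x * D = D * rmat M x" if "x \<in> basis H" for x
  proof -
    have "rmat N x * D = D * (rmat M x * e)" using that by (simp add: rN e mult_assoc_dim)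
    also have "\<dots> = D * e * rmat M x" using that by (simp add: mult_assoc_dim act_e)
    finally show ?thesis by (simp add: De)
  qed
  have actN: "act H N x = D * act H M x * C" for x
    unfolding act_lincomb \<open>rdim N = r\<close>
    by (subst mult_lincomb lincomb_mult; simp)+ (auto intro!: lincomb_cong simp: rN mult_assoc_dim)
  have N: "N \<in> reps H"
    unfolding reps_def
  proof (intro CollectI conjI ballI)
    show "rmat N \<in> basis H \<rightarrow>\<^sub>E carrier_mat (rdim N) (rdim N)" by (auto simp: N_def intro!: carrier_matI)
    show "act H N (unt H) = 1\<^sub>m (rdim N)" using M DC by (simp add: actN reps_def)
    fix x y assume xy: "x \<in> basis H" "y \<in> basis H"
    have "act H N (prd H x y) = D * (rmat M x * rmat M y) * C"
      using M xy by (simp add: actN reps_def)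
    also have "\<dots> = D * rmat M x * (C * rmat N y)" using xy by (simp add: CN mult_assoc_dim)
    also have "\<dots> = rmat N x * rmat N y" using xy by (simp add: rN mult_assoc_dim)
    finally show "act H N (prd H x y) = rmat N x * rmat N y" .
  qed
  have "rep_iso H M (rep_sum H X N)"
  proof (rule rep_iso_sumI[OF X N M a _ b _ ba])
    show "C \<in> rep_hom H N M" by (rule rep_homI) (auto simp: CN)
    show "D \<in> rep_hom H M N" by (rule rep_homI) (auto simp: DN)
    show "D * C = 1\<^sub>m (rdim N)" by (simp add: DC)
    show "b * C = 0\<^sub>m (rdim X) (rdim N)"
      by (simp flip: D1 add: mult_assoc_dim[symmetric] be)
    show "D * a = 0\<^sub>m (rdim N) (rdim X)"
      by (simp flip: C1 add: mult_assoc_dim ea)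
    show "a * b + C * D = 1\<^sub>m ?m"
      unfolding e[symmetric] e_def by (rule eq_matI) auto
  qed
  with N show ?thesis by (rule that)
qed

subsection \<open>Tensor products\<close>

lemma rdim_tensor [simp]: "rdim (rep_tensor H M N) = rdim M * rdim N"
  by (simp add: rep_tensor_def)

lemma rmat_tensor: "b \<in> basis H \<Longrightarrow> rmat (rep_tensor H M N) b =
  lincomb (rdim M * rdim N) (rdim M * rdim N) (basis H \<times> basis H) (coprd H b)
    (\<lambda>p. kron (rmat M (fst p)) (rmat N (snd p)))"
  by (simp add: rep_tensor_def lincomb_def)

lemma kron_rep_hom:
  assumes reps: "M \<in> reps H" "N \<in> reps H" "M' \<in> reps H" "N' \<in> reps H"
    and f: "f \<in> rep_hom H M M'" and g: "g \<in> rep_hom H N N'"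
  shows "kron f g \<in> rep_hom H (rep_tensor H M N) (rep_tensor H M' N')"
proof (rule rep_homI)
  note [simp] = rep_hom_dim[OF f] rep_hom_dim[OF g]
  show "dim_row (kron f g) = rdim (rep_tensor H M' N')" "dim_col (kron f g) = rdim (rep_tensor H M N)"
    by simp_all
  fix b assume b: "b \<in> basis H"
  show "rmat (rep_tensor H M' N') b * kron f g = kron f g * rmat (rep_tensor H M N) b"
    using b reps f g by (subst (1 2) rmat_tensor, simp, subst lincomb_mult, simp, simp add: mem_Times_iff,
      subst mult_lincomb, simp, simp add: mem_Times_iff)
     (auto intro!: lincomb_cong simp: kron_mult rep_homD)
qed

lemma rep_iso_tensor_cong:
  assumes "M \<in> reps H" "N \<in> reps H" "M' \<in> reps H" "N' \<in> reps H" "rep_iso H M M'" "rep_iso H N N'"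
  shows "rep_iso H (rep_tensor H M N) (rep_tensor H M' N')"
proof -
  obtain f g where fg: "f \<in> rep_hom H M M'" "g \<in> rep_hom H M' M" "g * f = 1\<^sub>m (rdim M)" "f * g = 1\<^sub>m (rdim M')"
    using assms by (auto simp: rep_iso_def)
  obtain f' g' where fg': "f' \<in> rep_hom H N N'" "g' \<in> rep_hom H N' N" "g' * f' = 1\<^sub>m (rdim N)" "f' * g' = 1\<^sub>m (rdim N')"
    using assms by (auto simp: rep_iso_def)
  show ?thesis
    by (rule rep_isoI[of "kron f f'" _ _ _ "kron g g'"]) (use assms fg fg' in \<open>auto intro!: kron_rep_hom simp: kron_mult\<close>)
qed

text \<open>A \<open>hopf\<close> record carries no axioms, so it has to be assumed here that the
  tensor products involved are modules.\<close>

lemma rep_tensor_sum_left: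
  assumes reps: "M \<in> reps H" "N \<in> reps H" "P \<in> reps H"
    and S: "rep_tensor H M P \<in> reps H" "rep_tensor H N P \<in> reps H" "rep_tensor H (rep_sum H M N) P \<in> reps H"
  shows "rep_iso H (rep_tensor H (rep_sum H M N) P) (rep_sum H (rep_tensor H M P) (rep_tensor H N P))"
proof -
  obtain i1 i2 p1 p2 where ip: "i1 \<in> rep_hom H M (rep_sum H M N)" "i2 \<in> rep_hom H N (rep_sum H M N)"
    "p1 \<in> rep_hom H (rep_sum H M N) M" "p2 \<in> rep_hom H (rep_sum H M N) N"
    "p1 * i1 = 1\<^sub>m (rdim M)" "p2 * i2 = 1\<^sub>m (rdim N)"
    "p1 * i2 = 0\<^sub>m (rdim M) (rdim N)" "p2 * i1 = 0\<^sub>m (rdim N) (rdim M)"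
    "i1 * p1 + i2 * p2 = 1\<^sub>m (rdim (rep_sum H M N))"
    using rep_sum_biproduct[OF reps(1,2)] .
  note [simp] = rep_hom_dim[OF ip(1)] rep_hom_dim[OF ip(2)] rep_hom_dim[OF ip(3)] rep_hom_dim[OF ip(4)]
  let ?k = "\<lambda>f. kron f (1\<^sub>m (rdim P))"
  show ?thesis
    by (rule rep_iso_sumI[OF S, of "?k i1" "?k i2" "?k p1" "?k p2"])
       (use reps ip in \<open>auto intro!: kron_rep_hom rep_hom_one rep_sum_rep simp: kron_mult simp flip: kron_add_left\<close>)
qed

lemma rep_tensor_sum_right:
  assumes reps: "M \<in> reps H" "N \<in> reps H" "P \<in> reps H"
    and S: "rep_tensor H P M \<in> reps H" "rep_tensor H P N \<in> reps H" "rep_tensor H P (rep_sum H M N) \<in> reps H"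
  shows "rep_iso H (rep_tensor H P (rep_sum H M N)) (rep_sum H (rep_tensor H P M) (rep_tensor H P N))"
proof -
  obtain i1 i2 p1 p2 where ip: "i1 \<in> rep_hom H M (rep_sum H M N)" "i2 \<in> rep_hom H N (rep_sum H M N)"
    "p1 \<in> rep_hom H (rep_sum H M N) M" "p2 \<in> rep_hom H (rep_sum H M N) N"
    "p1 * i1 = 1\<^sub>m (rdim M)" "p2 * i2 = 1\<^sub>m (rdim N)"
    "p1 * i2 = 0\<^sub>m (rdim M) (rdim N)" "p2 * i1 = 0\<^sub>m (rdim N) (rdim M)"
    "i1 * p1 + i2 * p2 = 1\<^sub>m (rdim (rep_sum H M N))"
    using rep_sum_biproduct[OF reps(1,2)] .
  note [simp] = rep_hom_dim[OF ip(1)] rep_hom_dim[OF ip(2)] rep_hom_dim[OF ip(3)] rep_hom_dim[OF ip(4)]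
  let ?k = "\<lambda>f. kron (1\<^sub>m (rdim P)) f"
  show ?thesis
    by (rule rep_iso_sumI[OF S, of "?k i1" "?k i2" "?k p1" "?k p2"])
       (use reps ip in \<open>auto intro!: kron_rep_hom rep_hom_one rep_sum_rep simp: kron_mult simp flip: kron_add_right\<close>)
qed

section \<open>The Green ring\<close>

definition field_ring :: "'k::field ring"
  where "field_ring = \<lparr>carrier = UNIV, monoid.mult = (*), one = 1, ring.zero = 0, ring.add = (+)\<rparr>"

lemma field_ring_simps [simp]:
  "carrier field_ring = UNIV" "x \<oplus>\<^bsub>field_ring\<^esub> y = x + y" "\<zero>\<^bsub>field_ring\<^esub> = 0"
  by (auto simp: field_ring_def)

lemma (in abelian_group) minus_diff_diff:
  "a \<in> carrier G \<Longrightarrow> b \<in> carrier G \<Longrightarrow> c \<in> carrier G \<Longrightarrow> d \<in> carrier G \<Longrightarrow>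
    (a \<ominus> b) \<ominus> (c \<ominus> d) = (a \<oplus> d) \<ominus> (b \<oplus> c)"
  by (simp add: minus_eq minus_add a_ac)

lemma frag_extend_fun_diff: "frag_extend (\<lambda>x. u x - v x) a = frag_extend u a - frag_extend v a"
  by (rule poly_mapping_eqI) (simp add: frag_extend_def lookup_minus lookup_sum right_diff_distrib sum_subtractf)

lemma frag_cmul_single: "frag_cmul c (Poly_Mapping.single x d) = Poly_Mapping.single x (c * d)"
  by (rule poly_mapping_eqI) (simp add: lookup_single when_def)

text \<open>What the Green ring needs of the Hopf algebra, with associativity and unit laws as
  equalities of modules. Both the group algebra and H are instances, so the construction is carried
  out once.\<close>

locale tensor_hopf =
  fixes H :: "('b, 'k::field) hopf"
  assumes tensor_rep: "M \<in> reps H \<Longrightarrow> N \<in> reps H \<Longrightarrow> rep_tensor H M N \<in> reps H"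
    and unit_rep: "rep_unit H \<in> reps H"
    and tensor_assoc: "M \<in> reps H \<Longrightarrow> N \<in> reps H \<Longrightarrow> P \<in> reps H \<Longrightarrow>
      rep_tensor H (rep_tensor H M N) P = rep_tensor H M (rep_tensor H N P)"
    and unit_tensor: "M \<in> reps H \<Longrightarrow> rep_tensor H (rep_unit H) M = M"
    and tensor_unit: "M \<in> reps H \<Longrightarrow> rep_tensor H M (rep_unit H) = M"
begin

definition "iso_classes = iso_class H ` reps H"

text \<open>The product of \<open>free_green\<close> expressed by \<open>frag_extend\<close>, whose
  additivity rules then apply in both arguments.\<close>

definition mul :: "(('b, 'k) rep set \<Rightarrow>\<^sub>0 int) \<Rightarrow> (('b, 'k) rep set \<Rightarrow>\<^sub>0 int) \<Rightarrow> ('b, 'k) rep set \<Rightarrow>\<^sub>0 int"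
  where "mul f g = frag_extend (\<lambda>X. frag_extend (\<lambda>Y. frag_of (class_tensor H X Y)) g) f"

lemma iso_class_eq_iff:
  assumes "M \<in> reps H" "N \<in> reps H"
  shows "iso_class H M = iso_class H N \<longleftrightarrow> rep_iso H M N"
proof
  assume "iso_class H M = iso_class H N"
  moreover have "N \<in> iso_class H N" using assms rep_iso_refl by (auto simp: iso_class_def)
  ultimately have "N \<in> iso_class H M" by simp
  then show "rep_iso H M N" by (simp add: iso_class_def)
next
  assume "rep_iso H M N"
  then show "iso_class H M = iso_class H N"
    using assms unfolding iso_class_def by (blast intro: rep_iso_trans rep_iso_sym)
qed

lemma class_tensor_iso_class:
  assumes "M \<in> reps H" "N \<in> reps H"
  shows "class_tensor H (iso_class H M) (iso_class H N) = iso_class H (rep_tensor H M N)"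
proof -
  have "iso_class H (rep_tensor H M' N') = iso_class H (rep_tensor H M N)"
    if "M' \<in> iso_class H M" "N' \<in> iso_class H N" for M' N'
    using that assms rep_iso_tensor_cong[of M H N M' N'] tensor_rep[of M N] tensor_rep[of M' N']
    by (subst iso_class_eq_iff) (auto simp: iso_class_def intro: rep_iso_sym)
  moreover have "M \<in> iso_class H M" "N \<in> iso_class H N" using assms rep_iso_refl by (auto simp: iso_class_def)
  ultimately show ?thesis unfolding class_tensor_def by blast
qed

lemma free_green_simps:
  "carrier (free_green H) = {c. Poly_Mapping.keys c \<subseteq> iso_classes}"
  "x \<otimes>\<^bsub>free_green H\<^esub> y = mul x y"
  "\<one>\<^bsub>free_green H\<^esub> = sgl H (rep_unit H)" "\<zero>\<^bsub>free_green H\<^esub> = 0" "x \<oplus>\<^bsub>free_green H\<^esub> y = x + y"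
  by (auto simp: free_green_def iso_classes_def mul_def frag_extend_def frag_cmul_sum frag_cmul_single)

lemma free_green_zero [simp]: "0 \<in> carrier (free_green H)"
  by (simp add: free_green_simps)

lemma mul_diff_left: "mul (a - b) c = mul a c - mul b c"
  by (simp add: mul_def frag_extend_diff)

lemma mul_diff_right: "mul c (a - b) = mul c a - mul c b"
  by (simp add: mul_def frag_extend_diff frag_extend_fun_diff)

lemma mul_zero [simp]: "mul 0 a = 0" "mul a 0 = 0"
  using mul_diff_right[of a 0 0] by (simp_all add: mul_def)

lemma mul_add_left: "mul (a + b) c = mul a c + mul b c"
  using mul_diff_left[of a "0 - b" c] mul_diff_left[of 0 b c] by simp

lemma mul_add_right: "mul c (a + b) = mul c a + mul c b"
  using mul_diff_right[of c a "0 - b"] mul_diff_right[of c 0 b] by simp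

lemma mul_sgl: "M \<in> reps H \<Longrightarrow> N \<in> reps H \<Longrightarrow> mul (sgl H M) (sgl H N) = sgl H (rep_tensor H M N)"
  by (simp add: mul_def class_tensor_iso_class)

text \<open>Closure under differences suffices, since sums and negatives are differences. Identities
  between additive maps are thereby reduced to isomorphism classes of modules.\<close>

lemma free_green_induct [consumes 1, case_names zero diff sgl]:
  assumes "x \<in> carrier (free_green H)"
    and "P 0" "\<And>x y. x \<in> carrier (free_green H) \<Longrightarrow> y \<in> carrier (free_green H) \<Longrightarrow> P x \<Longrightarrow> P y \<Longrightarrow> P (x - y)"
    and "\<And>M. M \<in> reps H \<Longrightarrow> P (sgl H M)"
  shows "P x"
proof (rule free_Abelian_group_induct[of x iso_classes])
  show "P (frag_of X)" if "X \<in> iso_classes" for X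
    using that assms(4) by (auto simp: iso_classes_def)
qed (use assms(1-3) in \<open>simp_all add: free_green_simps(1)\<close>)

lemma sgl_carrier [simp]: "M \<in> reps H \<Longrightarrow> sgl H M \<in> carrier (free_green H)"
  by (auto simp: free_green_simps iso_classes_def)

lemma free_green_abelian_group: "abelian_group (free_green H)"
proof (rule abelian_groupI)
  fix x assume "x \<in> carrier (free_green H)"
  then show "\<exists>y\<in>carrier (free_green H). y \<oplus>\<^bsub>free_green H\<^esub> x = \<zero>\<^bsub>free_green H\<^esub>"
    by (intro bexI[of _ "- x"]) (auto simp: free_green_simps)
qed (auto simp: free_green_simps dest: subsetD[OF keys_add])

lemma free_green_minus [simp]: "x \<in> carrier (free_green H) \<Longrightarrow> \<ominus>\<^bsub>free_green H\<^esub> x = - x"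
proof -
  interpret abelian_group "free_green H" by (rule free_green_abelian_group)
  assume x: "x \<in> carrier (free_green H)"
  then have "- x \<in> carrier (free_green H)" by (auto simp: free_green_simps)
  then show ?thesis using x by (intro minus_equality) (auto simp: free_green_simps)
qed

lemma free_green_diff_closed: "x \<in> carrier (free_green H) \<Longrightarrow> y \<in> carrier (free_green H) \<Longrightarrow> x - y \<in> carrier (free_green H)"
  by (auto simp: free_green_simps dest: subsetD[OF keys_diff])

lemma mul_closed:
  assumes "x \<in> carrier (free_green H)" "y \<in> carrier (free_green H)"
  shows "mul x y \<in> carrier (free_green H)"
  using assms(1)
proof (induction rule: free_green_induct)
  case (sgl M)
  show ?case using assms(2)
    by (induction rule: free_green_induct)
       (auto simp: mul_sgl sgl tensor_rep mul_diff_right intro: free_green_diff_closed)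
qed (auto simp: mul_diff_left intro: free_green_diff_closed)

lemma free_green_ring: "ring (free_green H)"
proof (rule ringI)
  show "abelian_group (free_green H)" by (rule free_green_abelian_group)
  show "Group.monoid (free_green H)"
  proof (rule monoidI)
    fix x y z assume xyz: "x \<in> carrier (free_green H)" "y \<in> carrier (free_green H)" "z \<in> carrier (free_green H)"
    have "mul (mul x y) z = mul x (mul y z)"
      using xyz(1)
    proof (induction rule: free_green_induct)
      case (sgl L)
      show ?case using xyz(2)
      proof (induction rule: free_green_induct)
        case (sgl M)
        show ?case using xyz(3)
          by (induction rule: free_green_induct)
             (auto simp: mul_diff_left mul_diff_right mul_sgl tensor_rep tensor_assoc \<open>L \<in> reps H\<close> \<open>M \<in> reps H\<close>)
      qed (auto simp: mul_diff_left mul_diff_right)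
    qed (auto simp: mul_diff_left mul_diff_right)
    then show "x \<otimes>\<^bsub>free_green H\<^esub> y \<otimes>\<^bsub>free_green H\<^esub> z = x \<otimes>\<^bsub>free_green H\<^esub> (y \<otimes>\<^bsub>free_green H\<^esub> z)"
      by (simp add: free_green_simps)
  next
    fix x assume x: "x \<in> carrier (free_green H)"
    then show "\<one>\<^bsub>free_green H\<^esub> \<otimes>\<^bsub>free_green H\<^esub> x = x"
      unfolding free_green_simps(2,3)
      by (induction rule: free_green_induct) (auto simp: mul_diff_right mul_sgl unit_rep unit_tensor)
    show "x \<otimes>\<^bsub>free_green H\<^esub> \<one>\<^bsub>free_green H\<^esub> = x" using x
      unfolding free_green_simps(2,3)
      by (induction rule: free_green_induct) (auto simp: mul_diff_left mul_sgl unit_rep tensor_unit)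
  next
    show "\<one>\<^bsub>free_green H\<^esub> \<in> carrier (free_green H)"
      unfolding free_green_simps(3) by (simp add: unit_rep)
  qed (simp add: free_green_simps(2) mul_closed)
qed (simp_all add: free_green_simps mul_add_left mul_add_right)

definition "gens = {sgl H (rep_sum H M N) - (sgl H M + sgl H N) | M N. M \<in> reps H \<and> N \<in> reps H}"

lemma green_rel_generate: "green_rel H = generate (add_monoid (free_green H)) gens"
  by (simp add: green_rel_def gens_def)

lemma gens_carrier: "gens \<subseteq> carrier (free_green H)"
proof
  fix x assume "x \<in> gens"
  then obtain M N where MN: "M \<in> reps H" "N \<in> reps H" "x = sgl H (rep_sum H M N) - (sgl H M + sgl H N)"
    by (auto simp: gens_def)
  have "sgl H M + sgl H N \<in> carrier (free_green H)"
    using MN ring.ring_simprules(1)[OF free_green_ring, of "sgl H M" "sgl H N"] by (simp add: free_green_simps(5))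
  then show "x \<in> carrier (free_green H)"
    unfolding MN(3) using MN(1,2) by (intro free_green_diff_closed[OF sgl_carrier[OF rep_sum_rep]])
qed

lemma green_rel_additive: "additive_subgroup (green_rel H) (free_green H)"
  unfolding green_rel_generate additive_subgroup_def
  using group.generate_is_subgroup[OF abelian_group.a_group[OF free_green_abelian_group]] gens_carrier by simp

lemma green_rel_sum: "M \<in> reps H \<Longrightarrow> N \<in> reps H \<Longrightarrow> sgl H (rep_sum H M N) - (sgl H M + sgl H N) \<in> green_rel H"
  unfolding green_rel_generate by (rule generate.incl) (auto simp: gens_def)

lemma green_rel_diff: "x \<in> green_rel H \<Longrightarrow> y \<in> green_rel H \<Longrightarrow> x - y \<in> green_rel H"
proof -
  interpret abelian_group "free_green H" by (rule free_green_abelian_group)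
  interpret additive_subgroup "green_rel H" "free_green H" by (rule green_rel_additive)
  assume xy: "x \<in> green_rel H" "y \<in> green_rel H"
  then have "x \<oplus>\<^bsub>free_green H\<^esub> \<ominus>\<^bsub>free_green H\<^esub> y \<in> green_rel H"
    using a_closed a_inv_closed by (auto intro!: a_closed)
  then show ?thesis using a_Hcarr[OF xy(2)] by (simp add: free_green_simps(5))
qed

lemma green_rel_zero: "0 \<in> green_rel H"
  using additive_subgroup.zero_closed[OF green_rel_additive] by (simp add: free_green_simps(4))

text \<open>Applied to left and to right multiplication by the class of a module, where only the
  effect on a generating relation has to be computed.\<close>

lemma green_rel_induct:
  assumes "\<And>x. x \<in> gens \<Longrightarrow> f x \<in> green_rel H" "\<And>x y. f (x - y) = f x - f y" "x \<in> green_rel H"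
  shows "f x \<in> green_rel H"
proof -
  have f0: "f 0 = 0" using assms(2)[of 0 0] by simp
  have fm: "f (- x) = - f x" for x using assms(2)[of 0 x] f0 by simp
  have fa: "f (x + y) = f x + f y" for x y using assms(2)[of x "- y"] fm by simp
  have neg: "- x \<in> green_rel H" if "x \<in> green_rel H" for x
    using green_rel_diff[OF green_rel_zero that] by simp
  show ?thesis using assms(3) unfolding green_rel_generate
  proof (induction rule: generate.induct)
    case one
    have "\<one>\<^bsub>add_monoid (free_green H)\<^esub> = 0" by (simp add: free_green_simps(4))
    then show ?case unfolding green_rel_generate[symmetric] by (simp only: f0 green_rel_zero)
  next
    case (incl x)
    then show ?case using assms(1) by (simp only: green_rel_generate)
  next
    case (inv x)
    then have "inv\<^bsub>add_monoid (free_green H)\<^esub> x = - x"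
      using free_green_minus[of x] gens_carrier by (auto simp: a_inv_def)
    then show ?case
      unfolding green_rel_generate[symmetric] using neg[OF assms(1)[OF inv]] fm by simp
  next
    case (eng x y)
    have "x \<otimes>\<^bsub>add_monoid (free_green H)\<^esub> y = x + y" by (simp add: free_green_simps(5))
    then show ?case using eng(3,4) green_rel_diff[of "f x" "- f y"] neg[of "f y"] fa
      unfolding green_rel_generate[symmetric] by simp
  qed
qed

lemma free_green_a_minus: "x \<in> carrier (free_green H) \<Longrightarrow> y \<in> carrier (free_green H) \<Longrightarrow> x \<ominus>\<^bsub>free_green H\<^esub> y = x - y"
  by (simp add: a_minus_def free_green_simps(5))

text \<open>Distributivity of the tensor product over direct sums turns a generating relation,
  multiplied by the class of a module, into another generating relation.\<close>

lemma green_rel_ideal: "ideal (green_rel H) (free_green H)"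
proof (rule idealI)
  show "ring (free_green H)" by (rule free_green_ring)
  show "subgroup (green_rel H) (add_monoid (free_green H))"
    using green_rel_additive by (simp add: additive_subgroup_def)
  have sgl_eq: "sgl H M = sgl H N" if "M \<in> reps H" "N \<in> reps H" "rep_iso H M N" for M N
    using iso_class_eq_iff[OF that(1,2)] that(3) by simp
  fix a x assume a: "a \<in> green_rel H" and x: "x \<in> carrier (free_green H)"
  have "mul x a \<in> green_rel H \<and> mul a x \<in> green_rel H"
    using x
  proof (induction rule: free_green_induct)
    case zero
    then show ?case using green_rel_zero by simp
  next
    case (diff x y)
    then show ?case by (simp add: mul_diff_left mul_diff_right green_rel_diff)
  next
    case (sgl P)
    show ?case
    proof
      show "mul (sgl H P) a \<in> green_rel H"
      proof (rule green_rel_induct[OF _ _ a])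
        fix x assume "x \<in> gens"
        then obtain M N where MN: "M \<in> reps H" "N \<in> reps H" "x = sgl H (rep_sum H M N) - (sgl H M + sgl H N)"
          by (auto simp: gens_def)
        then have "mul (sgl H P) x = sgl H (rep_tensor H P (rep_sum H M N)) - (sgl H (rep_tensor H P M) + sgl H (rep_tensor H P N))"
          using sgl by (simp add: mul_diff_right mul_add_right mul_sgl rep_sum_rep)
        also have "sgl H (rep_tensor H P (rep_sum H M N)) = sgl H (rep_sum H (rep_tensor H P M) (rep_tensor H P N))"
          using MN sgl by (intro sgl_eq rep_tensor_sum_right tensor_rep rep_sum_rep) auto
        finally show "mul (sgl H P) x \<in> green_rel H"
          using green_rel_sum MN sgl tensor_rep by simp
      qed (simp add: mul_diff_right)
      show "mul a (sgl H P) \<in> green_rel H"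
      proof (rule green_rel_induct[OF _ _ a, of "\<lambda>a. mul a (sgl H P)"])
        fix x assume "x \<in> gens"
        then obtain M N where MN: "M \<in> reps H" "N \<in> reps H" "x = sgl H (rep_sum H M N) - (sgl H M + sgl H N)"
          by (auto simp: gens_def)
        then have "mul x (sgl H P) = sgl H (rep_tensor H (rep_sum H M N) P) - (sgl H (rep_tensor H M P) + sgl H (rep_tensor H N P))"
          using sgl by (simp add: mul_diff_left mul_add_left mul_sgl rep_sum_rep)
        also have "sgl H (rep_tensor H (rep_sum H M N) P) = sgl H (rep_sum H (rep_tensor H M P) (rep_tensor H N P))"
          using MN sgl by (intro sgl_eq rep_tensor_sum_left tensor_rep rep_sum_rep) auto
        finally show "mul x (sgl H P) \<in> green_rel H"
          using green_rel_sum MN sgl tensor_rep by simp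
      qed (simp add: mul_diff_left)
    qed
  qed
  then show "x \<otimes>\<^bsub>free_green H\<^esub> a \<in> green_rel H" "a \<otimes>\<^bsub>free_green H\<^esub> x \<in> green_rel H"
    by (simp_all add: free_green_simps)
qed

lemma green_ring: "ring (green_ring H)"
  unfolding green_ring_def by (rule ideal.quotient_is_ring[OF green_rel_ideal])

lemma coset_hom: "a_r_coset (free_green H) (green_rel H) \<in> Ring.ring_hom (free_green H) (green_ring H)"
  unfolding green_ring_def by (rule ideal.rcos_ring_hom[OF green_rel_ideal])

lemma green_class_closed [simp]: "M \<in> reps H \<Longrightarrow> green_class H M \<in> carrier (green_ring H)"
  unfolding green_class_def using ring_hom_closed[OF coset_hom] by simp

lemma green_class_cong: "M \<in> reps H \<Longrightarrow> N \<in> reps H \<Longrightarrow> rep_iso H M N \<Longrightarrow> green_class H M = green_class H N"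
  unfolding green_class_def using iso_class_eq_iff[of M N] by simp

lemma green_class_tensor: "M \<in> reps H \<Longrightarrow> N \<in> reps H \<Longrightarrow>
    green_class H (rep_tensor H M N) = green_class H M \<otimes>\<^bsub>green_ring H\<^esub> green_class H N"
  unfolding green_class_def by (simp add: ring_hom_mult[OF coset_hom, symmetric] free_green_simps(2) mul_sgl)

lemma green_class_unit: "green_class H (rep_unit H) = \<one>\<^bsub>green_ring H\<^esub>"
  unfolding green_class_def using ring_hom_one[OF coset_hom] by (simp add: free_green_simps(3))

lemma green_class_sum:
  assumes "M \<in> reps H" "N \<in> reps H"
  shows "green_class H (rep_sum H M N) = green_class H M \<oplus>\<^bsub>green_ring H\<^esub> green_class H N"
proof -
  interpret ring "free_green H" by (rule free_green_ring)
  have "sgl H M \<oplus>\<^bsub>free_green H\<^esub> sgl H N \<in> carrier (free_green H)"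
    using assms by (intro a_closed) auto
  then have "green_rel H +>\<^bsub>free_green H\<^esub> sgl H (rep_sum H M N) = green_rel H +>\<^bsub>free_green H\<^esub> (sgl H M \<oplus>\<^bsub>free_green H\<^esub> sgl H N)"
    using assms green_rel_sum[OF assms]
    by (subst quotient_eq_iff_same_a_r_cos[OF green_rel_ideal, symmetric])
       (auto simp: free_green_a_minus rep_sum_rep, simp add: free_green_simps(5))
  then show ?thesis
    unfolding green_class_def using assms by (simp add: ring_hom_add[OF coset_hom])
qed

lemma green_carrier_coset: "x \<in> carrier (green_ring H) \<longleftrightarrow> (\<exists>f\<in>carrier (free_green H). x = green_rel H +>\<^bsub>free_green H\<^esub> f)"
  by (auto simp: green_ring_def FactRing_def A_RCOSETS_def')

lemma coset_diff:
  assumes "a \<in> carrier (free_green H)" "b \<in> carrier (free_green H)"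
  shows "green_rel H +>\<^bsub>free_green H\<^esub> (a - b) =
    (green_rel H +>\<^bsub>free_green H\<^esub> a) \<ominus>\<^bsub>green_ring H\<^esub> (green_rel H +>\<^bsub>free_green H\<^esub> b)"
proof -
  interpret R: ring "free_green H" by (rule free_green_ring)
  interpret S: ring "green_ring H" by (rule green_ring)
  interpret h: ring_hom_ring "free_green H" "green_ring H" "a_r_coset (free_green H) (green_rel H)"
    by (rule ring_hom_ringI2[OF R.ring_axioms S.ring_axioms coset_hom])
  have "a - b = a \<oplus>\<^bsub>free_green H\<^esub> \<ominus>\<^bsub>free_green H\<^esub> b" using assms by (simp add: free_green_simps(5))
  then show ?thesis using assms by (simp only: h.hom_add h.hom_a_inv R.a_inv_closed S.minus_eq)
qed

text \<open>The zero module is literally its own direct sum with itself, so its class c satisfies c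
  = c + c.\<close>

lemma green_class_zero: "green_class H (zero_rep H) = \<zero>\<^bsub>green_ring H\<^esub>"
proof -
  interpret S: ring "green_ring H" by (rule green_ring)
  have "rep_sum H (zero_rep H) (zero_rep H) = zero_rep H"
    by (rule rep_dim0_eq) (auto intro: rep_sum_rep)
  then have "green_class H (zero_rep H) = green_class H (zero_rep H) \<oplus>\<^bsub>green_ring H\<^esub> green_class H (zero_rep H)"
    using green_class_sum[of "zero_rep H" "zero_rep H"] by simp
  then show ?thesis using S.add.l_cancel_one' green_class_closed by (metis zero_rep(1))
qed

text \<open>Differences of differences regroup: (M - N) - (M' - N') is the class of M + N' minus the
  class of N + M'.\<close>

lemma green_elem:
  assumes "x \<in> carrier (green_ring H)"
  obtains M N where "M \<in> reps H" "N \<in> reps H" "x = green_class H M \<ominus>\<^bsub>green_ring H\<^esub> green_class H N"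
proof -
  interpret S: ring "green_ring H" by (rule green_ring)
  obtain f where f: "f \<in> carrier (free_green H)" "x = green_rel H +>\<^bsub>free_green H\<^esub> f"
    using assms green_carrier_coset by auto
  have "\<exists>M\<in>reps H. \<exists>N\<in>reps H. green_rel H +>\<^bsub>free_green H\<^esub> f = green_class H M \<ominus>\<^bsub>green_ring H\<^esub> green_class H N"
    using f(1)
  proof (induction rule: free_green_induct)
    case zero
    have "green_rel H +>\<^bsub>free_green H\<^esub> 0 = green_class H (zero_rep H) \<ominus>\<^bsub>green_ring H\<^esub> green_class H (zero_rep H)"
      using coset_diff[of "sgl H (zero_rep H)" "sgl H (zero_rep H)"] by (simp add: green_class_def)
    then show ?case by (intro bexI[of _ "zero_rep H"]) auto
  next
    case (sgl M)
    have eq: "green_class H M = green_class H M \<ominus>\<^bsub>green_ring H\<^esub> green_class H (zero_rep H)"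
      using sgl by (simp add: green_class_zero S.minus_eq)
    show ?case
      by (intro bexI[of _ M] bexI[of _ "zero_rep H"], fold green_class_def) (rule eq, use sgl in simp_all)
  next
    case (diff a b)
    obtain M N where MN: "M \<in> reps H" "N \<in> reps H"
      "green_rel H +>\<^bsub>free_green H\<^esub> a = green_class H M \<ominus>\<^bsub>green_ring H\<^esub> green_class H N" using diff by blast
    obtain M' N' where MN': "M' \<in> reps H" "N' \<in> reps H"
      "green_rel H +>\<^bsub>free_green H\<^esub> b = green_class H M' \<ominus>\<^bsub>green_ring H\<^esub> green_class H N'" using diff by blast
    have c: "green_class H M \<in> carrier (green_ring H)" "green_class H N \<in> carrier (green_ring H)"
      "green_class H M' \<in> carrier (green_ring H)" "green_class H N' \<in> carrier (green_ring H)"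
      using MN MN' by auto
    have "green_rel H +>\<^bsub>free_green H\<^esub> (a - b) =
      green_class H (rep_sum H M N') \<ominus>\<^bsub>green_ring H\<^esub> green_class H (rep_sum H N M')"
      unfolding coset_diff[OF diff(1,2)] MN(3) MN'(3)
      by (simp only: S.minus_diff_diff[OF c] green_class_sum MN(1,2) MN'(1,2))
    then show ?case using MN MN' by (intro bexI[of _ "rep_sum H M N'"] bexI[of _ "rep_sum H N M'"] rep_sum_rep)
  qed
  then show ?thesis using that f by blast
qed

text \<open>The universal property of the additive group of the Green ring: the map extends over the
  free abelian group and vanishes on the generating relations, so its value on a coset does not
  depend on the representative.\<close>

lemma green_extend:
  fixes T :: "('c, 'm) ring_scheme" and F :: "('b, 'k) rep \<Rightarrow> 'c"
  assumes T: "abelian_group T"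
    and F: "\<And>M. M \<in> reps H \<Longrightarrow> F M \<in> carrier T"
    and iso: "\<And>M N. M \<in> reps H \<Longrightarrow> N \<in> reps H \<Longrightarrow> rep_iso H M N \<Longrightarrow> F M = F N"
    and sum: "\<And>M N. M \<in> reps H \<Longrightarrow> N \<in> reps H \<Longrightarrow> F (rep_sum H M N) = F M \<oplus>\<^bsub>T\<^esub> F N"
  obtains \<phi> where "\<And>x. x \<in> carrier (green_ring H) \<Longrightarrow> \<phi> x \<in> carrier T"
    "\<And>M. M \<in> reps H \<Longrightarrow> \<phi> (green_class H M) = F M"
    "\<And>x y. x \<in> carrier (green_ring H) \<Longrightarrow> y \<in> carrier (green_ring H) \<Longrightarrow> \<phi> (x \<oplus>\<^bsub>green_ring H\<^esub> y) = \<phi> x \<oplus>\<^bsub>T\<^esub> \<phi> y"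
proof -
  interpret T: abelian_group T by fact
  interpret R: ring "free_green H" by (rule free_green_ring)
  interpret I: ideal "green_rel H" "free_green H" by (rule green_rel_ideal)
  \<comment> \<open>The free group is generated by classes, so F is read off at a chosen
    representative; invariance under isomorphism makes the choice harmless.\<close>
  define F' where "F' X = F (SOME M. M \<in> reps H \<and> iso_class H M = X)" for X
  have F': "F' (iso_class H M) = F M" if "M \<in> reps H" for M
  proof -
    have "\<exists>N. N \<in> reps H \<and> iso_class H N = iso_class H M" using that by blast
    then have "(SOME N. N \<in> reps H \<and> iso_class H N = iso_class H M) \<in> reps H \<and>
      iso_class H (SOME N. N \<in> reps H \<and> iso_class H N = iso_class H M) = iso_class H M" by (rule someI_ex)
    then show ?thesis unfolding F'_def using iso iso_class_eq_iff that by blast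
  qed
  have im: "F' ` iso_classes \<subseteq> carrier (add_monoid T)" using F F' by (auto simp: iso_classes_def)
  obtain h where h: "h \<in> hom (free_Abelian_group iso_classes) (add_monoid T)" "\<And>X. X \<in> iso_classes \<Longrightarrow> h (frag_of X) = F' X"
    using comm_group.free_Abelian_group_universal[OF T.a_comm_group im] by blast
  have h_add: "h (x + y) = h x \<oplus>\<^bsub>T\<^esub> h y" if "x \<in> carrier (free_green H)" "y \<in> carrier (free_green H)" for x y
    using hom_mult[OF h(1), of x y] that by (simp add: free_green_simps)
  have h_cl [simp]: "h x \<in> carrier T" if "x \<in> carrier (free_green H)" for x
    using hom_in_carrier[OF h(1), of x] that by (simp add: free_green_simps)
  have h0: "h 0 = \<zero>\<^bsub>T\<^esub>"
    using h_add[of 0 0] h_cl[of 0] T.add.l_cancel_one'[of "h 0" "h 0"] by (simp add: free_green_simps)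
  have h_minus: "h (- x) = \<ominus>\<^bsub>T\<^esub> h x" if "x \<in> carrier (free_green H)" for x
  proof -
    have "- x \<in> carrier (free_green H)" using that by (auto simp: free_green_simps)
    then show ?thesis using h_add[of "- x" x] that h0 T.minus_equality[of "h (- x)" "h x"] by simp
  qed
  have h_sgl: "h (sgl H M) = F M" if "M \<in> reps H" for M
    using h(2)[of "iso_class H M"] F'[OF that] that by (auto simp: iso_classes_def)
  have hg: "h x = \<zero>\<^bsub>T\<^esub>" if "x \<in> gens" for x
  proof -
    obtain M N where MN: "M \<in> reps H" "N \<in> reps H" "x = sgl H (rep_sum H M N) - (sgl H M + sgl H N)"
      using \<open>x \<in> gens\<close> by (auto simp: gens_def)
    have c: "sgl H M + sgl H N \<in> carrier (free_green H)" "x \<in> carrier (free_green H)"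
      using MN R.a_closed[of "sgl H M" "sgl H N"] that gens_carrier by (auto simp: free_green_simps(5))
    have "h (x + (sgl H M + sgl H N)) = h x \<oplus>\<^bsub>T\<^esub> (F M \<oplus>\<^bsub>T\<^esub> F N)"
      using MN(1,2) by (simp only: h_add[OF c(2,1)] h_add[OF sgl_carrier sgl_carrier] h_sgl)
    moreover have "x + (sgl H M + sgl H N) = sgl H (rep_sum H M N)" using MN by simp
    ultimately have "F M \<oplus>\<^bsub>T\<^esub> F N = h x \<oplus>\<^bsub>T\<^esub> (F M \<oplus>\<^bsub>T\<^esub> F N)"
      using MN by (simp add: h_sgl rep_sum_rep sum)
    then show ?thesis using c MN F T.add.r_cancel_one'[of "F M \<oplus>\<^bsub>T\<^esub> F N" "h x"] by simp
  qed
  have hr: "x \<in> carrier (free_green H) \<and> h x = \<zero>\<^bsub>T\<^esub>" if "x \<in> green_rel H" for x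
    using that unfolding green_rel_generate
  proof (induction rule: generate.induct)
    case one
    then show ?case using h0 by (simp add: free_green_simps)
  next
    case (incl x)
    then show ?case using hg gens_carrier by auto
  next
    case (inv x)
    then have "x \<in> carrier (free_green H)" using gens_carrier by auto
    moreover have "inv\<^bsub>add_monoid (free_green H)\<^esub> x = - x"
      using free_green_minus[OF calculation] by (simp add: a_inv_def)
    ultimately show ?case using hg[OF inv] h_minus[of x] by (auto simp: free_green_simps)
  next
    case (eng x y)
    then show ?case using h_add[of x y] R.a_closed[of x y] by (simp add: free_green_simps(5))
  qed
  \<comment> \<open>By \<open>hr\<close> the map h is constant on each coset, so any element of the
    coset may be chosen.\<close>
  define \<phi> where "\<phi> x = h (SOME f. f \<in> x)" for x
  have \<phi>: "\<phi> (green_rel H +>\<^bsub>free_green H\<^esub> f) = h f" if "f \<in> carrier (free_green H)" for f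
  proof -
    have "f \<in> green_rel H +>\<^bsub>free_green H\<^esub> f" using that I.a_rcos_self by simp
    then have "(SOME g. g \<in> green_rel H +>\<^bsub>free_green H\<^esub> f) \<in> green_rel H +>\<^bsub>free_green H\<^esub> f" by (rule someI)
    then obtain r where r: "r \<in> green_rel H" "(SOME g. g \<in> green_rel H +>\<^bsub>free_green H\<^esub> f) = r + f"
      by (auto simp: a_r_coset_def' free_green_simps)
    show ?thesis unfolding \<phi>_def r(2) using hr[OF r(1)] h_add[of r f] that by simp
  qed
  show thesis
  proof (rule that[of \<phi>])
    fix x assume "x \<in> carrier (green_ring H)"
    then show "\<phi> x \<in> carrier T" using \<phi> green_carrier_coset by auto
  next
    fix M assume "M \<in> reps H"
    then show "\<phi> (green_class H M) = F M" unfolding green_class_def using \<phi> h_sgl by simp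
  next
    fix x y assume "x \<in> carrier (green_ring H)" "y \<in> carrier (green_ring H)"
    then obtain f k where fk: "f \<in> carrier (free_green H)" "k \<in> carrier (free_green H)"
      "x = green_rel H +>\<^bsub>free_green H\<^esub> f" "y = green_rel H +>\<^bsub>free_green H\<^esub> k"
      using green_carrier_coset by auto
    have "x \<oplus>\<^bsub>green_ring H\<^esub> y = green_rel H +>\<^bsub>free_green H\<^esub> (f + k)"
      using fk ring_hom_add[OF coset_hom, of f k] by (simp add: free_green_simps(5))
    moreover have "f + k \<in> carrier (free_green H)" using R.a_closed[of f k] fk by (simp add: free_green_simps(5))
    ultimately show "\<phi> (x \<oplus>\<^bsub>green_ring H\<^esub> y) = \<phi> x \<oplus>\<^bsub>T\<^esub> \<phi> y" using fk \<phi> h_add by simp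
  qed
qed

end

section \<open>Gaussian binomials\<close>

text \<open>Defined by the q-Pascal rule, since the quotient formula has vanishing denominators at
  roots of unity, which is the case of interest.\<close>

fun qbinom :: "'k::field \<Rightarrow> nat \<Rightarrow> nat \<Rightarrow> 'k"
  where
    "qbinom q 0 k = of_bool (k = 0)"
  | "qbinom q (Suc m) 0 = 1"
  | "qbinom q (Suc m) (Suc k) = qbinom q m k + q ^ Suc k * qbinom q m (Suc k)"

lemma qbinom_0 [simp]: "qbinom q m 0 = 1"
  by (cases m) auto

lemma qbinom_gt: "m < k \<Longrightarrow> qbinom q m k = 0"
  by (induction q m k rule: qbinom.induct) auto

lemma qbinom_self [simp]: "qbinom q m m = 1"
  by (induction m) (auto simp: qbinom_gt)

text \<open>The quotient formula with its denominator cleared. It holds for every q, and also for k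
  > m, where both sides are zero.\<close>

lemma qbinom_prod: "qbinom q m k * (\<Prod>j<k. 1 - q ^ Suc j) = (\<Prod>j<k. 1 - q ^ (m - j))"
proof (induction q m k rule: qbinom.induct)
  case (1 q k)
  then show ?case by (cases k) (auto simp: prod.lessThan_Suc)
next
  case (2 q m)
  then show ?case by simp
next
  case (3 q m k)
  let ?P = "\<Prod>j<k. 1 - q ^ (m - j)"
  have "qbinom q (Suc m) (Suc k) * (\<Prod>j<Suc k. 1 - q ^ Suc j) =
    qbinom q m k * (\<Prod>j<k. 1 - q ^ Suc j) * (1 - q ^ Suc k) + q ^ Suc k * (qbinom q m (Suc k) * (\<Prod>j<Suc k. 1 - q ^ Suc j))"
    by (simp add: prod.lessThan_Suc algebra_simps)
  also have "\<dots> = ?P * (1 - q ^ Suc k) + q ^ Suc k * (?P * (1 - q ^ (m - k)))"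
    by (simp only: 3) (simp add: prod.lessThan_Suc)
  also have "\<dots> = ?P * (1 - q ^ Suc m)"
  proof (cases "k \<le> m")
    case True
    then have "q ^ Suc k * q ^ (m - k) = q ^ Suc m" by (simp flip: power_add)
    then show ?thesis by (simp add: algebra_simps del: power_Suc)
  next
    case False
    \<comment> \<open>For k > m the factor with j = m is 1 - q^0 = 0.\<close>
    then have P0: "?P = 0" by (intro prod_zero) (auto intro!: bexI[of _ m])
    show ?thesis by (simp only: P0 mult_zero_left mult_zero_right add_0)
  qed
  also have "\<dots> = (\<Prod>j<Suc k. 1 - q ^ (Suc m - j))"
    unfolding prod.lessThan_Suc_shift[of _ k] by (simp add: mult.commute)
  finally show ?case .
qed

text \<open>In the cleared quotient formula the factor 1 - q^n on the right vanishes, while the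
  denominator for k < n does not.\<close>

lemma qbinom_vanish:
  assumes "q ^ n = 1" "\<And>m. 0 < m \<Longrightarrow> m < n \<Longrightarrow> q ^ m \<noteq> 1" "0 < k" "k < n"
  shows "qbinom q n k = 0"
proof -
  have "(\<Prod>j<k. 1 - q ^ Suc j) \<noteq> 0" using assms(2,4) by (auto simp del: power_Suc)
  moreover have "(\<Prod>j<k. 1 - q ^ (n - j)) = 0"
    using assms by (intro prod_zero) (auto intro!: bexI[of _ 0])
  ultimately show ?thesis by (metis mult_eq_0_iff qbinom_prod)
qed

lemma qcommute_pow:
  fixes A B :: "'k::field mat"
  assumes dims: "dim_row A = d" "dim_col A = d" "dim_row B = d" "dim_col B = d"
    and BA: "B * A = q \<cdot>\<^sub>m (A * B)"
  shows "B * A ^\<^sub>m k = q ^ k \<cdot>\<^sub>m (A ^\<^sub>m k * B)"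
proof (induction k)
  case (Suc k)
  have "B * A ^\<^sub>m Suc k = (B * A ^\<^sub>m k) * A" by (simp add: dims mult_assoc_dim)
  also have "\<dots> = q ^ k \<cdot>\<^sub>m (A ^\<^sub>m k * (B * A))" by (simp add: Suc dims smult_mult_dim mult_assoc_dim)
  also have "\<dots> = q ^ Suc k \<cdot>\<^sub>m (A ^\<^sub>m Suc k * B)"
    by (simp add: BA dims mult_smult_dim mult_assoc_dim smult_smult_mat ac_simps)
  finally show ?case .
qed (simp add: dims)

text \<open>Multiplying the expansion by A + B from the left reproduces the q-Pascal rule: moving B
  past A^k costs q^k.\<close>

lemma qbinomial_theorem:
  fixes A B :: "'k::field mat"
  assumes dims: "dim_row A = d" "dim_col A = d" "dim_row B = d" "dim_col B = d"
    and BA: "B * A = q \<cdot>\<^sub>m (A * B)"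
  shows "(A + B) ^\<^sub>m m = lincomb d d {..m} (qbinom q m) (\<lambda>k. A ^\<^sub>m k * B ^\<^sub>m (m - k))"
proof (induction m)
  case 0
  show ?case by (rule eq_matI) (auto simp: lincomb_index dims)
next
  case (Suc m)
  let ?T = "\<lambda>m k. A ^\<^sub>m k * B ^\<^sub>m (m - k)"
  have AT: "A * ?T m k = ?T (Suc m) (Suc k)" for k
    by (simp only: pow_mat_Suc_left[of A k] dims diff_Suc_Suc) (simp add: dims mult_assoc_dim)
  have BT: "B * ?T m k = q ^ k \<cdot>\<^sub>m ?T (Suc m) k" if "k \<le> m" for k
  proof -
    have "B * ?T m k = (B * A ^\<^sub>m k) * B ^\<^sub>m (m - k)" by (simp add: dims mult_assoc_dim)
    also have "\<dots> = q ^ k \<cdot>\<^sub>m (A ^\<^sub>m k * (B * B ^\<^sub>m (m - k)))"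
      by (simp add: qcommute_pow[OF dims BA] dims smult_mult_dim mult_assoc_dim)
    also have "B * B ^\<^sub>m (m - k) = B ^\<^sub>m (Suc m - k)"
      using that by (simp add: Suc_diff_le dims flip: pow_mat_Suc_left)
    finally show ?thesis .
  qed
  have "(A + B) ^\<^sub>m Suc m = A * (A + B) ^\<^sub>m m + B * (A + B) ^\<^sub>m m"
    by (subst pow_mat_Suc_left) (auto simp: dims add_mult_dim)
  also have "\<dots> = lincomb d d {..m} (qbinom q m) (\<lambda>k. ?T (Suc m) (Suc k))
      + lincomb d d {..m} (qbinom q m) (\<lambda>k. q ^ k \<cdot>\<^sub>m ?T (Suc m) k)"
    unfolding Suc.IH
    by (subst (1 2) mult_lincomb) (auto simp: dims AT BT intro!: arg_cong2[of _ _ _ _ "(+)"] lincomb_cong)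
  also have "\<dots> = lincomb d d {..Suc m} (qbinom q (Suc m)) (?T (Suc m))" (is "?l + ?r = _")
  proof (rule eq_matI)
    fix i j assume "i < dim_row (lincomb d d {..Suc m} (qbinom q (Suc m)) (?T (Suc m)))"
      "j < dim_col (lincomb d d {..Suc m} (qbinom q (Suc m)) (?T (Suc m)))"
    then have ij: "i < d" "j < d" by auto
    let ?t = "\<lambda>k. ?T (Suc m) k $$ (i, j)"
    have dT: "dim_row (?T (Suc m) k) = d" "dim_col (?T (Suc m) k) = d" for k by (simp_all add: dims)
    have "(?l + ?r) $$ (i, j) = (\<Sum>k\<le>m. qbinom q m k * ?t (Suc k)) + (\<Sum>k\<le>m. qbinom q m k * (q ^ k * ?t k))"
      using ij by (simp add: lincomb_index dT dims del: pow_mat.simps index_mult_mat(1) diff_Suc_Suc)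
    also have "(\<Sum>k\<le>m. qbinom q m k * (q ^ k * ?t k)) = (\<Sum>k\<le>Suc m. qbinom q m k * (q ^ k * ?t k))"
      by (simp add: qbinom_gt)
    also have "\<dots> = ?t 0 + (\<Sum>k\<le>m. qbinom q m (Suc k) * (q ^ Suc k * ?t (Suc k)))"
      by (subst sum.atMost_Suc_shift) simp
    also have "(\<Sum>k\<le>m. qbinom q m k * ?t (Suc k)) + \<dots> = ?t 0 + (\<Sum>k\<le>m. qbinom q (Suc m) (Suc k) * ?t (Suc k))"
      by (simp add: sum.distrib algebra_simps del: pow_mat.simps index_mult_mat(1) diff_Suc_Suc)
    also have "\<dots> = (\<Sum>k\<le>Suc m. qbinom q (Suc m) k * ?t k)"
      unfolding sum.atMost_Suc_shift[of _ m] by simp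
    also have "\<dots> = lincomb d d {..Suc m} (qbinom q (Suc m)) (?T (Suc m)) $$ (i, j)"
      using ij by (simp only: lincomb_index)
    finally show "(?l + ?r) $$ (i, j) = lincomb d d {..Suc m} (qbinom q (Suc m)) (?T (Suc m)) $$ (i, j)" .
  qed auto
  finally show ?case .
qed

text \<open>Only the two end terms of the q-binomial expansion survive, and they are zero by
  assumption. With A = y \<otimes> g and B = 1 \<otimes> y this is the relation \<Delta>(y)^n =
  0.\<close>

lemma qcommuting_sum_pow_zero:
  fixes A B :: "'k::field mat"
  assumes dims: "dim_row A = d" "dim_col A = d" "dim_row B = d" "dim_col B = d"
    and BA: "B * A = q \<cdot>\<^sub>m (A * B)" and q: "q ^ n = 1" "\<And>m. 0 < m \<Longrightarrow> m < n \<Longrightarrow> q ^ m \<noteq> 1"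
    and AB: "A ^\<^sub>m n = 0\<^sub>m d d" "B ^\<^sub>m n = 0\<^sub>m d d"
  shows "(A + B) ^\<^sub>m n = 0\<^sub>m d d"
proof (rule eq_matI)
  fix i j assume ij: "i < dim_row (0\<^sub>m d d :: 'k mat)" "j < dim_col (0\<^sub>m d d :: 'k mat)"
  have "qbinom q n k * (A ^\<^sub>m k * B ^\<^sub>m (n - k)) $$ (i, j) = 0" if k: "k \<le> n" for k
  proof -
    consider "k = 0" | "k = n" | "0 < k" "k < n" using k by linarith
    then show ?thesis
    proof cases
      case 3
      then show ?thesis by (simp only: qbinom_vanish[OF q]) simp
    qed (use ij in \<open>simp_all add: AB dims\<close>)
  qed
  then have "(\<Sum>k\<le>n. qbinom q n k * (A ^\<^sub>m k * B ^\<^sub>m (n - k)) $$ (i, j)) = 0" by (intro sum.neutral) simp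
  then show "((A + B) ^\<^sub>m n) $$ (i, j) = (0\<^sub>m d d :: 'k mat) $$ (i, j)"
    using ij by (subst qbinomial_theorem[OF dims BA], subst lincomb_index) simp_all
qed (auto simp: dims)

section \<open>Modules over the group algebra and over the Hopf algebra of a group datum\<close>

text \<open>The order n is a parameter instead of an expression in \<chi> and g, so that two data
  with the same n share their index sets.\<close>

locale datum = G: group G for G :: "('g, 'm) monoid_scheme" (structure) +
  fixes \<chi> :: "'g \<Rightarrow> 'k::field_char_0" and g :: 'g and n :: nat
  assumes datum: "nilpotent_group_datum G \<chi> g" and mult_order: "mult_order (\<chi> g) = n" and n2: "n \<ge> 2"
begin

abbreviation "H \<equiv> datum_hopf G \<chi> g"
abbreviation "K \<equiv> (group_algebra G :: ('g, 'k) hopf)"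

lemma fin [simp]: "finite (carrier G)" and g [simp]: "g \<in> carrier G"
  and central: "h \<in> carrier G \<Longrightarrow> g \<otimes> h = h \<otimes> g"
  and \<chi>_nz [simp]: "h \<in> carrier G \<Longrightarrow> \<chi> h \<noteq> 0"
  and \<chi>_mult [simp]: "h \<in> carrier G \<Longrightarrow> l \<in> carrier G \<Longrightarrow> \<chi> (h \<otimes> l) = \<chi> h * \<chi> l"
  using datum by (auto simp: nilpotent_group_datum_def lin_character_def)

lemma \<chi>_one [simp]: "\<chi> \<one> = 1"
  using \<chi>_mult[of \<one> \<one>] \<chi>_nz[of \<one>] by (simp del: \<chi>_nz)

lemma \<chi>_inv: "h \<in> carrier G \<Longrightarrow> \<chi> (inv h) = inverse (\<chi> h)"
  using \<chi>_mult[of h "inv h"] by (simp add: field_simps del: \<chi>_mult)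

lemma \<chi>_pow: "h \<in> carrier G \<Longrightarrow> \<chi> (h [^] (k::nat)) = \<chi> h ^ k"
  by (induction k) auto

text \<open>The \<open>LEAST\<close> in \<open>mult_order\<close> is attained: g has finite order,
  so some positive power of \<chi>(g) is 1.\<close>

lemma q_pow_n: "\<chi> g ^ n = 1" and q_pow: "0 < m \<Longrightarrow> m < n \<Longrightarrow> \<chi> g ^ m \<noteq> 1" and n_pos: "0 < n"
proof -
  have "\<chi> g ^ Coset.order G = 1"
    using \<chi>_pow[of g "Coset.order G"] G.pow_order_eq_1[of g] by simp
  moreover have "0 < Coset.order G" using G.order_gt_0_iff_finite by simp
  ultimately have ex: "\<exists>m. 0 < m \<and> \<chi> g ^ m = 1" by blast
  show "\<chi> g ^ n = 1" "0 < n"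
    using LeastI_ex[OF ex] mult_order unfolding mult_order_def by auto
  show "0 < m \<Longrightarrow> m < n \<Longrightarrow> \<chi> g ^ m \<noteq> 1"
    using not_less_Least[of m "\<lambda>m. 0 < m \<and> \<chi> g ^ m = 1"] mult_order unfolding mult_order_def by auto
qed

lemma basis_H: "basis H = {..<n} \<times> carrier G"
  by (simp add: datum_hopf_def Let_def datum_basis_def mult_order)

lemma prd_H: "prd H (i, h) (j, l) = (\<lambda>p. inverse (\<chi> h) ^ j * ymon n (i + j) (h \<otimes> l) p)"
  by (simp add: datum_hopf_def Let_def datum_prd_def mult_order)

lemma unt_H: "unt H = ymon n 0 \<one>"
  by (simp add: datum_hopf_def Let_def mult_order)

lemma counit_H: "counit H (i, h) = of_bool (i = 0)"
  by (simp add: datum_hopf_def Let_def)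

lemma finite_basis_H [simp]: "finite (basis H)"
  by (simp add: basis_H)

lemma mem_basis_H [simp]: "(i, h) \<in> basis H \<longleftrightarrow> i < n \<and> h \<in> carrier G"
  by (simp add: basis_H)

abbreviation \<rho> :: "(nat \<times> 'g, 'k) rep \<Rightarrow> 'g \<Rightarrow> 'k mat" where "\<rho> M h \<equiv> rmat M (0, h)"
abbreviation Y :: "(nat \<times> 'g, 'k) rep \<Rightarrow> 'k mat" where "Y M \<equiv> rmat M (Suc 0, \<one>)"

lemma dim_\<rho>_Y [simp]:
  assumes "M \<in> reps H"
  shows "h \<in> carrier G \<Longrightarrow> dim_row (\<rho> M h) = rdim M" "h \<in> carrier G \<Longrightarrow> dim_col (\<rho> M h) = rdim M"
    "dim_row (Y M) = rdim M" "dim_col (Y M) = rdim M"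
  using reps_dim[OF assms, of "(0, h)"] reps_dim[OF assms, of "(Suc 0, \<one>)"] n2 by auto

lemma act_ymon:
  assumes "M \<in> reps H" "h \<in> carrier G"
  shows "act H M (ymon n i h) = (if i < n then rmat M (i, h) else 0\<^sub>m (rdim M) (rdim M))"
proof (cases "i < n")
  case True
  then have "act H M (ymon n i h) = lincomb (rdim M) (rdim M) (basis H) (\<lambda>p. of_bool (p = (i, h))) (rmat M)"
    by (simp add: act_lincomb ymon_def)
  also have "\<dots> = rmat M (i, h)" using assms True by (intro lincomb_delta_1) auto
  finally show ?thesis using True by simp
next
  case False
  then show ?thesis by (auto simp: act_lincomb ymon_def lincomb_index intro!: eq_matI)
qed

lemma rmat_mult:
  assumes M: "M \<in> reps H" and "i < n" "j < n" "h \<in> carrier G" "l \<in> carrier G"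
  shows "rmat M (i, h) * rmat M (j, l) =
    inverse (\<chi> h) ^ j \<cdot>\<^sub>m (if i + j < n then rmat M (i + j, h \<otimes> l) else 0\<^sub>m (rdim M) (rdim M))"
proof -
  have "rmat M (i, h) * rmat M (j, l) = act H M (prd H (i, h) (j, l))"
    using assms by (simp add: reps_def)
  also have "\<dots> = inverse (\<chi> h) ^ j \<cdot>\<^sub>m act H M (ymon n (i + j) (h \<otimes> l))"
    by (simp add: prd_H act_lincomb lincomb_smult)
  finally show ?thesis using assms by (simp add: act_ymon)
qed

lemma \<rho>_one [simp]: "M \<in> reps H \<Longrightarrow> \<rho> M \<one> = 1\<^sub>m (rdim M)"
  using act_ymon[of M \<one> 0] n_pos by (simp add: reps_def unt_H)

lemma \<rho>_mult: "M \<in> reps H \<Longrightarrow> h \<in> carrier G \<Longrightarrow> l \<in> carrier G \<Longrightarrow> \<rho> M (h \<otimes> l) = \<rho> M h * \<rho> M l"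
  using rmat_mult[of M 0 0 h l] n_pos by simp

lemma \<rho>_inv: "M \<in> reps H \<Longrightarrow> h \<in> carrier G \<Longrightarrow> \<rho> M (inv h) * \<rho> M h = 1\<^sub>m (rdim M)"
  "M \<in> reps H \<Longrightarrow> h \<in> carrier G \<Longrightarrow> \<rho> M h * \<rho> M (inv h) = 1\<^sub>m (rdim M)"
  using \<rho>_mult[of M "inv h" h] \<rho>_mult[of M h "inv h"] by simp_all

lemma rmat_eq: "M \<in> reps H \<Longrightarrow> i < n \<Longrightarrow> h \<in> carrier G \<Longrightarrow> rmat M (i, h) = Y M ^\<^sub>m i * \<rho> M h"
proof -
  assume M: "M \<in> reps H" and h: "h \<in> carrier G"
  have 1: "rmat M (i, \<one>) = Y M ^\<^sub>m i" if "i < n" for i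
    using that
  proof (induction i)
    case (Suc i)
    then show ?case using rmat_mult[OF M, of i "Suc 0" \<one> \<one>] n2 by simp
  qed (use M in simp)
  show "i < n \<Longrightarrow> rmat M (i, h) = Y M ^\<^sub>m i * \<rho> M h"
    using rmat_mult[OF M, of i 0 \<one> h] 1 h by simp
qed

lemma \<rho>_Y: "M \<in> reps H \<Longrightarrow> h \<in> carrier G \<Longrightarrow> \<rho> M h * Y M = inverse (\<chi> h) \<cdot>\<^sub>m (Y M * \<rho> M h)"
  using rmat_mult[of M 0 "Suc 0" h \<one>] rmat_eq[of M "Suc 0" h] n2 by simp

lemma Y_\<rho>: "M \<in> reps H \<Longrightarrow> h \<in> carrier G \<Longrightarrow> Y M * \<rho> M h = \<chi> h \<cdot>\<^sub>m (\<rho> M h * Y M)"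
  by (simp add: \<rho>_Y smult_smult_mat)

lemma Y_pow_n: "M \<in> reps H \<Longrightarrow> Y M ^\<^sub>m n = 0\<^sub>m (rdim M) (rdim M)"
proof -
  assume M: "M \<in> reps H"
  obtain m where m: "n = Suc m" "0 < m" using n2 by (cases n) auto
  have "Y M ^\<^sub>m n = rmat M (m, \<one>) * rmat M (Suc 0, \<one>)" using rmat_eq[OF M, of m \<one>] m M by simp
  then show ?thesis using rmat_mult[OF M, of m "Suc 0" \<one> \<one>] m by simp
qed

lemma \<rho>_Y_pow: "M \<in> reps H \<Longrightarrow> h \<in> carrier G \<Longrightarrow> \<rho> M h * Y M ^\<^sub>m k = inverse (\<chi> h) ^ k \<cdot>\<^sub>m (Y M ^\<^sub>m k * \<rho> M h)"
  by (rule qcommute_pow[of _ "rdim M"]) (auto simp: \<rho>_Y)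

definition mk_rep :: "nat \<Rightarrow> ('g \<Rightarrow> 'k mat) \<Rightarrow> 'k mat \<Rightarrow> (nat \<times> 'g, 'k) rep"
  where "mk_rep d r y = \<lparr>rdim = d, rmat = (\<lambda>b\<in>basis H. y ^\<^sub>m fst b * r (snd b))\<rparr>"

lemma rdim_mk_rep [simp]: "rdim (mk_rep d r y) = d"
  by (simp add: mk_rep_def)

lemma rmat_mk_rep: "i < n \<Longrightarrow> h \<in> carrier G \<Longrightarrow> rmat (mk_rep d r y) (i, h) = y ^\<^sub>m i * r h"
  by (simp add: mk_rep_def)

text \<open>The presentation of H by generators and relations. The work lies in products of basis
  elements: y^j is moved past h at the cost of \<chi>(h)^{-j}, and exponents from n on give zero on
  both sides.\<close>

lemma mk_rep:
  assumes r: "\<And>h. h \<in> carrier G \<Longrightarrow> dim_row (r h) = d \<and> dim_col (r h) = d" and y: "dim_row y = d" "dim_col y = d"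
    and r1: "r \<one> = 1\<^sub>m d" and rm: "\<And>h l. h \<in> carrier G \<Longrightarrow> l \<in> carrier G \<Longrightarrow> r (h \<otimes> l) = r h * r l"
    and yr: "\<And>h. h \<in> carrier G \<Longrightarrow> y * r h = \<chi> h \<cdot>\<^sub>m (r h * y)" and yn: "y ^\<^sub>m n = 0\<^sub>m d d"
  shows "mk_rep d r y \<in> reps H" "h \<in> carrier G \<Longrightarrow> \<rho> (mk_rep d r y) h = r h" "Y (mk_rep d r y) = y"
proof -
  let ?M = "mk_rep d r y"
  show \<rho>: "\<rho> ?M h = r h" if "h \<in> carrier G" for h
    using that r y n_pos by (simp add: rmat_mk_rep)
  show "Y ?M = y" using y n2 r1 by (simp add: rmat_mk_rep)
  have dimr: "dim_row (rmat ?M (i, h)) = d" "dim_col (rmat ?M (i, h)) = d" if "i < n" "h \<in> carrier G" for i h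
    using that r y by (simp_all add: rmat_mk_rep)
  have ym: "act H ?M (ymon n i h) = (if i < n then rmat ?M (i, h) else 0\<^sub>m d d)" if "h \<in> carrier G" for i h
  proof (cases "i < n")
    case True
    then have "act H ?M (ymon n i h) = lincomb d d (basis H) (\<lambda>p. of_bool (p = (i, h))) (rmat ?M)"
      by (simp add: act_lincomb ymon_def)
    also have "\<dots> = rmat ?M (i, h)" using that True dimr by (intro lincomb_delta_1) auto
    finally show ?thesis using True by simp
  next
    case False
    then show ?thesis by (auto simp: act_lincomb ymon_def lincomb_index intro!: eq_matI)
  qed
  have ry: "r h * y = inverse (\<chi> h) \<cdot>\<^sub>m (y * r h)" if "h \<in> carrier G" for h
    using that by (simp add: yr smult_smult_mat)
  have rypow: "r h * y ^\<^sub>m j = inverse (\<chi> h) ^ j \<cdot>\<^sub>m (y ^\<^sub>m j * r h)" if "h \<in> carrier G" for h j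
    by (rule qcommute_pow[of _ d]) (use that r y ry in auto)
  show "?M \<in> reps H"
    unfolding reps_def
  proof (intro CollectI conjI ballI)
    show "rmat ?M \<in> basis H \<rightarrow>\<^sub>E carrier_mat (rdim ?M) (rdim ?M)"
      using dimr by (auto simp: mk_rep_def basis_H intro!: carrier_matI)
    show "act H ?M (unt H) = 1\<^sub>m (rdim ?M)" using n_pos by (simp add: unt_H ym \<rho> r1)
    fix b c assume "b \<in> basis H" "c \<in> basis H"
    then obtain i h j l where b: "b = (i, h)" "c = (j, l)" "i < n" "j < n" "h \<in> carrier G" "l \<in> carrier G"
      by (auto simp: basis_H)
    have "rmat ?M b * rmat ?M c = y ^\<^sub>m i * ((r h * y ^\<^sub>m j) * r l)"
      using b r y by (simp add: rmat_mk_rep mult_assoc_dim)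
    also have "\<dots> = inverse (\<chi> h) ^ j \<cdot>\<^sub>m (y ^\<^sub>m (i + j) * r (h \<otimes> l))"
      using b r y by (simp add: rypow smult_mult_dim mult_smult_dim mult_assoc_dim rm pow_mat_add)
    also have "\<dots> = inverse (\<chi> h) ^ j \<cdot>\<^sub>m act H ?M (ymon n (i + j) (h \<otimes> l))"
      using b pow_mat_zero_mono[of y n "i + j"] y yn r by (auto simp: ym rmat_mk_rep)
    also have "\<dots> = act H ?M (prd H b c)" by (simp add: b prd_H act_lincomb lincomb_smult)
    finally show "act H ?M (prd H b c) = rmat ?M b * rmat ?M c" by simp
  qed
qed

lemma rep_eqI_H:
  assumes "M \<in> reps H" "N \<in> reps H" "rdim M = rdim N" "\<And>h. h \<in> carrier G \<Longrightarrow> \<rho> M h = \<rho> N h" "Y M = Y N"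
  shows "M = N"
proof (rule rep_eqI[of M H N])
  fix b assume "b \<in> basis H"
  then obtain i h where b: "b = (i, h)" "i < n" "h \<in> carrier G" by (auto simp: basis_H)
  show "rmat M b = rmat N b"
    using assms b by (simp add: rmat_eq[of M i h] rmat_eq[of N i h])
qed (use assms in auto)

lemma rep_homI_H:
  assumes MN: "M \<in> reps H" "N \<in> reps H" and f: "dim_row f = rdim N" "dim_col f = rdim M"
    and \<rho>: "\<And>h. h \<in> carrier G \<Longrightarrow> \<rho> N h * f = f * \<rho> M h" and Y: "Y N * f = f * Y M"
  shows "f \<in> rep_hom H M N"
proof (rule rep_homI)
  have Yk: "Y N ^\<^sub>m k * f = f * Y M ^\<^sub>m k" for k
  proof (induction k)
    case (Suc k)
    have "Y N ^\<^sub>m Suc k * f = Y N ^\<^sub>m k * (f * Y M)" using MN f Y by (simp add: mult_assoc_dim)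
    also have "\<dots> = f * Y M ^\<^sub>m Suc k" using MN f Suc by (simp add: mult_assoc_dim flip: mult_assoc_dim[of "Y N ^\<^sub>m k" f])
    finally show ?case .
  qed (use MN f in auto)
  fix b assume "b \<in> basis H"
  then obtain i h where b: "b = (i, h)" "i < n" "h \<in> carrier G" by (auto simp: basis_H)
  have "rmat N b * f = Y N ^\<^sub>m i * (f * \<rho> M h)" using b MN f \<rho> by (simp add: rmat_eq[of N i h] mult_assoc_dim)
  also have "\<dots> = f * rmat M b"
    using b MN f by (simp add: rmat_eq[of M i h] Yk mult_assoc_dim flip: mult_assoc_dim[of "Y N ^\<^sub>m i" f])
  finally show "rmat N b * f = f * rmat M b" .
qed (use f in auto)

lemma rep_homD_H:
  assumes "M \<in> reps H" "N \<in> reps H" "f \<in> rep_hom H M N"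
  shows "h \<in> carrier G \<Longrightarrow> \<rho> N h * f = f * \<rho> M h" "Y N * f = f * Y M" "Y N ^\<^sub>m k * f = f * Y M ^\<^sub>m k"
proof -
  show "h \<in> carrier G \<Longrightarrow> \<rho> N h * f = f * \<rho> M h" using rep_homD[OF assms(3), of "(0, h)"] n_pos by simp
  show Y: "Y N * f = f * Y M" using rep_homD[OF assms(3), of "(Suc 0, \<one>)"] n2 by simp
  note [simp] = rep_hom_dim[OF assms(3)]
  show "Y N ^\<^sub>m k * f = f * Y M ^\<^sub>m k"
  proof (induction k)
    case (Suc k)
    have "Y N ^\<^sub>m Suc k * f = Y N ^\<^sub>m k * (f * Y M)" using assms Y by (simp add: mult_assoc_dim)
    also have "\<dots> = f * Y M ^\<^sub>m Suc k" using assms Suc by (simp add: mult_assoc_dim flip: mult_assoc_dim[of "Y N ^\<^sub>m k" f])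
    finally show ?case .
  qed (use assms in auto)
qed

lemma sum_H:
  assumes "M \<in> reps H" "N \<in> reps H"
  shows "h \<in> carrier G \<Longrightarrow> \<rho> (rep_sum H M N) h = bdiag (\<rho> M h) (\<rho> N h)" "Y (rep_sum H M N) = bdiag (Y M) (Y N)"
  using assms n2 by (auto simp: rmat_sum)

subsection \<open>The tensor product\<close>

abbreviation act2 :: "(nat \<times> 'g, 'k) rep \<Rightarrow> (nat \<times> 'g, 'k) rep \<Rightarrow> ((nat \<times> 'g) \<times> (nat \<times> 'g) \<Rightarrow> 'k) \<Rightarrow> 'k mat"
  where "act2 M N x \<equiv> lincomb (rdim M * rdim N) (rdim M * rdim N) (basis H \<times> basis H) x
    (\<lambda>p. kron (rmat M (fst p)) (rmat N (snd p)))"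

lemma act2_tens:
  assumes "M \<in> reps H" "N \<in> reps H"
  shows "act2 M N (tens x y) = kron (act H M x) (act H N y)"
proof (rule eq_matI)
  fix i j assume "i < dim_row (kron (act H M x) (act H N y))" "j < dim_col (kron (act H M x) (act H N y))"
  then have ij: "i < rdim M * rdim N" "j < rdim M * rdim N" by (auto simp: act_def)
  then have ij': "i div rdim N < rdim M" "i mod rdim N < rdim N" "j div rdim N < rdim M" "j mod rdim N < rdim N"
    by (auto intro: div_less_of_mult mod_less_of_mult)
  have "act2 M N (tens x y) $$ (i, j) = (\<Sum>p\<in>basis H. \<Sum>q\<in>basis H.
      (x p * rmat M p $$ (i div rdim N, j div rdim N)) * (y q * rmat N q $$ (i mod rdim N, j mod rdim N)))"
    using ij assms by (auto simp: lincomb_index sum.cartesian_product tens_def kron_index intro!: sum.cong)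
  also have "\<dots> = kron (act H M x) (act H N y) $$ (i, j)"
    using ij ij' by (subst kron_index) (auto simp: act_def sum_product)
  finally show "act2 M N (tens x y) $$ (i, j) = kron (act H M x) (act H N y) $$ (i, j)" .
qed (auto simp: act_def)

text \<open>The tensor square of H acts on the tensor product of the spaces as an algebra. Hence
  \<Delta>(y)^i, computed in that algebra, acts as the i-th power of the matrix of
  \<Delta>(y).\<close>

lemma act2_bilin:
  assumes MN: "M \<in> reps H" "N \<in> reps H"
  shows "act2 M N (bilin (basis H \<times> basis H) (tens_prd (prd H)) x y) = act2 M N x * act2 M N y"
proof -
  let ?d = "rdim M * rdim N" and ?B = "basis H \<times> basis H" and ?k = "\<lambda>p. kron (rmat M (fst p)) (rmat N (snd p))"
  have tp: "act2 M N (tens_prd (prd H) a b) = ?k a * ?k b" if "a \<in> ?B" "b \<in> ?B" for a b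
  proof -
    have "act2 M N (tens_prd (prd H) a b) = kron (act H M (prd H (fst a) (fst b))) (act H N (prd H (snd a) (snd b)))"
      unfolding tens_prd_def using MN by (rule act2_tens)
    also have "\<dots> = kron (rmat M (fst a) * rmat M (fst b)) (rmat N (snd a) * rmat N (snd b))"
      using MN that by (auto simp: reps_def)
    also have "\<dots> = ?k a * ?k b" using MN that by (subst kron_mult) auto
    finally show ?thesis .
  qed
  have "act2 M N (bilin ?B (tens_prd (prd H)) x y) =
     lincomb ?d ?d ?B (\<lambda>c. \<Sum>a\<in>?B. x a * (\<Sum>b\<in>?B. y b * tens_prd (prd H) a b c)) ?k"
    by (simp add: bilin_def sum_distrib_left mult.assoc)
  also have "\<dots> = lincomb ?d ?d ?B x (\<lambda>a. lincomb ?d ?d ?B y (\<lambda>b. act2 M N (tens_prd (prd H) a b)))"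
    by (simp only: lincomb_sum)
  also have "\<dots> = lincomb ?d ?d ?B x (\<lambda>a. lincomb ?d ?d ?B y (\<lambda>b. ?k a * ?k b))"
    by (intro lincomb_mat_cong tp)
  also have "\<dots> = lincomb ?d ?d ?B x (\<lambda>a. ?k a * act2 M N y)"
    using MN by (intro lincomb_mat_cong, subst mult_lincomb) auto
  also have "\<dots> = act2 M N x * act2 M N y"
    using MN by (subst lincomb_mult) auto
  finally show ?thesis .
qed

text \<open>The matrix of \<Delta>(y) = y \<otimes> g + 1 \<otimes> y.\<close>

definition tensor_Y :: "(nat \<times> 'g, 'k) rep \<Rightarrow> (nat \<times> 'g, 'k) rep \<Rightarrow> 'k mat"
  where "tensor_Y M N = kron (Y M) (\<rho> N g) + kron (1\<^sub>m (rdim M)) (Y N)"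

lemma dim_tensor_Y [simp]:
  "M \<in> reps H \<Longrightarrow> N \<in> reps H \<Longrightarrow> dim_row (tensor_Y M N) = rdim M * rdim N"
  "M \<in> reps H \<Longrightarrow> N \<in> reps H \<Longrightarrow> dim_col (tensor_Y M N) = rdim M * rdim N"
  by (simp_all add: tensor_Y_def)

lemma rmat_tensor_H:
  assumes MN: "M \<in> reps H" "N \<in> reps H" and ih: "i < n" "h \<in> carrier G"
  shows "rmat (rep_tensor H M N) (i, h) = tensor_Y M N ^\<^sub>m i * kron (\<rho> M h) (\<rho> N h)"
proof -
  let ?b = "bilin (basis H \<times> basis H) (tens_prd (prd H))" and ?e = "tens (ymon n 0 \<one>) (ymon n 0 \<one>)"
  let ?d = "rdim M * rdim N"
  have e: "act2 M N ?e = 1\<^sub>m ?d"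
    using MN n_pos by (simp add: act2_tens act_ymon)
  have cy: "act2 M N (datum_coprd_y G \<chi> g) = tensor_Y M N"
    using MN n_pos n2 by (simp add: datum_coprd_y_def Let_def mult_order lincomb_add act2_tens act_ymon tensor_Y_def)
  have pow: "act2 M N (apow (basis H \<times> basis H) (tens_prd (prd H)) ?e (datum_coprd_y G \<chi> g) k) = tensor_Y M N ^\<^sub>m k" for k
  proof (induction k)
    case 0
    then show ?case using MN by (simp add: apow_def e)
  next
    case (Suc k)
    then show ?case using MN by (subst pow_mat_Suc_left) (simp_all add: apow_def act2_bilin cy)
  qed
  have "coprd H (i, h) = ?b (apow (basis H \<times> basis H) (tens_prd (prd H)) ?e (datum_coprd_y G \<chi> g) i) (tens (ymon n 0 h) (ymon n 0 h))"
    by (simp add: datum_hopf_def Let_def mult_order)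
  then show ?thesis
    using MN ih n_pos by (simp add: rmat_tensor act2_bilin pow act2_tens act_ymon)
qed

lemma tensor_H:
  assumes MN: "M \<in> reps H" "N \<in> reps H"
  shows "rep_tensor H M N \<in> reps H" "h \<in> carrier G \<Longrightarrow> \<rho> (rep_tensor H M N) h = kron (\<rho> M h) (\<rho> N h)"
    "Y (rep_tensor H M N) = tensor_Y M N"
proof -
  let ?A = "kron (Y M) (\<rho> N g)" and ?B = "kron (1\<^sub>m (rdim M)) (Y N)" and ?d = "rdim M * rdim N"
  \<comment> \<open>Here the comultiplication meets the relation y^n = 0: the two summands commute
    up to q = \<chi>(g), whose order is exactly n.\<close>
  have zero: "tensor_Y M N ^\<^sub>m n = 0\<^sub>m ?d ?d"
    unfolding tensor_Y_def
  proof (rule qcommuting_sum_pow_zero[where q = "\<chi> g"])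
    show "?B * ?A = \<chi> g \<cdot>\<^sub>m (?A * ?B)" using MN by (simp add: kron_mult Y_\<rho> kron_smult_right)
    show "?A ^\<^sub>m n = 0\<^sub>m ?d ?d" using MN by (simp add: kron_pow Y_pow_n)
    show "?B ^\<^sub>m n = 0\<^sub>m ?d ?d" using MN by (simp add: kron_pow Y_pow_n)
  qed (use MN q_pow_n q_pow in auto)
  have comm: "\<rho> N g * \<rho> N h = \<rho> N h * \<rho> N g" if "h \<in> carrier G" for h
    using MN that central[OF that] by (simp flip: \<rho>_mult)
  have yr: "tensor_Y M N * kron (\<rho> M h) (\<rho> N h) = \<chi> h \<cdot>\<^sub>m (kron (\<rho> M h) (\<rho> N h) * tensor_Y M N)" if "h \<in> carrier G" for h
    using MN that unfolding tensor_Y_def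
    by (simp add: add_mult_dim mult_add_dim kron_mult Y_\<rho> kron_smult_left kron_smult_right comm smult_add_dim)
  note mk = mk_rep[of "\<lambda>h. kron (\<rho> M h) (\<rho> N h)" ?d "tensor_Y M N", OF _ _ _ _ _ yr zero]
  have eq: "rep_tensor H M N = mk_rep ?d (\<lambda>h. kron (\<rho> M h) (\<rho> N h)) (tensor_Y M N)"
  proof -
    have "rmat (rep_tensor H M N) b = rmat (mk_rep ?d (\<lambda>h. kron (\<rho> M h) (\<rho> N h)) (tensor_Y M N)) b" for b
    proof (cases "b \<in> basis H")
      case True
      then show ?thesis using MN by (cases b) (simp add: rmat_tensor_H rmat_mk_rep)
    qed (simp add: rep_tensor_def mk_rep_def)
    then show ?thesis by (intro rep.equality) auto
  qed
  show "rep_tensor H M N \<in> reps H" unfolding eq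
    by (rule mk) (use MN in \<open>auto simp: \<rho>_mult kron_mult\<close>)
  show "h \<in> carrier G \<Longrightarrow> \<rho> (rep_tensor H M N) h = kron (\<rho> M h) (\<rho> N h)" unfolding eq
    by (rule mk) (use MN in \<open>auto simp: \<rho>_mult kron_mult\<close>)
  show "Y (rep_tensor H M N) = tensor_Y M N" unfolding eq
    by (rule mk) (use MN in \<open>auto simp: \<rho>_mult kron_mult\<close>)
qed

lemma unit_H:
  shows "rep_unit H \<in> reps H" "rdim (rep_unit H) = Suc 0" "h \<in> carrier G \<Longrightarrow> \<rho> (rep_unit H) h = 1\<^sub>m (Suc 0)"
    "Y (rep_unit H) = 0\<^sub>m (Suc 0) (Suc 0)"
proof -
  have z: "0\<^sub>m (Suc 0) (Suc 0) ^\<^sub>m k = (if k = 0 then 1\<^sub>m (Suc 0) else 0\<^sub>m (Suc 0) (Suc 0) :: 'k mat)" for k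
    by (cases k) auto
  have eq: "rep_unit H = mk_rep (Suc 0) (\<lambda>h. 1\<^sub>m (Suc 0)) (0\<^sub>m (Suc 0) (Suc 0))"
  proof -
    have "rmat (rep_unit H) b = rmat (mk_rep (Suc 0) (\<lambda>h. 1\<^sub>m (Suc 0)) (0\<^sub>m (Suc 0) (Suc 0))) b" for b
    proof (cases "b \<in> basis H")
      case True
      then show ?thesis
        by (cases b) (auto simp: rep_unit_def rmat_mk_rep counit_H z intro!: eq_matI)
    qed (simp add: rep_unit_def mk_rep_def)
    then show ?thesis by (intro rep.equality) (auto simp: rep_unit_def)
  qed
  note mk = mk_rep[of "\<lambda>h. 1\<^sub>m (Suc 0)" "Suc 0" "0\<^sub>m (Suc 0) (Suc 0)"]
  show "rep_unit H \<in> reps H" unfolding eq by (rule mk; use n_pos z in \<open>auto\<close>)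
  show "rdim (rep_unit H) = Suc 0" unfolding eq by simp
  show "Y (rep_unit H) = 0\<^sub>m (Suc 0) (Suc 0)" unfolding eq by (rule mk; use n_pos z in \<open>auto\<close>)
  show "h \<in> carrier G \<Longrightarrow> \<rho> (rep_unit H) h = 1\<^sub>m (Suc 0)"
    unfolding eq by (rule mk; use n_pos z in \<open>auto\<close>)
qed

sublocale TH: tensor_hopf H
proof
  fix M N P assume MNP: "M \<in> reps H" "N \<in> reps H" "P \<in> reps H"
  show "rep_tensor H (rep_tensor H M N) P = rep_tensor H M (rep_tensor H N P)"
  proof (rule rep_eqI_H)
    show "Y (rep_tensor H (rep_tensor H M N) P) = Y (rep_tensor H M (rep_tensor H N P))"
    proof -
      have k1: "1\<^sub>m (rdim M * rdim N) = kron (1\<^sub>m (rdim M)) (1\<^sub>m (rdim N) :: 'k mat)" by simp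
      show ?thesis
        using MNP by (simp add: tensor_H tensor_Y_def k1 kron_add_left kron_add_right kron_assoc add_assoc_dim del: kron_one)
    qed
  qed (use MNP in \<open>auto simp: tensor_H kron_assoc mult.assoc\<close>)
next
  fix M assume M: "M \<in> reps H"
  show "rep_tensor H (rep_unit H) M = M"
    by (rule rep_eqI_H) (use M in \<open>auto simp: tensor_H unit_H tensor_Y_def\<close>)
  show "rep_tensor H M (rep_unit H) = M"
    by (rule rep_eqI_H) (use M in \<open>auto simp: tensor_H unit_H tensor_Y_def\<close>)
qed (auto simp: tensor_H unit_H)

subsection \<open>Modules over the group algebra\<close>

lemma K_simps [simp]: "basis K = carrier G" "counit K h = 1"
  by (simp_all add: group_algebra_def)

lemma act_K:
  assumes "\<And>h. h \<in> carrier G \<Longrightarrow> dim_row (rmat V h) = rdim V \<and> dim_col (rmat V h) = rdim V" "h \<in> carrier G"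
  shows "act K V (\<lambda>x. of_bool (x = h)) = rmat V h"
  using assms by (simp add: act_lincomb) (rule lincomb_delta_1; simp)

lemma reps_K_iff:
  "V \<in> reps K \<longleftrightarrow> rmat V \<in> carrier G \<rightarrow>\<^sub>E carrier_mat (rdim V) (rdim V) \<and> rmat V \<one> = 1\<^sub>m (rdim V) \<and>
    (\<forall>h\<in>carrier G. \<forall>l\<in>carrier G. rmat V (h \<otimes> l) = rmat V h * rmat V l)"
proof -
  have "act K V (unt K) = rmat V \<one>" "h \<in> carrier G \<Longrightarrow> l \<in> carrier G \<Longrightarrow> act K V (prd K h l) = rmat V (h \<otimes> l)"
    if "rmat V \<in> carrier G \<rightarrow>\<^sub>E carrier_mat (rdim V) (rdim V)" for h l
  proof -
    have d: "\<And>h. h \<in> carrier G \<Longrightarrow> dim_row (rmat V h) = rdim V \<and> dim_col (rmat V h) = rdim V"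
      using that by (auto simp: PiE_iff)
    show "act K V (unt K) = rmat V \<one>" "h \<in> carrier G \<Longrightarrow> l \<in> carrier G \<Longrightarrow> act K V (prd K h l) = rmat V (h \<otimes> l)"
      using act_K[OF d] by (simp_all add: group_algebra_def)
  qed
  then show ?thesis by (auto simp: reps_def)
qed

lemma dim_K [simp]:
  "V \<in> reps K \<Longrightarrow> h \<in> carrier G \<Longrightarrow> dim_row (rmat V h) = rdim V"
  "V \<in> reps K \<Longrightarrow> h \<in> carrier G \<Longrightarrow> dim_col (rmat V h) = rdim V"
  by (auto simp: reps_K_iff PiE_iff)

lemma K_one [simp]: "V \<in> reps K \<Longrightarrow> rmat V \<one> = 1\<^sub>m (rdim V)"
  and K_mult: "V \<in> reps K \<Longrightarrow> h \<in> carrier G \<Longrightarrow> l \<in> carrier G \<Longrightarrow> rmat V (h \<otimes> l) = rmat V h * rmat V l"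
  by (auto simp: reps_K_iff)

lemma K_inv: "V \<in> reps K \<Longrightarrow> h \<in> carrier G \<Longrightarrow> rmat V (inv h) * rmat V h = 1\<^sub>m (rdim V)"
  "V \<in> reps K \<Longrightarrow> h \<in> carrier G \<Longrightarrow> rmat V h * rmat V (inv h) = 1\<^sub>m (rdim V)"
  using K_mult[of V "inv h" h] K_mult[of V h "inv h"] by simp_all

definition mk_K :: "nat \<Rightarrow> ('g \<Rightarrow> 'k mat) \<Rightarrow> ('g, 'k) rep"
  where "mk_K d r = \<lparr>rdim = d, rmat = (\<lambda>h\<in>carrier G. r h)\<rparr>"

lemma mk_K_simps [simp]: "rdim (mk_K d r) = d" "h \<in> carrier G \<Longrightarrow> rmat (mk_K d r) h = r h"
  by (simp_all add: mk_K_def)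

lemma mk_K:
  assumes "\<And>h. h \<in> carrier G \<Longrightarrow> dim_row (r h) = d \<and> dim_col (r h) = d" "r \<one> = 1\<^sub>m d"
    "\<And>h l. h \<in> carrier G \<Longrightarrow> l \<in> carrier G \<Longrightarrow> r (h \<otimes> l) = r h * r l"
  shows "mk_K d r \<in> reps K"
  unfolding reps_K_iff using assms by (auto simp: mk_K_def intro!: carrier_matI)

lemma tensor_K: "V \<in> reps K \<Longrightarrow> W \<in> reps K \<Longrightarrow> h \<in> carrier G \<Longrightarrow>
   rmat (rep_tensor K V W) h = kron (rmat V h) (rmat W h)"
  by (subst rmat_tensor, simp, simp add: group_algebra_def)
     (subst lincomb_delta_1[of _ "(h, h)"]; simp)

lemma tensor_K_rep: "V \<in> reps K \<Longrightarrow> W \<in> reps K \<Longrightarrow> rep_tensor K V W \<in> reps K"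
proof -
  assume VW: "V \<in> reps K" "W \<in> reps K"
  have "rmat (rep_tensor K V W) \<in> extensional (carrier G)" by (simp add: rep_tensor_def)
  then have "rmat (rep_tensor K V W) \<in> carrier G \<rightarrow>\<^sub>E carrier_mat (rdim (rep_tensor K V W)) (rdim (rep_tensor K V W))"
    using VW by (intro PiE_I) (auto simp: tensor_K extensional_def intro!: carrier_matI)
  then show ?thesis using VW
    unfolding reps_K_iff[of "rep_tensor K V W"] by (simp add: tensor_K K_mult kron_mult)
qed

lemma unit_K: "rep_unit K \<in> reps K" "rdim (rep_unit K) = Suc 0" "h \<in> carrier G \<Longrightarrow> rmat (rep_unit K) h = 1\<^sub>m (Suc 0)"
proof -
  show r: "h \<in> carrier G \<Longrightarrow> rmat (rep_unit K) h = 1\<^sub>m (Suc 0)" for h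
    by (simp add: rep_unit_def) (rule eq_matI; auto)
  show "rdim (rep_unit K) = Suc 0" by (simp add: rep_unit_def)
  then show "rep_unit K \<in> reps K" by (auto simp: reps_K_iff r, simp add: rep_unit_def)
qed

sublocale TK: tensor_hopf K
proof
  fix M N P assume MNP: "M \<in> reps K" "N \<in> reps K" "P \<in> reps K"
  show "rep_tensor K (rep_tensor K M N) P = rep_tensor K M (rep_tensor K N P)"
    by (rule rep_eqI[of _ K]) (use MNP in \<open>auto simp: tensor_K tensor_K_rep kron_assoc mult.assoc\<close>)
next
  fix M assume M: "M \<in> reps K"
  show "rep_tensor K (rep_unit K) M = M" "rep_tensor K M (rep_unit K) = M"
    by (rule rep_eqI[of _ K]; use M in \<open>auto simp: tensor_K tensor_K_rep unit_K\<close>)+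
qed (auto simp: tensor_K_rep unit_K)

lemma sum_K: "V \<in> reps K \<Longrightarrow> W \<in> reps K \<Longrightarrow> h \<in> carrier G \<Longrightarrow> rmat (rep_sum K V W) h = bdiag (rmat V h) (rmat W h)"
  by (simp add: rmat_sum)

subsection \<open>Inflation along the projection to the group algebra\<close>

definition infl :: "('g, 'k) rep \<Rightarrow> (nat \<times> 'g, 'k) rep"
  where "infl V = mk_rep (rdim V) (rmat V) (0\<^sub>m (rdim V) (rdim V))"

lemma zero_pow_mat: "0 < k \<Longrightarrow> 0\<^sub>m d d ^\<^sub>m k = (0\<^sub>m d d :: 'a::semiring_1 mat)"
  by (cases k) auto

lemma infl:
  assumes "V \<in> reps K"
  shows "infl V \<in> reps H" "h \<in> carrier G \<Longrightarrow> \<rho> (infl V) h = rmat V h" "Y (infl V) = 0\<^sub>m (rdim V) (rdim V)"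
  unfolding infl_def by (rule mk_rep; use assms n_pos in \<open>auto simp: K_mult zero_pow_mat\<close>)+

lemma rdim_infl [simp]: "rdim (infl V) = rdim V"
  by (simp add: infl_def)

lemma infl_tensor: "V \<in> reps K \<Longrightarrow> W \<in> reps K \<Longrightarrow> infl (rep_tensor K V W) = rep_tensor H (infl V) (infl W)"
  by (rule rep_eqI_H) (auto simp: infl tensor_H tensor_K tensor_K_rep tensor_Y_def)

lemma infl_sum: "V \<in> reps K \<Longrightarrow> W \<in> reps K \<Longrightarrow> infl (rep_sum K V W) = rep_sum H (infl V) (infl W)"
  by (rule rep_eqI_H) (auto simp: infl sum_H sum_K rep_sum_rep bdiag_def)

lemma infl_unit: "infl (rep_unit K) = rep_unit H"
  by (rule rep_eqI_H) (auto simp: infl unit_K unit_H)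

lemma infl_hom: "V \<in> reps K \<Longrightarrow> W \<in> reps K \<Longrightarrow> f \<in> rep_hom K V W \<Longrightarrow> f \<in> rep_hom H (infl V) (infl W)"
  by (rule rep_homI_H) (auto simp: infl rep_homD)

lemma infl_iso: "V \<in> reps K \<Longrightarrow> W \<in> reps K \<Longrightarrow> rep_iso K V W \<Longrightarrow> rep_iso H (infl V) (infl W)"
  unfolding rep_iso_def using infl_hom[of V W] infl_hom[of W V] by fastforce

end

section \<open>Complete reducibility and characters of the group\<close>

text \<open>In a rank factorization P = C D of an idempotent, D C is the identity of size r, so the
  trace of P is its rank; characteristic zero turns a vanishing trace into rank zero.\<close>

lemma idempotent_trace_nonzero:
  fixes P :: "'k::field_char_0 mat"
  assumes P: "P * P = P" "dim_row P = dim_col P" and tr: "tr P = 0"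
  shows "P = 0\<^sub>m (dim_col P) (dim_col P)"
proof -
  obtain C D C' D' r where CD: "P = C * D" "C' * C = 1\<^sub>m r" "D * D' = 1\<^sub>m r"
    and dims: "dim_row C = dim_row P" "dim_col C = r" "dim_row D = r" "dim_col D = dim_col P"
    "dim_row C' = r" "dim_col C' = dim_row P" "dim_row D' = dim_col P" "dim_col D' = r"
    by (rule rank_factorization[of P])
  note [simp] = dims
  have "D * C = C' * (P * P) * D'" using P(2) by (subst (1 2) CD(1)) (simp add: mult_assoc_dim CD(3) mult_cancel_left[OF CD(2)])
  also have "\<dots> = C' * (C * (D * D'))" using P(2) unfolding P(1) by (subst CD(1)) (simp add: mult_assoc_dim)
  finally have DC: "D * C = 1\<^sub>m r" by (simp add: CD(2,3))
  have "tr P = tr (D * C)" using P(2) by (subst CD(1), subst tr_mult_comm) simp_all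
  then have "r = 0" using tr by (simp add: DC)
  then show ?thesis using P(2) by (subst CD(1)) (auto simp: scalar_prod_def intro!: eq_matI)
qed

text \<open>Flattening by rows, in the order used by \<open>kron\<close>; it makes A \<otimes> B act
  on matrices as X \<mapsto> A X B^T.\<close>

definition vecm :: "'k::zero mat \<Rightarrow> 'k mat"
  where "vecm X = mat (dim_row X * dim_col X) 1 (\<lambda>(i, _). X $$ (i div dim_col X, i mod dim_col X))"

lemma dim_vecm [simp]: "dim_row (vecm X) = dim_row X * dim_col X" "dim_col (vecm X) = Suc 0"
  by (simp_all add: vecm_def)

lemma vecm_index: "i < dim_row X * dim_col X \<Longrightarrow> vecm X $$ (i, 0) = X $$ (i div dim_col X, i mod dim_col X)"
  by (simp add: vecm_def)

lemma vecm_inj: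
  assumes "vecm X = vecm Z" "dim_row X = dim_row Z" "dim_col X = dim_col Z"
  shows "X = Z"
proof (rule eq_matI)
  fix i j assume "i < dim_row Z" "j < dim_col Z"
  moreover have "vecm X $$ (i * dim_col Z + j, 0) = vecm Z $$ (i * dim_col Z + j, 0)" by (simp only: assms(1))
  ultimately show "X $$ (i, j) = Z $$ (i, j)"
    using assms(2,3) by (simp add: vecm_index pair_index_less)
qed (use assms in auto)

lemma kron_vecm:
  assumes "dim_col A = dim_row X" "dim_col B = dim_col X"
  shows "kron A B * vecm X = vecm (A * X * (B :: 'k::field mat)\<^sup>T)"
proof (cases "dim_col X = 0")
  case True
  then show ?thesis using assms
    by (intro eq_matI) (auto simp: vecm_def mult_mat_index scalar_prod_def div_less_of_mult mod_less_of_mult simp del: index_mult_mat(1))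
next
  case False
  show ?thesis
  proof (rule eq_matI)
    fix i j assume "i < dim_row (vecm (A * X * B\<^sup>T))" "j < dim_col (vecm (A * X * B\<^sup>T))"
    then have ij: "i < dim_row A * dim_row B" "j = 0" by auto
    then have i: "i div dim_row B < dim_row A" "i mod dim_row B < dim_row B"
      by (auto intro: div_less_of_mult mod_less_of_mult)
    have "(kron A B * vecm X) $$ (i, j) = (\<Sum>k<dim_row X * dim_col X.
      A $$ (i div dim_row B, k div dim_col X) * B $$ (i mod dim_row B, k mod dim_col X) * X $$ (k div dim_col X, k mod dim_col X))"
      using ij assms by (auto simp: mult_mat_index kron_index vecm_index simp del: index_mult_mat(1) intro!: sum.cong)
    also have "\<dots> = (\<Sum>k<dim_row X. \<Sum>l<dim_col X. A $$ (i div dim_row B, k) * B $$ (i mod dim_row B, l) * X $$ (k, l))"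
      using False by (subst sum_divmod[symmetric]) auto
    also have "\<dots> = (\<Sum>l<dim_col X. \<Sum>k<dim_row X. A $$ (i div dim_row B, k) * X $$ (k, l) * B $$ (i mod dim_row B, l))"
      by (subst sum.swap) (simp add: ac_simps)
    also have "\<dots> = vecm (A * X * B\<^sup>T) $$ (i, j)"
      using ij i assms by (simp add: vecm_index mult_mat_index sum_distrib_right del: index_mult_mat(1))
    finally show "(kron A B * vecm X) $$ (i, j) = vecm (A * X * B\<^sup>T) $$ (i, j)" .
  qed (use assms in auto)
qed

text \<open>\<open>1 - D' D\<close> projects onto the kernel of X, so the hypothesis forces
  \<open>D' D = 1\<close>. The test objects are square matrices so that this projection is one of
  them.\<close>

lemma trivial_kernel_left_inverse:
  fixes X :: "'k::field mat"
  assumes "\<And>Z. dim_row Z = dim_col X \<Longrightarrow> dim_col Z = dim_col X \<Longrightarrow> X * Z = 0\<^sub>m (dim_row X) (dim_col X) \<Longrightarrow> Z = 0\<^sub>m (dim_col X) (dim_col X)"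
  obtains L where "L * X = 1\<^sub>m (dim_col X)" "dim_row L = dim_col X" "dim_col L = dim_row X"
proof -
  obtain C D C' D' r where CD: "X = C * D" "C' * C = 1\<^sub>m r" "D * D' = 1\<^sub>m r"
    and dims: "dim_row C = dim_row X" "dim_col C = r" "dim_row D = r" "dim_col D = dim_col X"
    "dim_row C' = r" "dim_col C' = dim_row X" "dim_row D' = dim_col X" "dim_col D' = r"
    by (rule rank_factorization[of X])
  note [simp] = dims
  let ?Z = "1\<^sub>m (dim_col X) - D' * D"
  have "D * ?Z = 0\<^sub>m r (dim_col X)" by (simp add: mult_minus_dim mult_cancel_left[OF CD(3)]) (rule eq_matI; simp)
  then have "X * ?Z = 0\<^sub>m (dim_row X) (dim_col X)"
    by (subst CD(1)) (simp add: mult_assoc_dim)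
  then have Z: "?Z = 0\<^sub>m (dim_col X) (dim_col X)" by (intro assms) simp_all
  have "D' * D = 1\<^sub>m (dim_col X)"
  proof (rule eq_matI)
    fix i j assume ij: "i < dim_row (1\<^sub>m (dim_col X) :: 'k mat)" "j < dim_col (1\<^sub>m (dim_col X) :: 'k mat)"
    then have "?Z $$ (i, j) = 0" by (subst Z) simp
    then show "(D' * D) $$ (i, j) = (1\<^sub>m (dim_col X) :: 'k mat) $$ (i, j)" using ij by simp
  qed simp_all
  moreover have "C' * X = D" by (subst CD(1)) (simp add: mult_cancel_left[OF CD(2)])
  ultimately have "D' * C' * X = 1\<^sub>m (dim_col X)" by (simp add: mult_assoc_dim)
  then show ?thesis by (intro that[of "D' * C'"]) simp_all
qed

lemma lincomb_single:
  assumes "finite I" "t \<in> I" "\<And>s. s \<in> I \<Longrightarrow> s \<noteq> t \<Longrightarrow> A s = 0\<^sub>m r c" "dim_row (A t) = r" "dim_col (A t) = c"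
  shows "lincomb r c I (\<lambda>_. 1) A = (A t :: 'k::field mat)"
proof (rule eq_matI)
  fix i j assume ij: "i < dim_row (A t)" "j < dim_col (A t)"
  have "(\<Sum>p\<in>I. A p $$ (i, j)) = (\<Sum>p\<in>{t}. A p $$ (i, j))"
    using assms ij by (intro sum.mono_neutral_right) auto
  then show "lincomb r c I (\<lambda>_. 1) A $$ (i, j) = A t $$ (i, j)" using ij assms by (simp add: lincomb_index)
qed (use assms in auto)

lemma lincomb_const:
  assumes "finite I" "\<And>p. p \<in> I \<Longrightarrow> A p = B" "dim_row B = r" "dim_col B = c"
  shows "lincomb r c I (\<lambda>_. x) A = (of_nat (card I) * x) \<cdot>\<^sub>m (B :: 'k::field mat)"
  by (rule eq_matI) (use assms in \<open>auto simp: lincomb_index\<close>)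

section \<open>Averaging over G, Maschke's theorem and modules with equal characters\<close>

context datum
begin

lemma sum_translate: "l \<in> carrier G \<Longrightarrow> (\<Sum>h\<in>carrier G. f (l \<otimes> h)) = (\<Sum>h\<in>carrier G. f h)"
  by (rule sum.reindex_bij_witness[of _ "\<lambda>h. inv l \<otimes> h" "\<lambda>h. l \<otimes> h"]) (auto simp: G.m_assoc[symmetric])

lemma lincomb_translate: "l \<in> carrier G \<Longrightarrow> lincomb r c (carrier G) (\<lambda>_. x) (\<lambda>h. A (l \<otimes> h)) = lincomb r c (carrier G) (\<lambda>_. x) A"
  by (rule eq_matI) (simp_all add: lincomb_index sum_translate[of l "\<lambda>h. x * A h $$ (i, j)" for i j])

definition N_inv :: 'k where "N_inv = inverse (of_nat (card (carrier G)))"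

lemma card_pos: "card (carrier G) > 0"
  using G.one_closed by (auto simp: card_gt_0_iff)

lemma card_N_inv [simp]: "of_nat (card (carrier G)) * N_inv = 1"
proof -
  have "of_nat (card (carrier G)) \<noteq> (0 :: 'k)" using card_pos by (metis of_nat_eq_0_iff less_irrefl)
  then show ?thesis unfolding N_inv_def by (rule right_inverse)
qed

text \<open>The averaging projection of linear maps V \<rightarrow> W onto the
  G-homomorphisms.\<close>

definition avg :: "('g, 'k) rep \<Rightarrow> ('g, 'k) rep \<Rightarrow> 'k mat \<Rightarrow> 'k mat"
  where "avg V W E = lincomb (rdim W) (rdim V) (carrier G) (\<lambda>_. N_inv) (\<lambda>h. rmat W h * (E * rmat V (inv h)))"

lemma dim_avg [simp]: "dim_row (avg V W E) = rdim W" "dim_col (avg V W E) = rdim V"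
  by (simp_all add: avg_def)

lemma avg_hom:
  assumes VW: "V \<in> reps K" "W \<in> reps K" and E: "dim_row E = rdim W" "dim_col E = rdim V"
  shows "avg V W E \<in> rep_hom K V W"
proof (rule rep_homI)
  fix l assume "l \<in> basis K"
  then have l: "l \<in> carrier G" by simp
  let ?L = "lincomb (rdim W) (rdim V) (carrier G) (\<lambda>_. N_inv)"
  have "rmat W l * avg V W E = ?L (\<lambda>h. rmat W l * (rmat W h * (E * rmat V (inv h))))"
    unfolding avg_def using VW E l by (subst mult_lincomb) auto
  also have "\<dots> = ?L (\<lambda>h. rmat W (l \<otimes> h) * (E * rmat V (inv (l \<otimes> h) \<otimes> l)))"
    using VW E l by (intro lincomb_mat_cong) (simp add: K_mult G.inv_mult_group G.m_assoc mult_assoc_dim)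
  also have "\<dots> = ?L (\<lambda>h. rmat W h * (E * rmat V (inv h \<otimes> l)))"
    by (rule lincomb_translate[OF l, of _ _ _ "\<lambda>h. rmat W h * (E * rmat V (inv h \<otimes> l))"])
  also have "\<dots> = ?L (\<lambda>h. (rmat W h * (E * rmat V (inv h))) * rmat V l)"
    using VW E l by (intro lincomb_mat_cong) (simp add: K_mult mult_assoc_dim)
  also have "\<dots> = avg V W E * rmat V l"
    unfolding avg_def using VW E l by (subst lincomb_mult) auto
  finally show "rmat W l * avg V W E = avg V W E * rmat V l" .
qed simp_all

text \<open>Every conjugate h s h^{-1} of a linear section of a G-map is again a section, hence so
  is the average.\<close>

lemma maschke_section:
  assumes VW: "V \<in> reps K" "W \<in> reps K" and f: "f \<in> rep_hom K V W"
    and s: "f * s = 1\<^sub>m (rdim W)" "dim_row s = rdim V" "dim_col s = rdim W"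
  shows "\<exists>s\<in>rep_hom K W V. f * s = 1\<^sub>m (rdim W)"
proof
  note [simp] = rep_hom_dim[OF f]
  show "avg W V s \<in> rep_hom K W V" using VW s by (intro avg_hom) auto
  have "f * avg W V s = lincomb (rdim W) (rdim W) (carrier G) (\<lambda>_. N_inv) (\<lambda>h. f * (rmat V h * (s * rmat W (inv h))))"
    unfolding avg_def using VW s by (subst mult_lincomb) auto
  also have "\<dots> = (of_nat (card (carrier G)) * N_inv) \<cdot>\<^sub>m 1\<^sub>m (rdim W)"
  proof (rule lincomb_const)
    fix h assume h: "h \<in> carrier G"
    have "f * (rmat V h * (s * rmat W (inv h))) = (f * rmat V h) * (s * rmat W (inv h))"
      using VW s h by (simp add: mult_assoc_dim)
    also have "f * rmat V h = rmat W h * f" using rep_homD[OF f, of h] h by simp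
    also have "rmat W h * f * (s * rmat W (inv h)) = 1\<^sub>m (rdim W)"
      using VW s h by (simp add: mult_assoc_dim mult_cancel_left[OF s(1)] K_inv)
    finally show "f * (rmat V h * (s * rmat W (inv h))) = 1\<^sub>m (rdim W)" .
  qed auto
  finally show "f * avg W V s = 1\<^sub>m (rdim W)" by simp
qed

text \<open>Conjugates of a linear retraction of a G-map are retractions, and so is their
  average.\<close>

lemma maschke_retraction:
  assumes VW: "V \<in> reps K" "W \<in> reps K" and f: "f \<in> rep_hom K V W"
    and s: "s * f = 1\<^sub>m (rdim V)" "dim_row s = rdim V" "dim_col s = rdim W"
  shows "\<exists>s\<in>rep_hom K W V. s * f = 1\<^sub>m (rdim V)"
proof
  note [simp] = rep_hom_dim[OF f]
  show "avg W V s \<in> rep_hom K W V" using VW s by (intro avg_hom) auto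
  have "avg W V s * f = lincomb (rdim V) (rdim V) (carrier G) (\<lambda>_. N_inv) (\<lambda>h. (rmat V h * (s * rmat W (inv h))) * f)"
    unfolding avg_def using VW s by (subst lincomb_mult) auto
  also have "\<dots> = (of_nat (card (carrier G)) * N_inv) \<cdot>\<^sub>m 1\<^sub>m (rdim V)"
  proof (rule lincomb_const)
    fix h assume h: "h \<in> carrier G"
    have "(rmat V h * (s * rmat W (inv h))) * f = rmat V h * (s * (rmat W (inv h) * f))"
      using VW s h by (simp add: mult_assoc_dim)
    also have "rmat W (inv h) * f = f * rmat V (inv h)" using rep_homD[OF f, of "inv h"] h by simp
    also have "rmat V h * (s * (f * rmat V (inv h))) = 1\<^sub>m (rdim V)"
      using VW s h by (simp add: mult_cancel_left[OF s(1)] K_inv)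
    finally show "(rmat V h * (s * rmat W (inv h))) * f = 1\<^sub>m (rdim V)" .
  qed auto
  finally show "avg W V s * f = 1\<^sub>m (rdim V)" by simp
qed

text \<open>The kernel of D is the kernel of f and hence stable under G, so D h D' does not depend
  on the section D' and defines the action on the image of f.\<close>

lemma K_image:
  assumes VW: "V \<in> reps K" "W \<in> reps K" and f: "f \<in> rep_hom K V W"
  obtains I C D C' D' where "I \<in> reps K" "C \<in> rep_hom K I W" "D \<in> rep_hom K V I" "f = C * D"
    "C' * C = 1\<^sub>m (rdim I)" "D * D' = 1\<^sub>m (rdim I)"
    "dim_row C' = rdim I" "dim_col C' = rdim W" "dim_row D' = rdim V" "dim_col D' = rdim I"
    "\<And>h. h \<in> carrier G \<Longrightarrow> rmat I h = D * rmat V h * D'"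
proof -
  note [simp] = rep_hom_dim[OF f]
  obtain C D C' D' r where CD: "f = C * D" "C' * C = 1\<^sub>m r" "D * D' = 1\<^sub>m r"
    and dims0: "dim_row C = dim_row f" "dim_col C = r" "dim_row D = r" "dim_col D = dim_col f"
    "dim_row C' = r" "dim_col C' = dim_row f" "dim_row D' = dim_col f" "dim_col D' = r"
    by (rule rank_factorization[of f])
  note dims [simp] = dims0[unfolded rep_hom_dim[OF f]]
  define I where "I = mk_K r (\<lambda>h. D * rmat V h * D')"
  \<comment> \<open>D h vanishes on the image of 1 - D' D, which is the kernel of D.\<close>
  have comm: "D * rmat V h = D * rmat V h * D' * D" if h: "h \<in> carrier G" for h
  proof -
    have "D * rmat V h = C' * (f * rmat V h)" using VW h by (simp add: CD(1) mult_assoc_dim mult_cancel_left[OF CD(2)])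
    also have "\<dots> = C' * (rmat W h * (C * D))" using rep_homD[OF f, of h] h CD(1) by simp
    also have "\<dots> = C' * (rmat W h * (C * (D * D') * D))" using VW h by (simp add: CD(3))
    also have "\<dots> = C' * (rmat W h * f) * D' * D" using VW h by (simp add: CD(1) mult_assoc_dim)
    also have "\<dots> = C' * (f * rmat V h) * D' * D" using rep_homD[OF f, of h] h by simp
    also have "\<dots> = D * rmat V h * D' * D"
      using VW h by (simp add: CD(1) mult_assoc_dim mult_cancel_left[OF CD(2)])
    finally show ?thesis .
  qed
  have rI: "rmat I h = D * rmat V h * D'" if "h \<in> carrier G" for h using that by (simp add: I_def)
  have [simp]: "rdim I = r" by (simp add: I_def)
  have mult: "D * rmat V (h \<otimes> l) * D' = (D * rmat V h * D') * (D * rmat V l * D')"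
    if "h \<in> carrier G" "l \<in> carrier G" for h l
  proof -
    have "D * rmat V (h \<otimes> l) * D' = (D * rmat V h) * (rmat V l * D')" using VW that by (simp add: K_mult mult_assoc_dim)
    also have "\<dots> = (D * rmat V h * D' * D) * (rmat V l * D')" using comm[OF that(1)] by simp
    finally show ?thesis using VW that by (simp add: mult_assoc_dim)
  qed
  have I: "I \<in> reps K" unfolding I_def
    by (rule mk_K) (use VW mult in \<open>auto simp: CD(3)\<close>)
  have "D \<in> rep_hom K V I"
    by (rule rep_homI) (use comm in \<open>auto simp: rI\<close>)
  moreover have "C \<in> rep_hom K I W"
  proof (rule rep_homI)
    fix h assume "h \<in> basis K"
    then have h: "h \<in> carrier G" by simp
    have "rmat W h * C = (rmat W h * f) * D'" using VW h by (simp add: CD mult_assoc_dim)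
    also have "\<dots> = f * rmat V h * D'" using rep_homD[OF f, of h] h by simp
    also have "\<dots> = C * rmat I h" using VW h by (simp add: rI CD(1) mult_assoc_dim)
    finally show "rmat W h * C = C * rmat I h" .
  qed auto
  ultimately show ?thesis
    by (intro that[of I C D C' D', OF I _ _ CD(1)]) (simp_all add: CD(2,3) rI)
qed

definition ch :: "('g, 'k) rep \<Rightarrow> 'g \<Rightarrow> 'k"
  where "ch V h = tr (rmat V h)"

lemma ch_one [simp]: "V \<in> reps K \<Longrightarrow> ch V \<one> = of_nat (rdim V)"
  by (simp add: ch_def)

lemma ch_sum: "V \<in> reps K \<Longrightarrow> W \<in> reps K \<Longrightarrow> h \<in> carrier G \<Longrightarrow> ch (rep_sum K V W) h = ch V h + ch W h"
  by (simp add: ch_def sum_K tr_bdiag)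

lemma ch_iso:
  assumes VW: "V \<in> reps K" "W \<in> reps K" "rep_iso K V W" and h: "h \<in> carrier G"
  shows "ch V h = ch W h"
proof -
  obtain f e where fe: "f \<in> rep_hom K V W" "e \<in> rep_hom K W V" "e * f = 1\<^sub>m (rdim V)" "f * e = 1\<^sub>m (rdim W)"
    using VW by (auto simp: rep_iso_def)
  note [simp] = rep_hom_dim[OF fe(1)] rep_hom_dim[OF fe(2)]
  have "rmat V h = e * (rmat W h * f)"
    using VW h rep_homD[OF fe(1), of h] by (simp add: mult_cancel_left[OF fe(3)])
  then have "tr (rmat V h) = tr (rmat W h * f * e)" using VW h by (simp only:) (subst tr_mult_comm; simp)
  also have "\<dots> = tr (rmat W h)" using VW h by (simp add: mult_assoc_dim fe)
  finally show ?thesis by (simp add: ch_def)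
qed

text \<open>The average of \<open>h\<close> acting on \<open>V \<otimes> V\<^sup>*\<close> is an idempotent that fixes the identity matrix.\<close>

lemma ch_norm_nonzero:
  assumes V: "V \<in> reps K" and d: "rdim V > 0"
  shows "(\<Sum>h\<in>carrier G. ch V h * ch V (inv h)) \<noteq> 0"
proof
  assume zero: "(\<Sum>h\<in>carrier G. ch V h * ch V (inv h)) = 0"
  let ?d = "rdim V * rdim V"
  define U where "U h = kron (rmat V h) (rmat V (inv h))\<^sup>T" for h
  have dU [simp]: "dim_row (U h) = ?d" "dim_col (U h) = ?d" if "h \<in> carrier G" for h
    using that V by (simp_all add: U_def)
  have U_mult: "U (h \<otimes> l) = U h * U l" if "h \<in> carrier G" "l \<in> carrier G" for h l
    using that V by (simp add: U_def kron_mult K_mult G.inv_mult_group transpose_mult_dim)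
  define P where "P = lincomb ?d ?d (carrier G) (\<lambda>_. N_inv) U"
  have [simp]: "dim_row P = ?d" "dim_col P = ?d" by (simp_all add: P_def)
  have UP: "U l * P = P" if l: "l \<in> carrier G" for l
  proof -
    have "U l * P = lincomb ?d ?d (carrier G) (\<lambda>_. N_inv) (\<lambda>h. U (l \<otimes> h))"
      unfolding P_def using l by (subst mult_lincomb) (auto simp: U_mult intro!: lincomb_mat_cong)
    then show ?thesis by (simp only: lincomb_translate[OF l] P_def)
  qed
  have "P * P = lincomb ?d ?d (carrier G) (\<lambda>_. N_inv) (\<lambda>h. U h * P)"
    by (subst (1) P_def, subst lincomb_mult) auto
  also have "\<dots> = (of_nat (card (carrier G)) * N_inv) \<cdot>\<^sub>m P"
    by (rule lincomb_const) (auto simp: UP)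
  finally have PP: "P * P = P" by simp
  have "tr P = (\<Sum>h\<in>carrier G. N_inv * (ch V h * ch V (inv h)))"
    unfolding P_def using V by (subst tr_lincomb) (auto simp: U_def tr_kron tr_transpose ch_def)
  then have "tr P = 0" using zero by (simp flip: sum_distrib_left)
  then have P0: "P = 0\<^sub>m ?d ?d" using idempotent_trace_nonzero[OF PP] by simp
  have "P * vecm (1\<^sub>m (rdim V)) = lincomb ?d 1 (carrier G) (\<lambda>_. N_inv) (\<lambda>h. U h * vecm (1\<^sub>m (rdim V)))"
    unfolding P_def by (subst lincomb_mult) auto
  also have "\<dots> = (of_nat (card (carrier G)) * N_inv) \<cdot>\<^sub>m vecm (1\<^sub>m (rdim V))"
    by (rule lincomb_const) (use V in \<open>auto simp: U_def kron_vecm K_inv\<close>)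
  finally have "vecm (1\<^sub>m (rdim V)) = (0\<^sub>m ?d 1 :: 'k mat)" by (simp add: P0)
  then have "(vecm (1\<^sub>m (rdim V)) :: 'k mat) $$ (0, 0) = 0" using d by simp
  then show False using d by (simp add: vecm_index)
qed

text \<open>The (a, b) entry of the average of the matrix unit E_ab is the mean of W_aa(h)
  V_bb(h^{-1}). Were all averages zero, summation over a and b would give the vanishing of the
  character sum that \<open>ch_norm_nonzero\<close> excludes.\<close>

lemma exists_nonzero_hom:
  assumes VW: "V \<in> reps K" "W \<in> reps K" and ch: "\<And>h. h \<in> carrier G \<Longrightarrow> ch V h = ch W h" and d: "rdim V > 0"
  shows "\<exists>f\<in>rep_hom K V W. f \<noteq> 0\<^sub>m (rdim W) (rdim V)"
proof (rule ccontr)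
  assume "\<not> ?thesis"
  then have hom0: "f = 0\<^sub>m (rdim W) (rdim V)" if "f \<in> rep_hom K V W" for f using that by blast
  have "(\<Sum>h\<in>carrier G. rmat W h $$ (a, a) * rmat V (inv h) $$ (b, b)) = 0" if ab: "a < rdim W" "b < rdim V" for a b
  proof -
    define E where "E = mat (rdim W) (rdim V) (\<lambda>(i, j). of_bool (i = a \<and> j = b) :: 'k)"
    have [simp]: "dim_row E = rdim W" "dim_col E = rdim V" by (auto simp: E_def)
    have EV: "(E * rmat V (inv h)) $$ (k, b) = of_bool (k = a) * rmat V (inv h) $$ (b, b)"
      if "h \<in> carrier G" "k < rdim W" for h k
      using that ab VW by (subst mult_mat_index)
        (auto simp: E_def of_bool_def if_distrib if_distribR cong: if_cong)
    have "(rmat W h * (E * rmat V (inv h))) $$ (a, b) = rmat W h $$ (a, a) * rmat V (inv h) $$ (b, b)"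
      if h: "h \<in> carrier G" for h
    proof -
      have "(rmat W h * (E * rmat V (inv h))) $$ (a, b) = (\<Sum>k<rdim W. rmat W h $$ (a, k) * (of_bool (k = a) * rmat V (inv h) $$ (b, b)))"
        using h ab VW by (subst mult_mat_index) (auto simp: EV simp del: index_mult_mat(1) intro!: sum.cong)
      also have "\<dots> = rmat W h $$ (a, a) * rmat V (inv h) $$ (b, b)"
        using ab by (simp add: of_bool_def if_distrib if_distribR cong: if_cong)
      finally show ?thesis .
    qed
    then have "avg V W E $$ (a, b) = N_inv * (\<Sum>h\<in>carrier G. rmat W h $$ (a, a) * rmat V (inv h) $$ (b, b))"
      using ab by (simp add: avg_def lincomb_index sum_distrib_left del: index_mult_mat(1))
    moreover have "avg V W E $$ (a, b) = 0" using hom0[OF avg_hom[OF VW, of E]] ab by simp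
    moreover have "N_inv \<noteq> 0" using card_N_inv by (metis mult_zero_right zero_neq_one)
    ultimately show ?thesis by simp
  qed
  then have "(\<Sum>a<rdim W. \<Sum>b<rdim V. \<Sum>h\<in>carrier G. rmat W h $$ (a, a) * rmat V (inv h) $$ (b, b)) = 0" by simp
  moreover have "(\<Sum>a<rdim W. \<Sum>b<rdim V. \<Sum>h\<in>carrier G. rmat W h $$ (a, a) * rmat V (inv h) $$ (b, b)) =
      (\<Sum>h\<in>carrier G. \<Sum>a<rdim W. \<Sum>b<rdim V. rmat W h $$ (a, a) * rmat V (inv h) $$ (b, b))"
    by (simp add: sum.swap[of _ "carrier G"])
  moreover have "\<dots> = (\<Sum>h\<in>carrier G. ch V h * ch V (inv h))"
  proof (intro sum.cong refl)
    fix h assume h: "h \<in> carrier G"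
    have "ch V h * ch V (inv h) = ch W h * ch V (inv h)" using ch[OF h] by simp
    then show "(\<Sum>a<rdim W. \<Sum>b<rdim V. rmat W h $$ (a, a) * rmat V (inv h) $$ (b, b)) = ch V h * ch V (inv h)"
      using VW h by (simp add: ch_def tr_def sum_product)
  qed
  ultimately show False using ch_norm_nonzero[OF VW(1) d] by simp
qed

text \<open>The image of a nonzero homomorphism V \<rightarrow> W is a direct summand of both
  modules by Maschke's theorem; splitting it off leaves smaller modules with equal
  characters.\<close>

lemma K_iso_of_ch:
  assumes "V \<in> reps K" "W \<in> reps K" "\<And>h. h \<in> carrier G \<Longrightarrow> ch V h = ch W h"
  shows "rep_iso K V W"
  using assms
proof (induction "rdim V" arbitrary: V W rule: less_induct)
  case less
  note V = less(2) and W = less(3) and ch = less(4)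
  have "of_nat (rdim V) = (of_nat (rdim W) :: 'k)" using ch[of \<one>] V W by simp
  then have dim: "rdim V = rdim W" by simp
  show ?case
  proof (cases "rdim V = 0")
    case True
    then have "V = W" using V W dim rep_dim0_eq[of V K] rep_dim0_eq[of W K] by simp
    then show ?thesis using V rep_iso_refl by simp
  next
    case False
    then obtain f where f: "f \<in> rep_hom K V W" "f \<noteq> 0\<^sub>m (rdim W) (rdim V)"
      using exists_nonzero_hom[OF V W ch] by auto
    obtain I C D C' D' where I: "I \<in> reps K" "C \<in> rep_hom K I W" "D \<in> rep_hom K V I" "f = C * D"
      "C' * C = 1\<^sub>m (rdim I)" "D * D' = 1\<^sub>m (rdim I)"
      "dim_row C' = rdim I" "dim_col C' = rdim W" "dim_row D' = rdim V" "dim_col D' = rdim I"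
      by (rule K_image[OF V W f(1)])
    note [simp] = rep_hom_dim[OF I(2)] rep_hom_dim[OF I(3)]
    have "rdim I > 0"
    proof (rule ccontr)
      assume "\<not> rdim I > 0"
      then have "f = 0\<^sub>m (rdim W) (rdim V)" unfolding I(4) by (intro eq_matI) (auto simp: scalar_prod_def)
      then show False using f by simp
    qed
    obtain s where s: "s \<in> rep_hom K I V" "D * s = 1\<^sub>m (rdim I)" using maschke_section[OF V I(1,3,6,9,10)] by blast
    obtain p where p: "p \<in> rep_hom K W I" "p * C = 1\<^sub>m (rdim I)" using maschke_retraction[OF I(1) W I(2,5,7,8)] by blast
    obtain V' where V': "V' \<in> reps K" "rep_iso K V (rep_sum K I V')" by (rule rep_split[OF V I(1) s(1) I(3) s(2)])
    obtain W' where W': "W' \<in> reps K" "rep_iso K W (rep_sum K I W')" by (rule rep_split[OF W I(1,2) p])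
    have "ch V' h = ch W' h" if h: "h \<in> carrier G" for h
      using ch[OF h] ch_iso[OF V rep_sum_rep[OF I(1) V'(1)] V'(2) h] ch_iso[OF W rep_sum_rep[OF I(1) W'(1)] W'(2) h]
        ch_sum[OF I(1) V'(1) h] ch_sum[OF I(1) W'(1) h] by simp
    moreover have "rdim V' < rdim V" using rep_iso_dim[OF V'(2)] \<open>rdim I > 0\<close> by simp
    ultimately have "rep_iso K V' W'" using less(1) V' W' by blast
    then have "rep_iso K (rep_sum K I V') (rep_sum K I W')"
      using I V' W' by (intro rep_iso_sum_cong rep_iso_refl)
    then have "rep_iso K V (rep_sum K I W')"
      by (rule rep_iso_trans[OF V rep_sum_rep[OF I(1) V'(1)] rep_sum_rep[OF I(1) W'(1)] V'(2)])
    then show ?thesis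
      by (rule rep_iso_trans[OF V rep_sum_rep[OF I(1) W'(1)] W _ rep_iso_sym[OF W'(2)]])
  qed
qed

end

section \<open>The structure of modules over the Hopf algebra\<close>

lemma sum_if_mult:
  fixes j :: nat and y z :: "nat \<Rightarrow> 'a::semiring_0"
  shows "(\<Sum>k<j. y k * (if k = b then z k else 0)) = (if b < j then y b * z b else 0)"
    "(\<Sum>k<j. y k * (if b = k then z k else 0)) = (if b < j then y b * z b else 0)"
    "(\<Sum>k<j. (if k = b then z k else 0) * y k) = (if b < j then z b * y b else 0)"
    "(\<Sum>k<j. (if b = k then z k else 0) * y k) = (if b < j then z b * y b else 0)"
proof -
  have a: "y k * (if k = b then z k else 0) = (if k = b then y k * z k else 0)"
    "y k * (if b = k then z k else 0) = (if b = k then y k * z k else 0)"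
    "(if k = b then z k else 0) * y k = (if k = b then z k * y k else 0)"
    "(if b = k then z k else 0) * y k = (if b = k then z k * y k else 0)" for k
    by auto
  show "(\<Sum>k<j. y k * (if k = b then z k else 0)) = (if b < j then y b * z b else 0)"
    "(\<Sum>k<j. y k * (if b = k then z k else 0)) = (if b < j then y b * z b else 0)"
    "(\<Sum>k<j. (if k = b then z k else 0) * y k) = (if b < j then z b * y b else 0)"
    "(\<Sum>k<j. (if b = k then z k else 0) * y k) = (if b < j then z b * y b else 0)"
    unfolding a by (simp_all add: sum.delta sum.delta')
qed

lemma one_pow_mat: "1\<^sub>m d ^\<^sub>m i = (1\<^sub>m d :: 'a::semiring_1 mat)"
  by (induction i) auto

definition shiftm :: "nat \<Rightarrow> 'k::{zero,one} mat"
  where "shiftm j = mat j j (\<lambda>(a, b). if a = Suc b then 1 else 0)"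

text \<open>For t >= j this is the zero column, so that y e_t = e_{t+1} and the formulas for tensor
  products hold at the end of the range too.\<close>

definition ecol :: "nat \<Rightarrow> nat \<Rightarrow> 'k::{zero,one} mat"
  where "ecol j t = mat j 1 (\<lambda>(a, _). if a = t then 1 else 0)"

lemma dim_shiftm [simp]: "dim_row (shiftm j) = j" "dim_col (shiftm j) = j"
  by (simp_all add: shiftm_def)

lemma dim_ecol [simp]: "dim_row (ecol j t) = j" "dim_col (ecol j t) = Suc 0"
  by (simp_all add: ecol_def)

lemma dim_mat_diag [simp]: "dim_row (mat_diag j f) = j" "dim_col (mat_diag j f) = j"
  by (simp_all add: mat_diag_def)

lemma mat_diag_index: "a < j \<Longrightarrow> b < j \<Longrightarrow> mat_diag j f $$ (a, b) = (if a = b then f a else 0)"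
  by (auto simp: mat_diag_def)

lemma shiftm_pow: "shiftm j ^\<^sub>m i = (mat j j (\<lambda>(a, b). if a = b + i then 1 else 0) :: 'k::semiring_1 mat)"
proof (induction i)
  case (Suc i)
  show ?case
  proof (rule eq_matI)
    fix a b assume "a < dim_row (mat j j (\<lambda>(a, b). if a = b + Suc i then 1 else 0 :: 'k))"
      "b < dim_col (mat j j (\<lambda>(a, b). if a = b + Suc i then 1 else 0 :: 'k))"
    then have ab: "a < j" "b < j" by auto
    have "(shiftm j ^\<^sub>m Suc i) $$ (a, b) =
        (\<Sum>k<j. (mat j j (\<lambda>(a, b). if a = b + i then 1 else 0) :: 'k mat) $$ (a, k) * (if k = Suc b then 1 else 0))"
      using ab unfolding pow_mat.simps Suc by (subst mult_mat_index) (auto simp: shiftm_def intro!: sum.cong)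
    also have "\<dots> = (if a = b + Suc i then 1 else 0)" using ab by (simp only: sum_if_mult) auto
    finally show "(shiftm j ^\<^sub>m Suc i) $$ (a, b) = mat j j (\<lambda>(a, b). if a = b + Suc i then 1 else 0 :: 'k) $$ (a, b)"
      using ab by simp
  qed auto
qed (auto simp: shiftm_def)

lemma shiftm_pow_zero: "j \<le> i \<Longrightarrow> shiftm j ^\<^sub>m i = (0\<^sub>m j j :: 'k::semiring_1 mat)"
  by (subst shiftm_pow) auto

lemma mat_diag_ecol: "t < j \<Longrightarrow> mat_diag j f * ecol j t = f t \<cdot>\<^sub>m (ecol j t :: 'k::field mat)"
  by (rule eq_matI) (auto simp: mult_mat_index mat_diag_index ecol_def sum_if_mult simp del: index_mult_mat(1))

lemma ecol_mat_diag: "t < j \<Longrightarrow> (ecol j t)\<^sup>T * mat_diag j f = f t \<cdot>\<^sub>m (ecol j t :: 'k::field mat)\<^sup>T"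
  by (rule eq_matI) (auto simp: mult_mat_index mat_diag_index ecol_def sum_if_mult simp del: index_mult_mat(1))

lemma shiftm_ecol: "t < j \<Longrightarrow> shiftm j * ecol j t = (if Suc t < j then ecol j (Suc t) else 0\<^sub>m j 1 :: 'k::field mat)"
  by (rule eq_matI) (auto simp: mult_mat_index shiftm_def ecol_def sum_if_mult simp del: index_mult_mat(1))

lemma ecol_shiftm: "t < j \<Longrightarrow> (ecol j t)\<^sup>T * shiftm j = (if t = 0 then 0\<^sub>m 1 j else (ecol j (t - 1) :: 'k::field mat)\<^sup>T)"
  by (rule eq_matI) (auto simp: mult_mat_index shiftm_def ecol_def sum_if_mult simp del: index_mult_mat(1))

lemma ecol_ecol: "s < j \<Longrightarrow> t < j \<Longrightarrow> (ecol j s)\<^sup>T * ecol j t = (if s = t then 1\<^sub>m 1 else 0\<^sub>m 1 1 :: 'k::field mat)"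
  by (rule eq_matI) (auto simp: mult_mat_index ecol_def sum_if_mult simp del: index_mult_mat(1))

text \<open>Inclusion of the layer V \<otimes> e_t into V \<otimes> k^j, where d is the dimension of
  V; \<open>blk_pr\<close> is the projection onto it. Maps to and from \<open>Ind j V\<close> are
  compared layer by layer.\<close>

definition blk_in :: "nat \<Rightarrow> nat \<Rightarrow> nat \<Rightarrow> 'k::field mat"
  where "blk_in d j t = kron (1\<^sub>m d) (ecol j t)"

definition blk_pr :: "nat \<Rightarrow> nat \<Rightarrow> nat \<Rightarrow> 'k::field mat"
  where "blk_pr d j t = kron (1\<^sub>m d) (ecol j t)\<^sup>T"

lemma dim_inj [simp]: "dim_row (blk_in d j t) = d * j" "dim_col (blk_in d j t) = d"
  by (simp_all add: blk_in_def)

lemma dim_prj [simp]: "dim_row (blk_pr d j t) = d" "dim_col (blk_pr d j t) = d * j"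
  by (simp_all add: blk_pr_def)

lemma prj_inj: "s < j \<Longrightarrow> t < j \<Longrightarrow> blk_pr d j s * blk_in d j t = (if s = t then 1\<^sub>m d else 0\<^sub>m d d)"
  by (simp add: blk_in_def blk_pr_def kron_mult ecol_ecol)

lemma inj_index: "r < d * j \<Longrightarrow> v < d \<Longrightarrow> t < j \<Longrightarrow> blk_in d j t $$ (r, v) = (if r = v * j + t then 1 else 0)"
proof -
  assume a: "r < d * j" "v < d" "t < j"
  then have "r div j < d" "r mod j < j" by (auto intro: div_less_of_mult)
  moreover have "r = v * j + t \<longleftrightarrow> r div j = v \<and> r mod j = t"
    using a div_mult_mod_eq[of r j] by auto
  ultimately show ?thesis using a by (auto simp: blk_in_def kron_index ecol_def)
qed

lemma prj_transpose: "blk_pr d j t = (blk_in d j t)\<^sup>T"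
  by (simp add: blk_pr_def blk_in_def kron_transpose)

lemma mult_inj_index:
  assumes "dim_col A = d * j" "r < dim_row A" "v < d" "t < j"
  shows "(A * blk_in d j t) $$ (r, v) = A $$ (r, v * j + t)"
  using assms pair_index_less[of v d t j]
  by (simp add: mult_mat_index inj_index sum_if_mult del: index_mult_mat(1))

lemma prj_mult_index:
  assumes "dim_row A = d * j" "c < dim_col A" "v < d" "t < j"
  shows "(blk_pr d j t * A) $$ (v, c) = A $$ (v * j + t, c)"
  using assms pair_index_less[of v d t j]
  by (simp add: prj_transpose mult_mat_index inj_index sum_if_mult del: index_mult_mat(1))

lemma block_col_eqI:
  assumes "dim_row A = dim_row B" "dim_col A = d * j" "dim_col B = d * j"
    and "\<And>t. t < j \<Longrightarrow> A * blk_in d j t = B * blk_in d j t"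
  shows "A = B"
proof (rule eq_matI)
  fix r c assume rc: "r < dim_row B" "c < dim_col B"
  then have c: "c div j < d" "c mod j < j" using assms(3) by (auto intro: div_less_of_mult mod_less_of_mult)
  have "(A * blk_in d j (c mod j)) $$ (r, c div j) = (B * blk_in d j (c mod j)) $$ (r, c div j)" using assms(4)[OF c(2)] by simp
  then show "A $$ (r, c) = B $$ (r, c)" using rc c assms(1-3) by (simp add: mult_inj_index del: index_mult_mat(1))
qed (use assms in auto)

lemma block_row_eqI:
  assumes "dim_col A = dim_col B" "dim_row A = d * j" "dim_row B = d * j"
    and "\<And>t. t < j \<Longrightarrow> blk_pr d j t * A = blk_pr d j t * B"
  shows "A = B"
proof (rule eq_matI)
  fix r c assume rc: "r < dim_row B" "c < dim_col B"
  then have r: "r div j < d" "r mod j < j" using assms(3) by (auto intro: div_less_of_mult mod_less_of_mult)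
  have "(blk_pr d j (r mod j) * A) $$ (r div j, c) = (blk_pr d j (r mod j) * B) $$ (r div j, c)" using assms(4)[OF r(2)] by simp
  then show "A $$ (r, c) = B $$ (r, c)" using rc r assms(1-3) by (simp add: prj_mult_index del: index_mult_mat(1))
qed (use assms in auto)

lemma sum_inj_prj: "lincomb (d * j) (d * j) {..<j} (\<lambda>_. 1) (\<lambda>t. blk_in d j t * blk_pr d j t) = (1\<^sub>m (d * j) :: 'k::field mat)"
proof (rule block_row_eqI[of _ _ d j])
  fix t assume t: "t < j"
  have "blk_pr d j t * lincomb (d * j) (d * j) {..<j} (\<lambda>_. 1) (\<lambda>t. blk_in d j t * blk_pr d j t) =
      lincomb d (d * j) {..<j} (\<lambda>_. 1) (\<lambda>s. blk_pr d j t * blk_in d j s * (blk_pr d j s :: 'k mat))"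
    by (subst mult_lincomb) (auto simp: mult_assoc_dim)
  also have "\<dots> = blk_pr d j t * blk_in d j t * blk_pr d j t"
    by (rule lincomb_single[of _ t]) (use t in \<open>auto simp: prj_inj\<close>)
  finally show "blk_pr d j t * lincomb (d * j) (d * j) {..<j} (\<lambda>_. 1) (\<lambda>t. blk_in d j t * blk_pr d j t) = blk_pr d j t * (1\<^sub>m (d * j) :: 'k mat)"
    using t by (simp add: prj_inj)
qed auto

context datum
begin

text \<open>The uniserial module with basis \<open>1, y, \<dots>, y\<^bsup>j-1\<^esup>\<close>.\<close>

definition Mj :: "nat \<Rightarrow> (nat \<times> 'g, 'k) rep"
  where "Mj j = mk_rep j (\<lambda>h. mat_diag j (\<lambda>t. inverse (\<chi> h) ^ t)) (shiftm j)"

text \<open>From h y^t = \<chi>(h)^{-t} y^t h, the group acts on the basis vector y^t through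
  \<chi>^{-t}; this dictates the diagonal matrix.\<close>

lemma Mj:
  assumes "j \<le> n"
  shows "Mj j \<in> reps H" "h \<in> carrier G \<Longrightarrow> \<rho> (Mj j) h = mat_diag j (\<lambda>t. inverse (\<chi> h) ^ t)" "Y (Mj j) = shiftm j"
proof -
  have comm: "shiftm j * mat_diag j (\<lambda>t. inverse (\<chi> h) ^ t) = \<chi> h \<cdot>\<^sub>m (mat_diag j (\<lambda>t. inverse (\<chi> h) ^ t) * shiftm j)"
    if "h \<in> carrier G" for h
    using that by (intro eq_matI) (auto simp: mult_mat_index mat_diag_index shiftm_def sum_if_mult field_simps
        simp del: index_mult_mat(1))
  have diag: "mat_diag j ((^) (1 :: 'k)) = 1\<^sub>m j"
    "mat_diag j ((^) (x * y)) = mat_diag j (\<lambda>t. x ^ t * y ^ t)" for x y :: 'k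
    by (rule eq_matI; auto simp: mat_diag_index power_mult_distrib)+
  show "Mj j \<in> reps H" "h \<in> carrier G \<Longrightarrow> \<rho> (Mj j) h = mat_diag j (\<lambda>t. inverse (\<chi> h) ^ t)" "Y (Mj j) = shiftm j"
    unfolding Mj_def
    by (rule mk_rep; use comm assms in \<open>auto simp: shiftm_pow_zero diag\<close>)+
qed

lemma rdim_Mj [simp]: "rdim (Mj j) = j"
  by (simp add: Mj_def)

text \<open>Since y is zero on V, it acts on V \<otimes> M_j as 1 \<otimes> y: this is the module
  induced from V modulo the image of y^j.\<close>

definition Ind :: "nat \<Rightarrow> ('g, 'k) rep \<Rightarrow> (nat \<times> 'g, 'k) rep"
  where "Ind j V = rep_tensor H (infl V) (Mj j)"

lemma rdim_Ind [simp]: "rdim (Ind j V) = rdim V * j"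
  by (simp add: Ind_def)

lemma Ind:
  assumes "V \<in> reps K" "j \<le> n"
  shows "Ind j V \<in> reps H" "h \<in> carrier G \<Longrightarrow> \<rho> (Ind j V) h = kron (rmat V h) (mat_diag j (\<lambda>t. inverse (\<chi> h) ^ t))"
    "Y (Ind j V) = kron (1\<^sub>m (rdim V)) (shiftm j)"
  unfolding Ind_def using assms by (simp_all add: tensor_H infl Mj tensor_Y_def)

lemma \<rho>_Ind_inj: "V \<in> reps K \<Longrightarrow> j \<le> n \<Longrightarrow> h \<in> carrier G \<Longrightarrow> t < j \<Longrightarrow>
    \<rho> (Ind j V) h * blk_in (rdim V) j t = inverse (\<chi> h) ^ t \<cdot>\<^sub>m (blk_in (rdim V) j t * rmat V h)"
proof -
  assume a: "V \<in> reps K" "j \<le> n" "h \<in> carrier G" "t < j"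
  have "blk_in (rdim V) j t * rmat V h = kron (1\<^sub>m (rdim V)) (ecol j t) * kron (rmat V h) (1\<^sub>m (Suc 0))" by (simp add: blk_in_def)
  also have "\<dots> = kron (rmat V h) (ecol j t)" using a by (subst kron_mult) auto
  finally show ?thesis using a by (simp add: Ind blk_in_def kron_mult mat_diag_ecol kron_smult_right)
qed

lemma Y_Ind_inj: "V \<in> reps K \<Longrightarrow> j \<le> n \<Longrightarrow> t < j \<Longrightarrow>
    Y (Ind j V) * blk_in (rdim V) j t = (if Suc t < j then blk_in (rdim V) j (Suc t) else 0\<^sub>m (rdim V * j) (rdim V))"
  by (simp add: Ind blk_in_def kron_mult shiftm_ecol)

lemma prj_\<rho>_Ind: "V \<in> reps K \<Longrightarrow> j \<le> n \<Longrightarrow> h \<in> carrier G \<Longrightarrow> t < j \<Longrightarrow>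
    blk_pr (rdim V) j t * \<rho> (Ind j V) h = inverse (\<chi> h) ^ t \<cdot>\<^sub>m (rmat V h * blk_pr (rdim V) j t)"
proof -
  assume a: "V \<in> reps K" "j \<le> n" "h \<in> carrier G" "t < j"
  have "rmat V h * blk_pr (rdim V) j t = kron (rmat V h) (1\<^sub>m (Suc 0)) * kron (1\<^sub>m (rdim V)) (ecol j t)\<^sup>T" by (simp add: blk_pr_def)
  also have "\<dots> = kron (rmat V h) (ecol j t)\<^sup>T" using a by (subst kron_mult) auto
  finally show ?thesis using a by (simp add: Ind blk_pr_def kron_mult ecol_mat_diag kron_smult_right)
qed

lemma prj_Y_Ind: "V \<in> reps K \<Longrightarrow> j \<le> n \<Longrightarrow> t < j \<Longrightarrow>
    blk_pr (rdim V) j t * Y (Ind j V) = (if t = 0 then 0\<^sub>m (rdim V) (rdim V * j) else blk_pr (rdim V) j (t - 1))"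
  by (simp add: Ind blk_pr_def kron_mult ecol_shiftm)

text \<open>Column (v, t) is y^t f(v): the only possible extension of f from the generating layer t
  = 0 to \<open>Ind j V\<close>.\<close>

definition ext :: "nat \<Rightarrow> (nat \<times> 'g, 'k) rep \<Rightarrow> 'k mat \<Rightarrow> 'k mat"
  where "ext j M f = mat (rdim M) (dim_col f * j) (\<lambda>(r, c). (Y M ^\<^sub>m (c mod j) * f) $$ (r, c div j))"

lemma dim_ext [simp]: "dim_row (ext j M f) = rdim M" "dim_col (ext j M f) = dim_col f * j"
  by (simp_all add: ext_def)

lemma ext_inj:
  assumes "M \<in> reps H" "dim_row f = rdim M" "t < j"
  shows "ext j M f * blk_in (dim_col f) j t = Y M ^\<^sub>m t * f"
proof (rule eq_matI)
  fix r c assume "r < dim_row (Y M ^\<^sub>m t * f)" "c < dim_col (Y M ^\<^sub>m t * f)"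
  then show "(ext j M f * blk_in (dim_col f) j t) $$ (r, c) = (Y M ^\<^sub>m t * f) $$ (r, c)"
    using assms pair_index_less[of c "dim_col f" t j]
    by (simp add: mult_inj_index ext_def del: index_mult_mat(1))
qed (use assms in auto)

text \<open>Frobenius reciprocity: \<open>Ind j V\<close> is generated by \<open>V \<otimes> 1\<close>, subject to \<open>y\<^sup>j = 0\<close>.\<close>

lemma ext_hom:
  assumes V: "V \<in> reps K" and M: "M \<in> reps H" and j: "j \<le> n" and f: "dim_row f = rdim M" "dim_col f = rdim V"
    and fh: "\<And>h. h \<in> carrier G \<Longrightarrow> \<rho> M h * f = f * rmat V h" and fy: "Y M ^\<^sub>m j * f = 0\<^sub>m (rdim M) (rdim V)"
  shows "ext j M f \<in> rep_hom H (Ind j V) M"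
proof (rule rep_homI_H)
  let ?d = "rdim V"
  have [simp]: "Ind j V \<in> reps H" by (rule Ind(1)[OF V j])
  have e: "ext j M f * blk_in ?d j t = Y M ^\<^sub>m t * f" if "t < j" for t using ext_inj[OF M f(1) that] f by simp
  fix h assume h: "h \<in> carrier G"
  show "\<rho> M h * ext j M f = ext j M f * \<rho> (Ind j V) h"
  proof (rule block_col_eqI[of _ _ ?d j])
    fix t assume t: "t < j"
    have "\<rho> M h * ext j M f * blk_in ?d j t = \<rho> M h * Y M ^\<^sub>m t * f" using t M f h by (simp add: mult_assoc_dim e)
    also have "\<dots> = inverse (\<chi> h) ^ t \<cdot>\<^sub>m (Y M ^\<^sub>m t * (f * rmat V h))"
      using M f h V by (simp add: \<rho>_Y_pow smult_mult_dim mult_assoc_dim fh)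
    also have "\<dots> = inverse (\<chi> h) ^ t \<cdot>\<^sub>m (ext j M f * blk_in ?d j t * rmat V h)"
      using M f h V t by (simp add: e mult_assoc_dim)
    also have "\<dots> = ext j M f * \<rho> (Ind j V) h * blk_in ?d j t"
      using M f h V t j by (simp add: mult_assoc_dim \<rho>_Ind_inj mult_smult_dim)
    finally show "\<rho> M h * ext j M f * blk_in ?d j t = ext j M f * \<rho> (Ind j V) h * blk_in ?d j t" .
  qed (use M f h V j in auto)
next
  let ?d = "rdim V"
  have [simp]: "Ind j V \<in> reps H" by (rule Ind(1)[OF V j])
  have e: "ext j M f * blk_in ?d j t = Y M ^\<^sub>m t * f" if "t < j" for t using ext_inj[OF M f(1) that] f by simp
  show "Y M * ext j M f = ext j M f * Y (Ind j V)"
  proof (rule block_col_eqI[of _ _ ?d j])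
    fix t assume t: "t < j"
    have "Y M * ext j M f * blk_in ?d j t = Y M ^\<^sub>m Suc t * f"
      using t M f by (subst pow_mat_Suc_left) (simp_all add: mult_assoc_dim e)
    also have "\<dots> = (if Suc t < j then ext j M f * blk_in ?d j (Suc t) else 0\<^sub>m (rdim M) ?d)"
      using t fy e[of "Suc t"] by (cases "Suc t = j") auto
    also have "\<dots> = ext j M f * Y (Ind j V) * blk_in ?d j t"
      using M f V t j by (simp add: mult_assoc_dim Y_Ind_inj)
    finally show "Y M * ext j M f * blk_in ?d j t = ext j M f * Y (Ind j V) * blk_in ?d j t" .
  qed (use M f V j in auto)
qed (use assms Ind(1) in auto)

definition res :: "(nat \<times> 'g, 'k) rep \<Rightarrow> ('g, 'k) rep"
  where "res M = mk_K (rdim M) (\<rho> M)"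

lemma res: "M \<in> reps H \<Longrightarrow> res M \<in> reps K"
  unfolding res_def by (rule mk_K) (auto simp: \<rho>_mult)

lemma res_simps [simp]: "rdim (res M) = rdim M" "h \<in> carrier G \<Longrightarrow> rmat (res M) h = \<rho> M h"
  by (simp_all add: res_def)

text \<open>Because y h = \<chi>(h) h y, the operator y^k is G-linear only as a map from M to this
  twist of M.\<close>

definition twist :: "nat \<Rightarrow> ('g, 'k) rep \<Rightarrow> ('g, 'k) rep"
  where "twist k V = mk_K (rdim V) (\<lambda>h. \<chi> h ^ k \<cdot>\<^sub>m rmat V h)"

lemma twist: "V \<in> reps K \<Longrightarrow> twist k V \<in> reps K"
  unfolding twist_def
  by (rule mk_K) (auto simp: K_mult smult_mult_dim mult_smult_dim smult_smult_mat power_mult_distrib mult.commute)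

lemma twist_simps [simp]: "rdim (twist k V) = rdim V" "h \<in> carrier G \<Longrightarrow> rmat (twist k V) h = \<chi> h ^ k \<cdot>\<^sub>m rmat V h"
  by (simp_all add: twist_def)

lemma Y_pow_hom: "M \<in> reps H \<Longrightarrow> Y M ^\<^sub>m k \<in> rep_hom K (res M) (twist k (res M))"
  by (rule rep_homI) (auto simp: smult_mult_dim \<rho>_Y_pow smult_smult_mat simp flip: power_mult_distrib)

subsection \<open>Characters of the images of the powers of \<open>y\<close>\<close>

text \<open>\<open>X T\<close> projects along the kernel of \<open>T\<close>, so \<open>tch M i\<close> is the character of \<open>M / ker y\<^sup>i\<close>.\<close>

definition ginv :: "'k mat \<Rightarrow> 'k mat"
  where "ginv T = (SOME X. T * X * T = T \<and> dim_row X = dim_col T \<and> dim_col X = dim_row T)"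

lemma ginv: "T * ginv T * T = T" "dim_row (ginv T) = dim_col T" "dim_col (ginv T) = dim_row T"
proof -
  obtain C D C' D' r where CD: "T = C * D" "C' * C = 1\<^sub>m r" "D * D' = 1\<^sub>m r"
    and dims: "dim_row C = dim_row T" "dim_col C = r" "dim_row D = r" "dim_col D = dim_col T"
    "dim_row C' = r" "dim_col C' = dim_row T" "dim_row D' = dim_col T" "dim_col D' = r"
    by (rule rank_factorization[of T])
  have "(C * D) * (D' * C') * (C * D) = C * D"
    by (simp add: mult_assoc_dim dims mult_cancel_left[OF CD(2)] mult_cancel_left[OF CD(3)])
  then have "T * (D' * C') * T = T" by (simp only: CD(1)[symmetric])
  then have "\<exists>X. T * X * T = T \<and> dim_row X = dim_col T \<and> dim_col X = dim_row T"
    using dims by (intro exI[of _ "D' * C'"]) simp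
  from someI_ex[OF this] show "T * ginv T * T = T" "dim_row (ginv T) = dim_col T" "dim_col (ginv T) = dim_row T"
    unfolding ginv_def by auto
qed

definition tch :: "(nat \<times> 'g, 'k) rep \<Rightarrow> nat \<Rightarrow> 'g \<Rightarrow> 'k"
  where "tch M i h = tr (\<rho> M h * (ginv (Y M ^\<^sub>m i) * Y M ^\<^sub>m i))"

text \<open>The kernel of T = y^i is stable under h, which commutes with T up to a scalar, so the
  trace is that of h on the quotient by this kernel. In the computation the scalars \<chi>(h)^i and
  \<chi>(h)^{-i} cancel.\<close>

lemma tch_eq:
  assumes M: "M \<in> reps H" and h: "h \<in> carrier G"
    and X: "Y M ^\<^sub>m i * X * Y M ^\<^sub>m i = Y M ^\<^sub>m i" "dim_row X = rdim M" "dim_col X = rdim M"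
  shows "tch M i h = tr (\<rho> M h * (X * Y M ^\<^sub>m i))"
proof -
  let ?T = "Y M ^\<^sub>m i" and ?r = "\<rho> M h" and ?c = "inverse (\<chi> h) ^ i"
  have key: "tr (?r * (X * ?T)) = tr (?r * (Z * ?T))"
    if X: "?T * X * ?T = ?T" "dim_row X = rdim M" "dim_col X = rdim M"
    and Z: "?T * Z * ?T = ?T" "dim_row Z = rdim M" "dim_col Z = rdim M" for X Z
  proof -
    note [simp] = X(2,3) Z(2,3)
    have rT: "?r * ?T = ?c \<cdot>\<^sub>m (?T * ?r)" by (rule \<rho>_Y_pow[OF M h])
    have "tr (?r * (X * ?T)) = tr (?r * (X * (?T * Z * ?T)))" by (simp only: Z(1))
    also have "\<dots> = tr ((?r * X * ?T) * (Z * ?T))" using M h by (simp add: mult_assoc_dim)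
    also have "\<dots> = tr ((Z * ?T) * (?r * X * ?T))" using M h by (intro tr_mult_comm) auto
    also have "(Z * ?T) * (?r * X * ?T) = Z * ((?T * ?r) * (X * ?T))" using M h by (simp add: mult_assoc_dim)
    also have "?T * ?r = \<chi> h ^ i \<cdot>\<^sub>m (?r * ?T)"
      using h by (simp add: rT smult_smult_mat flip: power_mult_distrib)
    also have "Z * (\<chi> h ^ i \<cdot>\<^sub>m (?r * ?T) * (X * ?T)) = \<chi> h ^ i \<cdot>\<^sub>m (Z * (?r * (?T * X * ?T)))"
      using M h by (simp add: smult_mult_dim mult_smult_dim mult_assoc_dim)
    also have "\<dots> = Z * (?T * ?r)"
      using M h by (simp add: X(1) rT mult_smult_dim smult_smult_mat flip: power_mult_distrib)
    also have "tr (Z * (?T * ?r)) = tr ((Z * ?T) * ?r)" using M h by (simp add: mult_assoc_dim)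
    also have "\<dots> = tr (?r * (Z * ?T))" using M h by (intro tr_mult_comm) auto
    finally show ?thesis .
  qed
  show ?thesis unfolding tch_def
    by (rule key) (use ginv[of ?T] X M in auto)
qed

lemma tch_iso:
  assumes MN: "M \<in> reps H" "N \<in> reps H" "rep_iso H M N" and h: "h \<in> carrier G"
  shows "tch M i h = tch N i h"
proof -
  obtain f e where fe: "f \<in> rep_hom H M N" "e \<in> rep_hom H N M" "e * f = 1\<^sub>m (rdim M)" "f * e = 1\<^sub>m (rdim N)"
    using MN by (auto simp: rep_iso_def)
  note [simp] = rep_hom_dim[OF fe(1)] rep_hom_dim[OF fe(2)]
  let ?S = "Y M ^\<^sub>m i" and ?T = "Y N ^\<^sub>m i"
  let ?X = "ginv ?S"
  have dX [simp]: "dim_row ?X = rdim M" "dim_col ?X = rdim M" using ginv[of ?S] MN by auto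
  have Tf: "?T * f = f * ?S" by (rule rep_homD_H(3)[OF MN(1,2) fe(1)])
  have eT: "?S * e = e * ?T" by (rule rep_homD_H(3)[OF MN(2,1) fe(2)])
  have "?T * (f * ?X * e) * ?T = (?T * f) * ?X * (e * ?T)" using MN by (simp add: mult_assoc_dim)
  also have "\<dots> = f * (?S * ?X * ?S) * e" using MN by (simp add: Tf eT[symmetric] mult_assoc_dim)
  also have "\<dots> = (f * ?S) * e" by (simp only: ginv)
  also have "\<dots> = ?T" using MN by (simp add: Tf[symmetric] mult_assoc_dim fe)
  finally have "tch N i h = tr (\<rho> N h * (f * ?X * e * ?T))"
    by (intro tch_eq MN h) simp_all
  also have "\<rho> N h * (f * ?X * e * ?T) = (\<rho> N h * f) * (?X * (e * ?T))" using MN h by (simp add: mult_assoc_dim)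
  also have "\<dots> = f * (\<rho> M h * (?X * (?S * e)))"
    using MN h by (simp add: rep_homD_H(1)[OF MN(1,2) fe(1)] eT[symmetric] mult_assoc_dim)
  also have "tr \<dots> = tr (\<rho> M h * (?X * (?S * e)) * f)" using MN h by (intro tr_mult_comm) auto
  also have "\<rho> M h * (?X * (?S * e)) * f = \<rho> M h * (?X * ?S)" using MN h by (simp add: mult_assoc_dim fe)
  finally show ?thesis by (simp add: tch_def)
qed

lemma tch_sum:
  assumes MN: "M \<in> reps H" "N \<in> reps H" and h: "h \<in> carrier G"
  shows "tch (rep_sum H M N) i h = tch M i h + tch N i h"
proof -
  let ?S = "Y M ^\<^sub>m i" and ?T = "Y N ^\<^sub>m i"
  have d [simp]: "dim_row (ginv ?S) = rdim M" "dim_col (ginv ?S) = rdim M" "dim_row (ginv ?T) = rdim N" "dim_col (ginv ?T) = rdim N"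
    using ginv[of ?S] ginv[of ?T] MN by auto
  have pow: "Y (rep_sum H M N) ^\<^sub>m i = bdiag ?S ?T" using MN by (simp add: sum_H bdiag_pow)
  have eq: "tch (rep_sum H M N) i h = tr (\<rho> (rep_sum H M N) h * (bdiag (ginv ?S) (ginv ?T) * Y (rep_sum H M N) ^\<^sub>m i))"
    using MN h by (intro tch_eq rep_sum_rep) (auto simp: pow bdiag_mult ginv)
  show ?thesis unfolding eq pow using MN h by (simp add: sum_H bdiag_mult tr_bdiag tch_def)
qed

text \<open>The transpose of the power S of the shift is a generalized inverse: S^T S projects onto
  the layers t < j - i, those not killed by y^i.\<close>

lemma tch_Ind:
  assumes V: "V \<in> reps K" and j: "j \<le> n" and h: "h \<in> carrier G"
  shows "tch (Ind j V) i h = ch V h * (\<Sum>t<j - i. inverse (\<chi> h) ^ t)"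
proof -
  let ?d = "rdim V" and ?S = "shiftm j ^\<^sub>m i :: 'k mat"
  define L where "L = mat_diag j (\<lambda>t. if t < j - i then 1 else 0 :: 'k)"
  have [simp]: "dim_row L = j" "dim_col L = j" by (simp_all add: L_def)
  have SS: "?S\<^sup>T * ?S = L"
  proof (rule eq_matI)
    fix a b assume "a < dim_row L" "b < dim_col L"
    then have ab: "a < j" "b < j" by (auto simp: L_def)
    have "(?S\<^sup>T * ?S) $$ (a, b) = (\<Sum>k<j. (if k = a + i then 1 else 0) * (if k = b + i then 1 else 0))"
      using ab by (subst mult_mat_index) (auto simp: shiftm_pow intro!: sum.cong)
    also have "\<dots> = L $$ (a, b)" using ab by (simp only: sum_if_mult) (auto simp: L_def mat_diag_index)
    finally show "(?S\<^sup>T * ?S) $$ (a, b) = L $$ (a, b)" .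
  qed (auto simp: L_def)
  have SL: "?S * L = ?S"
    by (rule eq_matI) (auto simp: shiftm_pow L_def mult_mat_index mat_diag_index sum_if_mult simp del: index_mult_mat(1))
  have pow: "Y (Ind j V) ^\<^sub>m i = kron (1\<^sub>m ?d) ?S"
    using V j by (simp add: Ind kron_pow one_pow_mat)
  have "tch (Ind j V) i h = tr (\<rho> (Ind j V) h * (kron (1\<^sub>m ?d) ?S\<^sup>T * Y (Ind j V) ^\<^sub>m i))"
    using V j h by (intro tch_eq Ind) (simp_all add: pow kron_mult mult_assoc_dim SS SL)
  also have "\<dots> = ch V h * tr (mat_diag j (\<lambda>t. inverse (\<chi> h) ^ t) * L)"
    using V j h unfolding pow by (simp add: kron_mult SS Ind tr_kron ch_def)
  also have "tr (mat_diag j (\<lambda>t. inverse (\<chi> h) ^ t) * L) = (\<Sum>t<j. if t < j - i then inverse (\<chi> h) ^ t else 0)"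
    unfolding L_def mat_diag_diag by (auto simp: tr_def mat_diag_index intro!: sum.cong)
  also have "\<dots> = (\<Sum>t\<in>{..<j} \<inter> {t. t < j - i}. inverse (\<chi> h) ^ t)" by (simp add: sum.inter_restrict)
  also have "{..<j} \<inter> {t. t < j - i} = {..<j - i}" by auto
  finally show ?thesis .
qed

text \<open>\<open>ginv T * T\<close> is an idempotent with the kernel of T, and its trace is its
  rank.\<close>

lemma tch_zero_iff:
  assumes M: "M \<in> reps H"
  shows "tch M i \<one> = 0 \<longleftrightarrow> Y M ^\<^sub>m i = 0\<^sub>m (rdim M) (rdim M)"
proof
  let ?T = "Y M ^\<^sub>m i"
  have d [simp]: "dim_row (ginv ?T) = rdim M" "dim_col (ginv ?T) = rdim M" using ginv[of ?T] M by auto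
  { assume "tch M i \<one> = 0"
    then have "tr (ginv ?T * ?T) = 0" using M by (simp add: tch_def)
    moreover have "(ginv ?T * ?T) * (ginv ?T * ?T) = ginv ?T * (?T * ginv ?T * ?T)" using M by (simp add: mult_assoc_dim)
    then have "(ginv ?T * ?T) * (ginv ?T * ?T) = ginv ?T * ?T" by (simp only: ginv)
    ultimately have "ginv ?T * ?T = 0\<^sub>m (rdim M) (rdim M)"
      using idempotent_trace_nonzero[of "ginv ?T * ?T"] M by simp
    then have "?T * (ginv ?T * ?T) = 0\<^sub>m (rdim M) (rdim M)" using M by simp
    then show "?T = 0\<^sub>m (rdim M) (rdim M)" using ginv(1)[of ?T] M by (simp add: mult_assoc_dim) }
  { assume T: "?T = 0\<^sub>m (rdim M) (rdim M)"
    have "ginv ?T * ?T = 0\<^sub>m (rdim M) (rdim M)" by (subst (2) T) simp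
    then show "tch M i \<one> = 0" using M by (simp add: tch_def) }
qed

lemma tch_0: "M \<in> reps H \<Longrightarrow> tch M 0 \<one> = of_nat (rdim M)"
  using tch_eq[of M \<one> 0 "1\<^sub>m (rdim M)"] by simp

text \<open>Let V be the image of y^{r-1}. A G-linear section s of M \<rightarrow> V generates an
  image of V \<otimes> M_r in M, and a retraction p onto V gives a map B back. The composite is
  block triangular with identity diagonal, so V \<otimes> M_r is a direct summand.\<close>

lemma peel:
  assumes M: "M \<in> reps H" and r: "0 < r" "r \<le> n" "Y M ^\<^sub>m r = 0\<^sub>m (rdim M) (rdim M)"
  obtains V N where "V \<in> reps K" "N \<in> reps H" "rep_iso H M (rep_sum H (Ind r V) N)"
    "\<And>h. h \<in> carrier G \<Longrightarrow> ch V h = tch M (r - 1) h"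
proof -
  let ?k = "r - 1" and ?m = "rdim M"
  obtain V C D C' D' where V: "V \<in> reps K" "C \<in> rep_hom K V (twist ?k (res M))" "D \<in> rep_hom K (res M) V" "Y M ^\<^sub>m ?k = C * D"
      "C' * C = 1\<^sub>m (rdim V)" "D * D' = 1\<^sub>m (rdim V)"
      "dim_row C' = rdim V" "dim_col C' = rdim (twist ?k (res M))" "dim_row D' = rdim (res M)" "dim_col D' = rdim V"
      "\<And>h. h \<in> carrier G \<Longrightarrow> rmat V h = D * rmat (res M) h * D'"
    by (rule K_image[OF res[OF M] twist[OF res[OF M]] Y_pow_hom[OF M]]) blast
  note [simp] = rep_hom_dim[OF V(2)] rep_hom_dim[OF V(3)] V(7-10)
  let ?d = "rdim V"
  obtain s where s: "s \<in> rep_hom K V (res M)" "D * s = 1\<^sub>m ?d"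
    using maschke_section[OF res[OF M] V(1,3,6,9,10)] by blast
  obtain p where p: "p \<in> rep_hom K (twist ?k (res M)) V" "p * C = 1\<^sub>m ?d"
    using maschke_retraction[OF V(1) twist[OF res[OF M]] V(2,5,7,8)] by blast
  note [simp] = rep_hom_dim[OF s(1)] rep_hom_dim[OF p(1)]
  have zero: "Y M ^\<^sub>m i = 0\<^sub>m ?m ?m" if "r \<le> i" for i using pow_mat_zero_mono[of "Y M" r i] M r that by simp
  have A: "ext r M s \<in> rep_hom H (Ind r V) M"
    by (rule ext_hom[OF V(1) M r(2)]) (use M rep_homD[OF s(1)] r(3) in auto)
  note [simp] = rep_hom_dim[OF A] Ind(1)[OF V(1) r(2)]
  have ph: "p * \<rho> M h = inverse (\<chi> h) ^ ?k \<cdot>\<^sub>m (rmat V h * p)" if h: "h \<in> carrier G" for h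
  proof -
    have "rmat V h * p = \<chi> h ^ ?k \<cdot>\<^sub>m (p * \<rho> M h)" using rep_homD[OF p(1), of h] h M by (simp add: mult_smult_dim)
    then show ?thesis using h by (simp add: smult_smult_mat flip: power_mult_distrib)
  qed
  \<comment> \<open>The component in layer t is read off after applying y^{r-1-t}, which moves that
    layer to the last one.\<close>
  define B where "B = mat (?d * r) ?m (\<lambda>(i, c). (p * Y M ^\<^sub>m (?k - i mod r)) $$ (i div r, c))"
  have [simp]: "dim_row B = ?d * r" "dim_col B = ?m" by (auto simp: B_def)
  have pB: "blk_pr ?d r t * B = p * Y M ^\<^sub>m (?k - t)" if t: "t < r" for t
  proof (rule eq_matI)
    fix a c assume "a < dim_row (p * Y M ^\<^sub>m (?k - t))" "c < dim_col (p * Y M ^\<^sub>m (?k - t))"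
    then have ac: "a < ?d" "c < ?m" using M by (auto split: if_splits)
    then show "(blk_pr ?d r t * B) $$ (a, c) = (p * Y M ^\<^sub>m (?k - t)) $$ (a, c)"
      using t pair_index_less[of a ?d t r] by (subst prj_mult_index) (auto simp: B_def simp del: index_mult_mat(1))
  qed (use M in auto)
  have B: "B \<in> rep_hom H M (Ind r V)"
  proof (rule rep_homI_H)
    fix h assume h: "h \<in> carrier G"
    show "\<rho> (Ind r V) h * B = B * \<rho> M h"
    proof (rule block_row_eqI[of _ _ ?d r])
      fix t assume t: "t < r"
      have "blk_pr ?d r t * (\<rho> (Ind r V) h * B) = (blk_pr ?d r t * \<rho> (Ind r V) h) * B" using M h by (simp add: mult_assoc_dim)
      also have "\<dots> = inverse (\<chi> h) ^ t \<cdot>\<^sub>m (rmat V h * (p * Y M ^\<^sub>m (?k - t)))"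
        using V(1) r h t M by (simp add: prj_\<rho>_Ind smult_mult_dim mult_assoc_dim pB)
      also have "\<dots> = (inverse (\<chi> h) ^ t * \<chi> h ^ ?k) \<cdot>\<^sub>m (p * (\<rho> M h * Y M ^\<^sub>m (?k - t)))"
      proof -
        have "rmat V h * p = \<chi> h ^ ?k \<cdot>\<^sub>m (p * \<rho> M h)" using ph[OF h] h by (simp add: smult_smult_mat flip: power_mult_distrib)
        then have "rmat V h * (p * Y M ^\<^sub>m (?k - t)) = \<chi> h ^ ?k \<cdot>\<^sub>m (p * (\<rho> M h * Y M ^\<^sub>m (?k - t)))"
          using V(1) M h by (subst mult_assoc_dim[symmetric]) (auto simp: smult_mult_dim mult_assoc_dim)
        then show ?thesis by (simp add: smult_smult_mat)
      qed
      also have "\<dots> = (inverse (\<chi> h) ^ t * \<chi> h ^ ?k * inverse (\<chi> h) ^ (?k - t)) \<cdot>\<^sub>m (p * (Y M ^\<^sub>m (?k - t) * \<rho> M h))"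
        using M h by (simp add: \<rho>_Y_pow mult_smult_dim smult_smult_mat)
      also have "inverse (\<chi> h) ^ t * \<chi> h ^ ?k * inverse (\<chi> h) ^ (?k - t) = 1"
      proof -
        have "inverse (\<chi> h) ^ t * inverse (\<chi> h) ^ (?k - t) = inverse (\<chi> h) ^ ?k" using t by (simp flip: power_add)
        then have "inverse (\<chi> h) ^ t * \<chi> h ^ ?k * inverse (\<chi> h) ^ (?k - t) = inverse (\<chi> h) ^ ?k * \<chi> h ^ ?k"
          by (simp add: ac_simps)
        then show ?thesis using h by (simp flip: power_mult_distrib)
      qed
      also have "1 \<cdot>\<^sub>m (p * (Y M ^\<^sub>m (?k - t) * \<rho> M h)) = blk_pr ?d r t * (B * \<rho> M h)"
        using M h t by (simp add: pB mult_assoc_dim flip: mult_assoc_dim[of "blk_pr ?d r t" B])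
      finally show "blk_pr ?d r t * (\<rho> (Ind r V) h * B) = blk_pr ?d r t * (B * \<rho> M h)" .
    qed (use M h in auto)
  next
    show "Y (Ind r V) * B = B * Y M"
    proof (rule block_row_eqI[of _ _ ?d r])
      fix t assume t: "t < r"
      have "blk_pr ?d r t * (Y (Ind r V) * B) = (blk_pr ?d r t * Y (Ind r V)) * B" using M by (simp add: mult_assoc_dim)
      also have "\<dots> = (if t = 0 then 0\<^sub>m ?d ?m else p * Y M ^\<^sub>m (?k - (t - 1)))"
        using V(1) r t by (simp add: prj_Y_Ind pB)
      also have "\<dots> = p * (Y M ^\<^sub>m (?k - t) * Y M)"
      proof (cases "t = 0")
        case True
        have "Y M ^\<^sub>m ?k * Y M = 0\<^sub>m ?m ?m" using zero[of "Suc ?k"] by simp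
        then show ?thesis using True by simp
      next
        case False
        then have "?k - (t - 1) = Suc (?k - t)" using t by simp
        then show ?thesis using False by simp
      qed
      also have "\<dots> = blk_pr ?d r t * (B * Y M)"
        using M t by (simp add: pB mult_assoc_dim flip: mult_assoc_dim[of "blk_pr ?d r t" B])
      finally show "blk_pr ?d r t * (Y (Ind r V) * B) = blk_pr ?d r t * (B * Y M)" .
    qed (use M in auto)
  qed (use M in auto)
  have BA_hom: "B * ext r M s \<in> rep_hom H (Ind r V) (Ind r V)"
    by (rule rep_hom_comp[OF Ind(1)[OF V(1) r(2)] M Ind(1)[OF V(1) r(2)] A B])
  note dBA [simp] = rep_hom_dim[OF BA_hom]
  \<comment> \<open>The block (t, u) contains y^{r-1-t+u}: it vanishes for u > t and is p C D s = 1
    for u = t.\<close>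
  have BA: "blk_pr ?d r t * (B * ext r M s) * blk_in ?d r u = p * (Y M ^\<^sub>m (?k - t + u) * s)" if "t < r" "u < r" for t u
  proof -
    have "blk_pr ?d r t * (B * ext r M s) * blk_in ?d r u = (blk_pr ?d r t * B) * (ext r M s * blk_in ?d r u)"
      using M by (simp add: mult_assoc_dim)
    also have "\<dots> = p * Y M ^\<^sub>m (?k - t) * (Y M ^\<^sub>m u * s)" using that M ext_inj[OF M, of s u r] by (simp add: pB)
    finally show ?thesis using M by (simp add: pow_mat_add mult_assoc_dim)
  qed
  obtain L where L: "L * (B * ext r M s) = 1\<^sub>m (dim_col (B * ext r M s))" "dim_row L = dim_col (B * ext r M s)" "dim_col L = dim_row (B * ext r M s)"
  proof (rule trivial_kernel_left_inverse[of "B * ext r M s"])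
    fix Z assume Z: "dim_row Z = dim_col (B * ext r M s)" "dim_col Z = dim_col (B * ext r M s)"
      "B * ext r M s * Z = 0\<^sub>m (dim_row (B * ext r M s)) (dim_col (B * ext r M s))"
    have [simp]: "dim_row Z = ?d * r" "dim_col Z = ?d * r" using Z by auto
    \<comment> \<open>Forward substitution: the layers of Z are shown to vanish one after
      another.\<close>
    have pZ: "blk_pr ?d r t * Z = 0\<^sub>m ?d (?d * r)" if "t < r" for t
      using that
    proof (induction t rule: less_induct)
      case (less t)
      let ?P = "blk_pr ?d r t * (B * ext r M s)"
      have "0\<^sub>m ?d (?d * r) = blk_pr ?d r t * (B * ext r M s * Z)" by (subst Z(3)) simp
      also have "\<dots> = ?P * (lincomb (?d * r) (?d * r) {..<r} (\<lambda>_. 1) (\<lambda>u. blk_in ?d r u * blk_pr ?d r u) * Z)"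
        by (simp add: sum_inj_prj mult_assoc_dim)
      also have "\<dots> = lincomb ?d (?d * r) {..<r} (\<lambda>_. 1) (\<lambda>u. ?P * blk_in ?d r u * (blk_pr ?d r u * Z))"
        by (subst lincomb_mult, simp, simp, subst mult_lincomb) (auto simp: mult_assoc_dim)
      also have "\<dots> = ?P * blk_in ?d r t * (blk_pr ?d r t * Z)"
      proof (rule lincomb_single)
        fix u assume u: "u \<in> {..<r}" "u \<noteq> t"
        show "?P * blk_in ?d r u * (blk_pr ?d r u * Z) = 0\<^sub>m ?d (?d * r)"
        proof (cases "u < t")
          case True
          then show ?thesis using less by simp
        next
          case False
          then have "Y M ^\<^sub>m (?k - t + u) = 0\<^sub>m ?m ?m" using u less.prems by (intro zero) simp
          then have "?P * blk_in ?d r u = 0\<^sub>m ?d ?d" using BA[of t u] u less.prems by simp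
          then show ?thesis by simp
        qed
      qed (use less.prems in auto)
      also have "?P * blk_in ?d r t = 1\<^sub>m ?d"
        using BA[OF less.prems less.prems] less.prems M
        by (simp add: V(4)[simplified] mult_assoc_dim s(2) mult_cancel_left[OF p(2)] p(2))
      finally show ?case by simp
    qed
    have "Z = 0\<^sub>m (?d * r) (?d * r)" by (rule block_row_eqI[of _ _ ?d r]) (auto simp: pZ)
    then show "Z = 0\<^sub>m (dim_col (B * ext r M s)) (dim_col (B * ext r M s))" by simp
  qed (rule that)
  have dL [simp]: "dim_row L = ?d * r" "dim_col L = ?d * r" using L by auto
  have L1: "L * (B * ext r M s) = 1\<^sub>m (?d * r)" using L(1) by simp
  have L_hom: "L \<in> rep_hom H (Ind r V) (Ind r V)"
    by (rule rep_hom_inverse[OF _ _ BA_hom]) (use square_inverse_comm[OF L1] L1 in auto)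
  have "L * B * ext r M s = 1\<^sub>m (rdim (Ind r V))" using L1 M by (simp add: mult_assoc_dim)
  moreover have "L * B \<in> rep_hom H M (Ind r V)" using M B L_hom by (intro rep_hom_comp[of M H "Ind r V"]) auto
  ultimately obtain N where N: "N \<in> reps H" "rep_iso H M (rep_sum H (Ind r V) N)"
    using rep_split[OF M _ A] by auto
  have "ch V h = tch M ?k h" if h: "h \<in> carrier G" for h
  proof -
    let ?T = "Y M ^\<^sub>m ?k"
    have T: "Y M ^\<^sub>m (r - Suc 0) = C * D" using V(4) by simp
    \<comment> \<open>\<open>D' * C'\<close> is a generalized inverse of y^{r-1} = C D.\<close>
    have "tch M ?k h = tr (\<rho> M h * (D' * C' * ?T))"
      using M h by (intro tch_eq) (simp_all add: T mult_assoc_dim mult_cancel_left[OF V(5)] mult_cancel_left[OF V(6)])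
    also have "\<rho> M h * (D' * C' * ?T) = \<rho> M h * D' * D"
      using M h by (simp add: T mult_assoc_dim mult_cancel_left[OF V(5)])
    also have "tr \<dots> = tr (D * (\<rho> M h * D'))" using M h by (subst tr_mult_comm) auto
    also have "\<dots> = ch V h" using M h by (simp add: ch_def V(11) mult_assoc_dim)
    finally show ?thesis by simp
  qed
  then show ?thesis by (rule that[OF V(1) N])
qed

text \<open>The value at 1 is the rank of y^i, so both modules have the same nilpotency degree r. By
  \<open>peel\<close> both have a summand V \<otimes> M_r with the same character of V; removing it
  subtracts equal functions, and induction on the dimension applies.\<close>

lemma H_iso_of_tch:
  assumes "M \<in> reps H" "N \<in> reps H" "\<And>i h. h \<in> carrier G \<Longrightarrow> tch M i h = tch N i h"
  shows "rep_iso H M N"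
  using assms
proof (induction "rdim M" arbitrary: M N rule: less_induct)
  case less
  note M = less(2) and N = less(3) and tch = less(4)
  have dim: "rdim M = rdim N" using tch[of \<one> 0] M N by (simp add: tch_0)
  show ?case
  proof (cases "rdim M = 0")
    case True
    then have "M = N" using M N dim rep_dim0_eq[of M H] rep_dim0_eq[of N H] by simp
    then show ?thesis using M rep_iso_refl by simp
  next
    case False
    define r where "r = (LEAST r. Y M ^\<^sub>m r = 0\<^sub>m (rdim M) (rdim M))"
    have r: "Y M ^\<^sub>m r = 0\<^sub>m (rdim M) (rdim M)" unfolding r_def by (rule LeastI[of _ n]) (rule Y_pow_n[OF M])
    have rn: "r \<le> n" unfolding r_def by (rule Least_le) (rule Y_pow_n[OF M])
    have r0: "0 < r"
    proof (rule ccontr)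
      assume "\<not> 0 < r"
      then have "tch M 0 \<one> = 0" using tch_zero_iff[OF M, of r] r by simp
      then show False using False by (simp add: tch_0 M)
    qed
    have rN: "Y N ^\<^sub>m r = 0\<^sub>m (rdim N) (rdim N)"
      using tch_zero_iff[OF M, of r] tch_zero_iff[OF N, of r] tch[of \<one> r] r by simp
    have "Y M ^\<^sub>m (r - 1) \<noteq> 0\<^sub>m (rdim M) (rdim M)"
      using not_less_Least[of "r - 1" "\<lambda>r. Y M ^\<^sub>m r = 0\<^sub>m (rdim M) (rdim M)"] r0 unfolding r_def by auto
    then have tnz: "tch M (r - 1) \<one> \<noteq> 0" using tch_zero_iff[OF M] by simp
    obtain V M' where V: "V \<in> reps K" "M' \<in> reps H" "rep_iso H M (rep_sum H (Ind r V) M')"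
      "\<And>h. h \<in> carrier G \<Longrightarrow> ch V h = tch M (r - 1) h" by (rule peel[OF M r0 rn r]) blast
    obtain W N' where W: "W \<in> reps K" "N' \<in> reps H" "rep_iso H N (rep_sum H (Ind r W) N')"
      "\<And>h. h \<in> carrier G \<Longrightarrow> ch W h = tch N (r - 1) h" by (rule peel[OF N r0 rn rN]) blast
    have chVW: "ch V h = ch W h" if "h \<in> carrier G" for h using V(4) W(4) tch that by simp
    have VW: "rep_iso K V W" by (rule K_iso_of_ch[OF V(1) W(1) chVW])
    note I = Ind(1)[OF V(1) rn] Ind(1)[OF W(1) rn]
    have iI: "rep_iso H (Ind r V) (Ind r W)"
      unfolding Ind_def using V W VW rn by (intro rep_iso_tensor_cong infl_iso rep_iso_refl infl(1) Mj(1))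
    have "tch M' i h = tch N' i h" if h: "h \<in> carrier G" for i h
      using tch[OF h, of i] tch_iso[OF M rep_sum_rep[OF I(1) V(2)] V(3) h, of i] tch_iso[OF N rep_sum_rep[OF I(2) W(2)] W(3) h, of i]
        tch_sum[OF I(1) V(2) h, of i] tch_sum[OF I(2) W(2) h, of i] tch_Ind[OF V(1) rn h, of i] tch_Ind[OF W(1) rn h, of i] chVW[OF h]
      by simp
    moreover have "rdim M' < rdim M"
    proof -
      have "of_nat (rdim V) \<noteq> (0 :: 'k)" using V(1) V(4)[of \<one>] tnz by simp
      then have "rdim V > 0" by (cases "rdim V = 0") simp_all
      then show ?thesis using rep_iso_dim[OF V(3)] r0 by simp
    qed
    ultimately have "rep_iso H M' N'" using less(1) V(2) W(2) by blast
    then have "rep_iso H (rep_sum H (Ind r V) M') (rep_sum H (Ind r W) N')"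
      by (rule rep_iso_sum_cong[OF I(1) V(2) I(2) W(2) iI])
    then have "rep_iso H M (rep_sum H (Ind r W) N')"
      by (rule rep_iso_trans[OF M rep_sum_rep[OF I(1) V(2)] rep_sum_rep[OF I(2) W(2)] V(3)])
    then show ?thesis
      by (rule rep_iso_trans[OF M rep_sum_rep[OF I(2) W(2)] N _ rep_iso_sym[OF W(3)]])
  qed
qed

end

section \<open>Tensor products with uniserial and with regular modules\<close>

lemma shiftm_ecol': "shiftm j * ecol j t = (ecol j (Suc t) :: 'k::field mat)"
  by (rule eq_matI) (auto simp: mult_mat_index shiftm_def ecol_def sum_if_mult simp del: index_mult_mat(1))

lemma mat_diag_ecol': "mat_diag j f * ecol j t = f t \<cdot>\<^sub>m (ecol j t :: 'k::field mat)"
  by (rule eq_matI) (auto simp: mult_mat_index mat_diag_index ecol_def sum_if_mult simp del: index_mult_mat(1))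

lemma ecol_ge: "j \<le> t \<Longrightarrow> ecol j t = 0\<^sub>m j (Suc 0)"
  by (rule eq_matI) (auto simp: ecol_def)

lemma kron_ecol: "s < m \<Longrightarrow> t < d \<Longrightarrow> kron (ecol m s) (ecol d t) = (ecol (m * d) (s * d + t) :: 'k::field mat)"
proof (rule eq_matI)
  fix a b assume st: "s < m" "t < d" and "a < dim_row (ecol (m * d) (s * d + t) :: 'k mat)" "b < dim_col (ecol (m * d) (s * d + t) :: 'k mat)"
  then have ab: "a < m * d" "b = 0" by auto
  then have "a div d < m" "a mod d < d" by (auto intro: div_less_of_mult mod_less_of_mult)
  moreover have "a = s * d + t \<longleftrightarrow> a div d = s \<and> a mod d = t" using st div_mult_mod_eq[of a d] by auto
  ultimately show "kron (ecol m s) (ecol d t) $$ (a, b) = (ecol (m * d) (s * d + t) :: 'k mat) $$ (a, b)"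
    using ab by (auto simp: kron_index ecol_def)
qed auto

text \<open>The columns of A lie in the image of f. Surjectivity of a homomorphism is proved by
  generation, since its image is closed under the action.\<close>

definition covers :: "'k::field mat \<Rightarrow> 'k mat \<Rightarrow> bool"
  where "covers f A \<longleftrightarrow> (\<exists>Z. dim_row Z = dim_col f \<and> dim_col Z = dim_col A \<and> f * Z = A)"

lemma covers_self: "dim_row Z = dim_col f \<Longrightarrow> covers f (f * Z)"
  by (auto simp: covers_def)

lemma covers_mult_right: "covers f A \<Longrightarrow> dim_row B = dim_col A \<Longrightarrow> covers f (A * B)"
  unfolding covers_def by (metis mult_assoc_dim index_mult_mat(2,3))

lemma covers_smult: "covers f A \<Longrightarrow> covers f (c \<cdot>\<^sub>m A)"
  unfolding covers_def by (metis mult_smult_dim index_smult_mat(2,3))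

lemma covers_add: "covers f A \<Longrightarrow> covers f B \<Longrightarrow> dim_col A = dim_col B \<Longrightarrow> covers f (A + B)"
  unfolding covers_def by (metis mult_add_dim index_add_mat(2,3))

lemma covers_diff: "covers f A \<Longrightarrow> covers f B \<Longrightarrow> dim_col A = dim_col B \<Longrightarrow> covers f (A - B)"
  unfolding covers_def by (metis mult_minus_dim index_minus_mat(2,3))

lemma covers_one:
  fixes f :: "'k::field mat"
  assumes "dim_row f = d" "\<And>t. t < d \<Longrightarrow> covers f (ecol d t)"
  obtains Z where "f * Z = 1\<^sub>m d" "dim_row Z = dim_col f" "dim_col Z = d"
proof -
  obtain Z where Z: "\<And>t. t < d \<Longrightarrow> dim_row (Z t) = dim_col f \<and> dim_col (Z t) = Suc 0 \<and> f * Z t = ecol d t"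
    using assms(2) unfolding covers_def by (metis dim_ecol(2))
  define W where "W = mat (dim_col f) d (\<lambda>(a, t). Z t $$ (a, 0))"
  have "f * W = 1\<^sub>m d"
  proof (rule eq_matI)
    fix a t assume at: "a < dim_row (1\<^sub>m d :: 'k mat)" "t < dim_col (1\<^sub>m d :: 'k mat)"
    have "dim_row (Z t) = dim_col f" "dim_col (Z t) = Suc 0" using Z[of t] at by simp_all
    then have "(f * W) $$ (a, t) = (f * Z t) $$ (a, 0)"
      using at assms(1) by (simp add: mult_mat_index W_def del: index_mult_mat(1))
    also have "f * Z t = ecol d t" using Z[of t] at by simp
    finally show "(f * W) $$ (a, t) = (1\<^sub>m d :: 'k mat) $$ (a, t)" using at by (simp add: ecol_def)
  qed (use assms in \<open>auto simp: W_def\<close>)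
  then show ?thesis by (rule that) (auto simp: W_def)
qed

text \<open>Surjectivity suffices because the dimensions agree.\<close>

lemma rep_isoI_covers:
  fixes f :: "'k::field mat"
  assumes MN: "M \<in> reps H" "N \<in> reps H" "f \<in> rep_hom H M N" and d: "rdim M = rdim N"
    and "\<And>t. t < rdim N \<Longrightarrow> covers f (ecol (rdim N) t)"
  shows "rep_iso H M N"
proof -
  note [simp] = rep_hom_dim[OF MN(3)]
  obtain Z where Z: "f * Z = 1\<^sub>m (rdim N)" "dim_row Z = dim_col f" "dim_col Z = rdim N"
    by (rule covers_one[OF _ assms(5)]) simp_all
  then have "Z * f = 1\<^sub>m (rdim M)" using square_inverse_comm[OF Z(1)] d by simp
  then show ?thesis using Z d by (intro rep_isoI_hom[OF MN]) simp_all
qed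

lemma rep_isoI_covers_tensor:
  fixes f :: "'k::field mat"
  assumes "M \<in> reps H" "rep_tensor H P Q \<in> reps H" "f \<in> rep_hom H M (rep_tensor H P Q)" "rdim M = rdim P * rdim Q"
    and cov: "\<And>s t. s < rdim P \<Longrightarrow> t < rdim Q \<Longrightarrow> covers f (kron (ecol (rdim P) s) (ecol (rdim Q) t))"
  shows "rep_iso H M (rep_tensor H P Q)"
proof (rule rep_isoI_covers[OF assms(1-3)])
  fix c assume "c < rdim (rep_tensor H P Q)"
  then have c: "c < rdim P * rdim Q" by simp
  then have "c div rdim Q < rdim P" "c mod rdim Q < rdim Q" by (auto intro: div_less_of_mult mod_less_of_mult)
  then show "covers f (ecol (rdim (rep_tensor H P Q)) c)"
    using cov[of "c div rdim Q" "c mod rdim Q"] by (simp add: kron_ecol)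
qed (use assms in simp)

lemma rep_sum_hom_hcat:
  assumes reps: "M \<in> reps H" "N \<in> reps H" "P \<in> reps H" and fg: "f \<in> rep_hom H M P" "f' \<in> rep_hom H N P"
  shows "hcat f f' \<in> rep_hom H (rep_sum H M N) P"
proof -
  note [simp] = rep_hom_dim[OF fg(1)] rep_hom_dim[OF fg(2)]
  show ?thesis
    by (rule rep_homI) (use reps in \<open>auto simp: rmat_sum hcat_bdiag mult_hcat rep_homD[OF fg(1)] rep_homD[OF fg(2)]\<close>)
qed

lemma covers_hcat:
  assumes "dim_row A = dim_row B"
  shows "covers A X \<Longrightarrow> covers (hcat A B) X" "covers B X \<Longrightarrow> covers (hcat A B) X"
proof -
  assume "covers A X"
  then obtain Z where Z: "dim_row Z = dim_col A" "dim_col Z = dim_col X" "A * Z = X" by (auto simp: covers_def)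
  have "hcat A B * vcat Z (0\<^sub>m (dim_col B) (dim_col X)) = A * Z + B * 0\<^sub>m (dim_col B) (dim_col X)"
    using Z assms by (intro hcat_vcat) auto
  also have "\<dots> = X" using Z assms by auto
  finally show "covers (hcat A B) X" using Z unfolding covers_def by (intro exI[of _ "vcat Z (0\<^sub>m (dim_col B) (dim_col X))"]) simp
next
  assume "covers B X"
  then obtain Z where Z: "dim_row Z = dim_col B" "dim_col Z = dim_col X" "B * Z = X" by (auto simp: covers_def)
  have "hcat A B * vcat (0\<^sub>m (dim_col A) (dim_col X)) Z = A * 0\<^sub>m (dim_col A) (dim_col X) + B * Z"
    using Z assms by (intro hcat_vcat) auto
  also have "\<dots> = X" using Z assms by auto
  finally show "covers (hcat A B) X" using Z unfolding covers_def by (intro exI[of _ "vcat (0\<^sub>m (dim_col A) (dim_col X)) Z"]) simp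
qed

context datum
begin

lemma covers_rmat:
  assumes "M \<in> reps A" "N \<in> reps A" "f \<in> rep_hom A M N" "b \<in> basis A" "covers f X" "dim_row X = rdim N"
  shows "covers f (rmat N b * X)"
proof -
  note [simp] = rep_hom_dim[OF assms(3)]
  obtain Z where Z: "dim_row Z = dim_col f" "dim_col Z = dim_col X" "f * Z = X" using assms by (auto simp: covers_def)
  have "rmat N b * X = (rmat N b * f) * Z" using assms Z by (simp add: mult_assoc_dim)
  also have "\<dots> = f * (rmat M b * Z)" using assms Z by (simp add: rep_homD[OF assms(3,4)] mult_assoc_dim)
  finally show ?thesis using Z assms unfolding covers_def by (intro exI[of _ "rmat M b * Z"]) simp
qed

lemma covers_\<rho>_Y:
  assumes "M \<in> reps H" "N \<in> reps H" "f \<in> rep_hom H M N" "covers f X" "dim_row X = rdim N"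
  shows "h \<in> carrier G \<Longrightarrow> covers f (\<rho> N h * X)" "covers f (Y N * X)" "covers f (Y N ^\<^sub>m k * X)"
proof -
  show "h \<in> carrier G \<Longrightarrow> covers f (\<rho> N h * X)" using covers_rmat[OF assms(1-3) _ assms(4,5)] n_pos by simp
  show Y: "covers f (Y N * X)" using covers_rmat[OF assms(1-3) _ assms(4,5)] n2 by simp
  show "covers f (Y N ^\<^sub>m k * X)"
  proof (induction k)
    case (Suc k)
    have "Y N ^\<^sub>m Suc k * X = Y N * (Y N ^\<^sub>m k * X)"
      using assms(2,5) by (subst pow_mat_Suc_left) (simp_all add: mult_assoc_dim)
    then show ?case using covers_rmat[OF assms(1-3) _ Suc, of "(Suc 0, \<one>)"] n2 assms(2) by simp
  qed (use assms in simp)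
qed

lemma ext_covers: "M \<in> reps H \<Longrightarrow> dim_row f = rdim M \<Longrightarrow> 0 < j \<Longrightarrow> covers (ext j M f) f"
  using ext_inj[of M f 0 j] covers_self[of "blk_in (dim_col f) j 0" "ext j M f"] by simp

lemma infl_unit_Ind: "j \<le> n \<Longrightarrow> Ind j (rep_unit K) = Mj j"
  by (simp add: Ind_def infl_unit TH.unit_tensor Mj)

abbreviation A1 :: "('g, 'k) rep" where "A1 \<equiv> char_rep G (\<lambda>h. inverse (\<chi> h))"

lemma A1: "A1 \<in> reps K" "rdim A1 = Suc 0" "h \<in> carrier G \<Longrightarrow> rmat A1 h = inverse (\<chi> h) \<cdot>\<^sub>m 1\<^sub>m (Suc 0)"
proof -
  have r: "rmat A1 h = inverse (\<chi> h) \<cdot>\<^sub>m 1\<^sub>m (Suc 0)" if "h \<in> carrier G" for h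
    using that by (auto simp: char_rep_def intro!: eq_matI)
  then show "h \<in> carrier G \<Longrightarrow> rmat A1 h = inverse (\<chi> h) \<cdot>\<^sub>m 1\<^sub>m (Suc 0)" .
  show d: "rdim A1 = Suc 0" by (simp add: char_rep_def)
  have "rmat A1 \<in> carrier G \<rightarrow>\<^sub>E carrier_mat (Suc 0) (Suc 0)" by (auto simp: char_rep_def)
  then show "A1 \<in> reps K" unfolding reps_K_iff d
    by (auto simp: r smult_mult_dim mult_smult_dim smult_smult_mat mult.commute)
qed

subsection \<open>Clebsch--Gordan rules\<close>

lemma ecol_2: "ecol 2 2 = 0\<^sub>m 2 (Suc 0)" "ecol 2 (Suc (Suc 0)) = 0\<^sub>m 2 (Suc 0)"
  by (rule ecol_ge; simp)+

text \<open>In \<Delta>(y) = y \<otimes> g + 1 \<otimes> y the first summand contributes the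
  eigenvalue \<chi>(g)^{-t} of g on e_t.\<close>

lemma M2_tensor_Y_ecol:
  assumes "i \<le> n"
  shows "Y (rep_tensor H (Mj 2) (Mj i)) * kron (ecol 2 s) (ecol i t) =
    inverse (\<chi> g) ^ t \<cdot>\<^sub>m kron (ecol 2 (Suc s)) (ecol i t) + kron (ecol 2 s) (ecol i (Suc t))"
  using assms n2 by (simp add: tensor_H Mj tensor_Y_def add_mult_dim kron_mult shiftm_ecol' mat_diag_ecol' kron_smult_right)

lemma M2_tensor_\<rho>_ecol:
  assumes "i \<le> n" "h \<in> carrier G"
  shows "\<rho> (rep_tensor H (Mj 2) (Mj i)) h * kron (ecol 2 s) (ecol i t) =
    inverse (\<chi> h) ^ (s + t) \<cdot>\<^sub>m kron (ecol 2 s) (ecol i t)"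
  using assms n2 by (simp add: tensor_H Mj kron_mult mat_diag_ecol' kron_smult_left kron_smult_right smult_smult_mat power_add mult.commute)

lemma M2_tensor_Y_pow_1:
  assumes "i \<le> n"
  shows "Y (rep_tensor H (Mj 2) (Mj i)) ^\<^sub>m k * kron (ecol 2 (Suc 0)) (ecol i 0) = kron (ecol 2 (Suc 0)) (ecol i k)"
proof (induction k)
  case 0
  show ?case using assms n2 by (simp add: tensor_H Mj)
next
  case (Suc k)
  let ?T = "rep_tensor H (Mj 2) (Mj i)"
  have T: "?T \<in> reps H" using assms n2 by (simp add: tensor_H Mj)
  have "Y ?T ^\<^sub>m Suc k * kron (ecol 2 (Suc 0)) (ecol i 0) = Y ?T * (Y ?T ^\<^sub>m k * kron (ecol 2 (Suc 0)) (ecol i 0))"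
    using T by (subst pow_mat_Suc_left) (simp_all add: mult_assoc_dim)
  also have "\<dots> = kron (ecol 2 (Suc 0)) (ecol i (Suc k))"
    unfolding Suc M2_tensor_Y_ecol[OF assms] by (simp add: ecol_2)
  finally show ?case .
qed

text \<open>One of the factors y may move e_0 to e_1 in the first tensor factor; collecting the
  eigenvalues of g over its possible positions gives a q-integer in \<chi>(g)^{-1}.\<close>

lemma M2_tensor_Y_pow_0:
  assumes "i \<le> n"
  shows "Y (rep_tensor H (Mj 2) (Mj i)) ^\<^sub>m Suc k * kron (ecol 2 0) (ecol i 0) =
    kron (ecol 2 0) (ecol i (Suc k)) + (\<Sum>t<Suc k. inverse (\<chi> g) ^ t) \<cdot>\<^sub>m kron (ecol 2 (Suc 0)) (ecol i k)"
proof (induction k)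
  case 0
  have T: "rep_tensor H (Mj 2) (Mj i) \<in> reps H" using assms n2 by (simp add: tensor_H Mj)
  have "Y (rep_tensor H (Mj 2) (Mj i)) ^\<^sub>m Suc 0 = Y (rep_tensor H (Mj 2) (Mj i))" using T by simp
  then show ?case
    using M2_tensor_Y_ecol[OF assms, of 0 0] by (simp, intro eq_matI) auto
next
  case (Suc k)
  let ?T = "rep_tensor H (Mj 2) (Mj i)" and ?c = "\<Sum>t<Suc k. inverse (\<chi> g) ^ t"
  have T: "?T \<in> reps H" using assms n2 by (simp add: tensor_H Mj)
  have "Y ?T ^\<^sub>m Suc (Suc k) * kron (ecol 2 0) (ecol i 0) = Y ?T * (Y ?T ^\<^sub>m Suc k * kron (ecol 2 0) (ecol i 0))"
    using T by (subst pow_mat_Suc_left) (simp_all add: mult_assoc_dim)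
  also have "\<dots> = Y ?T * kron (ecol 2 0) (ecol i (Suc k)) + ?c \<cdot>\<^sub>m (Y ?T * kron (ecol 2 (Suc 0)) (ecol i k))"
    unfolding Suc using T by (subst mult_add_dim) (simp_all add: mult_smult_dim)
  also have "\<dots> = (inverse (\<chi> g) ^ Suc k \<cdot>\<^sub>m kron (ecol 2 (Suc 0)) (ecol i (Suc k)) + kron (ecol 2 0) (ecol i (Suc (Suc k)))) +
      ?c \<cdot>\<^sub>m kron (ecol 2 (Suc 0)) (ecol i (Suc k))"
    unfolding M2_tensor_Y_ecol[OF assms] by (simp add: ecol_2)
  also have "\<dots> = kron (ecol 2 0) (ecol i (Suc (Suc k))) + (\<Sum>t<Suc (Suc k). inverse (\<chi> g) ^ t) \<cdot>\<^sub>m kron (ecol 2 (Suc 0)) (ecol i (Suc k))"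
    by (rule eq_matI) (auto simp: algebra_simps)
  finally show ?case .
qed

text \<open>The q-integer [i] times 1 - \<chi>(g)^{-1} is 1 - \<chi>(g)^{-i}, which is nonzero below
  the order n.\<close>

lemma qsum_nonzero: "0 < i \<Longrightarrow> i < n \<Longrightarrow> (\<Sum>t<i. inverse (\<chi> g) ^ t) \<noteq> 0"
proof
  assume i: "0 < i" "i < n" and z: "(\<Sum>t<i. inverse (\<chi> g) ^ t) = 0"
  have "1 - inverse (\<chi> g) ^ i = (1 - inverse (\<chi> g)) * (\<Sum>t<i. inverse (\<chi> g) ^ t)"
    by (rule one_diff_power_eq)
  then have "inverse (\<chi> g ^ i) = 1" using z by (simp add: power_inverse)
  then have "\<chi> g ^ i = 1" by (simp add: inverse_eq_1_iff)
  then show False using q_pow[OF i] by simp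
qed

text \<open>M_2 \<otimes> M_i is generated by w = e_0 \<otimes> e_0, fixed by G, and by w' = e_1
  \<otimes> e_0 - \<mu> y w, on which G acts through \<chi>^{-1}. If w is killed by the power j of y
  and w' by the power j', Frobenius reciprocity gives a surjection from the direct sum, and the
  dimensions agree.\<close>

lemma clebsch_gordan_aux:
  assumes i: "0 < i" "i \<le> n" and j: "j \<le> n" "j' \<le> n" "0 < j" "j + j' = 2 * i"
    and w: "Y (rep_tensor H (Mj 2) (Mj i)) ^\<^sub>m j * kron (ecol 2 0) (ecol i 0) = 0\<^sub>m (2 * i) 1"
    and w': "Y (rep_tensor H (Mj 2) (Mj i)) ^\<^sub>m j' * (kron (ecol 2 (Suc 0)) (ecol i 0) -
      \<mu> \<cdot>\<^sub>m (Y (rep_tensor H (Mj 2) (Mj i)) * kron (ecol 2 0) (ecol i 0))) = 0\<^sub>m (2 * i) 1"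
    and cov0: "j' = 0 \<Longrightarrow> kron (ecol 2 (Suc 0)) (ecol i 0) - \<mu> \<cdot>\<^sub>m (Y (rep_tensor H (Mj 2) (Mj i)) * kron (ecol 2 0) (ecol i 0)) = 0\<^sub>m (2 * i) 1"
  shows "rep_iso H (rep_sum H (Mj j) (Ind j' A1)) (rep_tensor H (Mj 2) (Mj i))"
proof -
  let ?T = "rep_tensor H (Mj 2) (Mj i)"
  let ?w = "kron (ecol 2 0) (ecol i 0) :: 'k mat" and ?v = "kron (ecol 2 (Suc 0)) (ecol i 0) :: 'k mat"
  let ?w' = "?v - \<mu> \<cdot>\<^sub>m (Y ?T * ?w)"
  have T: "?T \<in> reps H" using i n2 by (simp add: tensor_H Mj)
  have dT [simp]: "dim_row (Y ?T) = 2 * i" "dim_col (Y ?T) = 2 * i" using T by simp_all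
  have \<rho>w: "\<rho> ?T h * ?w = ?w" if "h \<in> carrier G" for h using M2_tensor_\<rho>_ecol[OF i(2) that, of 0 0] by simp
  have \<rho>w': "\<rho> ?T h * ?w' = inverse (\<chi> h) \<cdot>\<^sub>m ?w'" if h: "h \<in> carrier G" for h
  proof -
    have "\<rho> ?T h * ?v = inverse (\<chi> h) \<cdot>\<^sub>m ?v" using M2_tensor_\<rho>_ecol[OF i(2) h, of 1 0] by simp
    moreover have "\<rho> ?T h * (Y ?T * ?w) = (\<rho> ?T h * Y ?T) * ?w" using T h by (simp add: mult_assoc_dim)
    then have "\<rho> ?T h * (Y ?T * ?w) = inverse (\<chi> h) \<cdot>\<^sub>m (Y ?T * ?w)"
      using T h by (simp add: \<rho>_Y smult_mult_dim mult_assoc_dim \<rho>w)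
    ultimately have "\<rho> ?T h * ?w' = inverse (\<chi> h) \<cdot>\<^sub>m ?v - \<mu> \<cdot>\<^sub>m (inverse (\<chi> h) \<cdot>\<^sub>m (Y ?T * ?w))"
      using T h by (simp add: mult_minus_dim mult_smult_dim)
    then show ?thesis by (simp, intro eq_matI) (auto simp: algebra_simps simp del: index_mult_mat(1))
  qed
  have 1: "ext j ?T ?w \<in> rep_hom H (Mj j) ?T"
    unfolding infl_unit_Ind[OF j(1), symmetric]
    by (rule ext_hom[OF unit_K(1) T j(1)]) (simp_all add: unit_K \<rho>w w)
  have 2: "ext j' ?T ?w' \<in> rep_hom H (Ind j' A1) ?T"
    by (rule ext_hom[OF A1(1) T j(2)]) (simp_all add: A1 \<rho>w' w' mult_smult_dim)
  let ?F = "hcat (ext j ?T ?w) (ext j' ?T ?w')"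
  have F: "?F \<in> rep_hom H (rep_sum H (Mj j) (Ind j' A1)) ?T"
    by (rule rep_sum_hom_hcat[OF Mj(1)[OF j(1)] Ind(1)[OF A1(1) j(2)] T 1 2])
  have S: "rep_sum H (Mj j) (Ind j' A1) \<in> reps H" by (rule rep_sum_rep[OF Mj(1)[OF j(1)] Ind(1)[OF A1(1) j(2)]])
  have cw: "covers ?F ?w"
    by (rule covers_hcat(1)) (simp, rule ext_covers[OF T _ j(3)], simp)
  have cw': "covers ?F ?w'"
  proof (cases "j' = 0")
    case True
    show ?thesis unfolding cov0[OF True] covers_def by (intro exI[of _ "0\<^sub>m (dim_col ?F) 1"]) simp
  next
    case False
    then show ?thesis by (intro covers_hcat(2)) (simp, rule ext_covers[OF T], simp_all)
  qed
  \<comment> \<open>Adding \<mu> y w back recovers e_1 \<otimes> e_0, whose y-powers are the e_1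
    \<otimes> e_t; subtracting these from the y-powers of w leaves the e_0 \<otimes> e_t.\<close>
  have "covers ?F (?w' + \<mu> \<cdot>\<^sub>m (Y ?T * ?w))"
    by (intro covers_add covers_smult covers_\<rho>_Y(2)[OF S T F] cw cw') simp_all
  moreover have "?w' + \<mu> \<cdot>\<^sub>m (Y ?T * ?w) = ?v" by (rule eq_matI) (auto simp del: index_mult_mat(1))
  ultimately have cv: "covers ?F ?v" by simp
  have c1: "covers ?F (kron (ecol 2 (Suc 0)) (ecol i t))" for t
    using covers_\<rho>_Y(3)[OF S T F cv, of t] M2_tensor_Y_pow_1[OF i(2), of t] by simp
  have c0: "covers ?F (kron (ecol 2 0) (ecol i t))" for t
  proof (cases t)
    case (Suc k)
    let ?c = "\<Sum>t<Suc k. inverse (\<chi> g) ^ t"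
    have "covers ?F (Y ?T ^\<^sub>m Suc k * ?w - ?c \<cdot>\<^sub>m kron (ecol 2 (Suc 0)) (ecol i k))"
      by (intro covers_diff covers_smult c1 covers_\<rho>_Y(3)[OF S T F] cw) simp_all
    moreover have "Y ?T ^\<^sub>m Suc k * ?w - ?c \<cdot>\<^sub>m kron (ecol 2 (Suc 0)) (ecol i k) = kron (ecol 2 0) (ecol i (Suc k))"
      unfolding M2_tensor_Y_pow_0[OF i(2)] by (rule eq_matI) auto
    ultimately show ?thesis using Suc by simp
  qed (use cw in simp)
  show ?thesis
  proof (rule rep_isoI_covers_tensor[OF S T F])
    show "rdim (rep_sum H (Mj j) (Ind j' A1)) = rdim (Mj 2) * rdim (Mj i)" using j A1(2) by simp
    fix s t assume "s < rdim (Mj 2)" "t < rdim (Mj i)"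
    then show "covers ?F (kron (ecol (rdim (Mj 2)) s) (ecol (rdim (Mj i)) t))"
      using c0[of t] c1[of t] by (cases "s = 0") (auto simp: less_2_cases_iff)
  qed
qed

text \<open>Since y^i w = [i] e_1 \<otimes> e_{i-1} and y^{i-1} (e_1 \<otimes> e_0) = e_1 \<otimes>
  e_{i-1}, the choice \<mu> = 1/[i] makes y^{i-1} w' zero. Invertibility of the q-integer [i] is
  where i < n enters.\<close>

lemma clebsch_gordan:
  assumes i: "0 < i" "i < n"
  shows "rep_iso H (rep_sum H (Mj (Suc i)) (Ind (i - 1) A1)) (rep_tensor H (Mj 2) (Mj i))"
proof -
  let ?T = "rep_tensor H (Mj 2) (Mj i)"
  let ?w = "kron (ecol 2 0) (ecol i 0) :: 'k mat" and ?v = "kron (ecol 2 (Suc 0)) (ecol i 0) :: 'k mat"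
  let ?c = "\<Sum>t<i. inverse (\<chi> g) ^ t"
  obtain k where k: "i = Suc k" using i by (cases i) auto
  have T: "?T \<in> reps H" using i n2 by (simp add: tensor_H Mj)
  have dT [simp]: "dim_row (Y ?T) = 2 * i" "dim_col (Y ?T) = 2 * i" using T by simp_all
  have c: "?c \<noteq> 0" by (rule qsum_nonzero[OF i])
  have Yi: "Y ?T ^\<^sub>m i * ?w = ?c \<cdot>\<^sub>m kron (ecol 2 (Suc 0)) (ecol i k)"
    using M2_tensor_Y_pow_0[of i k] i unfolding k[symmetric] by (simp add: ecol_ge)
  have w': "Y ?T ^\<^sub>m k * (?v - inverse ?c \<cdot>\<^sub>m (Y ?T * ?w)) = 0\<^sub>m (2 * i) 1"
  proof -
    have "Y ?T ^\<^sub>m k * (?v - inverse ?c \<cdot>\<^sub>m (Y ?T * ?w)) = Y ?T ^\<^sub>m k * ?v - inverse ?c \<cdot>\<^sub>m (Y ?T ^\<^sub>m k * Y ?T * ?w)"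
      by (simp add: mult_minus_dim mult_smult_dim mult_assoc_dim)
    also have "Y ?T ^\<^sub>m k * Y ?T = Y ?T ^\<^sub>m i" by (simp add: k)
    also have "Y ?T ^\<^sub>m k * ?v - inverse ?c \<cdot>\<^sub>m (Y ?T ^\<^sub>m i * ?w) = 0\<^sub>m (2 * i) 1"
      unfolding Yi using i c M2_tensor_Y_pow_1[of i k] by (simp add: smult_smult_mat) (rule eq_matI; auto)
    finally show ?thesis .
  qed
  have w: "Y ?T ^\<^sub>m Suc i * ?w = 0\<^sub>m (2 * i) 1"
    using M2_tensor_Y_pow_0[of i i] i by (simp add: ecol_ge)
  have w0: "?v - inverse ?c \<cdot>\<^sub>m (Y ?T * ?w) = 0\<^sub>m (2 * i) 1" if "i - 1 = 0"
    using w' that k T by (simp add: numeral_2_eq_2)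
  have ki: "i - 1 = k" by (simp add: k)
  show ?thesis
    by (rule clebsch_gordan_aux[where \<mu> = "inverse ?c"]) (use i w w' w0 ki in auto)
qed

text \<open>At i = n the nilpotency of y already kills w in degree n, so \<mu> = 0 serves and both
  summands have length n.\<close>

lemma clebsch_gordan_n: "rep_iso H (rep_sum H (Mj n) (Ind n A1)) (rep_tensor H (Mj 2) (Mj n))"
proof -
  have T: "rep_tensor H (Mj 2) (Mj n) \<in> reps H" using n2 by (simp add: tensor_H Mj)
  have z: "Y (rep_tensor H (Mj 2) (Mj n)) ^\<^sub>m n = 0\<^sub>m (2 * n) (2 * n)" using Y_pow_n[OF T] by simp
  show ?thesis
    by (rule clebsch_gordan_aux[where \<mu> = 0]) (use n_pos T z in auto)
qed

text \<open>On V \<otimes> M_2 the operator y is 1 \<otimes> y, on M_2 \<otimes> V it is y \<otimes>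
  g. The map generated by v \<otimes> e_0 \<mapsto> e_0 \<otimes> v thus sends v \<otimes> e_1 to
  e_1 \<otimes> g v and is onto because g is invertible.\<close>

lemma M2_commute:
  assumes V: "V \<in> reps K"
  shows "rep_iso H (rep_tensor H (infl V) (Mj 2)) (rep_tensor H (Mj 2) (infl V))"
proof -
  let ?T = "rep_tensor H (Mj 2) (infl V)" and ?d = "rdim V"
  let ?f = "kron (ecol 2 0) (1\<^sub>m ?d) :: 'k mat"
  have T: "?T \<in> reps H" using V n2 by (simp add: tensor_H Mj infl)
  have YT: "Y ?T = kron (shiftm 2) (rmat V g)" using V n2 by (simp add: tensor_H Mj infl tensor_Y_def)
  have Y2: "Y ?T ^\<^sub>m 2 * ?f = 0\<^sub>m (2 * ?d) ?d"
    using V unfolding YT by (simp add: kron_pow kron_mult shiftm_pow_zero)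
  have F: "ext 2 ?T ?f \<in> rep_hom H (Ind 2 V) ?T"
  proof (rule ext_hom[OF V T n2])
    fix h assume h: "h \<in> carrier G"
    have "?f * rmat V h = kron (ecol 2 0) (1\<^sub>m ?d) * kron (1\<^sub>m (Suc 0)) (rmat V h)" by simp
    also have "\<dots> = kron (ecol 2 0) (rmat V h)" using V h by (subst kron_mult) auto
    finally show "\<rho> ?T h * ?f = ?f * rmat V h"
      using V h n2 by (simp add: tensor_H Mj infl kron_mult mat_diag_ecol')
  qed (use Y2 in simp_all)
  have I: "Ind 2 V \<in> reps H" by (rule Ind(1)[OF V n2])
  let ?F = "ext 2 ?T ?f"
  have c0: "covers ?F ?f" by (rule ext_covers[OF T]) simp_all
  have "Y ?T * ?f = kron (ecol 2 (Suc 0)) (rmat V g)" using V unfolding YT by (simp add: kron_mult shiftm_ecol')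
  then have "covers ?F (kron (ecol 2 (Suc 0)) (rmat V g) * kron (1\<^sub>m (Suc 0)) (rmat V (inv g)))"
    using covers_\<rho>_Y(2)[OF I T F c0] V by (intro covers_mult_right) auto
  moreover have "kron (ecol 2 (Suc 0)) (rmat V g) * kron (1\<^sub>m (Suc 0)) (rmat V (inv g)) = kron (ecol 2 (Suc 0)) (1\<^sub>m ?d)"
    using V by (subst kron_mult) (auto simp: K_inv)
  ultimately have c1: "covers ?F (kron (ecol 2 (Suc 0)) (1\<^sub>m ?d))" by simp
  have "rep_iso H (Ind 2 V) ?T"
  proof (rule rep_isoI_covers_tensor[OF I T F])
    fix s t assume s: "s < rdim (Mj 2)" and t: "t < rdim (infl V)"
    have "covers ?F (kron (ecol 2 s) (1\<^sub>m ?d))" using c0 c1 s by (cases "s = 0") (auto simp: less_2_cases_iff)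
    then have "covers ?F (kron (ecol 2 s) (1\<^sub>m ?d) * kron (1\<^sub>m (Suc 0)) (ecol ?d t))"
      by (rule covers_mult_right) simp
    also have "kron (ecol 2 s) (1\<^sub>m ?d) * kron (1\<^sub>m (Suc 0)) (ecol ?d t) = kron (ecol 2 s) (ecol ?d t :: 'k mat)"
      by (subst kron_mult) auto
    finally show "covers ?F (kron (ecol (rdim (Mj 2)) s) (ecol (rdim (infl V)) t))" by simp
  qed simp
  then show ?thesis by (simp add: Ind_def)
qed

subsection \<open>The regular module absorbs tensor factors\<close>

text \<open>A numbering of the group elements, which turns functions on G into columns;
  \<open>el\<close> is its inverse.\<close>

definition idx :: "'g \<Rightarrow> nat"
  where "idx = (SOME f. bij_betw f (carrier G) {..<card (carrier G)})"

lemma idx: "bij_betw idx (carrier G) {..<card (carrier G)}"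
proof -
  have "\<exists>f. bij_betw f (carrier G) {..<card (carrier G)}"
    using ex_bij_betw_finite_nat[OF fin] by (simp add: lessThan_atLeast0)
  then show ?thesis unfolding idx_def by (rule someI_ex)
qed

lemma idx_less [simp]: "h \<in> carrier G \<Longrightarrow> idx h < card (carrier G)"
  using idx by (auto simp: bij_betw_def)

lemma idx_inj [simp]: "h \<in> carrier G \<Longrightarrow> l \<in> carrier G \<Longrightarrow> idx h = idx l \<longleftrightarrow> h = l"
  using idx by (auto simp: bij_betw_def inj_on_def)

lemma idx_surj: "i < card (carrier G) \<Longrightarrow> \<exists>h\<in>carrier G. idx h = i"
proof -
  assume "i < card (carrier G)"
  then have "i \<in> idx ` carrier G" using idx by (simp add: bij_betw_def)
  then show ?thesis by blast
qed

lemma sum_idx: "(\<Sum>i<card (carrier G). f i) = (\<Sum>h\<in>carrier G. f (idx h))"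
  by (rule sum.reindex_bij_betw[OF idx, symmetric])

definition el :: "nat \<Rightarrow> 'g" where "el = inv_into (carrier G) idx"

lemma el [simp]: "h \<in> carrier G \<Longrightarrow> el (idx h) = h" "i < card (carrier G) \<Longrightarrow> el i \<in> carrier G" "i < card (carrier G) \<Longrightarrow> idx (el i) = i"
  unfolding el_def using idx by (auto simp: bij_betw_def inv_into_into f_inv_into_f)

definition Kreg :: "('g, 'k) rep"
  where "Kreg = mk_K (card (carrier G)) (\<lambda>l. mat (card (carrier G)) (card (carrier G)) (\<lambda>(a, b). if a = idx (l \<otimes> el b) then 1 else 0))"

abbreviation eg :: "'g \<Rightarrow> 'k mat" where "eg h \<equiv> ecol (card (carrier G)) (idx h)"

lemma rdim_Kreg [simp]: "rdim Kreg = card (carrier G)"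
  by (simp add: Kreg_def)

lemma Kreg_index: "l \<in> carrier G \<Longrightarrow> a < card (carrier G) \<Longrightarrow> b < card (carrier G) \<Longrightarrow>
    rmat Kreg l $$ (a, b) = (if a = idx (l \<otimes> el b) then 1 else 0)"
  by (simp add: Kreg_def)

lemma Kreg: "Kreg \<in> reps K"
  unfolding Kreg_def
proof (rule mk_K)
  let ?R = "\<lambda>l. mat (card (carrier G)) (card (carrier G)) (\<lambda>(a, b). if a = idx (l \<otimes> el b) then 1 else 0) :: 'k mat"
  show "?R \<one> = 1\<^sub>m (card (carrier G))" by (rule eq_matI) auto
  fix h l assume hl: "h \<in> carrier G" "l \<in> carrier G"
  show "?R (h \<otimes> l) = ?R h * ?R l"
  proof (rule eq_matI)
    fix a b assume "a < dim_row (?R h * ?R l)" "b < dim_col (?R h * ?R l)"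
    then have ab: "a < card (carrier G)" "b < card (carrier G)" by auto
    have "(?R h * ?R l) $$ (a, b) = (\<Sum>k<card (carrier G). (if a = idx (h \<otimes> el k) then 1 else 0) * (if k = idx (l \<otimes> el b) then 1 else 0))"
      using ab by (subst mult_mat_index) auto
    also have "\<dots> = ?R (h \<otimes> l) $$ (a, b)"
      using ab hl by (simp only: sum_if_mult) (auto simp: G.m_assoc)
    finally show "?R (h \<otimes> l) $$ (a, b) = (?R h * ?R l) $$ (a, b)" by simp
  qed auto
qed auto

lemma Kreg_eg: "l \<in> carrier G \<Longrightarrow> h \<in> carrier G \<Longrightarrow> rmat Kreg l * eg h = eg (l \<otimes> h)"
proof (rule eq_matI)
  fix a b assume lh: "l \<in> carrier G" "h \<in> carrier G" and "a < dim_row (eg (l \<otimes> h))" "b < dim_col (eg (l \<otimes> h))"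
  then have ab: "a < card (carrier G)" "b = 0" by auto
  have "(rmat Kreg l * eg h) $$ (a, b) = (\<Sum>k<card (carrier G). (if a = idx (l \<otimes> el k) then 1 else 0) * (if k = idx h then 1 else 0))"
    using ab lh Kreg by (subst mult_mat_index) (auto simp: Kreg_index ecol_def)
  also have "\<dots> = eg (l \<otimes> h) $$ (a, b)" using ab lh by (simp only: sum_if_mult) (auto simp: ecol_def)
  finally show "(rmat Kreg l * eg h) $$ (a, b) = eg (l \<otimes> h) $$ (a, b)" .
qed (use Kreg in auto)

lemma eg_Kreg: "l \<in> carrier G \<Longrightarrow> h \<in> carrier G \<Longrightarrow> (eg (l \<otimes> h))\<^sup>T * rmat Kreg l = (eg h)\<^sup>T"
proof (rule eq_matI)
  fix a b assume lh: "l \<in> carrier G" "h \<in> carrier G" and "a < dim_row ((eg h)\<^sup>T)" "b < dim_col ((eg h)\<^sup>T)"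
  then have ab: "b < card (carrier G)" "a = 0" by auto
  have "((eg (l \<otimes> h))\<^sup>T * rmat Kreg l) $$ (a, b) =
      (\<Sum>k<card (carrier G). (if k = idx (l \<otimes> h) then 1 else 0) * (if k = idx (l \<otimes> el b) then 1 else 0))"
    using ab lh Kreg by (subst mult_mat_index) (auto simp: Kreg_index ecol_def)
  also have "\<dots> = (eg h)\<^sup>T $$ (a, b)" using ab lh by (simp only: sum_if_mult) (auto simp: ecol_def)
  finally show "((eg (l \<otimes> h))\<^sup>T * rmat Kreg l) $$ (a, b) = (eg h)\<^sup>T $$ (a, b)" .
qed (use Kreg in auto)

definition trivK :: "nat \<Rightarrow> ('g, 'k) rep" where "trivK d = mk_K d (\<lambda>_. 1\<^sub>m d)"

lemma trivK: "trivK d \<in> reps K" "rdim (trivK d) = d" "h \<in> carrier G \<Longrightarrow> rmat (trivK d) h = 1\<^sub>m d"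
  unfolding trivK_def by (auto intro!: mk_K)

abbreviation trivKreg :: "nat \<Rightarrow> ('g, 'k) rep" where "trivKreg d \<equiv> rep_tensor K (trivK d) Kreg"

text \<open>The \<open>G\<close>-homomorphism \<open>k\<^sup>d \<otimes> kG \<rightarrow> W\<close> with \<open>x \<otimes> h \<mapsto> h A x\<close>.\<close>

definition freeK :: "nat \<Rightarrow> ('g, 'k) rep \<Rightarrow> 'k mat \<Rightarrow> 'k mat"
  where "freeK d W A = lincomb (rdim W) (d * card (carrier G)) (carrier G) (\<lambda>_. 1) (\<lambda>h. rmat W h * (A * kron (1\<^sub>m d) (eg h)\<^sup>T))"

lemma dim_freeK [simp]: "dim_row (freeK d W A) = rdim W" "dim_col (freeK d W A) = d * card (carrier G)"
  by (simp_all add: freeK_def)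

lemma freeK_hom:
  assumes W: "W \<in> reps K" and A: "dim_row A = rdim W" "dim_col A = d"
  shows "freeK d W A \<in> rep_hom K (trivKreg d) W"
proof (rule rep_homI)
  fix l assume "l \<in> basis K"
  then have l: "l \<in> carrier G" by simp
  let ?N = "d * card (carrier G)"
  have R: "rmat (trivKreg d) l = kron (1\<^sub>m d) (rmat Kreg l)" using l by (simp add: tensor_K trivK Kreg)
  have dR: "dim_row (rmat Kreg l) = card (carrier G)" "dim_col (rmat Kreg l) = card (carrier G)" using Kreg l by auto
  let ?t = "\<lambda>h. rmat W h * (A * (kron (1\<^sub>m d) (eg h)\<^sup>T * rmat (trivKreg d) l))"
  have "freeK d W A * rmat (trivKreg d) l = lincomb (rdim W) ?N (carrier G) (\<lambda>_. 1) ?t"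
    unfolding freeK_def R using W A dR by (subst lincomb_mult) (auto simp: mult_assoc_dim intro!: lincomb_mat_cong)
  also have "\<dots> = lincomb (rdim W) ?N (carrier G) (\<lambda>_. 1) (\<lambda>h. ?t (l \<otimes> h))"
    by (rule lincomb_translate[OF l, symmetric])
  also have "\<dots> = lincomb (rdim W) ?N (carrier G) (\<lambda>_. 1) (\<lambda>h. rmat W l * (rmat W h * (A * kron (1\<^sub>m d) (eg h)\<^sup>T)))"
    using W A l dR by (intro lincomb_mat_cong) (simp add: R kron_mult eg_Kreg K_mult mult_assoc_dim)
  also have "\<dots> = rmat W l * freeK d W A"
    unfolding freeK_def using W A l by (subst mult_lincomb) auto
  finally show "rmat W l * freeK d W A = freeK d W A * rmat (trivKreg d) l" by simp
qed (auto simp: trivK)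

lemma freeK_one:
  assumes W: "W \<in> reps K" and A: "dim_row A = rdim W" "dim_col A = d"
  shows "freeK d W A * kron (1\<^sub>m d) (eg \<one>) = A"
proof -
  have e: "(eg h)\<^sup>T * eg \<one> = (if h = \<one> then 1\<^sub>m (Suc 0) else 0\<^sub>m (Suc 0) (Suc 0))" if "h \<in> carrier G" for h
    using that by (subst ecol_ecol) auto
  have "freeK d W A * kron (1\<^sub>m d) (eg \<one>) =
     lincomb (rdim W) d (carrier G) (\<lambda>_. 1) (\<lambda>h. rmat W h * (A * kron (1\<^sub>m d) ((eg h)\<^sup>T * eg \<one>)))"
    unfolding freeK_def using W A by (subst lincomb_mult) (auto simp: mult_assoc_dim kron_mult intro!: lincomb_mat_cong)
  also have "\<dots> = rmat W \<one> * (A * kron (1\<^sub>m d) ((eg \<one>)\<^sup>T * eg \<one>))"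
    by (rule lincomb_single) (use W A e in auto)
  finally show ?thesis using W A by (simp add: e)
qed

text \<open>The left regular module of H: \<open>bvec t h\<close> plays the part of the basis
  element y^t h, as \<open>reg_gen\<close> confirms.\<close>

definition reg :: "(nat \<times> 'g, 'k) rep" where "reg = Ind n Kreg"

abbreviation bvec :: "nat \<Rightarrow> 'g \<Rightarrow> 'k mat" where "bvec t h \<equiv> kron (eg h) (ecol n t)"

lemma reg: "reg \<in> reps H" "rdim reg = card (carrier G) * n"
  unfolding reg_def by (simp_all add: Ind(1)[OF Kreg])

lemma reg_bvec:
  shows "l \<in> carrier G \<Longrightarrow> h \<in> carrier G \<Longrightarrow> \<rho> reg l * bvec t h = inverse (\<chi> l) ^ t \<cdot>\<^sub>m bvec t (l \<otimes> h)"
    "Y reg * bvec t h = bvec (Suc t) h"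
  using Kreg by (simp_all add: reg_def Ind kron_mult Kreg_eg mat_diag_ecol' shiftm_ecol' kron_smult_right)

lemma reg_gen:
  assumes "h \<in> carrier G"
  shows "Y reg ^\<^sub>m t * (\<rho> reg h * bvec 0 \<one>) = bvec t h"
proof (induction t)
  case 0
  show ?case using assms reg by (simp add: reg_bvec)
next
  case (Suc t)
  have "Y reg ^\<^sub>m Suc t * (\<rho> reg h * bvec 0 \<one>) = Y reg * (Y reg ^\<^sub>m t * (\<rho> reg h * bvec 0 \<one>))"
    using reg assms by (subst pow_mat_Suc_left) (simp_all add: mult_assoc_dim)
  then show ?case by (simp only: Suc reg_bvec)
qed

lemma reg_basis: "c < rdim reg \<Longrightarrow> \<exists>t<n. \<exists>h\<in>carrier G. ecol (rdim reg) c = bvec t h"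
proof -
  assume "c < rdim reg"
  then have c: "c < card (carrier G) * n" by (simp add: reg)
  then have d: "c div n < card (carrier G)" "c mod n < n" by (auto intro: div_less_of_mult mod_less_of_mult)
  then obtain h where "h \<in> carrier G" "idx h = c div n" using idx_surj by blast
  then show ?thesis using d by (intro exI[of _ "c mod n"] conjI bexI[of _ h]) (auto simp: kron_ecol reg)
qed

lemma triv_reg_Ind: "rep_tensor H (infl (trivK d)) reg = Ind n (trivKreg d)"
  unfolding reg_def Ind_def using Kreg trivK(1)[of d] by (simp add: infl_tensor TH.tensor_assoc infl Mj)

text \<open>The left side is free of rank d: the d columns of A determine a homomorphism from it to
  P, by extension first to kG and then to H. It is an isomorphism as soon as the columns generate P,
  since the dimensions match.\<close>

lemma triv_reg_iso_aux:
  assumes P: "P \<in> reps H" and A: "dim_row A = rdim P" "dim_col A = d" and d: "rdim P = d * rdim reg"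
    and cov: "\<And>F. \<lbrakk>F \<in> rep_hom H (Ind n (trivKreg d)) P; covers F A\<rbrakk> \<Longrightarrow> \<forall>c<rdim P. covers F (ecol (rdim P) c)"
  shows "rep_iso H (rep_tensor H (infl (trivK d)) reg) P"
proof -
  let ?\<phi> = "freeK d (res P) A"
  have TR: "trivKreg d \<in> reps K" by (intro tensor_K_rep trivK Kreg)
  have \<phi>: "?\<phi> \<in> rep_hom K (trivKreg d) (res P)" by (rule freeK_hom[OF res[OF P]]) (use A in auto)
  have F: "ext n P ?\<phi> \<in> rep_hom H (Ind n (trivKreg d)) P"
  proof (rule ext_hom[OF TR P])
    show "\<And>h. h \<in> carrier G \<Longrightarrow> \<rho> P h * ?\<phi> = ?\<phi> * rmat (trivKreg d) h" using rep_homD[OF \<phi>] by simp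
    show "Y P ^\<^sub>m n * ?\<phi> = 0\<^sub>m (rdim P) (rdim (trivKreg d))" using Y_pow_n[OF P] by (simp add: trivK)
  qed (auto simp: trivK)
  have "covers (ext n P ?\<phi>) ?\<phi>" by (rule ext_covers[OF P _ n_pos]) simp
  then have "covers (ext n P ?\<phi>) (?\<phi> * kron (1\<^sub>m d) (eg \<one>))" by (rule covers_mult_right) simp
  then have "covers (ext n P ?\<phi>) A" using freeK_one[OF res[OF P], of A d] A by simp
  then show ?thesis
    unfolding triv_reg_Ind using cov[OF F]
    by (intro rep_isoI_covers[OF Ind(1)[OF TR] P F]) (auto simp: trivK d reg)
qed

text \<open>The elements m \<otimes> 1 generate M \<otimes> H: the x for which all m \<otimes> x lie
  in the image are closed under h, after replacing m by h^{-1} m, and under y, after subtracting y m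
  \<otimes> g x.\<close>

lemma tensor_reg_iso:
  assumes M: "M \<in> reps H"
  shows "rep_iso H (rep_tensor H (infl (trivK (rdim M))) reg) (rep_tensor H M reg)"
proof (rule triv_reg_iso_aux[where A = "kron (1\<^sub>m (rdim M)) (bvec 0 \<one>)"])
  let ?m = "rdim M" and ?P = "rep_tensor H M reg"
  show P: "?P \<in> reps H" using M reg by (simp add: tensor_H)
  fix F assume F: "F \<in> rep_hom H (Ind n (trivKreg ?m)) ?P" and c: "covers F (kron (1\<^sub>m ?m) (bvec 0 \<one>))"
  have I: "Ind n (trivKreg ?m) \<in> reps H" by (intro Ind(1) tensor_K_rep trivK Kreg) simp
  \<comment> \<open>\<open>?S x\<close> says that the whole subspace M \<otimes> x lies in the image
    of F.\<close>
  let ?S = "\<lambda>x. dim_row x = rdim reg \<and> dim_col x = Suc 0 \<and> covers F (kron (1\<^sub>m ?m) x)"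
  have kr: "kron A x * B = kron (A * B) x" if "dim_col x = Suc 0" "dim_row B = dim_col A" for A B x :: "'k mat"
  proof -
    have "kron A x * B = kron A x * kron B (1\<^sub>m (Suc 0))" by simp
    also have "\<dots> = kron (A * B) x" using that by (subst kron_mult) auto
    finally show ?thesis .
  qed
  have S\<rho>: "?S (\<rho> reg h * x)" if x: "?S x" and h: "h \<in> carrier G" for x h
  proof -
    have "covers F (\<rho> ?P h * kron (1\<^sub>m ?m) x * \<rho> M (inv h))"
      using x M h reg by (intro covers_mult_right covers_\<rho>_Y(1)[OF I P F _ _ h]) auto
    also have "\<rho> ?P h * kron (1\<^sub>m ?m) x * \<rho> M (inv h) = kron (1\<^sub>m ?m) (\<rho> reg h * x)"
      using x M h reg by (simp add: tensor_H kron_mult kr \<rho>_inv)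
    finally show ?thesis using reg h x by simp
  qed
  have SY: "?S (Y reg * x)" if x: "?S x" for x
  proof -
    have 1: "covers F (Y ?P * kron (1\<^sub>m ?m) x)" using x M reg by (intro covers_\<rho>_Y(2)[OF I P F]) auto
    have 2: "covers F (kron (1\<^sub>m ?m) (\<rho> reg g * x) * Y M)" using S\<rho>[OF x g] M reg by (intro covers_mult_right) auto
    have "covers F (Y ?P * kron (1\<^sub>m ?m) x - kron (1\<^sub>m ?m) (\<rho> reg g * x) * Y M)"
      using x M by (intro covers_diff[OF 1 2]) auto
    also have "Y ?P * kron (1\<^sub>m ?m) x - kron (1\<^sub>m ?m) (\<rho> reg g * x) * Y M = kron (1\<^sub>m ?m) (Y reg * x)"
    proof -
      have "Y ?P * kron (1\<^sub>m ?m) x = kron (Y M) (\<rho> reg g * x) + kron (1\<^sub>m ?m) (Y reg * x)"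
        using x M reg by (simp add: tensor_H tensor_Y_def add_mult_dim kron_mult)
      moreover have "kron (1\<^sub>m ?m) (\<rho> reg g * x) * Y M = kron (Y M) (\<rho> reg g * x)" using x M reg by (simp add: kr)
      ultimately show ?thesis using x M reg by (simp only:) (rule eq_matI; simp del: index_mult_mat(1))
    qed
    finally show ?thesis using reg x by simp
  qed
  have SYk: "?S (Y reg ^\<^sub>m t * x)" if "?S x" for x t
  proof (induction t)
    case (Suc t)
    have "Y reg ^\<^sub>m Suc t * x = Y reg * (Y reg ^\<^sub>m t * x)"
      using reg that by (subst pow_mat_Suc_left) (simp_all add: mult_assoc_dim)
    then show ?case using SY[OF Suc] by simp
  qed (use that reg in simp)
  have Sb: "?S (bvec t h)" if "h \<in> carrier G" for t h
    using SYk[OF S\<rho>[OF _ that], of "bvec 0 \<one>" t] reg_gen[OF that, of t] c reg by simp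
  show "\<forall>c<rdim ?P. covers F (ecol (rdim ?P) c)"
  proof (intro allI impI)
    fix k assume "k < rdim ?P"
    then have k: "k < ?m * rdim reg" by simp
    then have d: "k div rdim reg < ?m" "k mod rdim reg < rdim reg" by (auto intro: div_less_of_mult mod_less_of_mult)
    obtain t h where th: "h \<in> carrier G" "ecol (rdim reg) (k mod rdim reg) = bvec t h" using reg_basis[OF d(2)] by blast
    have "covers F (kron (1\<^sub>m ?m) (bvec t h) * ecol ?m (k div rdim reg))"
      using Sb[OF th(1)] by (intro covers_mult_right) auto
    also have "kron (1\<^sub>m ?m) (bvec t h) * ecol ?m (k div rdim reg) = kron (ecol ?m (k div rdim reg)) (ecol (rdim reg) (k mod rdim reg))"
      by (simp add: kr th(2))
    also have "\<dots> = ecol (rdim ?P) k" using d by (simp add: kron_ecol)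
    finally show "covers F (ecol (rdim ?P) k)" .
  qed
qed (simp_all add: reg)

text \<open>Here y (x \<otimes> m) = y x \<otimes> g m + x \<otimes> y m, so subtracting x \<otimes>
  y m and cancelling g gives closure under y.\<close>

lemma reg_tensor_iso:
  assumes M: "M \<in> reps H"
  shows "rep_iso H (rep_tensor H (infl (trivK (rdim M))) reg) (rep_tensor H reg M)"
proof (rule triv_reg_iso_aux[where A = "kron (bvec 0 \<one>) (1\<^sub>m (rdim M))"])
  let ?m = "rdim M" and ?P = "rep_tensor H reg M"
  show P: "?P \<in> reps H" using M reg by (simp add: tensor_H)
  fix F assume F: "F \<in> rep_hom H (Ind n (trivKreg ?m)) ?P" and c: "covers F (kron (bvec 0 \<one>) (1\<^sub>m ?m))"
  have I: "Ind n (trivKreg ?m) \<in> reps H" by (intro Ind(1) tensor_K_rep trivK Kreg) simp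
  let ?S = "\<lambda>x. dim_row x = rdim reg \<and> dim_col x = Suc 0 \<and> covers F (kron x (1\<^sub>m ?m))"
  have kr: "kron x A * B = kron x (A * B)" if "dim_col x = Suc 0" "dim_row B = dim_col A" for A B x :: "'k mat"
  proof -
    have "kron x A * B = kron x A * kron (1\<^sub>m (Suc 0)) B" by simp
    also have "\<dots> = kron x (A * B)" using that by (subst kron_mult) auto
    finally show ?thesis .
  qed
  have S\<rho>: "?S (\<rho> reg h * x)" if x: "?S x" and h: "h \<in> carrier G" for x h
  proof -
    have "covers F (\<rho> ?P h * kron x (1\<^sub>m ?m) * \<rho> M (inv h))"
      using x M h reg by (intro covers_mult_right covers_\<rho>_Y(1)[OF I P F _ _ h]) auto
    also have "\<rho> ?P h * kron x (1\<^sub>m ?m) * \<rho> M (inv h) = kron (\<rho> reg h * x) (1\<^sub>m ?m)"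
      using x M h reg by (simp add: tensor_H kron_mult kr \<rho>_inv)
    finally show ?thesis using reg h x by simp
  qed
  have SY: "?S (Y reg * x)" if x: "?S x" for x
  proof -
    have 1: "covers F (Y ?P * kron x (1\<^sub>m ?m))" using x M reg by (intro covers_\<rho>_Y(2)[OF I P F]) auto
    have 2: "covers F (kron x (1\<^sub>m ?m) * Y M)" using x M reg by (intro covers_mult_right) auto
    have "covers F ((Y ?P * kron x (1\<^sub>m ?m) - kron x (1\<^sub>m ?m) * Y M) * \<rho> M (inv g))"
      using x M by (intro covers_mult_right covers_diff[OF 1 2]) auto
    also have "Y ?P * kron x (1\<^sub>m ?m) - kron x (1\<^sub>m ?m) * Y M = kron (Y reg * x) (\<rho> M g)"
    proof -
      have "Y ?P * kron x (1\<^sub>m ?m) = kron (Y reg * x) (\<rho> M g) + kron x (Y M)"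
        using x M reg by (simp add: tensor_H tensor_Y_def add_mult_dim kron_mult)
      moreover have "kron x (1\<^sub>m ?m) * Y M = kron x (Y M)" using x M reg by (simp add: kr)
      ultimately show ?thesis using x M reg by (simp only:) (rule eq_matI; simp del: index_mult_mat(1))
    qed
    also have "kron (Y reg * x) (\<rho> M g) * \<rho> M (inv g) = kron (Y reg * x) (1\<^sub>m ?m)"
      using x M reg by (simp add: kr \<rho>_inv)
    finally show ?thesis using reg x by simp
  qed
  have SYk: "?S (Y reg ^\<^sub>m t * x)" if "?S x" for x t
  proof (induction t)
    case (Suc t)
    have "Y reg ^\<^sub>m Suc t * x = Y reg * (Y reg ^\<^sub>m t * x)"
      using reg that by (subst pow_mat_Suc_left) (simp_all add: mult_assoc_dim)
    then show ?case using SY[OF Suc] by simp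
  qed (use that reg in simp)
  have Sb: "?S (bvec t h)" if "h \<in> carrier G" for t h
    using SYk[OF S\<rho>[OF _ that], of "bvec 0 \<one>" t] reg_gen[OF that, of t] c reg by simp
  show "\<forall>c<rdim ?P. covers F (ecol (rdim ?P) c)"
  proof (intro allI impI)
    fix k assume "k < rdim ?P"
    then have k: "k < rdim reg * ?m" by simp
    then have d: "k div ?m < rdim reg" "k mod ?m < ?m" by (auto intro: div_less_of_mult mod_less_of_mult)
    obtain t h where th: "h \<in> carrier G" "ecol (rdim reg) (k div ?m) = bvec t h" using reg_basis[OF d(1)] by blast
    have "covers F (kron (bvec t h) (1\<^sub>m ?m) * ecol ?m (k mod ?m))"
      using Sb[OF th(1)] by (intro covers_mult_right) auto
    also have "kron (bvec t h) (1\<^sub>m ?m) * ecol ?m (k mod ?m) = kron (ecol (rdim reg) (k div ?m)) (ecol ?m (k mod ?m))"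
      by (simp add: kr th(2))
    also have "\<dots> = ecol (rdim ?P) k" using d by (simp add: kron_ecol)
    finally show "covers F (ecol (rdim ?P) k)" .
  qed
qed (simp_all add: reg)

end

section \<open>The isomorphism of Green rings\<close>

lemma additive_map:
  fixes S :: "('a, 'c) ring_scheme" and T :: "('b, 'd) ring_scheme"
  assumes S: "abelian_group S" and T: "abelian_group T"
    and cl: "\<And>x. x \<in> carrier S \<Longrightarrow> \<phi> x \<in> carrier T"
    and add: "\<And>x y. x \<in> carrier S \<Longrightarrow> y \<in> carrier S \<Longrightarrow> \<phi> (x \<oplus>\<^bsub>S\<^esub> y) = \<phi> x \<oplus>\<^bsub>T\<^esub> \<phi> y"
  shows "\<phi> \<zero>\<^bsub>S\<^esub> = \<zero>\<^bsub>T\<^esub>"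
    "x \<in> carrier S \<Longrightarrow> y \<in> carrier S \<Longrightarrow> \<phi> (x \<ominus>\<^bsub>S\<^esub> y) = \<phi> x \<ominus>\<^bsub>T\<^esub> \<phi> y"
proof -
  interpret S: abelian_group S by fact
  interpret T: abelian_group T by fact
  show 0: "\<phi> \<zero>\<^bsub>S\<^esub> = \<zero>\<^bsub>T\<^esub>"
    using add[of "\<zero>\<^bsub>S\<^esub>" "\<zero>\<^bsub>S\<^esub>"] cl[of "\<zero>\<^bsub>S\<^esub>"] T.add.l_cancel_one'[of "\<phi> \<zero>\<^bsub>S\<^esub>" "\<phi> \<zero>\<^bsub>S\<^esub>"] by simp
  assume xy: "x \<in> carrier S" "y \<in> carrier S"
  have "\<phi> (\<ominus>\<^bsub>S\<^esub> y) = \<ominus>\<^bsub>T\<^esub> \<phi> y"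
    using add[of "\<ominus>\<^bsub>S\<^esub> y" y] xy cl 0 T.minus_equality[of "\<phi> (\<ominus>\<^bsub>S\<^esub> y)" "\<phi> y"] by (simp add: S.l_neg)
  then show "\<phi> (x \<ominus>\<^bsub>S\<^esub> y) = \<phi> x \<ominus>\<^bsub>T\<^esub> \<phi> y" using xy add by (simp add: S.minus_eq T.minus_eq)
qed

lemma (in ring) minus_distrib:
  "a \<in> carrier R \<Longrightarrow> b \<in> carrier R \<Longrightarrow> c \<in> carrier R \<Longrightarrow> (a \<ominus> b) \<otimes> c = a \<otimes> c \<ominus> b \<otimes> c"
  "a \<in> carrier R \<Longrightarrow> b \<in> carrier R \<Longrightarrow> c \<in> carrier R \<Longrightarrow> c \<otimes> (a \<ominus> b) = c \<otimes> a \<ominus> c \<otimes> b"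
  by (simp_all add: minus_eq l_distr r_distr l_minus r_minus)

context tensor_hopf
begin

lemma green_induct [consumes 1, case_names cls minus]:
  assumes "x \<in> carrier (green_ring H)" and "\<And>M. M \<in> reps H \<Longrightarrow> P (green_class H M)"
    and "\<And>x y. x \<in> carrier (green_ring H) \<Longrightarrow> y \<in> carrier (green_ring H) \<Longrightarrow> P x \<Longrightarrow> P y \<Longrightarrow> P (x \<ominus>\<^bsub>green_ring H\<^esub> y)"
  shows "P x"
proof -
  obtain M N where "M \<in> reps H" "N \<in> reps H" "x = green_class H M \<ominus>\<^bsub>green_ring H\<^esub> green_class H N"
    by (rule green_elem[OF assms(1)])
  then show ?thesis using assms(2,3) by simp
qed

definition additive_inv :: "('c, 'm) ring_scheme \<Rightarrow> (('b, 'k) rep \<Rightarrow> 'c) \<Rightarrow> bool"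
  where "additive_inv T F \<longleftrightarrow> abelian_group T \<and> (\<forall>M\<in>reps H. F M \<in> carrier T)
    \<and> (\<forall>M\<in>reps H. \<forall>N\<in>reps H. rep_iso H M N \<longrightarrow> F M = F N)
    \<and> (\<forall>M\<in>reps H. \<forall>N\<in>reps H. F (rep_sum H M N) = F M \<oplus>\<^bsub>T\<^esub> F N)"

text \<open>The map supplied by \<open>green_extend\<close>, chosen once so that its properties have
  the same form for inflation and for every coordinate map.\<close>

definition extension :: "('c, 'm) ring_scheme \<Rightarrow> (('b, 'k) rep \<Rightarrow> 'c) \<Rightarrow> (('b, 'k) rep set \<Rightarrow>\<^sub>0 int) set \<Rightarrow> 'c"
  where "extension T F = (SOME \<phi>. (\<forall>x\<in>carrier (green_ring H). \<phi> x \<in> carrier T) \<and> (\<forall>M\<in>reps H. \<phi> (green_class H M) = F M)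
    \<and> (\<forall>x\<in>carrier (green_ring H). \<forall>y\<in>carrier (green_ring H). \<phi> (x \<oplus>\<^bsub>green_ring H\<^esub> y) = \<phi> x \<oplus>\<^bsub>T\<^esub> \<phi> y))"

lemma extension:
  assumes "additive_inv T F"
  shows "x \<in> carrier (green_ring H) \<Longrightarrow> extension T F x \<in> carrier T"
    "M \<in> reps H \<Longrightarrow> extension T F (green_class H M) = F M"
    "x \<in> carrier (green_ring H) \<Longrightarrow> y \<in> carrier (green_ring H) \<Longrightarrow> extension T F (x \<oplus>\<^bsub>green_ring H\<^esub> y) = extension T F x \<oplus>\<^bsub>T\<^esub> extension T F y"
    "x \<in> carrier (green_ring H) \<Longrightarrow> y \<in> carrier (green_ring H) \<Longrightarrow> extension T F (x \<ominus>\<^bsub>green_ring H\<^esub> y) = extension T F x \<ominus>\<^bsub>T\<^esub> extension T F y"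
    "extension T F \<zero>\<^bsub>green_ring H\<^esub> = \<zero>\<^bsub>T\<^esub>"
proof -
  have T: "abelian_group T" using assms by (simp add: additive_inv_def)
  obtain \<phi> where "\<And>x. x \<in> carrier (green_ring H) \<Longrightarrow> \<phi> x \<in> carrier T"
    "\<And>M. M \<in> reps H \<Longrightarrow> \<phi> (green_class H M) = F M"
    "\<And>x y. x \<in> carrier (green_ring H) \<Longrightarrow> y \<in> carrier (green_ring H) \<Longrightarrow> \<phi> (x \<oplus>\<^bsub>green_ring H\<^esub> y) = \<phi> x \<oplus>\<^bsub>T\<^esub> \<phi> y"
    by (rule green_extend[OF T, of F]) (use assms in \<open>auto simp: additive_inv_def\<close>)
  then have "\<exists>\<phi>. (\<forall>x\<in>carrier (green_ring H). \<phi> x \<in> carrier T) \<and> (\<forall>M\<in>reps H. \<phi> (green_class H M) = F M)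
    \<and> (\<forall>x\<in>carrier (green_ring H). \<forall>y\<in>carrier (green_ring H). \<phi> (x \<oplus>\<^bsub>green_ring H\<^esub> y) = \<phi> x \<oplus>\<^bsub>T\<^esub> \<phi> y)" by blast
  from someI_ex[OF this, folded extension_def]
  have *: "\<And>x. x \<in> carrier (green_ring H) \<Longrightarrow> extension T F x \<in> carrier T"
    "\<And>M. M \<in> reps H \<Longrightarrow> extension T F (green_class H M) = F M"
    "\<And>x y. x \<in> carrier (green_ring H) \<Longrightarrow> y \<in> carrier (green_ring H) \<Longrightarrow> extension T F (x \<oplus>\<^bsub>green_ring H\<^esub> y) = extension T F x \<oplus>\<^bsub>T\<^esub> extension T F y"
    by blast+
  interpret R: ring "green_ring H" by (rule green_ring)
  show "x \<in> carrier (green_ring H) \<Longrightarrow> extension T F x \<in> carrier T"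
    "M \<in> reps H \<Longrightarrow> extension T F (green_class H M) = F M"
    "x \<in> carrier (green_ring H) \<Longrightarrow> y \<in> carrier (green_ring H) \<Longrightarrow> extension T F (x \<oplus>\<^bsub>green_ring H\<^esub> y) = extension T F x \<oplus>\<^bsub>T\<^esub> extension T F y"
    by (fact *)+
  show "x \<in> carrier (green_ring H) \<Longrightarrow> y \<in> carrier (green_ring H) \<Longrightarrow> extension T F (x \<ominus>\<^bsub>green_ring H\<^esub> y) = extension T F x \<ominus>\<^bsub>T\<^esub> extension T F y"
    "extension T F \<zero>\<^bsub>green_ring H\<^esub> = \<zero>\<^bsub>T\<^esub>"
    using additive_map[OF R.is_abelian_group T *(1,3)] by blast+
qed

end

context datum
begin

sublocale RH: ring "green_ring H" by (rule TH.green_ring)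
sublocale RK: ring "green_ring K" by (rule TK.green_ring)

abbreviation "RH \<equiv> green_ring H"
abbreviation "RK \<equiv> green_ring K"
abbreviation "gH \<equiv> green_class H"
abbreviation "gK \<equiv> green_class K"

lemma infl_additive: "TK.additive_inv RH (\<lambda>V. gH (infl V))"
  unfolding TK.additive_inv_def
proof (intro conjI ballI impI)
  show "abelian_group RH" by (rule RH.is_abelian_group)
  fix V W assume "V \<in> reps K" "W \<in> reps K" "rep_iso K V W"
  then show "gH (infl V) = gH (infl W)" by (intro TH.green_class_cong infl_iso infl(1))
qed (simp_all add: infl infl_sum TH.green_class_sum)

definition \<iota> where "\<iota> = TK.extension RH (\<lambda>V. gH (infl V))"

lemmas \<iota> = TK.extension[OF infl_additive, folded \<iota>_def]

lemma \<iota>_mult: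
  assumes "x \<in> carrier RK" "y \<in> carrier RK"
  shows "\<iota> (x \<otimes>\<^bsub>RK\<^esub> y) = \<iota> x \<otimes>\<^bsub>RH\<^esub> \<iota> y"
  using assms(1)
proof (induction x rule: TK.green_induct)
  case (cls V)
  show ?case using assms(2)
  proof (induction y rule: TK.green_induct)
    case W: (cls W)
    then show ?case using cls
      by (simp add: TK.green_class_tensor[symmetric] \<iota>(2) TK.tensor_rep infl_tensor TH.green_class_tensor infl)
  next
    case (minus y z)
    then show ?case using cls by (simp add: RK.minus_distrib RH.minus_distrib \<iota> infl)
  qed
next
  case (minus x z)
  then show ?case using assms(2) by (simp add: RK.minus_distrib RH.minus_distrib \<iota>)
qed

lemma \<iota>_one: "\<iota> \<one>\<^bsub>RK\<^esub> = \<one>\<^bsub>RH\<^esub>"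
  using \<iota>(2)[OF TK.unit_rep] by (simp add: TK.green_class_unit infl_unit TH.green_class_unit)

definition e :: "nat \<Rightarrow> ((nat \<times> 'g, 'k) rep set \<Rightarrow>\<^sub>0 int) set" where "e j = gH (Mj j)"

lemma e_closed [simp]: "j \<le> n \<Longrightarrow> e j \<in> carrier RH"
  by (simp add: e_def Mj)

lemma e_0: "e 0 = \<zero>\<^bsub>RH\<^esub>"
  using rep_dim0_eq[of "Mj 0" H] by (simp add: e_def Mj TH.green_class_zero)

lemma e_1: "e (Suc 0) = \<one>\<^bsub>RH\<^esub>"
proof -
  have "Mj (Suc 0) = rep_unit H"
    using n2 by (intro rep_eqI_H) (auto simp: Mj unit_H mat_diag_index shiftm_def intro!: eq_matI)
  then show ?thesis by (simp add: e_def TH.green_class_unit)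
qed

lemma gH_Ind: "V \<in> reps K \<Longrightarrow> j \<le> n \<Longrightarrow> gH (Ind j V) = \<iota> (gK V) \<otimes>\<^bsub>RH\<^esub> e j"
  by (simp add: Ind_def TH.green_class_tensor infl Mj \<iota>(2) e_def)

lemma e_2_mult:
  assumes "0 < i" "i < n"
  shows "e 2 \<otimes>\<^bsub>RH\<^esub> e i = e (Suc i) \<oplus>\<^bsub>RH\<^esub> \<iota> (gK A1) \<otimes>\<^bsub>RH\<^esub> e (i - 1)"
proof -
  have reps: "Mj (Suc i) \<in> reps H" "Ind (i - 1) A1 \<in> reps H" "Mj 2 \<in> reps H" "Mj i \<in> reps H"
    using assms n2 by (auto intro!: Mj(1) Ind(1) A1(1))
  have "gH (rep_sum H (Mj (Suc i)) (Ind (i - 1) A1)) = gH (rep_tensor H (Mj 2) (Mj i))"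
    using reps by (intro TH.green_class_cong clebsch_gordan assms rep_sum_rep tensor_H(1))
  then show ?thesis
    using assms reps by (simp add: TH.green_class_sum TH.green_class_tensor gH_Ind A1(1)) (simp add: e_def)
qed

lemma e_2_mult_n: "e 2 \<otimes>\<^bsub>RH\<^esub> e n = e n \<oplus>\<^bsub>RH\<^esub> \<iota> (gK A1) \<otimes>\<^bsub>RH\<^esub> e n"
proof -
  have reps: "Mj n \<in> reps H" "Ind n A1 \<in> reps H" "Mj 2 \<in> reps H"
    using n2 by (auto intro!: Mj(1) Ind(1) A1(1))
  have "gH (rep_sum H (Mj n) (Ind n A1)) = gH (rep_tensor H (Mj 2) (Mj n))"
    using reps by (intro TH.green_class_cong clebsch_gordan_n rep_sum_rep tensor_H(1))
  then show ?thesis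
    using reps by (simp add: TH.green_class_sum TH.green_class_tensor gH_Ind A1(1)) (simp add: e_def)
qed

text \<open>Coefficients stand on the left of the e_r, so e_2 has to be moved past them before the
  rules for e_2 e_r apply.\<close>

lemma e_2_commute:
  assumes "x \<in> carrier RK"
  shows "e 2 \<otimes>\<^bsub>RH\<^esub> \<iota> x = \<iota> x \<otimes>\<^bsub>RH\<^esub> e 2"
  using assms
proof (induction x rule: TK.green_induct)
  case (cls V)
  have reps: "infl V \<in> reps H" "Mj 2 \<in> reps H" using cls n2 by (auto intro: infl(1) Mj(1))
  have "gH (rep_tensor H (infl V) (Mj 2)) = gH (rep_tensor H (Mj 2) (infl V))"
    using reps by (intro TH.green_class_cong M2_commute cls tensor_H(1))
  then show ?case using reps cls by (simp add: TH.green_class_tensor \<iota>(2) e_def)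
next
  case (minus x y)
  then show ?case using n2 by (simp add: RH.minus_distrib \<iota>)
qed

subsection \<open>Coordinates\<close>

lemma peel_off:
  assumes M: "M \<in> reps H" and d: "rdim M > 0"
  obtains r V N where "0 < r" "r \<le> n" "V \<in> reps K" "N \<in> reps H" "rep_iso H M (rep_sum H (Ind r V) N)" "rdim N < rdim M"
proof -
  define r where "r = (LEAST r. Y M ^\<^sub>m r = 0\<^sub>m (rdim M) (rdim M))"
  have r: "Y M ^\<^sub>m r = 0\<^sub>m (rdim M) (rdim M)" unfolding r_def by (rule LeastI[of _ n]) (rule Y_pow_n[OF M])
  have rn: "r \<le> n" unfolding r_def by (rule Least_le) (rule Y_pow_n[OF M])
  have r0: "0 < r"
  proof (rule ccontr)
    assume "\<not> 0 < r"
    then have "tch M 0 \<one> = 0" using tch_zero_iff[OF M, of r] r by simp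
    then show False using d by (simp add: tch_0 M)
  qed
  have "Y M ^\<^sub>m (r - 1) \<noteq> 0\<^sub>m (rdim M) (rdim M)"
    using not_less_Least[of "r - 1" "\<lambda>r. Y M ^\<^sub>m r = 0\<^sub>m (rdim M) (rdim M)"] r0 unfolding r_def by auto
  then have tnz: "tch M (r - 1) \<one> \<noteq> 0" using tch_zero_iff[OF M] by simp
  obtain V N where V: "V \<in> reps K" "N \<in> reps H" "rep_iso H M (rep_sum H (Ind r V) N)"
    "\<And>h. h \<in> carrier G \<Longrightarrow> ch V h = tch M (r - 1) h" by (rule peel[OF M r0 rn r]) blast
  have "of_nat (rdim V) \<noteq> (0 :: 'k)" using V(1) V(4)[of \<one>] tnz by simp
  then have "rdim V > 0" by (cases "rdim V = 0") simp_all
  then have "rdim N < rdim M" using rep_iso_dim[OF V(3)] r0 by simp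
  then show ?thesis by (rule that[OF r0 rn V(1-3)])
qed

text \<open>The character of the multiplicity space \<open>V\<close> of \<open>Ind j V\<close> in a module.\<close>

definition vch :: "nat \<Rightarrow> (nat \<times> 'g, 'k) rep \<Rightarrow> 'g \<Rightarrow> 'k"
  where "vch j M h = tch M (j - 1) h - tch M j h - inverse (\<chi> h) * (tch M j h - tch M (Suc j) h)"

lemma vch_iso: "M \<in> reps H \<Longrightarrow> N \<in> reps H \<Longrightarrow> rep_iso H M N \<Longrightarrow> h \<in> carrier G \<Longrightarrow> vch j M h = vch j N h"
  by (simp add: vch_def tch_iso)

lemma vch_sum: "M \<in> reps H \<Longrightarrow> N \<in> reps H \<Longrightarrow> h \<in> carrier G \<Longrightarrow> vch j (rep_sum H M N) h = vch j M h + vch j N h"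
  by (simp add: vch_def tch_sum algebra_simps)

text \<open>On V \<otimes> M_r the difference of \<open>tch\<close> at j - 1 and j is
  \<chi>^{-(r-j)} times the character of V for j <= r, and zero otherwise; the next difference,
  twisted by \<chi>^{-1}, cancels it except at j = r.\<close>

lemma vch_Ind:
  assumes V: "V \<in> reps K" and r: "r \<le> n" and j: "0 < j" and h: "h \<in> carrier G"
  shows "vch j (Ind r V) h = (if j = r then ch V h else 0)"
proof -
  let ?S = "\<lambda>m. \<Sum>t<m. inverse (\<chi> h) ^ t"
  have "?S (r - (j - 1)) - ?S (r - j) - inverse (\<chi> h) * (?S (r - j) - ?S (r - Suc j)) = (if j = r then 1 else 0)"
  proof (cases "r \<le> j")
    case True
    then have "r - j = 0" "r - Suc j = 0" "r - (j - 1) = (if j = r then 1 else 0)" using j by auto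
    then show ?thesis by simp
  next
    case False
    then obtain m where m: "r - j = Suc m" "r - Suc j = m" "r - (j - 1) = Suc (Suc m)" using j
      by (cases "r - j") auto
    show ?thesis unfolding m using False by simp
  qed
  then have "ch V h * (?S (r - (j - 1)) - ?S (r - j) - inverse (\<chi> h) * (?S (r - j) - ?S (r - Suc j))) = (if j = r then ch V h else 0)"
    by simp
  then show ?thesis by (simp add: vch_def tch_Ind[OF V r h] algebra_simps)
qed

text \<open>A combination of characters need not belong to a module; that this one does follows by
  splitting off summands with \<open>peel_off\<close>.\<close>

lemma vch_exists:
  assumes "M \<in> reps H" "0 < j"
  shows "\<exists>V\<in>reps K. \<forall>h\<in>carrier G. ch V h = vch j M h"
  using assms(1)
proof (induction "rdim M" arbitrary: M rule: less_induct)
  case less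
  show ?case
  proof (cases "rdim M = 0")
    case True
    have "vch j M h = 0" if "h \<in> carrier G" for h
      using less(2) True that by (simp add: vch_def tch_def tr_def)
    then show ?thesis by (intro bexI[of _ "zero_rep K"]) (auto simp: ch_def tr_def)
  next
    case False
    then obtain r V N where r: "0 < r" "r \<le> n" "V \<in> reps K" "N \<in> reps H" "rep_iso H M (rep_sum H (Ind r V) N)" "rdim N < rdim M"
      using peel_off[OF less(2)] by blast
    obtain W where W: "W \<in> reps K" "\<And>h. h \<in> carrier G \<Longrightarrow> ch W h = vch j N h" using less(1)[OF r(6,4)] by blast
    have I: "Ind r V \<in> reps H" by (rule Ind(1)[OF r(3,2)])
    have v: "vch j M h = (if j = r then ch V h else 0) + ch W h" if h: "h \<in> carrier G" for h
      using vch_iso[OF less(2) rep_sum_rep[OF I r(4)] r(5) h, of j] vch_sum[OF I r(4) h, of j]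
        vch_Ind[OF r(3,2) assms(2) h] W(2)[OF h] by simp
    show ?thesis
    proof (cases "j = r")
      case True
      then show ?thesis using v r(3) W by (intro bexI[of _ "rep_sum K V W"]) (auto simp: ch_sum rep_sum_rep)
    next
      case False
      then show ?thesis using v W by (intro bexI[of _ W]) auto
    qed
  qed
qed

definition vrep :: "nat \<Rightarrow> (nat \<times> 'g, 'k) rep \<Rightarrow> ('g, 'k) rep"
  where "vrep j M = (SOME V. V \<in> reps K \<and> (\<forall>h\<in>carrier G. ch V h = vch j M h))"

lemma vrep: "M \<in> reps H \<Longrightarrow> 0 < j \<Longrightarrow> vrep j M \<in> reps K"
  "M \<in> reps H \<Longrightarrow> 0 < j \<Longrightarrow> h \<in> carrier G \<Longrightarrow> ch (vrep j M) h = vch j M h"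
proof -
  have "M \<in> reps H \<Longrightarrow> 0 < j \<Longrightarrow> vrep j M \<in> reps K \<and> (\<forall>h\<in>carrier G. ch (vrep j M) h = vch j M h)"
    using someI_ex[of "\<lambda>V. V \<in> reps K \<and> (\<forall>h\<in>carrier G. ch V h = vch j M h)"] vch_exists[of M j]
    unfolding vrep_def by blast
  then show "M \<in> reps H \<Longrightarrow> 0 < j \<Longrightarrow> vrep j M \<in> reps K"
    "M \<in> reps H \<Longrightarrow> 0 < j \<Longrightarrow> h \<in> carrier G \<Longrightarrow> ch (vrep j M) h = vch j M h" by blast+
qed

lemma gK_eqI: "V \<in> reps K \<Longrightarrow> W \<in> reps K \<Longrightarrow> (\<And>h. h \<in> carrier G \<Longrightarrow> ch V h = ch W h) \<Longrightarrow> gK V = gK W"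
  by (intro TK.green_class_cong K_iso_of_ch)

lemma vrep_additive:
  assumes j: "0 < j"
  shows "TH.additive_inv RK (\<lambda>M. gK (vrep j M))"
  unfolding TH.additive_inv_def
proof (intro conjI ballI impI)
  show "abelian_group RK" by (rule RK.is_abelian_group)
  fix M N assume MN: "M \<in> reps H" "N \<in> reps H"
  have "gK (vrep j (rep_sum H M N)) = gK (rep_sum K (vrep j M) (vrep j N))"
    using MN j by (intro gK_eqI) (auto simp: vrep rep_sum_rep vch_sum ch_sum)
  then show "gK (vrep j (rep_sum H M N)) = gK (vrep j M) \<oplus>\<^bsub>RK\<^esub> gK (vrep j N)"
    using MN j by (simp add: TK.green_class_sum vrep)
next
  fix M N assume "M \<in> reps H" "N \<in> reps H" "rep_iso H M N"
  then show "gK (vrep j M) = gK (vrep j N)" using j by (intro gK_eqI) (auto simp: vrep vch_iso)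
qed (use j in \<open>auto simp: vrep\<close>)

definition v :: "nat \<Rightarrow> ((nat \<times> 'g, 'k) rep set \<Rightarrow>\<^sub>0 int) set \<Rightarrow> (('g, 'k) rep set \<Rightarrow>\<^sub>0 int) set"
  where "v j = TH.extension RK (\<lambda>M. gK (vrep j M))"

lemmas v = TH.extension[OF vrep_additive, folded v_def]

text \<open>Linear independence of the e_r over r(kG): the coordinates are dual to them.\<close>

lemma v_\<iota>_e:
  assumes x: "x \<in> carrier RK" and r: "r \<le> n" and j: "0 < j"
  shows "v j (\<iota> x \<otimes>\<^bsub>RH\<^esub> e r) = (if j = r then x else \<zero>\<^bsub>RK\<^esub>)"
  using x
proof (induction x rule: TK.green_induct)
  case (cls V)
  have I: "Ind r V \<in> reps H" by (rule Ind(1)[OF cls r])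
  have "v j (\<iota> (gK V) \<otimes>\<^bsub>RH\<^esub> e r) = gK (vrep j (Ind r V))"
    using gH_Ind[OF cls r] v(2)[OF j I] by simp
  also have "\<dots> = gK (if j = r then V else zero_rep K)"
    using cls I j r by (intro gK_eqI) (auto simp: vrep vch_Ind, simp add: ch_def tr_def)
  finally show ?case by (simp add: TK.green_class_zero)
next
  case (minus x y)
  then show ?case using r j by (simp add: \<iota> RH.minus_distrib v)
qed

text \<open>The spanning half of freeness: splitting off summands V \<otimes> M_r repeatedly writes
  a class as a sum of products x e_r with r > 0.\<close>

lemma RH_induct [consumes 1, case_names add minus gen]:
  assumes u: "u \<in> carrier RH"
    and add: "\<And>x y. x \<in> carrier RH \<Longrightarrow> y \<in> carrier RH \<Longrightarrow> P x \<Longrightarrow> P y \<Longrightarrow> P (x \<oplus>\<^bsub>RH\<^esub> y)"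
    and minus: "\<And>x y. x \<in> carrier RH \<Longrightarrow> y \<in> carrier RH \<Longrightarrow> P x \<Longrightarrow> P y \<Longrightarrow> P (x \<ominus>\<^bsub>RH\<^esub> y)"
    and gen: "\<And>x r. x \<in> carrier RK \<Longrightarrow> 0 < r \<Longrightarrow> r \<le> n \<Longrightarrow> P (\<iota> x \<otimes>\<^bsub>RH\<^esub> e r)"
  shows "P u"
  using u
proof (induction u rule: TH.green_induct)
  case (minus x y)
  then show ?case by (rule assms(3))
next
  case (cls M)
  then show ?case
  proof (induction "rdim M" arbitrary: M rule: less_induct)
    case less
    show ?case
    proof (cases "rdim M = 0")
      case True
      then have "gH M = \<zero>\<^bsub>RH\<^esub>" using rep_dim0_eq[OF less(2)] TH.green_class_zero by simp
      \<comment> \<open>The zero class has the required form as 0 e_1.\<close>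
      moreover have "\<iota> \<zero>\<^bsub>RK\<^esub> \<otimes>\<^bsub>RH\<^esub> e (Suc 0) = \<zero>\<^bsub>RH\<^esub>" using n2 by (simp add: \<iota>)
      ultimately show ?thesis using gen[of "\<zero>\<^bsub>RK\<^esub>" "Suc 0"] n2 by simp
    next
      case False
      then obtain r V N where r: "0 < r" "r \<le> n" "V \<in> reps K" "N \<in> reps H" "rep_iso H M (rep_sum H (Ind r V) N)" "rdim N < rdim M"
        using peel_off[OF less(2)] by blast
      have I: "Ind r V \<in> reps H" by (rule Ind(1)[OF r(3,2)])
      have "gH M = gH (rep_sum H (Ind r V) N)" by (rule TH.green_class_cong[OF less(2) rep_sum_rep[OF I r(4)] r(5)])
      also have "\<dots> = \<iota> (gK V) \<otimes>\<^bsub>RH\<^esub> e r \<oplus>\<^bsub>RH\<^esub> gH N" using I r by (simp add: TH.green_class_sum gH_Ind)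
      finally have eq: "gH M = \<iota> (gK V) \<otimes>\<^bsub>RH\<^esub> e r \<oplus>\<^bsub>RH\<^esub> gH N" .
      show ?thesis unfolding eq
        using r by (intro add gen less(1)[OF r(6,4)] RH.m_closed \<iota>(1) e_closed) simp_all
    qed
  qed
qed

end

section \<open>Change of coefficients along a ring homomorphism of r(kG)\<close>

locale two_data = D: datum G \<chi> g n + E: datum G \<chi>' g n for G :: "('g, 'm) monoid_scheme" (structure)
    and \<chi> \<chi>' :: "'g \<Rightarrow> 'k::field_char_0" and g :: 'g and n :: nat +
  fixes \<delta> :: "(('g, 'k) rep set \<Rightarrow>\<^sub>0 int) set \<Rightarrow> (('g, 'k) rep set \<Rightarrow>\<^sub>0 int) set"
  assumes \<delta>_hom: "\<delta> \<in> Ring.ring_hom D.RK D.RK" and \<delta>_A1: "\<delta> (D.gK D.A1) = D.gK E.A1"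
begin

abbreviation "RK \<equiv> D.RK"

lemma \<delta> [simp]: "x \<in> carrier RK \<Longrightarrow> \<delta> x \<in> carrier RK"
  "x \<in> carrier RK \<Longrightarrow> y \<in> carrier RK \<Longrightarrow> \<delta> (x \<oplus>\<^bsub>RK\<^esub> y) = \<delta> x \<oplus>\<^bsub>RK\<^esub> \<delta> y"
  "x \<in> carrier RK \<Longrightarrow> y \<in> carrier RK \<Longrightarrow> \<delta> (x \<otimes>\<^bsub>RK\<^esub> y) = \<delta> x \<otimes>\<^bsub>RK\<^esub> \<delta> y"
  "\<delta> \<one>\<^bsub>RK\<^esub> = \<one>\<^bsub>RK\<^esub>"
  by (fact ring_hom_closed[OF \<delta>_hom] ring_hom_add[OF \<delta>_hom] ring_hom_mult[OF \<delta>_hom] ring_hom_one[OF \<delta>_hom])+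

lemma \<delta>_zero [simp]: "\<delta> \<zero>\<^bsub>RK\<^esub> = \<zero>\<^bsub>RK\<^esub>"
  by (rule additive_map(1)[OF D.RK.is_abelian_group D.RK.is_abelian_group]) simp_all

definition \<Phi> where "\<Phi> u = (\<Oplus>\<^bsub>E.RH\<^esub>j\<in>{1..n}. E.\<iota> (\<delta> (D.v j u)) \<otimes>\<^bsub>E.RH\<^esub> E.e j)"

lemma \<Phi>_term: "u \<in> carrier D.RH \<Longrightarrow> j \<in> {1..n} \<Longrightarrow> E.\<iota> (\<delta> (D.v j u)) \<otimes>\<^bsub>E.RH\<^esub> E.e j \<in> carrier E.RH"
  by (intro E.RH.m_closed E.\<iota>(1) E.e_closed \<delta>(1) D.v(1)) auto

lemma \<Phi>_closed [simp]: "u \<in> carrier D.RH \<Longrightarrow> \<Phi> u \<in> carrier E.RH"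
  unfolding \<Phi>_def by (intro E.RH.finsum_closed) (use \<Phi>_term in auto)

lemma \<Phi>_add: "u \<in> carrier D.RH \<Longrightarrow> w \<in> carrier D.RH \<Longrightarrow> \<Phi> (u \<oplus>\<^bsub>D.RH\<^esub> w) = \<Phi> u \<oplus>\<^bsub>E.RH\<^esub> \<Phi> w"
proof -
  assume uw: "u \<in> carrier D.RH" "w \<in> carrier D.RH"
  have "\<Phi> (u \<oplus>\<^bsub>D.RH\<^esub> w) = (\<Oplus>\<^bsub>E.RH\<^esub>j\<in>{1..n}. E.\<iota> (\<delta> (D.v j u)) \<otimes>\<^bsub>E.RH\<^esub> E.e j \<oplus>\<^bsub>E.RH\<^esub> E.\<iota> (\<delta> (D.v j w)) \<otimes>\<^bsub>E.RH\<^esub> E.e j)"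
    unfolding \<Phi>_def
  proof (intro E.RH.finsum_cong' refl)
    fix j assume j: "j \<in> {1..n}"
    then have j': "0 < j" "j \<le> n" by auto
    show "E.\<iota> (\<delta> (D.v j (u \<oplus>\<^bsub>D.RH\<^esub> w))) \<otimes>\<^bsub>E.RH\<^esub> E.e j =
        E.\<iota> (\<delta> (D.v j u)) \<otimes>\<^bsub>E.RH\<^esub> E.e j \<oplus>\<^bsub>E.RH\<^esub> E.\<iota> (\<delta> (D.v j w)) \<otimes>\<^bsub>E.RH\<^esub> E.e j"
      using uw j' by (simp add: D.v E.\<iota> E.RH.l_distr)
  qed (use \<Phi>_term uw in auto)
  also have "\<dots> = \<Phi> u \<oplus>\<^bsub>E.RH\<^esub> \<Phi> w"
    unfolding \<Phi>_def using \<Phi>_term uw by (intro E.RH.finsum_addf) auto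
  finally show ?thesis .
qed

lemmas \<Phi>_zero = additive_map(1)[of D.RH E.RH \<Phi>, OF D.RH.is_abelian_group E.RH.is_abelian_group \<Phi>_closed \<Phi>_add]
lemmas \<Phi>_minus = additive_map(2)[of D.RH E.RH \<Phi>, OF D.RH.is_abelian_group E.RH.is_abelian_group \<Phi>_closed \<Phi>_add]

lemma \<Phi>_\<iota>_e:
  assumes x: "x \<in> carrier RK" and r: "r \<le> n"
  shows "\<Phi> (D.\<iota> x \<otimes>\<^bsub>D.RH\<^esub> D.e r) = E.\<iota> (\<delta> x) \<otimes>\<^bsub>E.RH\<^esub> E.e r"
proof (cases "r = 0")
  case True
  then show ?thesis using x by (simp add: D.e_0 E.e_0 D.\<iota> E.\<iota> \<Phi>_zero)
next
  case False
  have "\<Phi> (D.\<iota> x \<otimes>\<^bsub>D.RH\<^esub> D.e r) = (\<Oplus>\<^bsub>E.RH\<^esub>j\<in>{1..n}. if r = j then E.\<iota> (\<delta> x) \<otimes>\<^bsub>E.RH\<^esub> E.e j else \<zero>\<^bsub>E.RH\<^esub>)"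
    unfolding \<Phi>_def using x r
    by (intro E.RH.finsum_cong' refl) (auto simp: D.v_\<iota>_e E.\<iota>)
  also have "\<dots> = E.\<iota> (\<delta> x) \<otimes>\<^bsub>E.RH\<^esub> E.e r"
    using x r False by (intro E.RH.finsum_singleton) (auto simp: E.\<iota>)
  finally show ?thesis .
qed

lemma \<Phi>_\<iota>: "x \<in> carrier RK \<Longrightarrow> \<Phi> (D.\<iota> x) = E.\<iota> (\<delta> x)"
  using \<Phi>_\<iota>_e[of x "Suc 0"] D.n2 by (simp add: D.e_1 E.e_1 D.\<iota> E.\<iota>)

lemma \<Phi>_one: "\<Phi> \<one>\<^bsub>D.RH\<^esub> = \<one>\<^bsub>E.RH\<^esub>"
  using \<Phi>_\<iota>[of "\<one>\<^bsub>RK\<^esub>"] by (simp add: D.\<iota>_one E.\<iota>_one)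

lemma \<Phi>_e: "r \<le> n \<Longrightarrow> \<Phi> (D.e r) = E.e r"
  using \<Phi>_\<iota>_e[of "\<one>\<^bsub>RK\<^esub>" r] by (simp add: D.\<iota>_one E.\<iota>_one)

lemma \<Phi>_\<iota>_mult:
  assumes x: "x \<in> carrier RK" and u: "u \<in> carrier D.RH"
  shows "\<Phi> (D.\<iota> x \<otimes>\<^bsub>D.RH\<^esub> u) = E.\<iota> (\<delta> x) \<otimes>\<^bsub>E.RH\<^esub> \<Phi> u"
  using u
proof (induction u rule: D.RH_induct)
  case (gen y r)
  have "D.\<iota> x \<otimes>\<^bsub>D.RH\<^esub> (D.\<iota> y \<otimes>\<^bsub>D.RH\<^esub> D.e r) = D.\<iota> (x \<otimes>\<^bsub>RK\<^esub> y) \<otimes>\<^bsub>D.RH\<^esub> D.e r"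
    using gen x by (simp add: D.\<iota>_mult D.\<iota> D.RH.m_assoc)
  then show ?case using gen x by (simp add: \<Phi>_\<iota>_e E.\<iota>_mult E.\<iota> E.RH.m_assoc)
qed (use x in \<open>simp_all add: D.RH.r_distr E.RH.r_distr D.RH.minus_distrib E.RH.minus_distrib \<Phi>_add \<Phi>_minus D.\<iota> E.\<iota>\<close>)

text \<open>The rules for e_2 e_r have the same shape over both data, with a replaced by
  \<delta>(a); e_2 is first moved past the coefficient x.\<close>

lemma \<Phi>_e2_mult:
  assumes u: "u \<in> carrier D.RH"
  shows "\<Phi> (D.e 2 \<otimes>\<^bsub>D.RH\<^esub> u) = E.e 2 \<otimes>\<^bsub>E.RH\<^esub> \<Phi> u"
  using u
proof (induction u rule: D.RH_induct)
  case (gen x r)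
  note n2 = D.n2
  have c [simp]: "D.e 2 \<in> carrier D.RH" "E.e 2 \<in> carrier E.RH" "D.\<iota> x \<in> carrier D.RH" "E.\<iota> (\<delta> x) \<in> carrier E.RH"
    "D.e r \<in> carrier D.RH" "E.e r \<in> carrier E.RH"
    using gen n2 by (auto simp: D.\<iota> E.\<iota>)
  have a [simp]: "D.gK D.A1 \<in> carrier RK" "D.gK E.A1 \<in> carrier RK" "D.\<iota> (D.gK D.A1) \<in> carrier D.RH" "E.\<iota> (D.gK E.A1) \<in> carrier E.RH"
    by (auto intro!: D.\<iota>(1) E.\<iota>(1) simp: D.A1 E.A1)
  have key: "\<Phi> (D.e 2 \<otimes>\<^bsub>D.RH\<^esub> D.e r) = E.e 2 \<otimes>\<^bsub>E.RH\<^esub> E.e r"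
  proof (cases "r = n")
    case True
    then show ?thesis using n2 D.e_2_mult_n E.e_2_mult_n
      by (simp add: \<Phi>_add \<Phi>_e \<Phi>_\<iota>_e \<delta>_A1)
  next
    case False
    then have "r < n" "r - 1 \<le> n" "Suc r \<le> n" using gen by auto
    then show ?thesis using gen D.e_2_mult[of r] E.e_2_mult[of r]
      by (simp add: \<Phi>_add \<Phi>_e \<Phi>_\<iota>_e \<delta>_A1)
  qed
  have "D.e 2 \<otimes>\<^bsub>D.RH\<^esub> (D.\<iota> x \<otimes>\<^bsub>D.RH\<^esub> D.e r) = D.\<iota> x \<otimes>\<^bsub>D.RH\<^esub> (D.e 2 \<otimes>\<^bsub>D.RH\<^esub> D.e r)"
    using gen by (simp add: D.RH.m_assoc[symmetric] D.e_2_commute)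
  then have "\<Phi> (D.e 2 \<otimes>\<^bsub>D.RH\<^esub> (D.\<iota> x \<otimes>\<^bsub>D.RH\<^esub> D.e r)) = E.\<iota> (\<delta> x) \<otimes>\<^bsub>E.RH\<^esub> (E.e 2 \<otimes>\<^bsub>E.RH\<^esub> E.e r)"
    using gen by (simp add: \<Phi>_\<iota>_mult key)
  also have "\<dots> = E.e 2 \<otimes>\<^bsub>E.RH\<^esub> (E.\<iota> (\<delta> x) \<otimes>\<^bsub>E.RH\<^esub> E.e r)"
    using gen by (simp add: E.RH.m_assoc[symmetric] E.e_2_commute)
  finally show ?case using gen by (simp add: \<Phi>_\<iota>_e)
next
  have c [simp]: "D.e 2 \<in> carrier D.RH" "E.e 2 \<in> carrier E.RH" using D.n2 by auto
  { case (add x y)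
    then show ?case by (simp add: D.RH.r_distr E.RH.r_distr \<Phi>_add) }
  { case (minus x y)
    then show ?case by (simp add: D.RH.minus_distrib E.RH.minus_distrib \<Phi>_minus) }
qed

text \<open>The elements on which left multiplication is respected form a subring. It contains the
  coefficients and e_2, hence every e_r through e_{i+1} = e_2 e_i - a e_{i-1}, and these
  generate.\<close>

lemma \<Phi>_mult:
  assumes u: "u \<in> carrier D.RH" and w: "w \<in> carrier D.RH"
  shows "\<Phi> (u \<otimes>\<^bsub>D.RH\<^esub> w) = \<Phi> u \<otimes>\<^bsub>E.RH\<^esub> \<Phi> w"
proof -
  \<comment> \<open>Membership in the carrier is part of P, so that P describes a subring.\<close>
  define P where "P u \<longleftrightarrow> u \<in> carrier D.RH \<and> (\<forall>w\<in>carrier D.RH. \<Phi> (u \<otimes>\<^bsub>D.RH\<^esub> w) = \<Phi> u \<otimes>\<^bsub>E.RH\<^esub> \<Phi> w)" for u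
  have P_mult: "P (x \<otimes>\<^bsub>D.RH\<^esub> y)" if "P x" "P y" for x y
    using that unfolding P_def by (simp add: D.RH.m_assoc E.RH.m_assoc)
  have P_minus: "P (x \<ominus>\<^bsub>D.RH\<^esub> y)" if "P x" "P y" for x y
    using that unfolding P_def by (simp add: D.RH.minus_distrib E.RH.minus_distrib \<Phi>_minus)
  have P_add: "P (x \<oplus>\<^bsub>D.RH\<^esub> y)" if "P x" "P y" for x y
    using that unfolding P_def by (simp add: D.RH.l_distr E.RH.l_distr \<Phi>_add)
  have P_\<iota>: "P (D.\<iota> x)" if "x \<in> carrier RK" for x
    using that unfolding P_def by (simp add: D.\<iota> \<Phi>_\<iota> \<Phi>_\<iota>_mult)
  have P_e2: "P (D.e 2)"
    using D.n2 unfolding P_def by (simp add: \<Phi>_e \<Phi>_e2_mult)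
  have P_0: "P \<zero>\<^bsub>D.RH\<^esub>" unfolding P_def by (simp add: \<Phi>_zero)
  have P_e: "P (D.e r)" if "r \<le> n" for r
    using that
  proof (induction r rule: less_induct)
    case (less r)
    consider "r = 0" | "r = Suc 0" | "r = 2" | "2 < r" by linarith
    then show ?case
    proof cases
      case 2
      then show ?thesis unfolding P_def by (simp add: D.e_1 \<Phi>_one)
    next
      case 4
      define i where "i = r - 1"
      have i: "r = Suc i" "0 < i" "1 < i" using 4 by (auto simp: i_def)
      have a: "D.gK D.A1 \<in> carrier RK" by (simp add: D.A1)
      have "D.e r = D.e 2 \<otimes>\<^bsub>D.RH\<^esub> D.e i \<ominus>\<^bsub>D.RH\<^esub> D.\<iota> (D.gK D.A1) \<otimes>\<^bsub>D.RH\<^esub> D.e (i - 1)"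
        using D.e_2_mult[of i] i less.prems a
        by (simp add: D.RH.minus_eq D.RH.a_assoc D.RH.r_neg D.\<iota>)
      then show ?thesis
        using less i a by (auto intro!: P_minus P_mult P_e2 P_\<iota>)
    qed (use P_0 P_e2 in \<open>simp_all add: D.e_0\<close>)
  qed
  have "P u" using u
    by (induction u rule: D.RH_induct) (auto intro: P_add P_minus P_mult P_\<iota> P_e)
  then show ?thesis using w by (simp add: P_def)
qed

lemma \<Phi>_hom: "\<Phi> \<in> Ring.ring_hom D.RH E.RH"
  by (rule ring_hom_memI) (simp_all add: \<Phi>_mult \<Phi>_add \<Phi>_one)

end

lemma green_rings_iso:
  fixes G :: "('g, 'm) monoid_scheme" and \<chi> \<chi>' :: "'g \<Rightarrow> 'k::field_char_0"
  assumes D: "datum G \<chi> g n" and E: "datum G \<chi>' g n"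
    and \<delta>: "\<delta> \<in> ring_iso (green_ring (group_algebra G :: ('g, 'k) hopf)) (green_ring (group_algebra G))"
    and \<delta>_A1: "\<delta> (green_class (group_algebra G) (char_rep G (\<lambda>h. inverse (\<chi> h)))) =
      green_class (group_algebra G) (char_rep G (\<lambda>h. inverse (\<chi>' h)))"
  shows "green_ring (datum_hopf G \<chi> g) \<simeq> green_ring (datum_hopf G \<chi>' g)"
proof -
  interpret D: datum G \<chi> g n by (rule D)
  interpret E: datum G \<chi>' g n by (rule E)
  let ?R = "green_ring (group_algebra G :: ('g, 'k) hopf)"
  define \<delta>' where "\<delta>' = inv_into (carrier ?R) \<delta>"
  have \<delta>': "\<delta>' \<in> ring_iso ?R ?R" unfolding \<delta>'_def using ring_iso_set_sym[OF D.RK.ring_axioms \<delta>] by simp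
  have bij: "bij_betw \<delta> (carrier ?R) (carrier ?R)" using \<delta> by (simp add: ring_iso_def)
  then have inv: "\<delta>' (\<delta> x) = x" "\<delta> (\<delta>' x) = x" if "x \<in> carrier ?R" for x
    using that by (auto simp: \<delta>'_def bij_betw_def inv_into_f_f f_inv_into_f)
  \<comment> \<open>The locale asks only for a ring homomorphism carrying a to a', so \<delta> and
    its inverse both give instances; the two maps \<Phi> are mutually inverse because they are so on
    the products x e_r.\<close>
  interpret F: two_data G \<chi> \<chi>' g n \<delta>
    by unfold_locales (use \<delta> \<delta>_A1 in \<open>auto simp: ring_iso_def\<close>)
  interpret B: two_data G \<chi>' \<chi> g n \<delta>'
    by unfold_locales (use \<delta>' \<delta>_A1[symmetric] inv D.A1 in \<open>auto simp: ring_iso_def\<close>)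
  have 1: "B.\<Phi> (F.\<Phi> u) = u" if "u \<in> carrier D.RH" for u
    using that
  proof (induction u rule: D.RH_induct)
    case (gen x r)
    then show ?case by (simp add: F.\<Phi>_\<iota>_e B.\<Phi>_\<iota>_e inv)
  qed (simp_all add: F.\<Phi>_add B.\<Phi>_add F.\<Phi>_minus B.\<Phi>_minus)
  have 2: "F.\<Phi> (B.\<Phi> u) = u" if "u \<in> carrier E.RH" for u
    using that
  proof (induction u rule: E.RH_induct)
    case (gen x r)
    then show ?case by (simp add: F.\<Phi>_\<iota>_e B.\<Phi>_\<iota>_e inv)
  qed (simp_all add: F.\<Phi>_add B.\<Phi>_add F.\<Phi>_minus B.\<Phi>_minus)
  have "bij_betw F.\<Phi> (carrier D.RH) (carrier E.RH)"
    by (rule bij_betw_byWitness[of _ B.\<Phi>]) (auto simp: 1 2)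
  then have "F.\<Phi> \<in> ring_iso D.RH E.RH" using F.\<Phi>_hom by (simp add: ring_iso_def)
  then show ?thesis unfolding is_ring_iso_def by blast
qed

section \<open>Duals and natural operators\<close>

lemma pow_transpose: "dim_row A = dim_col A \<Longrightarrow> A\<^sup>T ^\<^sub>m i = (A ^\<^sub>m i :: 'k::comm_semiring_1 mat)\<^sup>T"
proof (induction i)
  case (Suc i)
  have "A\<^sup>T ^\<^sub>m Suc i = (A ^\<^sub>m i)\<^sup>T * A\<^sup>T" using Suc by simp
  also have "\<dots> = (A * A ^\<^sub>m i)\<^sup>T" using Suc by (simp add: transpose_mult_dim)
  also have "A * A ^\<^sub>m i = A ^\<^sub>m Suc i" using pow_mat_Suc_left[of A i] Suc by simp
  finally show ?case .
qed simp

lemma pow_smult: "dim_row A = dim_col A \<Longrightarrow> (c \<cdot>\<^sub>m A) ^\<^sub>m i = c ^ i \<cdot>\<^sub>m (A ^\<^sub>m i :: 'k::field mat)"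
  by (induction i) (auto simp: smult_mult_dim mult_smult_dim smult_smult_mat mult.commute)

lemma transpose_smult: "(c \<cdot>\<^sub>m A)\<^sup>T = c \<cdot>\<^sub>m A\<^sup>T"
  by (rule eq_matI) auto

lemma transpose_add_dim: "dim_row A = dim_row B \<Longrightarrow> dim_col A = dim_col B \<Longrightarrow> (A + B)\<^sup>T = A\<^sup>T + B\<^sup>T"
  by (rule eq_matI) auto

lemma mat_eqI_ecol:
  fixes A B :: "'k::field mat"
  assumes "dim_row A = dim_row B" "dim_col A = d" "dim_col B = d" "\<And>c. c < d \<Longrightarrow> A * ecol d c = B * ecol d c"
  shows "A = B"
proof (rule eq_matI)
  fix i c assume ic: "i < dim_row B" "c < dim_col B"
  have e: "(X * ecol d c) $$ (i, 0) = X $$ (i, c)" if "dim_col X = d" "i < dim_row X" for X :: "'k mat"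
    using that ic assms(3) by (subst mult_mat_index) (auto simp: ecol_def sum_if_mult)
  have "(A * ecol d c) $$ (i, 0) = (B * ecol d c) $$ (i, 0)" using assms(3,4) ic by simp
  then show "A $$ (i, c) = B $$ (i, c)" using e[of A] e[of B] assms ic by simp
qed (use assms in auto)

lemma mult_ecol_index: "dim_col X = d \<Longrightarrow> c < d \<Longrightarrow> i < dim_row X \<Longrightarrow> (X * ecol d c) $$ (i, 0) = (X :: 'k::field mat) $$ (i, c)"
  by (subst mult_mat_index) (auto simp: ecol_def sum_if_mult)

definition rowm :: "'k::zero mat \<Rightarrow> 'k mat"
  where "rowm X = (vecm X)\<^sup>T"

lemma dim_rowm [simp]: "dim_row (rowm X) = Suc 0" "dim_col (rowm X) = dim_row X * dim_col X"
  by (simp_all add: rowm_def)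

lemma rowm_inj: "rowm X = rowm Z \<Longrightarrow> dim_row X = dim_row Z \<Longrightarrow> dim_col X = dim_col Z \<Longrightarrow> X = Z"
  unfolding rowm_def by (rule vecm_inj) (simp_all only: transpose_mat_eq)

lemma rowm_kron: "dim_row A = dim_row X \<Longrightarrow> dim_row B = dim_col X \<Longrightarrow>
    rowm X * kron A B = rowm ((A :: 'k::field mat)\<^sup>T * X * B)"
proof -
  assume d: "dim_row A = dim_row X" "dim_row B = dim_col X"
  have "(kron A\<^sup>T B\<^sup>T * vecm X)\<^sup>T = (vecm (A\<^sup>T * X * B\<^sup>T\<^sup>T))\<^sup>T" using d by (subst kron_vecm) auto
  moreover have "(kron A\<^sup>T B\<^sup>T * vecm X)\<^sup>T = (vecm X)\<^sup>T * kron A B"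
    using d by (subst transpose_mult_dim) (auto simp: kron_transpose)
  ultimately show ?thesis by (simp add: rowm_def)
qed

lemma vecm_add: "dim_row X = dim_row Z \<Longrightarrow> dim_col X = dim_col Z \<Longrightarrow> vecm (X + Z) = vecm X + vecm Z"
  by (rule eq_matI) (auto simp: vecm_def div_less_of_mult mod_less_of_mult)

lemma rowm_add: "dim_row X = dim_row Z \<Longrightarrow> dim_col X = dim_col Z \<Longrightarrow> rowm (X + Z) = rowm X + rowm Z"
  by (simp add: rowm_def vecm_add transpose_add_dim)

lemma vecm_zero [simp]: "vecm (0\<^sub>m a b) = 0\<^sub>m (a * b) (Suc 0)"
  by (rule eq_matI) (auto simp: vecm_def div_less_of_mult mod_less_of_mult)

lemma rowm_zero [simp]: "rowm (0\<^sub>m a b) = 0\<^sub>m (Suc 0) (a * b)"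
  by (simp add: rowm_def)

lemma vecm_surj:
  assumes "dim_row c = a * b" "dim_col c = Suc 0"
  obtains X where "dim_row X = a" "dim_col X = b" "vecm X = c"
proof (rule that[of "mat a b (\<lambda>(i, j). c $$ (i * b + j, 0))"])
  show "vecm (mat a b (\<lambda>(i, j). c $$ (i * b + j, 0))) = c"
    using assms by (intro eq_matI) (auto simp: vecm_def div_less_of_mult mod_less_of_mult)
qed auto

lemma rowm_surj:
  assumes "dim_col c = a * b" "dim_row c = Suc 0"
  obtains X where "dim_row X = a" "dim_col X = b" "rowm X = c"
proof -
  obtain X where "dim_row X = a" "dim_col X = b" "vecm X = c\<^sup>T" by (rule vecm_surj[of "c\<^sup>T" a b]) (use assms in auto)
  then show ?thesis by (intro that[of X]) (auto simp: rowm_def)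
qed

lemma rowm_vecm:
  assumes d: "dim_row X = dim_row Z" "dim_col X = dim_col Z"
  shows "rowm X * vecm Z = tr (X\<^sup>T * Z) \<cdot>\<^sub>m (1\<^sub>m (Suc 0) :: 'k::field mat)"
proof (cases "dim_col Z = 0")
  case True
  then show ?thesis using d by (intro eq_matI) (auto simp: tr_def mult_mat_index simp del: index_mult_mat(1))
next
  case False
  have "(\<Sum>k<dim_row Z * dim_col Z. X $$ (k div dim_col Z, k mod dim_col Z) * Z $$ (k div dim_col Z, k mod dim_col Z)) =
      (\<Sum>a<dim_row Z. \<Sum>b<dim_col Z. X $$ (a, b) * Z $$ (a, b))"
    using False by (subst sum_divmod) auto
  also have "\<dots> = tr (X\<^sup>T * Z)" using d by (subst sum.swap) (simp add: tr_mult)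
  finally show ?thesis
    using d by (intro eq_matI) (auto simp: mult_mat_index rowm_def vecm_index simp del: index_mult_mat(1))
qed

text \<open>The two matrices are a copairing and a pairing on k^d, and contracting the middle factor
  is matrix multiplication. B and Q are arbitrary because a tensor functor need not carry the
  standard evaluation to the standard one.\<close>

lemma zigzag_mat:
  assumes "dim_row B = d" "dim_col B = d" "dim_row Q = d" "dim_col Q = d"
  shows "kron (1\<^sub>m d) (rowm Q) * kron (vecm B) (1\<^sub>m d) = B * (Q :: 'k::field mat)"
proof (cases "d = 0")
  case True
  then show ?thesis using assms by (intro eq_matI) auto
next
  case False
  show ?thesis
  proof (rule eq_matI)
    fix i j assume "i < dim_row (B * Q)" "j < dim_col (B * Q)"
    then have ij: "i < d" "j < d" using assms by auto
    \<comment> \<open>The three tensor factors of k^d \<otimes> k^d \<otimes> k^d, read from an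
      index in either bracketing.\<close>
    have dm: "k div d div d = k div (d * d)" "k div d mod d = (k mod (d * d)) div d" "k mod (d * d) mod d = k mod d" for k
      using False by (simp_all add: div_mult2_eq mod_mult2_eq mod_mod_cancel)
    have b: "k div (d * d) < d" "k mod (d * d) div d < d" "k mod d < d" "k div d < d * d" "k mod (d * d) < d * d" if "k < d * (d * d)" for k
      using that False by (auto simp: less_mult_imp_div_less mult.assoc)
    have "(kron (1\<^sub>m d) (rowm Q) * kron (vecm B) (1\<^sub>m d)) $$ (i, j) =
      (\<Sum>k<d * (d * d). kron (1\<^sub>m d) (rowm Q) $$ (i, k) * kron (vecm B) (1\<^sub>m d) $$ (k, j))"
      using ij assms by (subst mult_mat_index) (simp_all add: mult.assoc)
    also have "\<dots> = (\<Sum>k<d * (d * d). (\<lambda>a m. (if i = a then 1 else 0) * Q $$ (m div d, m mod d) *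
        (B $$ (a, m div d) * (if m mod d = j then 1 else 0))) (k div (d * d)) (k mod (d * d)))"
    proof (rule sum.cong[OF refl])
      fix k assume "k \<in> {..<d * (d * d)}"
      then have k: "k < d * (d * d)" by simp
      have "kron (1\<^sub>m d) (rowm Q) $$ (i, k) = (if i = k div (d * d) then 1 else 0) * Q $$ (k mod (d * d) div d, k mod (d * d) mod d)"
        using ij k b[OF k] assms by (subst kron_index) (auto simp: rowm_def vecm_index)
      moreover have "kron (vecm B) (1\<^sub>m d) $$ (k, j) = B $$ (k div (d * d), k mod (d * d) div d) * (if k mod (d * d) mod d = j then 1 else 0)"
        using ij k b[OF k] assms by (subst kron_index) (auto simp: vecm_index dm mult.assoc)
      ultimately show "kron (1\<^sub>m d) (rowm Q) $$ (i, k) * kron (vecm B) (1\<^sub>m d) $$ (k, j) =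
        (\<lambda>a m. (if i = a then 1 else 0) * Q $$ (m div d, m mod d) *
        (B $$ (a, m div d) * (if m mod d = j then 1 else 0))) (k div (d * d)) (k mod (d * d))" by simp
    qed
    also have "\<dots> = (\<Sum>a<d. \<Sum>m<d * d. (if i = a then 1 else 0) * Q $$ (m div d, m mod d) *
        (B $$ (a, m div d) * (if m mod d = j then 1 else 0)))"
      using False by (subst sum_divmod) auto
    also have "\<dots> = (\<Sum>a<d. (if i = a then (\<Sum>m<d * d. Q $$ (m div d, m mod d) *
        (B $$ (i, m div d) * (if m mod d = j then 1 else 0))) else 0))"
      by (intro sum.cong) auto
    also have "\<dots> = (\<Sum>m<d * d. (\<lambda>b c. Q $$ (b, c) * (B $$ (i, b) * (if c = j then 1 else 0))) (m div d) (m mod d))"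
      using ij by simp
    also have "\<dots> = (\<Sum>b<d. \<Sum>c<d. Q $$ (b, c) * (B $$ (i, b) * (if c = j then 1 else 0)))"
      using False by (subst sum_divmod) auto
    also have "\<dots> = (\<Sum>b<d. Q $$ (b, j) * B $$ (i, b))"
    proof (intro sum.cong refl)
      fix b
      have "(\<Sum>c<d. Q $$ (b, c) * (B $$ (i, b) * (if c = j then 1 else 0))) = (\<Sum>c<d. (Q $$ (b, c) * B $$ (i, b)) * (if c = j then 1 else 0))"
        by (simp add: mult.assoc)
      then show "(\<Sum>c<d. Q $$ (b, c) * (B $$ (i, b) * (if c = j then 1 else 0))) = Q $$ (b, j) * B $$ (i, b)"
        using ij by (simp add: sum_if_mult)
    qed
    also have "\<dots> = (B * Q) $$ (i, j)"
      using ij assms by (simp add: mult_mat_index mult.commute del: index_mult_mat(1))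
    finally show "(kron (1\<^sub>m d) (rowm Q) * kron (vecm B) (1\<^sub>m d)) $$ (i, j) = (B * Q) $$ (i, j)" .
  qed (use assms in auto)
qed

context datum
begin

text \<open>The action on the dual space through the antipode: S(h) = h^{-1} and S(y) = -y
  g^{-1}.\<close>

definition dual :: "(nat \<times> 'g, 'k) rep \<Rightarrow> (nat \<times> 'g, 'k) rep"
  where "dual M = mk_rep (rdim M) (\<lambda>h. (\<rho> M (inv h))\<^sup>T) ((-1) \<cdot>\<^sub>m (Y M * \<rho> M (inv g))\<^sup>T)"

lemma rdim_dual [simp]: "rdim (dual M) = rdim M"
  by (simp add: dual_def)

text \<open>The power of \<chi>(g) that collects in (y g^{-1})^i = \<chi>(g)^{i(i-1)/2} y^i
  g^{-i}.\<close>

definition cq :: "nat \<Rightarrow> 'k" where "cq i = (\<Prod>t<i. \<chi> g ^ t)"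

lemma cq: "cq 0 = 1" "cq (Suc i) = cq i * \<chi> g ^ i"
  by (simp_all add: cq_def)

lemma Yg_pow:
  assumes M: "M \<in> reps H"
  shows "(Y M * \<rho> M (inv g)) ^\<^sub>m i = cq i \<cdot>\<^sub>m (Y M ^\<^sub>m i * \<rho> M (inv g [^] i))"
proof (induction i)
  case 0
  then show ?case using M by (simp add: cq)
next
  case (Suc i)
  have gi: "inv g [^] i \<in> carrier G" by simp
  have "inverse (\<chi> (inv g [^] i)) = \<chi> g ^ i" by (simp add: \<chi>_pow \<chi>_inv power_inverse)
  then have c: "\<rho> M (inv g [^] i) * Y M = \<chi> g ^ i \<cdot>\<^sub>m (Y M * \<rho> M (inv g [^] i))" using \<rho>_Y[OF M gi] by simp
  have "(Y M * \<rho> M (inv g)) ^\<^sub>m Suc i = cq i \<cdot>\<^sub>m (Y M ^\<^sub>m i * ((\<rho> M (inv g [^] i) * Y M) * \<rho> M (inv g)))"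
    using M Suc by (simp add: smult_mult_dim mult_assoc_dim)
  also have "\<dots> = cq (Suc i) \<cdot>\<^sub>m (Y M ^\<^sub>m i * (Y M * (\<rho> M (inv g [^] i) * \<rho> M (inv g))))"
    using M by (simp add: c cq smult_mult_dim mult_smult_dim smult_smult_mat mult_assoc_dim)
  also have "\<dots> = cq (Suc i) \<cdot>\<^sub>m (Y M ^\<^sub>m Suc i * \<rho> M (inv g [^] Suc i))"
    using M by (simp add: \<rho>_mult mult_assoc_dim)
  finally show ?case .
qed

lemma dual:
  assumes M: "M \<in> reps H"
  shows "dual M \<in> reps H" "h \<in> carrier G \<Longrightarrow> \<rho> (dual M) h = (\<rho> M (inv h))\<^sup>T"
    "Y (dual M) = (-1) \<cdot>\<^sub>m (Y M * \<rho> M (inv g))\<^sup>T"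
proof -
  let ?r = "\<lambda>h. (\<rho> M (inv h))\<^sup>T" and ?y = "(-1) \<cdot>\<^sub>m (Y M * \<rho> M (inv g))\<^sup>T"
  have comm: "\<rho> M (inv g) * \<rho> M (inv h) = \<rho> M (inv h) * \<rho> M (inv g)" if h: "h \<in> carrier G" for h
    using M h central[OF h] by (simp flip: \<rho>_mult G.inv_mult_group)
  have yr: "?y * ?r h = \<chi> h \<cdot>\<^sub>m (?r h * ?y)" if h: "h \<in> carrier G" for h
  proof -
    have "?y * ?r h = (-1) \<cdot>\<^sub>m (\<rho> M (inv h) * (Y M * \<rho> M (inv g)))\<^sup>T"
      using M h by (simp add: smult_mult_dim transpose_mult_dim[symmetric])
    also have "\<rho> M (inv h) * (Y M * \<rho> M (inv g)) = \<chi> h \<cdot>\<^sub>m ((Y M * \<rho> M (inv g)) * \<rho> M (inv h))"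
      using M h by (simp add: mult_assoc_dim[symmetric] \<rho>_Y \<chi>_inv smult_mult_dim)
        (simp add: mult_assoc_dim comm)
    also have "(-1) \<cdot>\<^sub>m (\<chi> h \<cdot>\<^sub>m ((Y M * \<rho> M (inv g)) * \<rho> M (inv h)))\<^sup>T = \<chi> h \<cdot>\<^sub>m (?r h * ?y)"
      using M h by (simp add: transpose_smult mult_smult_dim transpose_mult_dim[of "Y M * \<rho> M (inv g)"] smult_smult_mat)
    finally show ?thesis .
  qed
  have rm: "?r (h \<otimes> l) = ?r h * ?r l" if "h \<in> carrier G" "l \<in> carrier G" for h l
    using M that by (simp add: G.inv_mult_group \<rho>_mult transpose_mult_dim)
  have yn: "?y ^\<^sub>m n = 0\<^sub>m (rdim M) (rdim M)"
    using M by (simp add: pow_smult pow_transpose Yg_pow Y_pow_n)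
  show "dual M \<in> reps H" "h \<in> carrier G \<Longrightarrow> \<rho> (dual M) h = (\<rho> M (inv h))\<^sup>T" "Y (dual M) = ?y"
    unfolding dual_def by (rule mk_rep; use M yr rm yn in simp)+
qed

text \<open>Transposing the action on the dual gives the action of the antipode, so the right side
  is S(y^i h). Up to a scalar, S keeps the degree i and sends h to h^{-1} g^{-i}.\<close>

lemma antipode_eq:
  assumes M: "M \<in> reps H" and i: "i < n" and h: "h \<in> carrier G"
  shows "(rmat (dual M) (i, h))\<^sup>T = ((-1) ^ i * cq i * \<chi> h ^ i) \<cdot>\<^sub>m (Y M ^\<^sub>m i * \<rho> M (inv h \<otimes> inv g [^] i))"
proof -
  have "rmat (dual M) (i, h) = (-1) ^ i \<cdot>\<^sub>m (((Y M * \<rho> M (inv g)) ^\<^sub>m i)\<^sup>T * (\<rho> M (inv h))\<^sup>T)"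
    using M h by (simp add: rmat_eq[OF dual(1)[OF M] i h] dual pow_smult pow_transpose smult_mult_dim)
  also have "\<dots> = (-1) ^ i \<cdot>\<^sub>m (\<rho> M (inv h) * (Y M * \<rho> M (inv g)) ^\<^sub>m i)\<^sup>T"
    using M h by (simp add: transpose_mult_dim)
  finally have "(rmat (dual M) (i, h))\<^sup>T = (-1) ^ i \<cdot>\<^sub>m (\<rho> M (inv h) * (cq i \<cdot>\<^sub>m (Y M ^\<^sub>m i * \<rho> M (inv g [^] i))))"
    using M by (simp add: transpose_smult Yg_pow)
  also have "\<dots> = ((-1) ^ i * cq i) \<cdot>\<^sub>m ((\<rho> M (inv h) * Y M ^\<^sub>m i) * \<rho> M (inv g [^] i))"
    using M h by (simp add: mult_smult_dim smult_smult_mat mult_assoc_dim)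
  also have "\<dots> = ((-1) ^ i * cq i * \<chi> h ^ i) \<cdot>\<^sub>m (Y M ^\<^sub>m i * (\<rho> M (inv h) * \<rho> M (inv g [^] i)))"
    using M h by (simp add: \<rho>_Y_pow \<chi>_inv smult_mult_dim smult_smult_mat mult_assoc_dim)
  also have "\<rho> M (inv h) * \<rho> M (inv g [^] i) = \<rho> M (inv h \<otimes> inv g [^] i)" using M h by (simp add: \<rho>_mult)
  finally show ?thesis .
qed

lemma dual_hom:
  assumes MN: "M \<in> reps H" "N \<in> reps H" and f: "f \<in> rep_hom H M N"
  shows "f\<^sup>T \<in> rep_hom H (dual N) (dual M)"
proof (rule rep_homI_H)
  note [simp] = rep_hom_dim[OF f]
  show "dual M \<in> reps H" "dual N \<in> reps H" using MN dual by auto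
  show "\<rho> (dual M) h * f\<^sup>T = f\<^sup>T * \<rho> (dual N) h" if h: "h \<in> carrier G" for h
    using MN h rep_homD_H(1)[OF MN f, of "inv h"] by (simp add: dual flip: transpose_mult_dim)
  have "f * (Y M * \<rho> M (inv g)) = (Y N * \<rho> N (inv g)) * f"
  proof -
    have "f * (Y M * \<rho> M (inv g)) = (f * Y M) * \<rho> M (inv g)" using MN by (simp add: mult_assoc_dim)
    also have "\<dots> = Y N * (f * \<rho> M (inv g))" using MN by (simp add: rep_homD_H(2)[OF MN f, symmetric] mult_assoc_dim)
    also have "\<dots> = (Y N * \<rho> N (inv g)) * f" using MN by (simp add: rep_homD_H(1)[OF MN f, of "inv g", symmetric] mult_assoc_dim)
    finally show ?thesis .
  qed
  then show "Y (dual M) * f\<^sup>T = f\<^sup>T * Y (dual N)"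
    using MN by (simp add: dual smult_mult_dim mult_smult_dim flip: transpose_mult_dim)
qed (use MN rep_hom_dim[OF f] in simp_all)

text \<open>For y, both summands of \<Delta>(y) enter: y acts on the dual through -y g^{-1}, the g
  of y \<otimes> g cancels g^{-1}, and 1 \<otimes> y supplies the opposite term.\<close>

lemma ev_hom: "M \<in> reps H \<Longrightarrow> rowm (1\<^sub>m (rdim M)) \<in> rep_hom H (rep_tensor H (dual M) M) (rep_unit H)"
proof (rule rep_homI_H)
  assume M: "M \<in> reps H"
  show "rep_tensor H (dual M) M \<in> reps H" "rep_unit H \<in> reps H" using M by (auto simp: tensor_H dual unit_H)
  show "\<rho> (rep_unit H) h * rowm (1\<^sub>m (rdim M)) = rowm (1\<^sub>m (rdim M)) * \<rho> (rep_tensor H (dual M) M) h" if h: "h \<in> carrier G" for h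
    using M h by (simp add: tensor_H dual unit_H rowm_kron \<rho>_inv)
  have d: "dual M \<in> reps H" by (rule dual(1)[OF M])
  have "rowm (1\<^sub>m (rdim M)) * Y (rep_tensor H (dual M) M) =
    rowm ((Y (dual M))\<^sup>T * \<rho> M g) + rowm (Y M)"
    using M d by (simp add: tensor_H tensor_Y_def mult_add_dim rowm_kron)
  also have "(Y (dual M))\<^sup>T * \<rho> M g = (-1) \<cdot>\<^sub>m Y M"
    using M by (simp add: dual transpose_smult smult_mult_dim mult_assoc_dim \<rho>_inv)
  also have "rowm ((-1) \<cdot>\<^sub>m Y M) + rowm (Y M) = rowm ((-1) \<cdot>\<^sub>m Y M + Y M)" using M by (simp add: rowm_add)
  also have "(-1) \<cdot>\<^sub>m Y M + Y M = 0\<^sub>m (rdim M) (rdim M)" using M by (intro eq_matI) auto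
  finally show "Y (rep_unit H) * rowm (1\<^sub>m (rdim M)) = rowm (1\<^sub>m (rdim M)) * Y (rep_tensor H (dual M) M)"
    using M by (simp add: unit_H)
qed (simp_all add: unit_H)

lemma coev_hom: "M \<in> reps H \<Longrightarrow> vecm (1\<^sub>m (rdim M)) \<in> rep_hom H (rep_unit H) (rep_tensor H M (dual M))"
proof (rule rep_homI_H)
  assume M: "M \<in> reps H"
  show "rep_tensor H M (dual M) \<in> reps H" "rep_unit H \<in> reps H" using M by (auto simp: tensor_H dual unit_H)
  show "\<rho> (rep_tensor H M (dual M)) h * vecm (1\<^sub>m (rdim M)) = vecm (1\<^sub>m (rdim M)) * \<rho> (rep_unit H) h" if h: "h \<in> carrier G" for h
    using M h by (simp add: tensor_H dual unit_H kron_vecm \<rho>_inv)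
  have d: "dual M \<in> reps H" by (rule dual(1)[OF M])
  have "Y (rep_tensor H M (dual M)) * vecm (1\<^sub>m (rdim M)) = vecm (Y M * (\<rho> (dual M) g)\<^sup>T) + vecm ((Y (dual M))\<^sup>T)"
    using M d by (simp add: tensor_H tensor_Y_def add_mult_dim kron_vecm)
  also have "\<dots> = vecm (Y M * \<rho> M (inv g)) + vecm ((-1) \<cdot>\<^sub>m (Y M * \<rho> M (inv g)))"
    using M by (simp add: dual transpose_smult)
  also have "\<dots> = vecm (Y M * \<rho> M (inv g) + (-1) \<cdot>\<^sub>m (Y M * \<rho> M (inv g)))" using M by (simp add: vecm_add)
  also have "Y M * \<rho> M (inv g) + (-1) \<cdot>\<^sub>m (Y M * \<rho> M (inv g)) = 0\<^sub>m (rdim M) (rdim M)"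
    using M by (intro eq_matI) (auto simp del: index_mult_mat(1))
  finally show "Y (rep_tensor H M (dual M)) * vecm (1\<^sub>m (rdim M)) = vecm (1\<^sub>m (rdim M)) * Y (rep_unit H)"
    using M by (simp add: unit_H)
qed (simp_all add: unit_H)

subsection \<open>The regular module represents the forgetful functor\<close>

abbreviation u :: "'k mat" where "u \<equiv> bvec 0 \<one>"

text \<open>The homomorphism from the regular module that sends the generator 1 to x.\<close>

definition ev :: "(nat \<times> 'g, 'k) rep \<Rightarrow> 'k mat \<Rightarrow> 'k mat"
  where "ev M x = ext n M (freeK 1 (res M) x)"

lemma trivKreg_1: "trivKreg (Suc 0) = Kreg"
proof -
  have "trivK (Suc 0) = rep_unit K" by (rule rep_eqI[of _ K]) (auto simp: trivK unit_K)
  then show ?thesis by (simp add: TK.unit_tensor Kreg)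
qed

lemma ev:
  assumes M: "M \<in> reps H" and x: "dim_row x = rdim M" "dim_col x = Suc 0"
  shows "ev M x \<in> rep_hom H reg M" "ev M x * u = x"
proof -
  let ?\<phi> = "freeK 1 (res M) x"
  have \<phi>: "?\<phi> \<in> rep_hom K Kreg (res M)" using freeK_hom[OF res[OF M], of x 1] x by (simp add: trivKreg_1)
  show "ev M x \<in> rep_hom H reg M"
    unfolding ev_def reg_def
    by (rule ext_hom[OF Kreg M]) (use rep_homD[OF \<phi>] Y_pow_n[OF M] in auto)
  have "u = blk_in (card (carrier G)) n 0 * eg \<one>"
  proof -
    have "blk_in (card (carrier G)) n 0 * eg \<one> = kron (1\<^sub>m (card (carrier G))) (ecol n 0) * kron (eg \<one>) (1\<^sub>m (Suc 0))"
      by (simp add: blk_in_def)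
    also have "\<dots> = u" by (subst kron_mult) auto
    finally show ?thesis by simp
  qed
  then have "ev M x * u = (ext n M ?\<phi> * blk_in (card (carrier G)) n 0) * eg \<one>" by (simp add: ev_def mult_assoc_dim)
  also have "ext n M ?\<phi> * blk_in (card (carrier G)) n 0 = ?\<phi>" using ext_inj[OF M, of ?\<phi> 0 n] n_pos M by simp
  also have "?\<phi> * eg \<one> = x" using freeK_one[OF res[OF M], of x 1] x by simp
  finally show "ev M x * u = x" .
qed

lemma hom_bvec:
  assumes M: "M \<in> reps H" and f: "f \<in> rep_hom H reg M" and h: "h \<in> carrier G"
  shows "f * bvec t h = Y M ^\<^sub>m t * (\<rho> M h * (f * u))"
proof -
  note [simp] = rep_hom_dim[OF f] reg
  have "f * bvec t h = f * (Y reg ^\<^sub>m t * (\<rho> reg h * u))" by (simp only: reg_gen[OF h])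
  also have "\<dots> = (f * Y reg ^\<^sub>m t) * (\<rho> reg h * u)" using h by (simp add: mult_assoc_dim)
  also have "\<dots> = Y M ^\<^sub>m t * ((f * \<rho> reg h) * u)"
    using h M by (simp add: rep_homD_H(3)[OF reg(1) M f, symmetric] mult_assoc_dim)
  also have "\<dots> = Y M ^\<^sub>m t * (\<rho> M h * (f * u))"
    using h M by (simp add: rep_homD_H(1)[OF reg(1) M f, symmetric] mult_assoc_dim)
  finally show ?thesis .
qed

lemma ev_unique:
  assumes M: "M \<in> reps H" and f: "f \<in> rep_hom H reg M" "f' \<in> rep_hom H reg M" and eq: "f * u = f' * u"
  shows "f = f'"
proof (rule mat_eqI_ecol)
  fix c assume "c < rdim reg"
  then obtain t h where "h \<in> carrier G" "ecol (rdim reg) c = bvec t h" using reg_basis by blast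
  then show "f * ecol (rdim reg) c = f' * ecol (rdim reg) c" by (simp only: hom_bvec[OF M f(1)] hom_bvec[OF M f(2)] eq)
qed (use f in auto)

text \<open>The index of the basis element y^i h of H that has number c in the regular
  module.\<close>

definition bas :: "nat \<Rightarrow> nat \<times> 'g" where "bas c = (c mod n, el (c div n))"

abbreviation Nd :: nat where "Nd \<equiv> card (carrier G) * n"

lemma bas: "c < Nd \<Longrightarrow> fst (bas c) < n" "c < Nd \<Longrightarrow> snd (bas c) \<in> carrier G" "c < Nd \<Longrightarrow> bas c \<in> basis H"
  "c < Nd \<Longrightarrow> ecol Nd c = bvec (fst (bas c)) (snd (bas c))"
proof -
  assume c: "c < Nd"
  then have d: "c div n < card (carrier G)" "c mod n < n" by (auto intro: div_less_of_mult mod_less_of_mult)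
  then show "fst (bas c) < n" "snd (bas c) \<in> carrier G" "bas c \<in> basis H" by (simp_all add: bas_def)
  show "ecol Nd c = bvec (fst (bas c)) (snd (bas c))" using d by (simp add: bas_def kron_ecol)
qed

lemma rmat_reg_u: "c < Nd \<Longrightarrow> rmat reg (bas c) * u = ecol Nd c"
proof -
  assume c: "c < Nd"
  have "rmat reg (bas c) = Y reg ^\<^sub>m fst (bas c) * \<rho> reg (snd (bas c))"
    using rmat_eq[OF reg(1) bas(1,2)[OF c]] by simp
  then show ?thesis using reg_gen[OF bas(2)[OF c], of "fst (bas c)"] reg bas[OF c] by (simp add: mult_assoc_dim)
qed

lemma col_lincomb:
  assumes "dim_row x = d" "dim_col x = Suc 0"
  shows "(x :: 'k mat) = lincomb d 1 {..<d} (\<lambda>c. x $$ (c, 0)) (\<lambda>c. ecol d c)"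
proof (rule eq_matI)
  fix a b assume "a < dim_row (lincomb d 1 {..<d} (\<lambda>c. x $$ (c, 0)) (\<lambda>c. ecol d c))"
    "b < dim_col (lincomb d 1 {..<d} (\<lambda>c. x $$ (c, 0)) (\<lambda>c. ecol d c))"
  then have ab: "a < d" "b = 0" by auto
  have "(\<Sum>c<d. x $$ (c, 0) * ecol d c $$ (a, 0)) = (\<Sum>c<d. x $$ (c, 0) * (if a = c then 1 else 0))"
    using ab by (intro sum.cong) (auto simp: ecol_def)
  also have "\<dots> = x $$ (a, 0)" using ab by (simp only: sum_if_mult) simp
  finally show "x $$ (a, b) = lincomb d 1 {..<d} (\<lambda>c. x $$ (c, 0)) (\<lambda>c. ecol d c) $$ (a, b)"
    using ab by (simp add: lincomb_index)
qed (use assms in auto)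

text \<open>The action on \<open>M\<close> of the algebra element with coefficient column \<open>a\<close>.\<close>

definition actv :: "(nat \<times> 'g, 'k) rep \<Rightarrow> 'k mat \<Rightarrow> 'k mat"
  where "actv M a = lincomb (rdim M) (rdim M) {..<Nd} (\<lambda>c. a $$ (c, 0)) (\<lambda>c. rmat M (bas c))"

definition natural_op :: "((nat \<times> 'g, 'k) rep \<Rightarrow> 'k mat) \<Rightarrow> bool"
  where "natural_op X \<longleftrightarrow> (\<forall>M\<in>reps H. dim_row (X M) = rdim M \<and> dim_col (X M) = rdim M) \<and>
    (\<forall>M\<in>reps H. \<forall>N\<in>reps H. \<forall>f\<in>rep_hom H M N. X N * f = f * X M)"

text \<open>Yoneda for the forgetful functor: every vector of M is the image of 1 under a map from
  the regular module, so X is multiplication by the element X(1) of H.\<close>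

lemma natural_op_eq:
  assumes X: "natural_op X" and M: "M \<in> reps H"
  shows "X M = actv M (X reg * u)"
  unfolding actv_def
proof (rule mat_eqI_ecol)
  have dX [simp]: "dim_row (X M) = rdim M" "dim_col (X M) = rdim M" "dim_row (X reg) = Nd" "dim_col (X reg) = Nd"
    using X M reg unfolding natural_op_def by auto
  show "dim_row (X M) = dim_row (lincomb (rdim M) (rdim M) {..<Nd} (\<lambda>c. (X reg * u) $$ (c, 0)) (\<lambda>c. rmat M (bas c)))"
    "dim_col (X M) = rdim M" "dim_col (lincomb (rdim M) (rdim M) {..<Nd} (\<lambda>c. (X reg * u) $$ (c, 0)) (\<lambda>c. rmat M (bas c))) = rdim M"
    by simp_all
  fix j assume j: "j < rdim M"
  let ?x = "ecol (rdim M) j :: 'k mat" and ?y = "X reg * u"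
  note e = ev[OF M, of ?x, simplified]
  note [simp] = rep_hom_dim[OF e(1)] reg
  have y: "?y = lincomb Nd 1 {..<Nd} (\<lambda>c. ?y $$ (c, 0)) (\<lambda>c. ecol Nd c)" by (rule col_lincomb) simp_all
  have "X M * ?x = X M * ev M ?x * u" using M by (simp add: mult_assoc_dim e(2))
  also have "X M * ev M ?x = ev M ?x * X reg" using X M reg(1) e(1) unfolding natural_op_def by blast
  also have "\<dots> * u = ev M ?x * ?y" by (simp add: mult_assoc_dim)
  also have "\<dots> = lincomb (rdim M) 1 {..<Nd} (\<lambda>c. ?y $$ (c, 0)) (\<lambda>c. ev M ?x * ecol Nd c)"
    by (subst y, subst mult_lincomb) auto
  also have "\<dots> = lincomb (rdim M) 1 {..<Nd} (\<lambda>c. ?y $$ (c, 0)) (\<lambda>c. rmat M (bas c) * ?x)"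
  proof (rule lincomb_mat_cong)
    fix c assume "c \<in> {..<Nd}"
    then have c: "c < Nd" by simp
    have "ev M ?x * ecol Nd c = Y M ^\<^sub>m fst (bas c) * (\<rho> M (snd (bas c)) * ?x)"
      using hom_bvec[OF M e(1) bas(2)[OF c]] by (simp add: bas(4)[OF c] e(2))
    also have "\<dots> = rmat M (bas c) * ?x"
      using rmat_eq[OF M bas(1,2)[OF c]] M bas[OF c] by (simp add: mult_assoc_dim)
    finally show "ev M ?x * ecol Nd c = rmat M (bas c) * ?x" .
  qed
  also have "\<dots> = lincomb (rdim M) (rdim M) {..<Nd} (\<lambda>c. ?y $$ (c, 0)) (\<lambda>c. rmat M (bas c)) * ?x"
    using M bas(3) by (subst lincomb_mult) auto
  finally show "X M * ?x = lincomb (rdim M) (rdim M) {..<Nd} (\<lambda>c. (X reg * u) $$ (c, 0)) (\<lambda>c. rmat M (bas c)) * ?x" .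
qed

subsection \<open>The trace of the antipode\<close>

text \<open>The trace of x \<mapsto> l S(x) l' on H for group elements l, l' with l'^{-1} l = m; at
  m = 1 it is the trace of the antipode.\<close>

definition sclass :: "'g \<Rightarrow> 'k"
  where "sclass m = (\<Sum>i<n. (-1) ^ i * cq i * inverse (\<chi> m) ^ i *
    (\<Sum>k\<in>carrier G. if k \<otimes> k \<otimes> g [^] i = m then \<chi> k ^ i else 0))"

text \<open>Conjugation carries the solutions k of k^2 g^i = m to those for the conjugate of m, g
  being central, and does not change \<chi>(k).\<close>

lemma sclass_conj:
  assumes x: "x \<in> carrier G" and m: "m \<in> carrier G"
  shows "sclass (inv x \<otimes> m \<otimes> x) = sclass m"
proof -
  have \<chi>m: "\<chi> (inv x \<otimes> m \<otimes> x) = \<chi> m" using x m by (simp add: \<chi>_inv)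
  have gi: "g [^] (i::nat) \<otimes> h = h \<otimes> g [^] i" if "h \<in> carrier G" for i h
    using that by (induction i) (simp_all add: G.m_assoc central, simp add: G.m_assoc[symmetric])
  have "(\<Sum>k\<in>carrier G. if k \<otimes> k \<otimes> g [^] i = inv x \<otimes> m \<otimes> x then \<chi> k ^ i else 0) =
    (\<Sum>k\<in>carrier G. if k \<otimes> k \<otimes> g [^] i = m then \<chi> k ^ i else 0)" for i
  proof (rule sum.reindex_bij_witness[of _ "\<lambda>k. inv x \<otimes> k \<otimes> x" "\<lambda>k. x \<otimes> k \<otimes> inv x"])
    fix k assume k: "k \<in> carrier G"
    have xx: "x \<otimes> (inv x \<otimes> y) = y" "inv x \<otimes> (x \<otimes> y) = y" if "y \<in> carrier G" for y
      using x that by (simp_all add: G.m_assoc[symmetric])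
    show "inv x \<otimes> (x \<otimes> k \<otimes> inv x) \<otimes> x = k" "x \<otimes> (inv x \<otimes> k \<otimes> x) \<otimes> inv x = k"
      using x k by (simp_all add: G.m_assoc xx)
    have \<chi>k: "\<chi> (x \<otimes> k \<otimes> inv x) = \<chi> k" using x k by (simp add: \<chi>_inv)
    have sq: "(x \<otimes> k \<otimes> inv x) \<otimes> (x \<otimes> k \<otimes> inv x) \<otimes> g [^] i = x \<otimes> (k \<otimes> k \<otimes> g [^] i) \<otimes> inv x"
    proof -
      have "(x \<otimes> k \<otimes> inv x) \<otimes> (x \<otimes> k \<otimes> inv x) \<otimes> g [^] i = x \<otimes> (k \<otimes> (k \<otimes> (inv x \<otimes> g [^] i)))"
        using x k by (simp add: G.m_assoc xx)
      also have "inv x \<otimes> g [^] i = g [^] i \<otimes> inv x" using x by (simp add: gi)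
      finally show ?thesis using x k by (simp add: G.m_assoc)
    qed
    have "(x \<otimes> k \<otimes> inv x) \<otimes> (x \<otimes> k \<otimes> inv x) \<otimes> g [^] i = m \<longleftrightarrow> k \<otimes> k \<otimes> g [^] i = inv x \<otimes> m \<otimes> x"
    proof
      assume "(x \<otimes> k \<otimes> inv x) \<otimes> (x \<otimes> k \<otimes> inv x) \<otimes> g [^] i = m"
      then have "m = x \<otimes> (k \<otimes> k \<otimes> g [^] i) \<otimes> inv x" using sq by simp
      then show "k \<otimes> k \<otimes> g [^] i = inv x \<otimes> m \<otimes> x" using x k by (simp add: G.m_assoc xx)
    next
      assume "k \<otimes> k \<otimes> g [^] i = inv x \<otimes> m \<otimes> x"
      then show "(x \<otimes> k \<otimes> inv x) \<otimes> (x \<otimes> k \<otimes> inv x) \<otimes> g [^] i = m"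
        unfolding sq using x m by (simp add: G.m_assoc xx)
    qed
    then show "(if (x \<otimes> k \<otimes> inv x) \<otimes> (x \<otimes> k \<otimes> inv x) \<otimes> g [^] i = m then \<chi> (x \<otimes> k \<otimes> inv x) ^ i else 0) =
      (if k \<otimes> k \<otimes> g [^] i = inv x \<otimes> m \<otimes> x then \<chi> k ^ i else 0)"
      by (simp only: \<chi>k)
  qed (use x in auto)
  then show ?thesis by (simp add: sclass_def \<chi>m)
qed

end

context datum
begin

lemma dim_actv [simp]: "dim_row (actv M a) = rdim M" "dim_col (actv M a) = rdim M"
  by (simp_all add: actv_def)

lemma Y_pow_bvec: "h \<in> carrier G \<Longrightarrow> Y reg ^\<^sub>m i * bvec t h = bvec (t + i) h"
proof (induction i arbitrary: t)
  case 0
  then show ?case using reg by simp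
next
  case (Suc i)
  have "Y reg ^\<^sub>m Suc i * bvec t h = Y reg ^\<^sub>m i * (Y reg * bvec t h)" using reg by (simp add: mult_assoc_dim)
  then show ?case using Suc by (simp add: reg_bvec)
qed

lemma bvec_index: "c < Nd \<Longrightarrow> h \<in> carrier G \<Longrightarrow> bvec t h $$ (c, 0) = (if el (c div n) = h \<and> c mod n = t then 1 else 0)"
proof -
  assume c: "c < Nd" and h: "h \<in> carrier G"
  then have d: "c div n < card (carrier G)" "c mod n < n" by (auto intro: div_less_of_mult mod_less_of_mult)
  have "c div n = idx h \<longleftrightarrow> el (c div n) = h" using d h by auto
  then show ?thesis using c d by (subst kron_index) (auto simp: ecol_def)
qed

definition acoef :: "nat \<Rightarrow> 'g \<Rightarrow> 'k"
  where "acoef i h = (-1) ^ i * cq i * \<chi> h ^ i"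

text \<open>The product of y^j l, S(y^i k) and the second basis element has degree i + j + j', so it
  can contribute to the coefficient at y^i k only for j = j' = 0.\<close>

lemma antipode_term:
  assumes c: "c < Nd" "bas c = (i, k)" and c1: "c1 < Nd" "bas c1 = (j, l)" and c2: "c2 < Nd" "bas c2 = (j', l')"
  shows "(rmat reg (bas c1) * ((rmat (dual reg) (bas c))\<^sup>T * ecol Nd c2)) $$ (c, 0) =
    (if j = 0 \<and> j' = 0 \<and> l \<otimes> (inv k \<otimes> inv g [^] i \<otimes> l') = k then acoef i k * inverse (\<chi> l) ^ i else 0)"
proof -
  let ?m = "inv k \<otimes> inv g [^] i"
  have i: "i < n" "k \<in> carrier G" and j: "j < n" "l \<in> carrier G" and j': "l' \<in> carrier G"
    using bas[OF c(1)] bas[OF c1(1)] bas[OF c2(1)] c c1 c2 by auto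
  have m: "?m \<in> carrier G" using i by simp
  have ci: "el (c div n) = k" "c mod n = i" using c by (auto simp: bas_def)
  have "(rmat (dual reg) (bas c))\<^sup>T * ecol Nd c2 = acoef i k \<cdot>\<^sub>m (Y reg ^\<^sub>m i * (\<rho> reg ?m * bvec j' l'))"
    using bas(4)[OF c2(1)] c2 reg m by (simp add: c antipode_eq[OF reg(1) i] smult_mult_dim mult_assoc_dim acoef_def)
  also have "\<dots> = (acoef i k * inverse (\<chi> ?m) ^ j') \<cdot>\<^sub>m bvec (j' + i) (?m \<otimes> l')"
    using m j' reg by (simp add: reg_bvec mult_smult_dim smult_smult_mat Y_pow_bvec del: \<chi>_mult)
  finally have 1: "(rmat (dual reg) (bas c))\<^sup>T * ecol Nd c2 = (acoef i k * inverse (\<chi> ?m) ^ j') \<cdot>\<^sub>m bvec (j' + i) (?m \<otimes> l')" .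
  have "rmat reg (bas c1) = Y reg ^\<^sub>m j * \<rho> reg l" using rmat_eq[OF reg(1) j] c1 by simp
  then have "rmat reg (bas c1) * bvec (j' + i) (?m \<otimes> l') = Y reg ^\<^sub>m j * (\<rho> reg l * bvec (j' + i) (?m \<otimes> l'))"
    using reg j by (simp add: mult_assoc_dim)
  also have "\<dots> = inverse (\<chi> l) ^ (j' + i) \<cdot>\<^sub>m bvec (j' + i + j) (l \<otimes> (?m \<otimes> l'))"
    using m j j' reg by (simp add: reg_bvec mult_smult_dim Y_pow_bvec del: G.m_assoc)
  finally have 2: "rmat reg (bas c1) * bvec (j' + i) (?m \<otimes> l') = inverse (\<chi> l) ^ (j' + i) \<cdot>\<^sub>m bvec (j' + i + j) (l \<otimes> (?m \<otimes> l'))" .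
  have d: "dim_col (rmat reg (bas c1)) = Nd" using reg bas[OF c1(1)] by simp
  have "rmat reg (bas c1) * ((rmat (dual reg) (bas c))\<^sup>T * ecol Nd c2) =
    (acoef i k * inverse (\<chi> ?m) ^ j' * inverse (\<chi> l) ^ (j' + i)) \<cdot>\<^sub>m bvec (j' + i + j) (l \<otimes> (?m \<otimes> l'))"
    unfolding 1 by (subst mult_smult_dim) (simp_all add: d 2 smult_smult_mat)
  moreover have "bvec (j' + i + j) (l \<otimes> (?m \<otimes> l')) $$ (c, 0) = (if j = 0 \<and> j' = 0 \<and> l \<otimes> (?m \<otimes> l') = k then 1 else 0)"
    using bvec_index[OF c(1), of "l \<otimes> (?m \<otimes> l')" "j' + i + j"] ci m j j' by auto
  ultimately show ?thesis using c(1) by auto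
qed

lemma sum_Nd: "(\<Sum>c<Nd. f c) = (\<Sum>h\<in>carrier G. \<Sum>t<n. f (idx h * n + t))"
proof -
  have "(\<Sum>c<Nd. f c) = (\<Sum>c<Nd. (\<lambda>s t. f (s * n + t)) (c div n) (c mod n))" by simp
  also have "\<dots> = (\<Sum>s<card (carrier G). \<Sum>t<n. f (s * n + t))" using n_pos by (rule sum_divmod)
  finally show ?thesis by (simp only: sum_idx)
qed

lemma bas_index: "h \<in> carrier G \<Longrightarrow> t < n \<Longrightarrow> bas (idx h * n + t) = (t, h)"
  "h \<in> carrier G \<Longrightarrow> t < n \<Longrightarrow> idx h * n + t < Nd"
  by (simp_all add: bas_def pair_index_less)

text \<open>The coefficient of \<open>h\<close> in the algebra element with coefficient column \<open>x\<close>.\<close>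

definition gcoef :: "'k mat \<Rightarrow> 'g \<Rightarrow> 'k" where "gcoef x h = x $$ (idx h * n, 0)"

lemma sum_deg0: "(\<Sum>c<Nd. x $$ (c, 0) * (if fst (bas c) = 0 then f (snd (bas c)) else 0)) = (\<Sum>h\<in>carrier G. gcoef x h * f h)"
proof -
  have "(\<Sum>t<n. x $$ (idx h * n + t, 0) * (if fst (bas (idx h * n + t)) = 0 then f (snd (bas (idx h * n + t))) else 0)) = gcoef x h * f h"
    if h: "h \<in> carrier G" for h
  proof -
    have "(\<Sum>t<n. x $$ (idx h * n + t, 0) * (if fst (bas (idx h * n + t)) = 0 then f (snd (bas (idx h * n + t))) else 0)) =
      (\<Sum>t<n. x $$ (idx h * n + t, 0) * (if t = 0 then f h else 0))"
    proof (intro sum.cong refl)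
      fix t assume "t \<in> {..<n}"
      then show "x $$ (idx h * n + t, 0) * (if fst (bas (idx h * n + t)) = 0 then f (snd (bas (idx h * n + t))) else 0) =
        x $$ (idx h * n + t, 0) * (if t = 0 then f h else 0)"
        using bas_index(1)[OF h n_pos] by (cases "t = 0") (simp_all add: bas_index(1)[OF h])
    qed
    also have "\<dots> = gcoef x h * f h" using n_pos by (simp add: sum_if_mult gcoef_def)
    finally show ?thesis .
  qed
  then show ?thesis by (simp add: sum_Nd)
qed

text \<open>Substituting k = l' m turns the fixed-point condition l k^{-1} g^{-i} l' = k into m^2
  g^i = l'^{-1} l, which involves l and l' only through this quotient.\<close>

lemma sclass_sum:
  assumes l: "l \<in> carrier G" "l' \<in> carrier G"
  shows "(\<Sum>k\<in>carrier G. \<Sum>i<n. if l \<otimes> (inv k \<otimes> inv g [^] i \<otimes> l') = k then acoef i k * inverse (\<chi> l) ^ i else 0) = sclass (inv l' \<otimes> l)"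
proof -
  have "(\<Sum>k\<in>carrier G. if l \<otimes> (inv k \<otimes> inv g [^] i \<otimes> l') = k then acoef i k * inverse (\<chi> l) ^ i else 0) =
    (-1) ^ i * cq i * inverse (\<chi> (inv l' \<otimes> l)) ^ i * (\<Sum>k\<in>carrier G. if k \<otimes> k \<otimes> g [^] i = inv l' \<otimes> l then \<chi> k ^ i else 0)" for i :: nat
  proof -
    let ?z = "g [^] i" and ?w = "inv g [^] i"
    have z: "?z \<in> carrier G" "?w \<in> carrier G" by auto
    have zc: "?z \<otimes> h = h \<otimes> ?z" if "h \<in> carrier G" for h
      using that by (induction i) (simp_all add: G.m_assoc central, simp add: G.m_assoc[symmetric])
    have w: "?w = inv ?z" by (simp add: G.nat_pow_inv)
    have wc: "?w \<otimes> h = h \<otimes> ?w" if h: "h \<in> carrier G" for h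
    proof -
      have zw: "?z \<otimes> ?w = \<one>" using z by (simp only: w G.r_inv)
      have "?z \<otimes> (h \<otimes> ?w) = (?z \<otimes> h) \<otimes> ?w" using h z by (simp only: G.m_assoc)
      also have "\<dots> = h \<otimes> (?z \<otimes> ?w)" using h z by (simp only: zc G.m_assoc)
      also have "\<dots> = (?z \<otimes> ?w) \<otimes> h" using h by (simp only: zw G.r_one G.l_one)
      also have "\<dots> = ?z \<otimes> (?w \<otimes> h)" using h z by (simp only: G.m_assoc)
      finally have "?z \<otimes> (?w \<otimes> h) = ?z \<otimes> (h \<otimes> ?w)" by simp
      then show ?thesis using h z by simp
    qed
    have eq: "l \<otimes> (inv (l' \<otimes> m) \<otimes> ?w \<otimes> l') = l' \<otimes> m \<longleftrightarrow> m \<otimes> m \<otimes> ?z = inv l' \<otimes> l" if m: "m \<in> carrier G" for m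
    proof -
      have "inv (l' \<otimes> m) \<otimes> ?w \<otimes> l' = inv m \<otimes> ?w"
        using l m z by (simp add: G.inv_mult_group G.m_assoc wc)  (simp add: G.m_assoc[symmetric])
      then have "l \<otimes> (inv (l' \<otimes> m) \<otimes> ?w \<otimes> l') = l' \<otimes> m \<longleftrightarrow> l \<otimes> (inv m \<otimes> inv ?z) = l' \<otimes> m" by (simp add: w)
      also have "\<dots> \<longleftrightarrow> l = l' \<otimes> m \<otimes> (?z \<otimes> m)"
      proof -
        have "inv m \<otimes> inv ?z = inv (?z \<otimes> m)" using m z by (simp add: G.inv_mult_group)
        moreover have "l \<otimes> inv (?z \<otimes> m) = l' \<otimes> m \<longleftrightarrow> l = l' \<otimes> m \<otimes> (?z \<otimes> m)"
          using l m z by (metis G.inv_solve_right G.m_closed)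
        ultimately show ?thesis by simp
      qed
      also have "l' \<otimes> m \<otimes> (?z \<otimes> m) = l' \<otimes> (m \<otimes> m \<otimes> ?z)" using l m z by (simp add: zc G.m_assoc)
      also have "l = l' \<otimes> (m \<otimes> m \<otimes> ?z) \<longleftrightarrow> m \<otimes> m \<otimes> ?z = inv l' \<otimes> l"
        using l m z by (metis G.inv_solve_left G.m_closed)
      finally show ?thesis .
    qed
    have "(\<Sum>k\<in>carrier G. if l \<otimes> (inv k \<otimes> ?w \<otimes> l') = k then acoef i k * inverse (\<chi> l) ^ i else 0) =
      (\<Sum>m\<in>carrier G. if l \<otimes> (inv (l' \<otimes> m) \<otimes> ?w \<otimes> l') = l' \<otimes> m then acoef i (l' \<otimes> m) * inverse (\<chi> l) ^ i else 0)"
      by (rule sum_translate[OF l(2), symmetric])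
    also have "\<dots> = (\<Sum>m\<in>carrier G. (-1) ^ i * cq i * inverse (\<chi> (inv l' \<otimes> l)) ^ i * (if m \<otimes> m \<otimes> ?z = inv l' \<otimes> l then \<chi> m ^ i else 0))"
      using l by (intro sum.cong refl) (simp add: eq acoef_def \<chi>_inv power_mult_distrib field_simps)
    finally show ?thesis by (simp add: sum_distrib_left)
  qed
  then show ?thesis by (subst sum.swap) (simp add: sclass_def)
qed

text \<open>Only the group-like parts of \<open>a\<close> and \<open>q\<close> contribute to the trace of
  \<open>x \<mapsto> a S(x) q\<close>, because the antipode does not lower the degree in \<open>y\<close>.\<close>

lemma trace_antipode:
  assumes q: "dim_row q = Nd" "dim_col q = Suc 0"
  shows "(\<Sum>c<Nd. (actv reg a * ((rmat (dual reg) (bas c))\<^sup>T * q)) $$ (c, 0)) =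
    (\<Sum>l\<in>carrier G. \<Sum>l'\<in>carrier G. gcoef a l * gcoef q l' * sclass (inv l' \<otimes> l))"
proof -
  let ?W = "\<lambda>c l l'. case bas c of (i, k) \<Rightarrow> if l \<otimes> (inv k \<otimes> inv g [^] i \<otimes> l') = k then acoef i k * inverse (\<chi> l) ^ i else 0"
  have trm: "(actv reg a * ((rmat (dual reg) (bas c))\<^sup>T * q)) $$ (c, 0) =
      (\<Sum>l'\<in>carrier G. gcoef q l' * (\<Sum>l\<in>carrier G. gcoef a l * ?W c l l'))" if c: "c < Nd" for c
  proof -
    let ?T = "(rmat (dual reg) (bas c))\<^sup>T"
    have T: "dim_row ?T = Nd" "dim_col ?T = Nd" using bas[OF c] dual(1)[OF reg(1)] reg by auto
    obtain i k where ik: "bas c = (i, k)" by (cases "bas c")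
    have 1: "(actv reg a * (?T * ecol Nd c2)) $$ (c, 0) =
      (if fst (bas c2) = 0 then (\<Sum>l\<in>carrier G. gcoef a l * ?W c l (snd (bas c2))) else 0)" if c2: "c2 < Nd" for c2
    proof -
      obtain j' l' where jl': "bas c2 = (j', l')" by (cases "bas c2")
      have "actv reg a * (?T * ecol Nd c2) = lincomb Nd 1 {..<Nd} (\<lambda>c. a $$ (c, 0)) (\<lambda>c. rmat reg (bas c) * (?T * ecol Nd c2))"
        unfolding actv_def using T reg bas(3) by (subst lincomb_mult) auto
      then have "(actv reg a * (?T * ecol Nd c2)) $$ (c, 0) = (\<Sum>c1<Nd. a $$ (c1, 0) * (rmat reg (bas c1) * (?T * ecol Nd c2)) $$ (c, 0))"
        using c by (simp add: lincomb_index)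
      also have "\<dots> = (\<Sum>c1<Nd. a $$ (c1, 0) * (if fst (bas c1) = 0 then (if j' = 0 then ?W c (snd (bas c1)) l' else 0) else 0))"
      proof (intro sum.cong refl)
        fix c1 assume "c1 \<in> {..<Nd}"
        then have c1: "c1 < Nd" by simp
        obtain j l where jl: "bas c1 = (j, l)" by (cases "bas c1")
        show "a $$ (c1, 0) * (rmat reg (bas c1) * (?T * ecol Nd c2)) $$ (c, 0) =
          a $$ (c1, 0) * (if fst (bas c1) = 0 then (if j' = 0 then ?W c (snd (bas c1)) l' else 0) else 0)"
          unfolding antipode_term[OF c ik c1 jl c2 jl'] by (simp add: jl ik)
      qed
      also have "\<dots> = (\<Sum>l\<in>carrier G. gcoef a l * (if j' = 0 then ?W c l l' else 0))" by (rule sum_deg0)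
      finally show ?thesis by (simp add: jl')
    qed
    have "actv reg a * (?T * q) = actv reg a * (?T * lincomb Nd 1 {..<Nd} (\<lambda>c. q $$ (c, 0)) (\<lambda>c. ecol Nd c))"
      using col_lincomb[OF q] by simp
    also have "\<dots> = lincomb Nd 1 {..<Nd} (\<lambda>c. q $$ (c, 0)) (\<lambda>c. actv reg a * (?T * ecol Nd c))"
      using T reg by (simp add: mult_lincomb)
    finally have "(actv reg a * (?T * q)) $$ (c, 0) = (\<Sum>c2<Nd. q $$ (c2, 0) * (actv reg a * (?T * ecol Nd c2)) $$ (c, 0))"
      using c by (simp add: lincomb_index)
    also have "\<dots> = (\<Sum>c2<Nd. q $$ (c2, 0) * (if fst (bas c2) = 0 then (\<Sum>l\<in>carrier G. gcoef a l * ?W c l (snd (bas c2))) else 0))"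
      by (intro sum.cong refl) (simp add: 1)
    also have "\<dots> = (\<Sum>l'\<in>carrier G. gcoef q l' * (\<Sum>l\<in>carrier G. gcoef a l * ?W c l l'))" by (rule sum_deg0)
    finally show ?thesis .
  qed
  have W: "(\<Sum>c<Nd. ?W c l l') = sclass (inv l' \<otimes> l)" if "l \<in> carrier G" "l' \<in> carrier G" for l l'
  proof -
    have "(\<Sum>c<Nd. ?W c l l') = (\<Sum>k\<in>carrier G. \<Sum>i<n. if l \<otimes> (inv k \<otimes> inv g [^] i \<otimes> l') = k then acoef i k * inverse (\<chi> l) ^ i else 0)"
      unfolding sum_Nd by (intro sum.cong refl) (simp add: bas_index)
    then show ?thesis using that by (simp only: sclass_sum)
  qed
  have "(\<Sum>c<Nd. (actv reg a * ((rmat (dual reg) (bas c))\<^sup>T * q)) $$ (c, 0)) =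
    (\<Sum>c<Nd. \<Sum>l'\<in>carrier G. \<Sum>l\<in>carrier G. gcoef q l' * (gcoef a l * ?W c l l'))"
    by (intro sum.cong refl) (simp add: trm sum_distrib_left)
  also have "\<dots> = (\<Sum>l'\<in>carrier G. \<Sum>c<Nd. \<Sum>l\<in>carrier G. gcoef q l' * (gcoef a l * ?W c l l'))" by (rule sum.swap)
  also have "\<dots> = (\<Sum>l'\<in>carrier G. \<Sum>l\<in>carrier G. \<Sum>c<Nd. gcoef q l' * (gcoef a l * ?W c l l'))"
    by (intro sum.cong refl sum.swap)
  also have "\<dots> = (\<Sum>l'\<in>carrier G. \<Sum>l\<in>carrier G. gcoef q l' * (gcoef a l * sclass (inv l' \<otimes> l)))"
  proof (intro sum.cong refl)
    fix l' l assume l: "l' \<in> carrier G" "l \<in> carrier G"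
    show "(\<Sum>c<Nd. gcoef q l' * (gcoef a l * ?W c l l')) = gcoef q l' * (gcoef a l * sclass (inv l' \<otimes> l))"
      by (subst W[OF l(2,1), symmetric]) (simp only: sum_distrib_left)
  qed
  also have "\<dots> = (\<Sum>l\<in>carrier G. \<Sum>l'\<in>carrier G. gcoef q l' * (gcoef a l * sclass (inv l' \<otimes> l)))" by (rule sum.swap)
  finally show ?thesis by (simp add: ac_simps)
qed

lemma natural_op_one: "natural_op (\<lambda>M. 1\<^sub>m (rdim M))"
  unfolding natural_op_def by (auto dest: rep_hom_dim)

lemma gcoef_u: "h \<in> carrier G \<Longrightarrow> gcoef u h = (if h = \<one> then 1 else 0)"
  using bvec_index[of "idx h * n" \<one> 0] bas_index(2)[of h 0] n_pos by (auto simp: gcoef_def)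

lemma u_sum: "(\<Sum>h\<in>carrier G. gcoef u h * f h) = f \<one>"
proof -
  have "(\<Sum>h\<in>carrier G. gcoef u h * f h) = (\<Sum>h\<in>carrier G. if h = \<one> then f h else 0)"
    by (intro sum.cong) (auto simp: gcoef_u)
  then show ?thesis by simp
qed

text \<open>The case a = q = 1 of \<open>trace_antipode\<close>: the column \<open>u\<close> acts as
  the identity.\<close>

lemma trace_antipode_one: "(\<Sum>c<Nd. ((rmat (dual reg) (bas c))\<^sup>T * u) $$ (c, 0)) = sclass \<one>"
proof -
  have "actv reg u = 1\<^sub>m Nd" using natural_op_eq[OF natural_op_one reg(1)] reg by simp
  then have "(\<Sum>c<Nd. ((rmat (dual reg) (bas c))\<^sup>T * u) $$ (c, 0)) = (\<Sum>c<Nd. (actv reg u * ((rmat (dual reg) (bas c))\<^sup>T * u)) $$ (c, 0))"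
    using bas(3) dual(1)[OF reg(1)] reg by (intro sum.cong refl) simp
  also have "\<dots> = (\<Sum>l\<in>carrier G. \<Sum>l'\<in>carrier G. gcoef u l * gcoef u l' * sclass (inv l' \<otimes> l))"
    by (rule trace_antipode) auto
  also have "\<dots> = (\<Sum>l\<in>carrier G. gcoef u l * (\<Sum>l'\<in>carrier G. gcoef u l' * sclass (inv l' \<otimes> l)))"
    by (simp add: sum_distrib_left mult.assoc)
  finally show ?thesis by (simp add: u_sum)
qed

text \<open>l' k x = l k holds exactly when x is the conjugate of l'^{-1} l by k, so the hypothesis
  says that the products of coefficients are distributed over the conjugacy classes like those of
  the unit. Pairing with the class function \<open>sclass\<close> gives its value at 1.\<close>

lemma sclass_average:
  assumes A: "\<And>x. x \<in> carrier G \<Longrightarrow>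
    (\<Sum>l\<in>carrier G. \<Sum>l'\<in>carrier G. a l * q l' * (\<Sum>k\<in>carrier G. if l' \<otimes> k \<otimes> x = l \<otimes> k then 1 else 0)) =
    (if x = \<one> then of_nat (card (carrier G)) else 0)"
  shows "(\<Sum>l\<in>carrier G. \<Sum>l'\<in>carrier G. a l * q l' * sclass (inv l' \<otimes> l)) = sclass \<one>"
proof -
  let ?N = "of_nat (card (carrier G)) :: 'k" and ?I = "\<lambda>x l l' k. if l' \<otimes> k \<otimes> x = l \<otimes> k then 1 else 0 :: 'k"
  have N: "?N \<noteq> 0" using G.one_closed by auto
  have s: "(\<Sum>k\<in>carrier G. \<Sum>x\<in>carrier G. sclass x * ?I x l l' k) = ?N * sclass (inv l' \<otimes> l)" if l: "l \<in> carrier G" "l' \<in> carrier G" for l l'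
  proof -
    have "(\<Sum>x\<in>carrier G. sclass x * ?I x l l' k) = sclass (inv l' \<otimes> l)" if k: "k \<in> carrier G" for k
    proof -
      let ?y = "inv k \<otimes> (inv l' \<otimes> l) \<otimes> k"
      have "l' \<otimes> k \<otimes> x = l \<otimes> k \<longleftrightarrow> x = ?y" if x: "x \<in> carrier G" for x
      proof -
        have "l' \<otimes> k \<otimes> x = l \<otimes> k \<longleftrightarrow> x = inv (l' \<otimes> k) \<otimes> (l \<otimes> k)" using l k x by (metis G.inv_solve_left G.m_closed)
        then show ?thesis using l k by (simp add: G.inv_mult_group G.m_assoc)
      qed
      then have "(\<Sum>x\<in>carrier G. sclass x * ?I x l l' k) = (\<Sum>x\<in>carrier G. if x = ?y then sclass x else 0)" by (intro sum.cong) auto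
      also have "\<dots> = sclass ?y" using l k by simp
      finally show ?thesis using sclass_conj[OF k, of "inv l' \<otimes> l"] l by simp
    qed
    then show ?thesis by simp
  qed
  have "?N * (\<Sum>l\<in>carrier G. \<Sum>l'\<in>carrier G. a l * q l' * sclass (inv l' \<otimes> l)) =
    (\<Sum>l\<in>carrier G. \<Sum>l'\<in>carrier G. a l * q l' * (?N * sclass (inv l' \<otimes> l)))"
    by (simp add: sum_distrib_left mult_ac)
  also have "\<dots> =
    (\<Sum>l\<in>carrier G. \<Sum>l'\<in>carrier G. a l * q l' * (\<Sum>k\<in>carrier G. \<Sum>x\<in>carrier G. sclass x * ?I x l l' k))"
    by (intro sum.cong refl) (simp only: s)
  also have "\<dots> = (\<Sum>l\<in>carrier G. \<Sum>l'\<in>carrier G. \<Sum>x\<in>carrier G. sclass x * (a l * q l' * (\<Sum>k\<in>carrier G. ?I x l l' k)))"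
    by (intro sum.cong refl, subst sum.swap) (simp add: sum_distrib_left mult_ac)
  also have "\<dots> = (\<Sum>l\<in>carrier G. \<Sum>x\<in>carrier G. \<Sum>l'\<in>carrier G. sclass x * (a l * q l' * (\<Sum>k\<in>carrier G. ?I x l l' k)))"
    by (intro sum.cong refl sum.swap)
  also have "\<dots> = (\<Sum>x\<in>carrier G. \<Sum>l\<in>carrier G. \<Sum>l'\<in>carrier G. sclass x * (a l * q l' * (\<Sum>k\<in>carrier G. ?I x l l' k)))"
    by (rule sum.swap)
  also have "\<dots> = (\<Sum>x\<in>carrier G. sclass x * (if x = \<one> then ?N else 0))"
    by (intro sum.cong refl) (simp only: A[symmetric] sum_distrib_left)
  also have "\<dots> = (\<Sum>x\<in>carrier G. if x = \<one> then sclass x * ?N else 0)" by (intro sum.cong) auto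
  also have "\<dots> = ?N * sclass \<one>" by simp
  finally show ?thesis using N by simp
qed

lemma cq_eq: "cq i = \<chi> g ^ (i * (i - 1) div 2)"
proof (induction i)
  case (Suc i)
  have "Suc i * i div 2 = i * (i - 1) div 2 + i" by (cases i) (simp_all add: algebra_simps)
  then show ?case using Suc by (simp add: cq power_add)
qed (simp add: cq)

text \<open>The k with k^2 g^i = 1 form the set G_i of the theorem. It remains to rewrite the
  antipode scalar: h^2 = g^{-i} trades \<chi>(h)^i for \<chi>(h)^{-i} at the cost of
  \<chi>(g)^{-i^2}, which turns the exponent i(i-1)/2 of \<chi>(g) into -i(i+1)/2.\<close>

lemma sclass_one_eq: "sclass \<one> = char_lin G \<chi> (theta G g n)"
proof -
  have trm: "(-1) ^ i * cq i * \<chi> h ^ i =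
    (-1) ^ i * \<chi> (h [^] (- int i) \<otimes> g [^] (- int (i * (1 + i) div 2)))" if h: "h \<in> root_set G g i" for i h
  proof -
    have hG: "h \<in> carrier G" and h2: "h [^] (2::nat) = g [^] (- int i)" using h by (auto simp: root_set_def)
    have neg: "\<chi> (x [^] (- int k)) = inverse (\<chi> x ^ k)" if "x \<in> carrier G" for x k
      using that by (simp add: G.int_pow_neg_int \<chi>_inv \<chi>_pow)
    have e: "\<chi> h ^ 2 * \<chi> g ^ i = 1" using h2 hG neg[of g i] \<chi>_pow[OF hG, of 2] by (metis g \<chi>_nz power_not_zero left_inverse)
    have "(\<chi> h ^ i * \<chi> h ^ i) * (cq i * \<chi> g ^ (i * (1 + i) div 2)) = (\<chi> h ^ 2 * \<chi> g ^ i) ^ i"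
    proof -
      have "even (i * (i - 1))" "even (i * (1 + i))" by auto
      then have "i * (i - 1) div 2 + i * (1 + i) div 2 = (i * (i - 1) + i * (1 + i)) div 2" by (simp add: div_add)
      also have "i * (i - 1) + i * (1 + i) = 2 * (i * i)" by (cases i) (simp_all add: algebra_simps)
      finally have "cq i * \<chi> g ^ (i * (1 + i) div 2) = \<chi> g ^ (i * i)" by (simp add: cq_eq flip: power_add)
      then show ?thesis by (simp add: power_mult_distrib power_mult power2_eq_square)
    qed
    then have "(\<chi> h ^ i * \<chi> h ^ i) * (cq i * \<chi> g ^ (i * (1 + i) div 2)) = 1" by (simp add: e)
    then have "cq i * \<chi> h ^ i = inverse (\<chi> h ^ i) * inverse (\<chi> g ^ (i * (1 + i) div 2))"
      using hG by (simp add: field_simps)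
    then show ?thesis using hG neg[of h i] neg[of g "i * (1 + i) div 2"] by simp
  qed
  have rs: "root_set G g i = {k \<in> carrier G. k \<otimes> k \<otimes> g [^] i = \<one>}" for i
  proof -
    have "k [^] (2::nat) = g [^] (- int i) \<longleftrightarrow> k \<otimes> k \<otimes> g [^] i = \<one>" if k: "k \<in> carrier G" for k
    proof -
      have "k [^] (2::nat) = k \<otimes> k" using k by (simp add: numeral_2_eq_2)
      moreover have "g [^] (- int i) = inv (g [^] i)" by (simp add: G.int_pow_neg_int)
      moreover have "k \<otimes> k = inv (g [^] i) \<longleftrightarrow> k \<otimes> k \<otimes> g [^] i = \<one>"
        using k by (metis G.inv_equality G.l_inv G.m_closed G.nat_pow_closed g)
      ultimately show ?thesis by simp
    qed
    then show ?thesis by (auto simp: root_set_def)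
  qed
  have fr: "finite (root_set G g i)" for i by (simp add: root_set_def)
  have "char_lin G \<chi> (theta G g n) =
    (\<Sum>x\<in>carrier G. \<Sum>i<n. \<Sum>h\<in>root_set G g i. (-1) ^ i * (if x = h [^] (- int i) \<otimes> g [^] (- int (i * (1 + i) div 2)) then \<chi> x else 0))"
  proof -
    \<comment> \<open>As n > 0, the outer sum in \<open>theta\<close> has exactly n terms.\<close>
    have "{0..n - 1} = {..<n}" using n_pos by auto
    then show ?thesis
      unfolding char_lin_def theta_def by (simp add: sum_distrib_right of_bool_def if_distribR) (intro sum.cong refl, auto)
  qed
  also have "\<dots> = (\<Sum>i<n. \<Sum>x\<in>carrier G. \<Sum>h\<in>root_set G g i. (-1) ^ i * (if x = h [^] (- int i) \<otimes> g [^] (- int (i * (1 + i) div 2)) then \<chi> x else 0))"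
    by (rule sum.swap)
  also have "\<dots> = (\<Sum>i<n. \<Sum>h\<in>root_set G g i. (-1) ^ i * cq i * \<chi> h ^ i)"
  proof (rule sum.cong[OF refl])
    fix i
    have "(\<Sum>x\<in>carrier G. (-1) ^ i * (if x = h [^] (- int i) \<otimes> g [^] (- int (i * (1 + i) div 2)) then \<chi> x else 0)) =
      (-1) ^ i * cq i * \<chi> h ^ i" if h: "h \<in> root_set G g i" for h
    proof -
      have hG: "h \<in> carrier G" using h by (auto simp: root_set_def)
      then show ?thesis unfolding trm[OF h] by (simp only: sum_distrib_left[symmetric] sum.delta fin) simp
    qed
    then show "(\<Sum>x\<in>carrier G. \<Sum>h\<in>root_set G g i. (-1) ^ i * (if x = h [^] (- int i) \<otimes> g [^] (- int (i * (1 + i) div 2)) then \<chi> x else 0)) =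
      (\<Sum>h\<in>root_set G g i. (-1) ^ i * cq i * \<chi> h ^ i)"
      by (subst sum.swap) (simp cong: sum.cong)
  qed
  also have "\<dots> = sclass \<one>"
    unfolding sclass_def rs
    by (simp add: sum.inter_filter sum_distrib_left) (intro sum.cong refl, simp)
  finally show ?thesis by simp
qed

subsection \<open>Traces on the inflated regular module\<close>

lemma rmat_infl: "V \<in> reps K \<Longrightarrow> t < n \<Longrightarrow> h \<in> carrier G \<Longrightarrow> rmat (infl V) (t, h) = (if t = 0 then rmat V h else 0\<^sub>m (rdim V) (rdim V))"
proof (cases t)
  case (Suc s)
  assume a: "V \<in> reps K" "t < n" "h \<in> carrier G"
  have "Y (infl V) ^\<^sub>m t = 0\<^sub>m (rdim V) (rdim V)" using a by (simp add: infl zero_pow_mat Suc)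
  then show ?thesis using a Suc rmat_eq[OF infl(1)[OF a(1)] a(2,3)] by (simp add: infl)
qed (simp add: infl)

text \<open>Positive powers of y vanish on an inflated module, so an element of H is seen there only
  through its group-like coefficients, the same ones that enter
  \<open>trace_antipode\<close>.\<close>

lemma actv_infl:
  assumes V: "V \<in> reps K"
  shows "actv (infl V) a = lincomb (rdim V) (rdim V) (carrier G) (gcoef a) (rmat V)"
proof (rule eq_matI)
  fix i j assume "i < dim_row (lincomb (rdim V) (rdim V) (carrier G) (gcoef a) (rmat V))"
    "j < dim_col (lincomb (rdim V) (rdim V) (carrier G) (gcoef a) (rmat V))"
  then have ij: "i < rdim V" "j < rdim V" by auto
  have "actv (infl V) a $$ (i, j) = (\<Sum>c<Nd. a $$ (c, 0) * (if fst (bas c) = 0 then rmat V (snd (bas c)) $$ (i, j) else 0))"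
  proof -
    have "rmat (infl V) (bas c) $$ (i, j) = (if fst (bas c) = 0 then rmat V (snd (bas c)) $$ (i, j) else 0)" if c: "c < Nd" for c
      using rmat_infl[OF V bas(1)[OF c] bas(2)[OF c]] ij by simp
    then show ?thesis unfolding actv_def using ij by (simp add: lincomb_index)
  qed
  also have "\<dots> = (\<Sum>h\<in>carrier G. gcoef a h * rmat V h $$ (i, j))" by (rule sum_deg0)
  finally show "actv (infl V) a $$ (i, j) = lincomb (rdim V) (rdim V) (carrier G) (gcoef a) (rmat V) $$ (i, j)"
    using ij by (simp add: lincomb_index)
qed simp_all

text \<open>Permutation matrices are orthogonal. Because this is an equality of modules, the
  coevaluation and the evaluation of kG can be composed to a scalar.\<close>

lemma dual_infl_Kreg: "dual (infl Kreg) = infl Kreg"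
proof (rule rep_eqI_H)
  show "\<rho> (dual (infl Kreg)) h = \<rho> (infl Kreg) h" if h: "h \<in> carrier G" for h
  proof -
    have "(rmat Kreg (inv h))\<^sup>T = rmat Kreg h"
    proof (rule eq_matI)
      fix a b assume "a < dim_row (rmat Kreg h)" "b < dim_col (rmat Kreg h)"
      then have ab: "a < card (carrier G)" "b < card (carrier G)" using h Kreg by auto
      have el_eq: "c = idx x \<longleftrightarrow> el c = x" if "c < card (carrier G)" "x \<in> carrier G" for c x
        using that by auto
      have "b = idx (inv h \<otimes> el a) \<longleftrightarrow> el b = inv h \<otimes> el a" using ab h by (intro el_eq) auto
      also have "\<dots> \<longleftrightarrow> el a = h \<otimes> el b" using ab h by (metis G.inv_solve_left el(2))
      also have "\<dots> \<longleftrightarrow> a = idx (h \<otimes> el b)" using ab h by (intro el_eq[symmetric]) auto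
      finally show "(rmat Kreg (inv h))\<^sup>T $$ (a, b) = rmat Kreg h $$ (a, b)" using ab h Kreg by (simp add: Kreg_index)
    qed (use h Kreg in auto)
    then show ?thesis using h Kreg by (simp add: dual infl)
  qed
qed (use Kreg in \<open>auto simp: dual infl\<close>)

text \<open>Right translation by x, an endomorphism of the left regular representation. Its trace
  counts the h with h x = h.\<close>

definition rtrans :: "'g \<Rightarrow> 'k mat"
  where "rtrans x = mat (card (carrier G)) (card (carrier G)) (\<lambda>(a, b). if a = idx (el b \<otimes> x) then 1 else 0)"

lemma dim_rtrans [simp]: "dim_row (rtrans x) = card (carrier G)" "dim_col (rtrans x) = card (carrier G)"
  by (simp_all add: rtrans_def)

lemma rtrans_eg:
  assumes "x \<in> carrier G" "h \<in> carrier G"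
  shows "rtrans x * eg h = eg (h \<otimes> x)"
proof (rule eq_matI)
  fix a b assume "a < dim_row (eg (h \<otimes> x))" "b < dim_col (eg (h \<otimes> x))"
  then have ab: "a < card (carrier G)" "b = 0" by auto
  show "(rtrans x * eg h) $$ (a, b) = eg (h \<otimes> x) $$ (a, b)"
    using ab assms mult_ecol_index[of "rtrans x" "card (carrier G)" "idx h" a] by (simp add: rtrans_def ecol_def)
qed simp_all

lemma rtrans_hom:
  assumes x: "x \<in> carrier G"
  shows "rtrans x \<in> rep_hom K Kreg Kreg"
proof (rule rep_homI)
  fix l assume "l \<in> basis K"
  then have l: "l \<in> carrier G" by simp
  show "rmat Kreg l * rtrans x = rtrans x * rmat Kreg l"
  proof (rule mat_eqI_ecol)
    fix c assume "c < card (carrier G)"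
    then obtain h where h: "h \<in> carrier G" "c = idx h" using idx_surj by blast
    show "(rmat Kreg l * rtrans x) * ecol (card (carrier G)) c = (rtrans x * rmat Kreg l) * ecol (card (carrier G)) c"
      using l h x Kreg by (simp add: mult_assoc_dim rtrans_eg Kreg_eg G.m_assoc)
  qed (use l Kreg in auto)
qed simp_all

lemma tr_rtrans: "x \<in> carrier G \<Longrightarrow> tr (rtrans x) = (if x = \<one> then of_nat (card (carrier G)) else 0)"
proof -
  assume x: "x \<in> carrier G"
  have "tr (rtrans x) = (\<Sum>h\<in>carrier G. if h = h \<otimes> x then 1 else 0)"
    using x by (simp add: tr_def sum_idx rtrans_def)
  also have "\<dots> = (\<Sum>h\<in>carrier G. if x = \<one> then 1 else 0)"
    using x by (intro sum.cong refl) simp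
  finally show ?thesis by simp
qed

text \<open>The transpose turns the trace into a sum of products of entries; for permutation
  matrices it counts the k at which l' k x and l k agree.\<close>

lemma tr_actv_Kreg:
  assumes x: "x \<in> carrier G"
  shows "tr ((actv (infl Kreg) q * rtrans x)\<^sup>T * actv (infl Kreg) a) =
    (\<Sum>l\<in>carrier G. \<Sum>l'\<in>carrier G. gcoef a l * gcoef q l' * (\<Sum>k\<in>carrier G. if l' \<otimes> k \<otimes> x = l \<otimes> k then 1 else 0))"
proof -
  let ?d = "card (carrier G)"
  have t: "tr ((rmat Kreg l' * rtrans x)\<^sup>T * rmat Kreg l) = (\<Sum>k\<in>carrier G. if l' \<otimes> k \<otimes> x = l \<otimes> k then 1 else 0)"
    if l: "l \<in> carrier G" "l' \<in> carrier G" for l l'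
  proof -
    let ?A = "rmat Kreg l' * rtrans x" and ?B = "rmat Kreg l"
    have d: "dim_row ?A = ?d" "dim_col ?A = ?d" "dim_row ?B = ?d" "dim_col ?B = ?d" using l Kreg by auto
    have "tr (?A\<^sup>T * ?B) = (\<Sum>c<?d. \<Sum>s<?d. ?A $$ (s, c) * ?B $$ (s, c))"
      using d by (subst tr_mult) (simp_all del: index_mult_mat(1))
    also have "\<dots> = (\<Sum>k\<in>carrier G. \<Sum>s<?d. ?A $$ (s, idx k) * ?B $$ (s, idx k))" by (simp only: sum_idx[of "\<lambda>c. \<Sum>s<?d. ?A $$ (s, c) * ?B $$ (s, c)"])
    also have "\<dots> = (\<Sum>k\<in>carrier G. if l' \<otimes> k \<otimes> x = l \<otimes> k then 1 else 0)"
    proof (intro sum.cong refl)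
      fix k assume k: "k \<in> carrier G"
      have A: "?A $$ (s, idx k) = (if s = idx (l' \<otimes> k \<otimes> x) then 1 else 0)" if s: "s < ?d" for s
      proof -
        have "?A * eg k = eg (l' \<otimes> k \<otimes> x)" using l k x Kreg by (simp add: mult_assoc_dim rtrans_eg Kreg_eg G.m_assoc)
        then show ?thesis using mult_ecol_index[of ?A ?d "idx k" s] d k s by (simp add: ecol_def)
      qed
      have B: "?B $$ (s, idx k) = (if s = idx (l \<otimes> k) then 1 else 0)" if s: "s < ?d" for s
        using l k s by (simp add: Kreg_index)
      have "(\<Sum>s<?d. ?A $$ (s, idx k) * ?B $$ (s, idx k)) =
        (\<Sum>s<?d. (if s = idx (l' \<otimes> k \<otimes> x) then 1 else 0) * (if s = idx (l \<otimes> k) then 1 else 0))"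
        by (intro sum.cong refl) (simp add: A B del: index_mult_mat(1))
      also have "\<dots> = (if l' \<otimes> k \<otimes> x = l \<otimes> k then 1 else 0)" using l k x by (simp only: sum_if_mult) auto
      finally show "(\<Sum>s<?d. ?A $$ (s, idx k) * ?B $$ (s, idx k)) = (if l' \<otimes> k \<otimes> x = l \<otimes> k then 1 else 0)" .
    qed
    finally show ?thesis .
  qed
  have Kd: "l \<in> carrier G \<Longrightarrow> dim_row (rmat Kreg l) = ?d \<and> dim_col (rmat Kreg l) = ?d" for l using Kreg by simp
  have "actv (infl Kreg) q * rtrans x = lincomb ?d ?d (carrier G) (gcoef q) (\<lambda>l'. rmat Kreg l' * rtrans x)"
    unfolding actv_infl[OF Kreg] using Kd by (simp add: lincomb_mult)
  then have "(actv (infl Kreg) q * rtrans x)\<^sup>T = lincomb ?d ?d (carrier G) (gcoef q) (\<lambda>l'. (rmat Kreg l' * rtrans x)\<^sup>T)"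
    using Kd by (intro eq_matI) (auto simp: lincomb_index simp del: index_mult_mat(1))
  then have "(actv (infl Kreg) q * rtrans x)\<^sup>T * actv (infl Kreg) a =
    lincomb ?d ?d (carrier G) (gcoef q) (\<lambda>l'. (rmat Kreg l' * rtrans x)\<^sup>T * lincomb ?d ?d (carrier G) (gcoef a) (rmat Kreg))"
    unfolding actv_infl[OF Kreg] using Kd by (simp add: lincomb_mult)
  then have "tr ((actv (infl Kreg) q * rtrans x)\<^sup>T * actv (infl Kreg) a) =
    (\<Sum>l'\<in>carrier G. gcoef q l' * tr ((rmat Kreg l' * rtrans x)\<^sup>T * lincomb ?d ?d (carrier G) (gcoef a) (rmat Kreg)))"
    by (simp add: tr_lincomb)
  also have "\<dots> = (\<Sum>l'\<in>carrier G. gcoef q l' * (\<Sum>l\<in>carrier G. gcoef a l * tr ((rmat Kreg l' * rtrans x)\<^sup>T * rmat Kreg l)))"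
    using Kd by (intro sum.cong refl) (simp add: mult_lincomb tr_lincomb)
  also have "\<dots> = (\<Sum>l'\<in>carrier G. \<Sum>l\<in>carrier G. gcoef a l * gcoef q l' * (\<Sum>k\<in>carrier G. if l' \<otimes> k \<otimes> x = l \<otimes> k then 1 else 0))"
    unfolding sum_distrib_left[of "gcoef q _"] by (intro sum.cong refl) (simp only: t mult_ac)
  also have "\<dots> = (\<Sum>l\<in>carrier G. \<Sum>l'\<in>carrier G. gcoef a l * gcoef q l' * (\<Sum>k\<in>carrier G. if l' \<otimes> k \<otimes> x = l \<otimes> k then 1 else 0))"
    by (rule sum.swap)
  finally show ?thesis .
qed

end

section \<open>Tensor equivalences\<close>

lemma rep_cat_simps:
  "Obj (rep_cat H) = reps H" "Hom (rep_cat H) = rep_hom H" "Ident (rep_cat H) M = 1\<^sub>m (rdim M)"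
  "Comp (rep_cat H) = (*)" "Plus (rep_cat H) = (+)" "Scale (rep_cat H) = smult_mat"
  "TObj (rep_cat H) = rep_tensor H" "TMor (rep_cat H) = kron" "TUnit (rep_cat H) = rep_unit H"
  "Assoc (rep_cat H) M N P = 1\<^sub>m (rdim M * rdim N * rdim P)" "LUnit (rep_cat H) M = 1\<^sub>m (rdim M)" "RUnit (rep_cat H) M = 1\<^sub>m (rdim M)"
  by (simp_all add: rep_cat_def)

lemma lincomb_insert:
  "finite I \<Longrightarrow> p \<notin> I \<Longrightarrow> dim_row (A p) = r \<Longrightarrow> dim_col (A p) = c \<Longrightarrow>
    lincomb r c (insert p I) x A = x p \<cdot>\<^sub>m A p + lincomb r c I x (A :: _ \<Rightarrow> 'k::field mat)"
  by (rule eq_matI) (auto simp: lincomb_index)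

lemma lincomb_empty: "lincomb r c {} x A = 0\<^sub>m r c"
  by (rule eq_matI) (auto simp: lincomb_index)

locale rep_functor =
  fixes A :: "('b, 'k::field_char_0) hopf" and B :: "('c, 'k) hopf"
    and F0 :: "('b, 'k) rep \<Rightarrow> ('c, 'k) rep" and F1 :: "('b, 'k) rep \<Rightarrow> ('b, 'k) rep \<Rightarrow> 'k mat \<Rightarrow> 'k mat"
  assumes linear: "linear_functor (rep_cat A) (rep_cat B) F0 F1"
begin

lemma F0 [simp]: "M \<in> reps A \<Longrightarrow> F0 M \<in> reps B"
  and F1: "M \<in> reps A \<Longrightarrow> N \<in> reps A \<Longrightarrow> f \<in> rep_hom A M N \<Longrightarrow> F1 M N f \<in> rep_hom B (F0 M) (F0 N)"
  and F_id: "M \<in> reps A \<Longrightarrow> F1 M M (1\<^sub>m (rdim M)) = 1\<^sub>m (rdim (F0 M))"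
  and F_comp: "M \<in> reps A \<Longrightarrow> N \<in> reps A \<Longrightarrow> P \<in> reps A \<Longrightarrow> f \<in> rep_hom A M N \<Longrightarrow> f' \<in> rep_hom A N P \<Longrightarrow>
    F1 M P (f' * f) = F1 N P f' * F1 M N f"
  and F_add: "M \<in> reps A \<Longrightarrow> N \<in> reps A \<Longrightarrow> f \<in> rep_hom A M N \<Longrightarrow> f' \<in> rep_hom A M N \<Longrightarrow>
    F1 M N (f + f') = F1 M N f + F1 M N f'"
  and F_smult: "M \<in> reps A \<Longrightarrow> N \<in> reps A \<Longrightarrow> f \<in> rep_hom A M N \<Longrightarrow> F1 M N (c \<cdot>\<^sub>m f) = c \<cdot>\<^sub>m F1 M N f"
  using linear unfolding linear_functor_def rep_cat_simps by blast+

lemma dim_F1 [simp]: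
  "M \<in> reps A \<Longrightarrow> N \<in> reps A \<Longrightarrow> f \<in> rep_hom A M N \<Longrightarrow> dim_row (F1 M N f) = rdim (F0 N)"
  "M \<in> reps A \<Longrightarrow> N \<in> reps A \<Longrightarrow> f \<in> rep_hom A M N \<Longrightarrow> dim_col (F1 M N f) = rdim (F0 M)"
  using F1 rep_hom_dim by blast+

lemma F_zero: "M \<in> reps A \<Longrightarrow> N \<in> reps A \<Longrightarrow> F1 M N (0\<^sub>m (rdim N) (rdim M)) = 0\<^sub>m (rdim (F0 N)) (rdim (F0 M))"
proof -
  assume MN: "M \<in> reps A" "N \<in> reps A"
  let ?z = "0\<^sub>m (rdim N) (rdim M) :: 'k mat"
  have z: "?z \<in> rep_hom A M N" by (rule rep_hom_zero[OF MN])
  have "0 \<cdot>\<^sub>m ?z = ?z" by (rule eq_matI) auto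
  then have "F1 M N ?z = 0 \<cdot>\<^sub>m F1 M N ?z" using F_smult[OF MN z, of 0] by simp
  also have "\<dots> = 0\<^sub>m (rdim (F0 N)) (rdim (F0 M))" using MN z by (intro eq_matI) auto
  finally show ?thesis .
qed

lemma F_lincomb:
  assumes MN: "M \<in> reps A" "N \<in> reps A" and "finite I" "\<And>p. p \<in> I \<Longrightarrow> X p \<in> rep_hom A M N"
  shows "lincomb (rdim N) (rdim M) I x X \<in> rep_hom A M N"
    "F1 M N (lincomb (rdim N) (rdim M) I x X) = lincomb (rdim (F0 N)) (rdim (F0 M)) I x (\<lambda>p. F1 M N (X p))"
proof -
  have "lincomb (rdim N) (rdim M) I x X \<in> rep_hom A M N \<and>
    F1 M N (lincomb (rdim N) (rdim M) I x X) = lincomb (rdim (F0 N)) (rdim (F0 M)) I x (\<lambda>p. F1 M N (X p))"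
    using assms(3,4)
  proof (induction I)
    case empty
    then show ?case using MN by (simp add: lincomb_empty rep_hom_zero F_zero)
  next
    case (insert p I)
    then have h: "X p \<in> rep_hom A M N" "lincomb (rdim N) (rdim M) I x X \<in> rep_hom A M N"
      "F1 M N (lincomb (rdim N) (rdim M) I x X) = lincomb (rdim (F0 N)) (rdim (F0 M)) I x (\<lambda>p. F1 M N (X p))" by auto
    have 1: "lincomb (rdim N) (rdim M) (insert p I) x X = x p \<cdot>\<^sub>m X p + lincomb (rdim N) (rdim M) I x X"
      by (rule lincomb_insert) (use insert rep_hom_dim[OF h(1)] in auto)
    have 2: "lincomb (rdim (F0 N)) (rdim (F0 M)) (insert p I) x (\<lambda>p. F1 M N (X p)) =
      x p \<cdot>\<^sub>m F1 M N (X p) + lincomb (rdim (F0 N)) (rdim (F0 M)) I x (\<lambda>p. F1 M N (X p))"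
      by (rule lincomb_insert) (use insert MN h(1) in auto)
    have "x p \<cdot>\<^sub>m X p \<in> rep_hom A M N" by (rule rep_hom_smult[OF MN h(1)])
    then show ?case unfolding 1 2 using h MN by (simp add: F_add F_smult rep_hom_add)
  qed
  then show "lincomb (rdim N) (rdim M) I x X \<in> rep_hom A M N"
    "F1 M N (lincomb (rdim N) (rdim M) I x X) = lincomb (rdim (F0 N)) (rdim (F0 M)) I x (\<lambda>p. F1 M N (X p))" by auto
qed

lemma F_iso:
  assumes "M \<in> reps A" "N \<in> reps A" "rep_iso A M N"
  shows "rep_iso B (F0 M) (F0 N)"
proof -
  obtain f f' where f: "f \<in> rep_hom A M N" "f' \<in> rep_hom A N M" "f' * f = 1\<^sub>m (rdim M)" "f * f' = 1\<^sub>m (rdim N)"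
    using assms(3) by (auto simp: rep_iso_def)
  show ?thesis
    by (rule rep_isoI[of "F1 M N f" _ _ _ "F1 N M f'"]) (use assms f in \<open>auto simp: F1 F_id simp flip: F_comp\<close>)
qed

lemma F_sum:
  assumes "M \<in> reps A" "N \<in> reps A"
  shows "rep_iso B (F0 (rep_sum A M N)) (rep_sum B (F0 M) (F0 N))"
proof -
  let ?S = "rep_sum A M N"
  have S: "?S \<in> reps A" using assms by (rule rep_sum_rep)
  obtain i1 i2 p1 p2 where ip: "i1 \<in> rep_hom A M ?S" "i2 \<in> rep_hom A N ?S" "p1 \<in> rep_hom A ?S M" "p2 \<in> rep_hom A ?S N"
    "p1 * i1 = 1\<^sub>m (rdim M)" "p2 * i2 = 1\<^sub>m (rdim N)"
    "p1 * i2 = 0\<^sub>m (rdim M) (rdim N)" "p2 * i1 = 0\<^sub>m (rdim N) (rdim M)" "i1 * p1 + i2 * p2 = 1\<^sub>m (rdim ?S)"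
    by (rule rep_sum_biproduct[OF assms]) auto
  have "F1 ?S ?S (i1 * p1 + i2 * p2) = F1 ?S ?S (i1 * p1) + F1 ?S ?S (i2 * p2)"
    by (rule F_add[OF S S rep_hom_comp[OF S assms(1) S ip(3,1)] rep_hom_comp[OF S assms(2) S ip(4,2)]])
  then have "F1 M ?S i1 * F1 ?S M p1 + F1 N ?S i2 * F1 ?S N p2 = F1 ?S ?S (i1 * p1 + i2 * p2)"
    by (simp only: F_comp[OF S assms(1) S ip(3,1)] F_comp[OF S assms(2) S ip(4,2)])
  also have "\<dots> = 1\<^sub>m (rdim (F0 ?S))" using S by (simp add: ip(9) F_id del: rdim_sum)
  finally show ?thesis
    using assms S ip
    by (intro rep_iso_sumI[of "F0 M" B "F0 N" "F0 ?S" "F1 M ?S i1" "F1 N ?S i2" "F1 ?S M p1" "F1 ?S N p2"])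
      (auto simp: F1 F_id F_zero simp flip: F_comp)
qed

end

section \<open>Additive invariants of modules and invariant pairings\<close>

context datum
begin

text \<open>The trivial module of dimension d is a sum of d copies of the unit. Stated for an
  arbitrary additive invariant, so that it applies to dimensions and characters, also after a
  functor.\<close>

lemma triv_tensor_additive:
  fixes \<psi> :: "(nat \<times> 'g, 'k) rep \<Rightarrow> 'k"
  assumes iso: "\<And>M N. M \<in> reps H \<Longrightarrow> N \<in> reps H \<Longrightarrow> rep_iso H M N \<Longrightarrow> \<psi> M = \<psi> N"
    and sum: "\<And>M N. M \<in> reps H \<Longrightarrow> N \<in> reps H \<Longrightarrow> \<psi> (rep_sum H M N) = \<psi> M + \<psi> N"
    and M: "M \<in> reps H"
  shows "\<psi> (rep_tensor H (infl (trivK d)) M) = of_nat d * \<psi> M"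
proof (induction d)
  case 0
  let ?P = "rep_tensor H (infl (trivK 0)) M"
  have P: "?P \<in> reps H" "rdim ?P = 0"
    using TH.tensor_rep[OF infl(1)[OF trivK(1), of 0] M] by (simp_all add: trivK(2) rep_tensor_def)
  have "rep_sum H ?P ?P = ?P" using P rep_dim0_eq[of ?P H] rep_dim0_eq[of "rep_sum H ?P ?P" H] by (simp add: rep_sum_rep)
  then have "\<psi> ?P = \<psi> ?P + \<psi> ?P" using sum[OF P(1) P(1)] by simp
  then show ?case by simp
next
  case (Suc d)
  have "trivK (Suc d) = rep_sum K (trivK d) (rep_unit K)"
    by (rule rep_eqI[of _ K]) (auto simp: trivK sum_K unit_K rep_sum_rep bdiag_one)
  then have t: "infl (trivK (Suc d)) = rep_sum H (infl (trivK d)) (rep_unit H)"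
    by (simp add: infl_sum trivK unit_K infl_unit)
  have r: "infl (trivK d) \<in> reps H" by (rule infl(1)[OF trivK(1)])
  have "\<psi> (rep_tensor H (infl (trivK (Suc d))) M) = \<psi> (rep_sum H (rep_tensor H (infl (trivK d)) M) (rep_tensor H (rep_unit H) M))"
    unfolding t by (intro iso rep_tensor_sum_left TH.tensor_rep rep_sum_rep r M TH.unit_rep)
  also have "\<dots> = of_nat d * \<psi> M + \<psi> M"
    using r M Suc by (simp add: sum TH.tensor_rep TH.unit_rep TH.unit_tensor)
  finally show ?case by (simp add: algebra_simps)
qed

text \<open>Invariance of a pairing says that its matrix intertwines the action on M with the dual
  action on N; for y, cancelling g on the second factor produces S(y) = -y g^{-1}.\<close>

lemma pairing_hom:
  assumes MN: "M \<in> reps H" "N \<in> reps H" and X: "dim_row X = rdim M" "dim_col X = rdim N"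
    and hom: "rowm X \<in> rep_hom H (rep_tensor H M N) (rep_unit H)"
  shows "X\<^sup>T \<in> rep_hom H M (dual N)"
proof (rule rep_homI_H)
  have T: "rep_tensor H M N \<in> reps H" using MN by (rule TH.tensor_rep)
  show "\<rho> (dual N) h * X\<^sup>T = X\<^sup>T * \<rho> M h" if h: "h \<in> carrier G" for h
  proof -
    have "rowm X * \<rho> (rep_tensor H M N) h = rowm X"
      using rep_homD_H(1)[OF T TH.unit_rep hom h] h MN by (simp add: unit_H)
    then have "rowm ((\<rho> M h)\<^sup>T * X * \<rho> N h) = rowm X" using MN X h by (simp add: tensor_H rowm_kron)
    then have "(\<rho> M h)\<^sup>T * X * \<rho> N h = X" by (rule rowm_inj) (use MN X h in auto)
    then have "X * \<rho> N (inv h) = ((\<rho> M h)\<^sup>T * X * \<rho> N h) * \<rho> N (inv h)" by simp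
    also have "\<dots> = (\<rho> M h)\<^sup>T * X" using MN X h by (simp add: mult_assoc_dim \<rho>_inv)
    finally have "(X * \<rho> N (inv h))\<^sup>T = ((\<rho> M h)\<^sup>T * X)\<^sup>T" by simp
    then show ?thesis using MN X h by (simp add: dual transpose_mult_dim)
  qed
  have "rowm X * Y (rep_tensor H M N) = 0\<^sub>m (Suc 0) (rdim M * rdim N)"
    using rep_homD_H(2)[OF T TH.unit_rep hom] MN X by (simp add: unit_H)
  moreover have "rowm X * Y (rep_tensor H M N) = rowm ((Y M)\<^sup>T * X * \<rho> N g + X * Y N)"
    using MN X by (simp add: tensor_H tensor_Y_def mult_add_dim rowm_kron rowm_add)
  ultimately have "rowm ((Y M)\<^sup>T * X * \<rho> N g + X * Y N) = rowm (0\<^sub>m (rdim M) (rdim N))" by simp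
  then have 0: "(Y M)\<^sup>T * X * \<rho> N g + X * Y N = 0\<^sub>m (rdim M) (rdim N)" by (rule rowm_inj) (use MN X in auto)
  have "X * Y N = (-1) \<cdot>\<^sub>m ((Y M)\<^sup>T * X * \<rho> N g)"
  proof (rule eq_matI)
    fix i j assume "i < dim_row ((-1) \<cdot>\<^sub>m ((Y M)\<^sup>T * X * \<rho> N g))" "j < dim_col ((-1) \<cdot>\<^sub>m ((Y M)\<^sup>T * X * \<rho> N g))"
    then have ij: "i < rdim M" "j < rdim N" using MN by auto
    have "((Y M)\<^sup>T * X * \<rho> N g + X * Y N) $$ (i, j) = 0" using ij by (simp add: 0)
    then have "((Y M)\<^sup>T * X * \<rho> N g) $$ (i, j) + (X * Y N) $$ (i, j) = 0"
      using ij MN X by (simp del: index_mult_mat(1))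
    then show "(X * Y N) $$ (i, j) = ((-1) \<cdot>\<^sub>m ((Y M)\<^sup>T * X * \<rho> N g)) $$ (i, j)"
      using ij MN by (simp del: index_mult_mat(1) add: eq_neg_iff_add_eq_0 add.commute)
  qed (use MN X in auto)
  then have "X * ((-1) \<cdot>\<^sub>m (Y N * \<rho> N (inv g))) = (Y M)\<^sup>T * X"
    using MN X by (simp add: mult_smult_dim mult_assoc_dim[symmetric] smult_mult_dim smult_smult_mat)
      (simp add: mult_assoc_dim \<rho>_inv)
  then have "(X * ((-1) \<cdot>\<^sub>m (Y N * \<rho> N (inv g))))\<^sup>T = ((Y M)\<^sup>T * X)\<^sup>T" by simp
  then show "Y (dual N) * X\<^sup>T = X\<^sup>T * Y M"
    using MN X by (simp add: dual transpose_mult_dim[of X] transpose_mult_dim[of "(Y M)\<^sup>T"] transpose_smult)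
qed (use MN X dual in auto)

end

section \<open>A tensor equivalence preserves dimensions and the regular module\<close>

locale tensor_equiv = D: datum G \<chi> g n + E: datum G \<chi>' g n
  for G :: "('g, 'm) monoid_scheme" (structure) and \<chi> \<chi>' :: "'g \<Rightarrow> 'k::field_char_0" and g :: 'g and n :: nat +
  fixes F0 :: "(nat \<times> 'g, 'k) rep \<Rightarrow> (nat \<times> 'g, 'k) rep"
    and F1 :: "(nat \<times> 'g, 'k) rep \<Rightarrow> (nat \<times> 'g, 'k) rep \<Rightarrow> 'k mat \<Rightarrow> 'k mat"
    and J :: "(nat \<times> 'g, 'k) rep \<Rightarrow> (nat \<times> 'g, 'k) rep \<Rightarrow> 'k mat" and \<phi> :: "'k mat"
  assumes equiv: "equivalence_functor (rep_cat D.H) (rep_cat E.H) F0 F1"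
    and tensor: "tensor_structure (rep_cat D.H) (rep_cat E.H) F0 F1 J \<phi>"
begin

sublocale F: rep_functor D.H E.H F0 F1
  using equiv by unfold_locales (simp add: equivalence_functor_def)

text \<open>Naturality of \<eta> recovers a homomorphism from its image under F, as \<eta> at the
  target is invertible.\<close>

lemma faithful:
  assumes MN: "M \<in> reps D.H" "N \<in> reps D.H" and f: "f \<in> rep_hom D.H M N" "f' \<in> rep_hom D.H M N"
    and eq: "F1 M N f = F1 M N f'"
  shows "f = f'"
proof -
  obtain G0 G1 \<eta> where
    nat: "natural_iso (rep_cat D.H) (rep_cat D.H) (\<lambda>X. X) (\<lambda>X Y f. f) (\<lambda>X. G0 (F0 X)) (\<lambda>X Y f. G1 (F0 X) (F0 Y) (F1 X Y f)) \<eta>"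
    using equiv unfolding equivalence_functor_def by blast
  have "is_iso (rep_cat D.H) N (G0 (F0 N)) (\<eta> N)" using nat MN by (simp add: natural_iso_def rep_cat_simps)
  then obtain e where e: "e * \<eta> N = 1\<^sub>m (rdim N)" "\<eta> N \<in> rep_hom D.H N (G0 (F0 N))" "e \<in> rep_hom D.H (G0 (F0 N)) N"
    by (auto simp: is_iso_def rep_cat_simps)
  have n: "\<eta> N * k = G1 (F0 M) (F0 N) (F1 M N k) * \<eta> M" if "k \<in> rep_hom D.H M N" for k
    using nat MN that by (simp add: natural_iso_def rep_cat_simps)
  have k: "k = e * (\<eta> N * k)" if "k \<in> rep_hom D.H M N" for k
    using mult_cancel_left[OF e(1)] rep_hom_dim[OF e(2)] rep_hom_dim[OF e(3)] rep_hom_dim[OF that] by simp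
  show ?thesis using k[OF f(1)] k[OF f(2)] n[OF f(1)] n[OF f(2)] eq by simp
qed

lemma ess_surj:
  assumes "N \<in> reps E.H"
  obtains M where "M \<in> reps D.H" "rep_iso E.H (F0 M) N"
proof -
  obtain G0 G1 \<epsilon> where lin: "linear_functor (rep_cat E.H) (rep_cat D.H) G0 G1" and
    nat: "natural_iso (rep_cat E.H) (rep_cat E.H) (\<lambda>X. F0 (G0 X)) (\<lambda>X Y f. F1 (G0 X) (G0 Y) (G1 X Y f)) (\<lambda>X. X) (\<lambda>X Y f. f) \<epsilon>"
    using equiv unfolding equivalence_functor_def by blast
  show ?thesis
  proof (rule that)
    show "G0 N \<in> reps D.H" using lin assms by (simp add: linear_functor_def rep_cat_simps)
    have "is_iso (rep_cat E.H) (F0 (G0 N)) N (\<epsilon> N)" using nat assms by (simp add: natural_iso_def rep_cat_simps)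
    then show "rep_iso E.H (F0 (G0 N)) N" by (auto simp: is_iso_def rep_cat_simps rep_iso_def)
  qed
qed

lemma J_ex:
  assumes "M \<in> reps D.H" "N \<in> reps D.H"
  shows "J M N \<in> rep_hom E.H (rep_tensor E.H (F0 M) (F0 N)) (F0 (rep_tensor D.H M N))"
    "\<exists>k\<in>rep_hom E.H (F0 (rep_tensor D.H M N)) (rep_tensor E.H (F0 M) (F0 N)).
      k * J M N = 1\<^sub>m (rdim (F0 M) * rdim (F0 N)) \<and> J M N * k = 1\<^sub>m (rdim (F0 (rep_tensor D.H M N)))"
  using tensor assms unfolding tensor_structure_def rep_cat_simps is_iso_def by (simp_all add: rep_tensor_def)

lemma J_nat:
  assumes "M \<in> reps D.H" "M' \<in> reps D.H" "N \<in> reps D.H" "N' \<in> reps D.H" "f \<in> rep_hom D.H M M'" "k \<in> rep_hom D.H N N'"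
  shows "J M' N' * kron (F1 M M' f) (F1 N N' k) = F1 (rep_tensor D.H M N) (rep_tensor D.H M' N') (kron f k) * J M N"
  using tensor assms unfolding tensor_structure_def rep_cat_simps by blast

lemma J_iso:
  assumes "M \<in> reps D.H" "N \<in> reps D.H"
  shows "rep_iso E.H (rep_tensor E.H (F0 M) (F0 N)) (F0 (rep_tensor D.H M N))"
  using J_ex[OF assms] by (auto simp: rep_iso_def rep_tensor_def)

lemma Nd_pos: "0 < D.Nd"
  using D.G.one_closed D.n_pos by (auto simp: card_gt_0_iff)

text \<open>F(M) \<otimes> F(H) is isomorphic to F(M \<otimes> H), and M \<otimes> H is free of rank
  dim M. An additive invariant turns this into a numerical identity.\<close>

lemma F_tensor_reg:
  fixes \<psi> :: "(nat \<times> 'g, 'k) rep \<Rightarrow> 'k"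
  assumes iso: "\<And>M N. M \<in> reps E.H \<Longrightarrow> N \<in> reps E.H \<Longrightarrow> rep_iso E.H M N \<Longrightarrow> \<psi> M = \<psi> N"
    and sum: "\<And>M N. M \<in> reps E.H \<Longrightarrow> N \<in> reps E.H \<Longrightarrow> \<psi> (rep_sum E.H M N) = \<psi> M + \<psi> N"
    and M: "M \<in> reps D.H"
  shows "\<psi> (rep_tensor E.H (F0 M) (F0 D.reg)) = of_nat (rdim M) * \<psi> (F0 D.reg)"
proof -
  note R = D.reg(1)
  have T: "D.infl (D.trivK (rdim M)) \<in> reps D.H" by (rule D.infl(1)[OF D.trivK(1)])
  have "\<psi> (rep_tensor E.H (F0 M) (F0 D.reg)) = \<psi> (F0 (rep_tensor D.H M D.reg))"
    using M R by (intro iso J_iso E.TH.tensor_rep F.F0 D.TH.tensor_rep)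
  also have "\<dots> = \<psi> (F0 (rep_tensor D.H (D.infl (D.trivK (rdim M))) D.reg))"
    using M R T by (intro iso F.F_iso F.F0 D.TH.tensor_rep rep_iso_sym[OF D.tensor_reg_iso])
  also have "\<dots> = of_nat (rdim M) * \<psi> (F0 D.reg)"
  proof (rule D.triv_tensor_additive[of "\<lambda>M. \<psi> (F0 M)", OF _ _ R])
    show "\<psi> (F0 M) = \<psi> (F0 N)" if "M \<in> reps D.H" "N \<in> reps D.H" "rep_iso D.H M N" for M N
      using that by (intro iso F.F0 F.F_iso)
    show "\<psi> (F0 (rep_sum D.H M N)) = \<psi> (F0 M) + \<psi> (F0 N)" if "M \<in> reps D.H" "N \<in> reps D.H" for M N
      using that iso[OF _ _ F.F_sum[OF that]] by (simp add: rep_sum_rep sum)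
  qed
  finally show ?thesis .
qed

text \<open>For the dimension, \<open>F_tensor_reg\<close> reads dim F(M) dim F(H) = dim M dim F(H),
  and F(H) is nonzero because F is faithful.\<close>

lemma F_dim [simp]:
  assumes M: "M \<in> reps D.H"
  shows "rdim (F0 M) = rdim M"
proof -
  note R = D.reg(1)
  have "(of_nat (rdim (rep_tensor E.H (F0 M) (F0 D.reg))) :: 'k) = of_nat (rdim M) * of_nat (rdim (F0 D.reg))"
    by (rule F_tensor_reg[OF _ _ M]) (auto dest: rep_iso_dim)
  then have "rdim (F0 M) * rdim (F0 D.reg) = rdim M * rdim (F0 D.reg)"
    unfolding of_nat_mult[symmetric] of_nat_eq_iff by (simp add: rep_tensor_def)
  moreover have "rdim (F0 D.reg) \<noteq> 0"
  proof
    assume 0: "rdim (F0 D.reg) = 0"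
    \<comment> \<open>If F(H) had dimension zero, F could not distinguish the identity of H from the
      zero map.\<close>
    have "F1 D.reg D.reg (1\<^sub>m (rdim D.reg)) = F1 D.reg D.reg (0\<^sub>m (rdim D.reg) (rdim D.reg))"
      by (rule eq_matI) (use R 0 in \<open>auto simp: rep_hom_one rep_hom_zero\<close>)
    then have "1\<^sub>m (rdim D.reg) = (0\<^sub>m (rdim D.reg) (rdim D.reg) :: 'k mat)"
      by (rule faithful[OF R R rep_hom_one[OF R] rep_hom_zero[OF R R]])
    then have "1\<^sub>m D.Nd $$ (0, 0) = (0\<^sub>m D.Nd D.Nd :: 'k mat) $$ (0, 0)" by (simp only: D.reg(2))
    then show False using Nd_pos by simp
  qed
  ultimately show ?thesis by simp
qed

text \<open>Choose M with F(M) isomorphic to the regular module H' of the target. Counting H'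
  \<otimes> F(H) in two ways gives dim H copies of H' on one side and dim H copies of F(H) on the
  other, so their characters \<open>tch\<close> agree.\<close>

lemma F_reg: "rep_iso E.H E.reg (F0 D.reg)"
proof (rule E.H_iso_of_tch)
  note R = D.reg(1) and R' = E.reg(1)
  fix i h assume h: "h \<in> carrier G"
  obtain M where M: "M \<in> reps D.H" "rep_iso E.H (F0 M) E.reg" by (rule ess_surj[OF R'])
  have dM: "rdim M = D.Nd" using rep_iso_dim[OF M(2)] M by (simp add: E.reg)
  have iso: "\<And>M N. M \<in> reps E.H \<Longrightarrow> N \<in> reps E.H \<Longrightarrow> rep_iso E.H M N \<Longrightarrow> E.tch M i h = E.tch N i h" by (rule E.tch_iso[OF _ _ _ h])
  have sum: "\<And>M N. M \<in> reps E.H \<Longrightarrow> N \<in> reps E.H \<Longrightarrow> E.tch (rep_sum E.H M N) i h = E.tch M i h + E.tch N i h" by (rule E.tch_sum[OF _ _ h])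
  have "of_nat D.Nd * E.tch E.reg i h = E.tch (rep_tensor E.H (E.infl (E.trivK (rdim (F0 D.reg)))) E.reg) i h"
    using E.triv_tensor_additive[of "\<lambda>M. E.tch M i h", OF iso sum R', of "rdim (F0 D.reg)"] R by (simp add: D.reg)
  also have "\<dots> = E.tch (rep_tensor E.H E.reg (F0 D.reg)) i h"
    by (intro iso E.reg_tensor_iso E.TH.tensor_rep E.infl(1) E.trivK(1) F.F0 R R')
  also have "\<dots> = E.tch (rep_tensor E.H (F0 M) (F0 D.reg)) i h"
    by (intro iso rep_iso_tensor_cong E.TH.tensor_rep F.F0 R R' M rep_iso_sym[OF M(2)] rep_iso_refl)
  also have "\<dots> = of_nat D.Nd * E.tch (F0 D.reg) i h"
    using F_tensor_reg[of "\<lambda>M. E.tch M i h", OF iso sum M(1)] by (simp only: dM)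
  finally show "E.tch E.reg i h = E.tch (F0 D.reg) i h" using Nd_pos D.G.one_closed by auto
qed (use D.reg E.reg in auto)

end

definition colm :: "nat \<Rightarrow> (nat \<Rightarrow> 'k::zero mat) \<Rightarrow> 'k mat"
  where "colm d f = mat d d (\<lambda>(i, c). f c $$ (i, 0))"

lemma dim_colm [simp]: "dim_row (colm d f) = d" "dim_col (colm d f) = d"
  by (simp_all add: colm_def)

lemma colm_ecol:
  fixes f :: "nat \<Rightarrow> 'k::field mat"
  assumes "c < d" "dim_row (f c) = d" "dim_col (f c) = Suc 0"
  shows "colm d f * ecol d c = f c"
proof (rule eq_matI)
  fix i j assume "i < dim_row (f c)" "j < dim_col (f c)"
  then show "(colm d f * ecol d c) $$ (i, j) = f c $$ (i, j)"
    using assms mult_ecol_index[of "colm d f" d c i] by (simp add: colm_def)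
qed (use assms in auto)

lemma tr_mult_colm:
  fixes f :: "nat \<Rightarrow> 'k::field mat"
  assumes A: "dim_row A = d" "dim_col A = d" and f: "\<And>c. c < d \<Longrightarrow> dim_row (f c) = d \<and> dim_col (f c) = Suc 0"
  shows "tr (A * colm d f) = (\<Sum>c<d. (A * f c) $$ (c, 0))"
proof -
  have "(A * colm d f) $$ (c, c) = (A * f c) $$ (c, 0)" if c: "c < d" for c
  proof -
    have "(A * colm d f) $$ (c, c) = (A * colm d f * ecol d c) $$ (c, 0)"
      using A c by (subst mult_ecol_index) (auto simp del: index_mult_mat(1))
    also have "A * colm d f * ecol d c = A * f c" using A f[OF c] colm_ecol[of c d f] c by (simp add: mult_assoc_dim)
    finally show ?thesis .
  qed
  then show ?thesis using A by (simp add: tr_def del: index_mult_mat(1))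
qed

lemma (in datum) actv_transpose_mult:
  assumes M: "M \<in> reps H" and q: "dim_row q = rdim M"
  shows "(actv M x)\<^sup>T * q = lincomb (rdim M) (dim_col q) {..<Nd} (\<lambda>c. x $$ (c, 0)) (\<lambda>c. (rmat M (bas c))\<^sup>T * q)"
proof -
  have "(actv M x)\<^sup>T = lincomb (rdim M) (rdim M) {..<Nd} (\<lambda>c. x $$ (c, 0)) (\<lambda>c. (rmat M (bas c))\<^sup>T)"
    using M bas(3) by (intro eq_matI) (auto simp: actv_def lincomb_index)
  then show ?thesis using M bas(3) q by (simp only:) (subst lincomb_mult, auto)
qed

section \<open>Comparison of the forgetful functor with its composite with F\<close>

context tensor_equiv
begin

lemma unit_rdim [simp]: "rdim (rep_unit H') = Suc 0"
  by (simp add: rep_unit_def)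

declare D.TH.tensor_rep [simp] E.TH.tensor_rep [simp] D.TH.unit_rep [simp] E.TH.unit_rep [simp] D.reg [simp] E.reg [simp]

lemma dual_rep [simp]: "M \<in> reps D.H \<Longrightarrow> D.dual M \<in> reps D.H" "M \<in> reps E.H \<Longrightarrow> E.dual M \<in> reps E.H"
  by (simp_all add: D.dual E.dual)

definition I :: "'k mat"
  where "I = (SOME f. f \<in> rep_hom E.H E.reg (F0 D.reg) \<and>
    (\<exists>k\<in>rep_hom E.H (F0 D.reg) E.reg. k * f = 1\<^sub>m D.Nd \<and> f * k = 1\<^sub>m D.Nd))"

lemma I: "I \<in> rep_hom E.H E.reg (F0 D.reg)"
  "\<exists>k\<in>rep_hom E.H (F0 D.reg) E.reg. k * I = 1\<^sub>m D.Nd \<and> I * k = 1\<^sub>m D.Nd"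
proof -
  have "\<exists>f. f \<in> rep_hom E.H E.reg (F0 D.reg) \<and> (\<exists>k\<in>rep_hom E.H (F0 D.reg) E.reg. k * f = 1\<^sub>m D.Nd \<and> f * k = 1\<^sub>m D.Nd)"
    using F_reg by (auto simp: rep_iso_def)
  from someI_ex[OF this, folded I_def]
  show "I \<in> rep_hom E.H E.reg (F0 D.reg)" "\<exists>k\<in>rep_hom E.H (F0 D.reg) E.reg. k * I = 1\<^sub>m D.Nd \<and> I * k = 1\<^sub>m D.Nd" by auto
qed

lemma dim_I [simp]: "dim_row I = D.Nd" "dim_col I = D.Nd"
  using rep_hom_dim[OF I(1)] by simp_all

abbreviation p :: "'k mat" where "p \<equiv> I * E.u"

text \<open>A natural identification of the underlying space of \<open>V\<close> with that of its image.\<close>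

definition \<theta> :: "(nat \<times> 'g, 'k) rep \<Rightarrow> 'k mat"
  where "\<theta> V = mat (rdim V) (rdim V) (\<lambda>(i, j). (F1 D.reg V (D.ev V (ecol (rdim V) j)) * p) $$ (i, 0))"

lemma dim_\<theta> [simp]: "dim_row (\<theta> V) = rdim V" "dim_col (\<theta> V) = rdim V"
  by (simp_all add: \<theta>_def)

text \<open>The map is the composite V = Hom(H, V) \<rightarrow> Hom(F(H), F(V)) = Hom(H', F(V)) =
  F(V), where the middle identification is \<open>I\<close>. The definition fixes it on basis
  vectors; linearity of F gives it everywhere.\<close>

lemma \<theta>_mult:
  assumes V: "V \<in> reps D.H" and x: "dim_row x = rdim V" "dim_col x = Suc 0"
  shows "\<theta> V * x = F1 D.reg V (D.ev V x) * p"
proof -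
  let ?d = "rdim V" and ?E = "\<lambda>c. D.ev V (ecol (rdim V) c)"
  have E: "?E c \<in> rep_hom D.H D.reg V" "?E c * D.u = ecol ?d c" for c by (rule D.ev[OF V]; simp)+
  have dE [simp]: "dim_row (?E c) = ?d" "dim_col (?E c) = D.Nd" for c using rep_hom_dim[OF E(1)] by simp_all
  have \<theta>e: "\<theta> V * ecol ?d c = F1 D.reg V (?E c) * p" if c: "c < ?d" for c
  proof (rule eq_matI)
    fix i j assume "i < dim_row (F1 D.reg V (?E c) * p)" "j < dim_col (F1 D.reg V (?E c) * p)"
    then have "i < ?d" "j = 0" using V E by auto
    then show "(\<theta> V * ecol ?d c) $$ (i, j) = (F1 D.reg V (?E c) * p) $$ (i, j)"
      using c mult_ecol_index[of "\<theta> V" ?d c i] by (simp add: \<theta>_def del: index_mult_mat(1))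
  qed (use V E in auto)
  let ?L = "lincomb ?d (rdim D.reg) {..<?d} (\<lambda>c. x $$ (c, 0)) ?E"
  note L = F.F_lincomb[OF D.reg(1) V, of "{..<?d}" ?E "\<lambda>c. x $$ (c, 0)", OF _ E(1), simplified]
  have xl: "x = lincomb ?d 1 {..<?d} (\<lambda>c. x $$ (c, 0)) (\<lambda>c. ecol ?d c)" by (rule D.col_lincomb[OF x])
  have "?L * D.u = lincomb ?d 1 {..<?d} (\<lambda>c. x $$ (c, 0)) (\<lambda>c. ?E c * D.u)"
    by (subst lincomb_mult) auto
  also have "\<dots> = x" using xl by (simp add: E(2))
  finally have Lu: "?L * D.u = x" .
  have "D.ev V x = ?L"
    by (rule D.ev_unique[OF V]) (use D.ev[OF V x] L(1) Lu in auto)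
  then have "F1 D.reg V (D.ev V x) * p = lincomb ?d D.Nd {..<?d} (\<lambda>c. x $$ (c, 0)) (\<lambda>c. F1 D.reg V (?E c)) * p"
    using L(2) V by simp
  also have "\<dots> = lincomb ?d 1 {..<?d} (\<lambda>c. x $$ (c, 0)) (\<lambda>c. F1 D.reg V (?E c) * p)"
    using V E by (subst lincomb_mult) auto
  also have "\<dots> = lincomb ?d 1 {..<?d} (\<lambda>c. x $$ (c, 0)) (\<lambda>c. \<theta> V * ecol ?d c)"
    by (rule lincomb_mat_cong) (simp add: \<theta>e)
  also have "\<dots> = \<theta> V * lincomb ?d 1 {..<?d} (\<lambda>c. x $$ (c, 0)) (\<lambda>c. ecol ?d c)" by (subst mult_lincomb) auto
  finally show ?thesis using xl by simp
qed

lemma \<theta>_natural: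
  assumes V: "V \<in> reps D.H" "W \<in> reps D.H" and f: "f \<in> rep_hom D.H V W"
  shows "\<theta> W * f = F1 V W f * \<theta> V"
proof (rule mat_eqI_ecol)
  note [simp] = rep_hom_dim[OF f]
  fix c assume c: "c < rdim V"
  let ?e = "ecol (rdim V) c :: 'k mat"
  have e: "D.ev V ?e \<in> rep_hom D.H D.reg V" "D.ev V ?e * D.u = ?e" by (rule D.ev[OF V(1)]; simp)+
  have e': "D.ev W (f * ?e) \<in> rep_hom D.H D.reg W" "D.ev W (f * ?e) * D.u = f * ?e" by (rule D.ev[OF V(2)]; simp)+
  have [simp]: "dim_row (D.ev V ?e) = rdim V" "dim_col (D.ev V ?e) = D.Nd" using rep_hom_dim[OF e(1)] by simp_all
  have fe: "f * D.ev V ?e \<in> rep_hom D.H D.reg W" by (rule rep_hom_comp[OF D.reg(1) V e(1) f])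
  have "D.ev W (f * ?e) = f * D.ev V ?e"
    by (rule D.ev_unique[OF V(2) e'(1) fe]) (simp add: e' e(2) mult_assoc_dim)
  then have "\<theta> W * (f * ?e) = F1 D.reg W (f * D.ev V ?e) * p" using V by (subst \<theta>_mult) auto
  also have "\<dots> = F1 V W f * (F1 D.reg V (D.ev V ?e) * p)"
    using V f e(1) by (simp add: F.F_comp[OF D.reg(1) V e(1) f] mult_assoc_dim)
  also have "F1 D.reg V (D.ev V ?e) * p = \<theta> V * ?e" using V by (subst \<theta>_mult) auto
  finally show "\<theta> W * f * ?e = F1 V W f * \<theta> V * ?e" using V f by (simp add: mult_assoc_dim)
qed (use V rep_hom_dim[OF f] f in auto)

text \<open>If F(w) kills the generator p of F(H), it is zero on all of F(H), and then w = 0 because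
  F is faithful.\<close>

lemma \<theta>_inj:
  assumes V: "V \<in> reps D.H" and x: "dim_row x = rdim V" "dim_col x = Suc 0" and 0: "\<theta> V * x = 0\<^sub>m (rdim V) (Suc 0)"
  shows "x = 0\<^sub>m (rdim V) (Suc 0)"
proof -
  let ?w = "D.ev V x"
  have w: "?w \<in> rep_hom D.H D.reg V" "?w * D.u = x" by (rule D.ev[OF V x])+
  have Fw: "F1 D.reg V ?w \<in> rep_hom E.H (F0 D.reg) (F0 V)" using V w by (intro F.F1) auto
  obtain k where k: "k \<in> rep_hom E.H (F0 D.reg) E.reg" "I * k = 1\<^sub>m D.Nd" using I(2) by blast
  note [simp] = rep_hom_dim[OF k(1)] rep_hom_dim[OF Fw]
  have a1: "F1 D.reg V ?w * I * E.u = 0\<^sub>m (rdim V) (rdim E.reg) * E.u"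
    using 0 V by (simp add: \<theta>_mult[OF V x] mult_assoc_dim)
  have a2: "F1 D.reg V ?w * I \<in> rep_hom E.H E.reg (F0 V)"
    by (rule rep_hom_comp[OF _ _ _ I(1) Fw]) (use V in auto)
  have a3: "0\<^sub>m (rdim V) (rdim E.reg) \<in> rep_hom E.H E.reg (F0 V)"
    using rep_hom_zero[of E.reg E.H "F0 V"] V by simp
  have "F1 D.reg V ?w * I = 0\<^sub>m (rdim V) (rdim E.reg)"
    by (rule E.ev_unique[OF F.F0[OF V] a2 a3 a1])
  then have "F1 D.reg V ?w * I * k = 0\<^sub>m (rdim V) D.Nd * k" by simp
  then have "F1 D.reg V ?w = 0\<^sub>m (rdim V) D.Nd" by (simp add: V mult_assoc_dim k(2))
  then have "F1 D.reg V ?w = F1 D.reg V (0\<^sub>m (rdim V) (rdim D.reg))" using V F.F_zero[of D.reg V] by simp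
  then have "?w = 0\<^sub>m (rdim V) (rdim D.reg)" by (rule faithful[OF D.reg(1) V w(1) rep_hom_zero[OF D.reg(1) V]])
  then have "x = 0\<^sub>m (rdim V) (rdim D.reg) * D.u" using w(2) by (simp only:)
  then show ?thesis by simp
qed

text \<open>Injectivity is enough: F preserves dimensions, so the matrix is square.\<close>

lemma \<theta>_inverse:
  assumes V: "V \<in> reps D.H"
  obtains L where "L * \<theta> V = 1\<^sub>m (rdim V)" "\<theta> V * L = 1\<^sub>m (rdim V)" "dim_row L = rdim V" "dim_col L = rdim V"
proof -
  obtain L where L: "L * \<theta> V = 1\<^sub>m (rdim V)" "dim_row L = rdim V" "dim_col L = rdim V"
  proof (rule trivial_kernel_left_inverse[of "\<theta> V"])
    fix Z :: "'k mat" assume Z: "dim_row Z = dim_col (\<theta> V)" "dim_col Z = dim_col (\<theta> V)"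
      "\<theta> V * Z = 0\<^sub>m (dim_row (\<theta> V)) (dim_col (\<theta> V))"
    show "Z = 0\<^sub>m (dim_col (\<theta> V)) (dim_col (\<theta> V))"
    proof (rule mat_eqI_ecol)
      fix c assume c: "c < rdim V"
      have "\<theta> V * (Z * ecol (rdim V) c) = \<theta> V * Z * ecol (rdim V) c" using Z(1,2) by (simp add: mult_assoc_dim)
      also have "\<dots> = 0\<^sub>m (rdim V) (Suc 0)" unfolding Z(3) by simp
      finally have "Z * ecol (rdim V) c = 0\<^sub>m (rdim V) (Suc 0)" by (rule \<theta>_inj[OF V, rotated 2]) (use Z in auto)
      then show "Z * ecol (rdim V) c = 0\<^sub>m (dim_col (\<theta> V)) (dim_col (\<theta> V)) * ecol (rdim V) c" by simp
    qed (use Z in auto)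
  qed auto
  then show ?thesis by (intro that[of L] square_inverse_comm[of L "\<theta> V"]) auto
qed

definition \<theta>i :: "(nat \<times> 'g, 'k) rep \<Rightarrow> 'k mat"
  where "\<theta>i V = (SOME L. L * \<theta> V = 1\<^sub>m (rdim V) \<and> \<theta> V * L = 1\<^sub>m (rdim V) \<and> dim_row L = rdim V \<and> dim_col L = rdim V)"

lemma \<theta>i [simp]:
  assumes V: "V \<in> reps D.H"
  shows "\<theta>i V * \<theta> V = 1\<^sub>m (rdim V)" "\<theta> V * \<theta>i V = 1\<^sub>m (rdim V)" "dim_row (\<theta>i V) = rdim V" "dim_col (\<theta>i V) = rdim V"
proof -
  have "\<exists>L. L * \<theta> V = 1\<^sub>m (rdim V) \<and> \<theta> V * L = 1\<^sub>m (rdim V) \<and> dim_row L = rdim V \<and> dim_col L = rdim V"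
    using \<theta>_inverse[OF V] by metis
  from someI_ex[OF this, folded \<theta>i_def]
  show "\<theta>i V * \<theta> V = 1\<^sub>m (rdim V)" "\<theta> V * \<theta>i V = 1\<^sub>m (rdim V)" "dim_row (\<theta>i V) = rdim V" "dim_col (\<theta>i V) = rdim V" by auto
qed

lemma \<theta>_cancel:
  assumes V: "V \<in> reps D.H" and A: "dim_row A = rdim V"
  shows "\<theta>i V * (\<theta> V * A) = A" "\<theta> V * (\<theta>i V * A) = A" "(\<theta> V)\<^sup>T * ((\<theta>i V)\<^sup>T * A) = A" "(\<theta>i V)\<^sup>T * ((\<theta> V)\<^sup>T * A) = A"
proof -
  show "\<theta>i V * (\<theta> V * A) = A" "\<theta> V * (\<theta>i V * A) = A"
    using V A by (auto intro!: mult_cancel_left[of _ _ "rdim V"])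
  have t: "(\<theta> V)\<^sup>T * (\<theta>i V)\<^sup>T = 1\<^sub>m (rdim V)" "(\<theta>i V)\<^sup>T * (\<theta> V)\<^sup>T = 1\<^sub>m (rdim V)"
    using V by (simp_all flip: transpose_mult_dim)
  show "(\<theta> V)\<^sup>T * ((\<theta>i V)\<^sup>T * A) = A" "(\<theta>i V)\<^sup>T * ((\<theta> V)\<^sup>T * A) = A"
    using V A t by (auto intro!: mult_cancel_left[of _ _ "rdim V"])
qed

lemma \<theta>_reg: "\<theta> D.reg * D.u = p"
proof -
  have "D.ev D.reg D.u = 1\<^sub>m (rdim D.reg)"
    by (rule D.ev_unique[of D.reg]) (use D.ev[of D.reg D.u] rep_hom_one[of D.reg D.H] in auto)
  then show ?thesis using F.F_id[of D.reg] by (subst \<theta>_mult) auto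
qed

subsection \<open>Transport of evaluation and coevaluation\<close>

definition Ji :: "(nat \<times> 'g, 'k) rep \<Rightarrow> (nat \<times> 'g, 'k) rep \<Rightarrow> 'k mat"
  where "Ji M N = (SOME k. k \<in> rep_hom E.H (F0 (rep_tensor D.H M N)) (rep_tensor E.H (F0 M) (F0 N)) \<and>
      k * J M N = 1\<^sub>m (rdim M * rdim N) \<and> J M N * k = 1\<^sub>m (rdim M * rdim N))"

lemma Ji:
  assumes "M \<in> reps D.H" "N \<in> reps D.H"
  shows "Ji M N \<in> rep_hom E.H (F0 (rep_tensor D.H M N)) (rep_tensor E.H (F0 M) (F0 N))"
    "Ji M N * J M N = 1\<^sub>m (rdim M * rdim N)" "J M N * Ji M N = 1\<^sub>m (rdim M * rdim N)"
proof -
  have "\<exists>k. k \<in> rep_hom E.H (F0 (rep_tensor D.H M N)) (rep_tensor E.H (F0 M) (F0 N)) \<and>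
      k * J M N = 1\<^sub>m (rdim M * rdim N) \<and> J M N * k = 1\<^sub>m (rdim M * rdim N)"
    using J_ex[OF assms] assms by auto
  from someI_ex[OF this, folded Ji_def]
  show "Ji M N \<in> rep_hom E.H (F0 (rep_tensor D.H M N)) (rep_tensor E.H (F0 M) (F0 N))"
    "Ji M N * J M N = 1\<^sub>m (rdim M * rdim N)" "J M N * Ji M N = 1\<^sub>m (rdim M * rdim N)" by auto
qed

lemma dim_J [simp]:
  assumes "M \<in> reps D.H" "N \<in> reps D.H"
  shows "dim_row (J M N) = rdim M * rdim N" "dim_col (J M N) = rdim M * rdim N"
    "dim_row (Ji M N) = rdim M * rdim N" "dim_col (Ji M N) = rdim M * rdim N"
  using rep_hom_dim[OF J_ex(1)[OF assms]] rep_hom_dim[OF Ji(1)[OF assms]] assms by simp_all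

abbreviation "\<I> \<equiv> rep_unit D.H"
abbreviation "\<I>' \<equiv> rep_unit E.H"

definition \<phi>i :: "'k mat"
  where "\<phi>i = (SOME k. k \<in> rep_hom E.H (F0 \<I>) \<I>' \<and> k * \<phi> = 1\<^sub>m (Suc 0) \<and> \<phi> * k = 1\<^sub>m (Suc 0))"

lemma \<phi>: "\<phi> \<in> rep_hom E.H \<I>' (F0 \<I>)" "\<phi>i \<in> rep_hom E.H (F0 \<I>) \<I>'" "\<phi>i * \<phi> = 1\<^sub>m (Suc 0)" "\<phi> * \<phi>i = 1\<^sub>m (Suc 0)"
proof -
  have i: "is_iso (rep_cat E.H) \<I>' (F0 \<I>) \<phi>"
    using tensor unfolding tensor_structure_def rep_cat_simps by blast
  then have "\<exists>k. k \<in> rep_hom E.H (F0 \<I>) \<I>' \<and> k * \<phi> = 1\<^sub>m (Suc 0) \<and> \<phi> * k = 1\<^sub>m (Suc 0)"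
    by (auto simp: is_iso_def rep_cat_simps)
  from someI_ex[OF this, folded \<phi>i_def] i
  show "\<phi> \<in> rep_hom E.H \<I>' (F0 \<I>)" "\<phi>i \<in> rep_hom E.H (F0 \<I>) \<I>'" "\<phi>i * \<phi> = 1\<^sub>m (Suc 0)" "\<phi> * \<phi>i = 1\<^sub>m (Suc 0)"
    by (auto simp: is_iso_def rep_cat_simps)
qed

lemma dim_\<phi> [simp]: "dim_row \<phi> = Suc 0" "dim_col \<phi> = Suc 0" "dim_row \<phi>i = Suc 0" "dim_col \<phi>i = Suc 0"
  using rep_hom_dim[OF \<phi>(1)] rep_hom_dim[OF \<phi>(2)] by simp_all

text \<open>The unit axioms of the tensor structure, in which the unit constraints are identity
  matrices.\<close>

lemma J_unit:
  assumes M: "M \<in> reps D.H"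
  shows "J M \<I> = kron (1\<^sub>m (rdim M)) \<phi>i" "J \<I> M * kron \<phi> (1\<^sub>m (rdim M)) = 1\<^sub>m (rdim M)"
proof -
  have "F1 (rep_tensor D.H M \<I>) M (1\<^sub>m (rdim M)) * (J M \<I> * kron (1\<^sub>m (rdim (F0 M))) \<phi>) = 1\<^sub>m (rdim (F0 M))"
    using tensor M unfolding tensor_structure_def rep_cat_simps by blast
  then have 1: "J M \<I> * kron (1\<^sub>m (rdim M)) \<phi> = 1\<^sub>m (rdim M)" using M by (simp add: D.TH.tensor_unit F.F_id)
  have "J M \<I> = J M \<I> * (kron (1\<^sub>m (rdim M)) \<phi> * kron (1\<^sub>m (rdim M)) \<phi>i)"
    using M by (simp add: kron_mult \<phi>)
  also have "\<dots> = kron (1\<^sub>m (rdim M)) \<phi>i" using M 1 by (simp add: mult_assoc_dim[symmetric])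
  finally show "J M \<I> = kron (1\<^sub>m (rdim M)) \<phi>i" .
  have "F1 (rep_tensor D.H \<I> M) M (1\<^sub>m (rdim M)) * (J \<I> M * kron \<phi> (1\<^sub>m (rdim (F0 M)))) = 1\<^sub>m (rdim (F0 M))"
    using tensor M unfolding tensor_structure_def rep_cat_simps by blast
  then show "J \<I> M * kron \<phi> (1\<^sub>m (rdim M)) = 1\<^sub>m (rdim M)" using M by (simp add: D.TH.unit_tensor F.F_id)
qed

lemma J_assoc:
  assumes "M \<in> reps D.H" "N \<in> reps D.H" "P \<in> reps D.H"
  shows "J M (rep_tensor D.H N P) * kron (1\<^sub>m (rdim M)) (J N P) = J (rep_tensor D.H M N) P * kron (J M N) (1\<^sub>m (rdim P))"
proof -
  have "F1 (rep_tensor D.H (rep_tensor D.H M N) P) (rep_tensor D.H M (rep_tensor D.H N P)) (1\<^sub>m (rdim M * rdim N * rdim P)) *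
      (J (rep_tensor D.H M N) P * kron (J M N) (1\<^sub>m (rdim (F0 P)))) =
    J M (rep_tensor D.H N P) * (kron (1\<^sub>m (rdim (F0 M))) (J N P) * 1\<^sub>m (rdim (F0 M) * rdim (F0 N) * rdim (F0 P)))"
    using tensor assms unfolding tensor_structure_def rep_cat_simps by blast
  then show ?thesis
    using assms F.F_id[of "rep_tensor D.H M (rep_tensor D.H N P)"] by (simp add: D.TH.tensor_assoc mult.assoc)
qed

abbreviation evm :: "(nat \<times> 'g, 'k) rep \<Rightarrow> 'k mat" where "evm V \<equiv> rowm (1\<^sub>m (rdim V))"
abbreviation coevm :: "(nat \<times> 'g, 'k) rep \<Rightarrow> 'k mat" where "coevm V \<equiv> vecm (1\<^sub>m (rdim V))"

text \<open>The evaluation of V carried over by F: a pairing between F of the dual of V and F(V).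
  \<open>coevF\<close> is the copairing.\<close>

definition evF :: "(nat \<times> 'g, 'k) rep \<Rightarrow> 'k mat"
  where "evF V = \<phi>i * (F1 (rep_tensor D.H (D.dual V) V) \<I> (evm V) * J (D.dual V) V)"

definition coevF :: "(nat \<times> 'g, 'k) rep \<Rightarrow> 'k mat"
  where "coevF V = Ji V (D.dual V) * (F1 \<I> (rep_tensor D.H V (D.dual V)) (coevm V) * \<phi>)"

lemma dim_evF [simp]:
  assumes "V \<in> reps D.H"
  shows "dim_row (evF V) = Suc 0" "dim_col (evF V) = rdim V * rdim V"
    "dim_row (coevF V) = rdim V * rdim V" "dim_col (coevF V) = Suc 0"
  using assms by (simp_all add: evF_def coevF_def)

lemma evF_hom:
  assumes V: "V \<in> reps D.H"
  shows "evF V \<in> rep_hom E.H (rep_tensor E.H (F0 (D.dual V)) (F0 V)) \<I>'"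
proof -
  let ?T = "rep_tensor E.H (F0 (D.dual V)) (F0 V)" and ?T2 = "rep_tensor D.H (D.dual V) V"
  have "F1 ?T2 \<I> (evm V) * J (D.dual V) V \<in> rep_hom E.H ?T (F0 \<I>)"
    by (rule rep_hom_comp[OF _ _ _ J_ex(1) F.F1[OF _ _ D.ev_hom]]) (use V in auto)
  then show ?thesis unfolding evF_def
    by (intro rep_hom_comp[OF _ _ _ _ \<phi>(2)]) (use V in auto)
qed

text \<open>A tensor functor preserves duality: the associativity axiom for J brings the structure
  maps together, and naturality leaves F applied to the zigzag of V, which is the identity.\<close>

lemma zigzag:
  assumes V: "V \<in> reps D.H"
  shows "kron (1\<^sub>m (rdim V)) (evF V) * kron (coevF V) (1\<^sub>m (rdim V)) = 1\<^sub>m (rdim V)"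
proof -
  let ?d = "rdim V" and ?X = "D.dual V"
  let ?VX = "rep_tensor D.H V ?X" and ?XV = "rep_tensor D.H ?X V"
  let ?T = "rep_tensor D.H V ?XV"
  have T: "rep_tensor D.H ?VX V = ?T" using V by (simp add: D.TH.tensor_assoc)
  have Tr: "?T \<in> reps D.H" using V by simp
  note ev = D.ev_hom[OF V] and coev = D.coev_hom[OF V]
  have XV: "?X \<in> reps D.H" "?VX \<in> reps D.H" "?XV \<in> reps D.H" using V by auto
  let ?Fe = "F1 ?XV \<I> (evm V)" and ?Fc = "F1 \<I> ?VX (coevm V)"
  have dF [simp]: "dim_row ?Fe = Suc 0" "dim_col ?Fe = ?d * ?d" "dim_row ?Fc = ?d * ?d" "dim_col ?Fc = Suc 0"
    using V XV ev coev by auto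
  have ke: "kron (1\<^sub>m ?d) (evm V) \<in> rep_hom D.H ?T V"
    using kron_rep_hom[of V D.H ?XV V \<I> "1\<^sub>m ?d" "evm V"] V XV ev D.TH.tensor_unit[OF V] by (simp add: rep_hom_one)
  have kc: "kron (coevm V) (1\<^sub>m ?d) \<in> rep_hom D.H V ?T"
    using kron_rep_hom[of \<I> D.H V ?VX V "coevm V" "1\<^sub>m ?d"] V XV coev D.TH.unit_tensor[OF V] T by (simp add: rep_hom_one)
  have "kron (1\<^sub>m ?d) (evF V) = kron (1\<^sub>m ?d) \<phi>i * (kron (1\<^sub>m ?d) ?Fe * kron (1\<^sub>m ?d) (J ?X V))"
    using V XV by (simp add: evF_def kron_mult)
  also have "\<dots> = (J V \<I> * kron (F1 V V (1\<^sub>m ?d)) ?Fe) * kron (1\<^sub>m ?d) (J ?X V)"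
    using V XV by (simp add: J_unit F.F_id mult_assoc_dim)
  also have "J V \<I> * kron (F1 V V (1\<^sub>m ?d)) ?Fe = F1 ?T V (kron (1\<^sub>m ?d) (evm V)) * J V ?XV"
    using J_nat[of V V ?XV \<I> "1\<^sub>m ?d" "evm V"] V XV ev D.TH.tensor_unit[OF V] by (simp add: rep_hom_one)
  \<comment> \<open>\<open>J_assoc\<close> exchanges the bracketing, so that \<open>J V ?X\<close>
    can meet its inverse inside the coevaluation.\<close>
  finally have 1: "kron (1\<^sub>m ?d) (evF V) = F1 ?T V (kron (1\<^sub>m ?d) (evm V)) * (J ?VX V * kron (J V ?X) (1\<^sub>m ?d))"
    using V XV Tr ke by (simp add: mult_assoc_dim J_assoc del: kron_one)
  have 2: "kron (coevF V) (1\<^sub>m ?d) = kron (Ji V ?X) (1\<^sub>m ?d) * (kron ?Fc (1\<^sub>m ?d) * kron \<phi> (1\<^sub>m ?d))"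
    using V XV by (simp add: coevF_def kron_mult)
  have JJ: "kron (J V ?X) (1\<^sub>m ?d) * (kron (Ji V ?X) (1\<^sub>m ?d) * A) = A" if "dim_row A = ?d * ?d * ?d" for A
    using V XV that by (intro mult_cancel_left[of _ _ "?d * ?d * ?d"]) (auto simp: kron_mult Ji)
  have "kron (1\<^sub>m ?d) (evF V) * kron (coevF V) (1\<^sub>m ?d) =
    F1 ?T V (kron (1\<^sub>m ?d) (evm V)) * (J ?VX V * (kron ?Fc (1\<^sub>m ?d) * kron \<phi> (1\<^sub>m ?d)))"
    unfolding 1 2 using V XV Tr ke by (simp add: mult_assoc_dim JJ mult.assoc)
  also have "\<dots> = F1 ?T V (kron (1\<^sub>m ?d) (evm V)) * ((J ?VX V * kron ?Fc (F1 V V (1\<^sub>m ?d))) * kron \<phi> (1\<^sub>m ?d))"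
    using V XV by (simp add: mult_assoc_dim F.F_id)
  also have "J ?VX V * kron ?Fc (F1 V V (1\<^sub>m ?d)) = F1 V ?T (kron (coevm V) (1\<^sub>m ?d)) * J \<I> V"
    using J_nat[of \<I> ?VX V V "coevm V" "1\<^sub>m ?d"] V XV coev D.TH.unit_tensor[OF V] T by (simp add: rep_hom_one)
  also have "F1 ?T V (kron (1\<^sub>m ?d) (evm V)) * (F1 V ?T (kron (coevm V) (1\<^sub>m ?d)) * J \<I> V * kron \<phi> (1\<^sub>m ?d)) =
    F1 ?T V (kron (1\<^sub>m ?d) (evm V)) * F1 V ?T (kron (coevm V) (1\<^sub>m ?d))"
    using V XV Tr ke kc by (simp add: mult_assoc_dim J_unit del: kron_one)
  also have "\<dots> = F1 V V (kron (1\<^sub>m ?d) (evm V) * kron (coevm V) (1\<^sub>m ?d))"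
    by (rule F.F_comp[OF V Tr V kc ke, symmetric])
  also have "kron (1\<^sub>m ?d) (evm V) * kron (coevm V) (1\<^sub>m ?d) = 1\<^sub>m ?d" by (subst zigzag_mat) auto
  finally show ?thesis using V by (simp add: F.F_id)
qed

end

section \<open>Naturality and traces of the transported pairings\<close>

context tensor_equiv
begin

text \<open>Before transport both sides are the pairing (\<xi>, v) \<mapsto> \<xi>(f v); naturality
  of J moves F past the tensor products.\<close>

lemma evF_natural:
  assumes V: "V \<in> reps D.H" "W \<in> reps D.H" and f: "f \<in> rep_hom D.H V W"
  shows "evF V * kron (F1 (D.dual W) (D.dual V) f\<^sup>T) (1\<^sub>m (rdim V)) = evF W * kron (1\<^sub>m (rdim W)) (F1 V W f)"
proof -
  note [simp] = rep_hom_dim[OF f]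
  let ?X = "D.dual V" and ?Z = "D.dual W"
  let ?XV = "rep_tensor D.H ?X V" and ?ZV = "rep_tensor D.H ?Z V" and ?ZW = "rep_tensor D.H ?Z W"
  have r: "?X \<in> reps D.H" "?Z \<in> reps D.H" "?XV \<in> reps D.H" "?ZV \<in> reps D.H" "?ZW \<in> reps D.H" using V by auto
  note ft = D.dual_hom[OF V f]
  note e = D.ev_hom[OF V(1)] D.ev_hom[OF V(2)]
  have one: "1\<^sub>m (rdim V) \<in> rep_hom D.H V V" "1\<^sub>m (rdim W) \<in> rep_hom D.H ?Z ?Z"
    using rep_hom_one[OF V(1)] rep_hom_one[OF r(2)] by simp_all
  have k: "kron f\<^sup>T (1\<^sub>m (rdim V)) \<in> rep_hom D.H ?ZV ?XV" "kron (1\<^sub>m (rdim W)) f \<in> rep_hom D.H ?ZV ?ZW"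
    by (intro kron_rep_hom V r ft f one)+
  have "evF V * kron (F1 ?Z ?X f\<^sup>T) (1\<^sub>m (rdim V)) =
    \<phi>i * (F1 ?XV \<I> (evm V) * (J ?X V * kron (F1 ?Z ?X f\<^sup>T) (F1 V V (1\<^sub>m (rdim V)))))"
    using V r ft e by (simp add: evF_def mult_assoc_dim F.F_id)
  also have "J ?X V * kron (F1 ?Z ?X f\<^sup>T) (F1 V V (1\<^sub>m (rdim V))) = F1 ?ZV ?XV (kron f\<^sup>T (1\<^sub>m (rdim V))) * J ?Z V"
    by (rule J_nat[OF r(2,1) V(1,1) ft one(1)])
  also have "\<phi>i * (F1 ?XV \<I> (evm V) * \<dots>) = \<phi>i * (F1 ?ZV \<I> (evm V * kron f\<^sup>T (1\<^sub>m (rdim V))) * J ?Z V)"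
    using V r e k by (simp add: F.F_comp[OF r(4,3) D.TH.unit_rep k(1) e(1)] mult_assoc_dim)
  also have "evm V * kron f\<^sup>T (1\<^sub>m (rdim V)) = evm W * kron (1\<^sub>m (rdim W)) f"
    by (simp add: rowm_kron)
  also have "\<phi>i * (F1 ?ZV \<I> (evm W * kron (1\<^sub>m (rdim W)) f) * J ?Z V) =
    \<phi>i * (F1 ?ZW \<I> (evm W) * (F1 ?ZV ?ZW (kron (1\<^sub>m (rdim W)) f) * J ?Z V))"
    using V r e k by (simp add: F.F_comp[OF r(4,5) D.TH.unit_rep k(2) e(2)] mult_assoc_dim)
  also have "F1 ?ZV ?ZW (kron (1\<^sub>m (rdim W)) f) * J ?Z V = J ?Z W * kron (F1 ?Z ?Z (1\<^sub>m (rdim W))) (F1 V W f)"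
    by (rule J_nat[OF r(2,2) V one(2) f, symmetric])
  also have "F1 ?Z ?Z (1\<^sub>m (rdim W)) = 1\<^sub>m (rdim W)" using F.F_id[OF r(2)] r V by simp
  also have "\<phi>i * (F1 ?ZW \<I> (evm W) * (J ?Z W * kron (1\<^sub>m (rdim W)) (F1 V W f))) = evF W * kron (1\<^sub>m (rdim W)) (F1 V W f)"
    using V r f e by (simp add: evF_def mult_assoc_dim)
  finally show ?thesis .
qed

text \<open>J cancels against its inverse, leaving F applied to an endomorphism of the unit object.
  That endomorphism is the scalar tr f, and a linear functor preserves scalars. The equality of V
  with its dual makes the composite well-formed.\<close>

lemma evF_trace:
  assumes V: "V \<in> reps D.H" and VV: "D.dual V = V" and f: "f \<in> rep_hom D.H V V"
  shows "evF V * (kron (1\<^sub>m (rdim V)) (F1 V V f) * coevF V) = tr f \<cdot>\<^sub>m 1\<^sub>m (Suc 0)"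
proof -
  note [simp] = rep_hom_dim[OF f]
  let ?T = "rep_tensor D.H V V" and ?k = "kron (1\<^sub>m (rdim V)) f"
  have T: "?T \<in> reps D.H" using V by simp
  have e: "evm V \<in> rep_hom D.H ?T \<I>" "coevm V \<in> rep_hom D.H \<I> ?T"
    using D.ev_hom[OF V] D.coev_hom[OF V] by (simp_all add: VV)
  have k: "?k \<in> rep_hom D.H ?T ?T" by (intro kron_rep_hom V f rep_hom_one)
  have ek: "evm V * ?k \<in> rep_hom D.H ?T \<I>" by (rule rep_hom_comp[OF T T D.TH.unit_rep k e(1)])
  have "evF V * (kron (1\<^sub>m (rdim V)) (F1 V V f) * coevF V) =
    \<phi>i * (F1 ?T \<I> (evm V) * ((J V V * kron (F1 V V (1\<^sub>m (rdim V))) (F1 V V f)) * (Ji V V * (F1 \<I> ?T (coevm V) * \<phi>))))"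
    using V T e f by (simp add: evF_def coevF_def VV mult_assoc_dim F.F_id)
  also have "J V V * kron (F1 V V (1\<^sub>m (rdim V))) (F1 V V f) = F1 ?T ?T ?k * J V V"
    by (rule J_nat[OF V V V V rep_hom_one[OF V] f])
  also have "F1 ?T ?T ?k * J V V * (Ji V V * (F1 \<I> ?T (coevm V) * \<phi>)) = F1 ?T ?T ?k * (F1 \<I> ?T (coevm V) * \<phi>)"
    using V T e k by (simp add: mult_assoc_dim mult_cancel_left[OF Ji(3)[OF V V]])
  also have "F1 ?T \<I> (evm V) * (F1 ?T ?T ?k * (F1 \<I> ?T (coevm V) * \<phi>)) = F1 \<I> \<I> (evm V * ?k * coevm V) * \<phi>"
    unfolding F.F_comp[OF D.TH.unit_rep T D.TH.unit_rep e(2) ek] F.F_comp[OF T T D.TH.unit_rep k e(1)]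
    using V T e k by (simp add: mult_assoc_dim)
  also have "evm V * ?k * coevm V = tr f \<cdot>\<^sub>m 1\<^sub>m (rdim \<I>)"
    by (simp add: rowm_kron rowm_vecm tr_transpose)
  also have "F1 \<I> \<I> (tr f \<cdot>\<^sub>m 1\<^sub>m (rdim \<I>)) = tr f \<cdot>\<^sub>m 1\<^sub>m (Suc 0)"
    using F.F_smult[OF D.TH.unit_rep D.TH.unit_rep rep_hom_one[OF D.TH.unit_rep]] F.F_id[OF D.TH.unit_rep] by simp
  also have "\<phi>i * (tr f \<cdot>\<^sub>m 1\<^sub>m (Suc 0) * \<phi>) = tr f \<cdot>\<^sub>m 1\<^sub>m (Suc 0)"
    by (simp add: smult_mult_dim mult_smult_dim \<phi>)
  finally show ?thesis .
qed

text \<open>Rewriting the transported pairing and copairing as square matrices turns contraction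
  into matrix multiplication.\<close>

definition evQ :: "(nat \<times> 'g, 'k) rep \<Rightarrow> 'k mat"
  where "evQ V = (SOME X. dim_row X = rdim V \<and> dim_col X = rdim V \<and> rowm X = evF V)"

definition coevQ :: "(nat \<times> 'g, 'k) rep \<Rightarrow> 'k mat"
  where "coevQ V = (SOME X. dim_row X = rdim V \<and> dim_col X = rdim V \<and> vecm X = coevF V)"

lemma evQ:
  assumes V: "V \<in> reps D.H"
  shows "dim_row (evQ V) = rdim V" "dim_col (evQ V) = rdim V" "rowm (evQ V) = evF V"
    "dim_row (coevQ V) = rdim V" "dim_col (coevQ V) = rdim V" "vecm (coevQ V) = coevF V"
proof -
  have "\<exists>X. dim_row X = rdim V \<and> dim_col X = rdim V \<and> rowm X = evF V"
    using V by (metis dim_evF(1,2) rowm_surj)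
  from someI_ex[OF this, folded evQ_def]
  show "dim_row (evQ V) = rdim V" "dim_col (evQ V) = rdim V" "rowm (evQ V) = evF V" by auto
  have "\<exists>X. dim_row X = rdim V \<and> dim_col X = rdim V \<and> vecm X = coevF V"
    using V by (metis dim_evF(3,4) vecm_surj)
  from someI_ex[OF this, folded coevQ_def]
  show "dim_row (coevQ V) = rdim V" "dim_col (coevQ V) = rdim V" "vecm (coevQ V) = coevF V" by auto
qed

lemma dim_evQ [simp]:
  assumes V: "V \<in> reps D.H"
  shows "dim_row (evQ V) = rdim V" "dim_col (evQ V) = rdim V" "dim_row (coevQ V) = rdim V" "dim_col (coevQ V) = rdim V"
  using evQ[OF V] by auto

lemma coevQ_evQ: "V \<in> reps D.H \<Longrightarrow> coevQ V * evQ V = 1\<^sub>m (rdim V)"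
  using zigzag[of V] zigzag_mat[of "coevQ V" "rdim V" "evQ V"] by (simp add: evQ)

lemma evQ_natural:
  assumes V: "V \<in> reps D.H" "W \<in> reps D.H" and f: "f \<in> rep_hom D.H V W"
  shows "(F1 (D.dual W) (D.dual V) f\<^sup>T)\<^sup>T * evQ V = evQ W * F1 V W f"
proof (rule rowm_inj)
  note [simp] = rep_hom_dim[OF f]
  note ft = D.dual_hom[OF V f]
  have "rowm ((F1 (D.dual W) (D.dual V) f\<^sup>T)\<^sup>T * evQ V) = evF V * kron (F1 (D.dual W) (D.dual V) f\<^sup>T) (1\<^sub>m (rdim V))"
    using V ft by (simp add: rowm_kron flip: evQ(3))
  also have "\<dots> = evF W * kron (1\<^sub>m (rdim W)) (F1 V W f)" by (rule evF_natural[OF V f])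
  also have "\<dots> = rowm (evQ W * F1 V W f)" using V f by (simp add: rowm_kron flip: evQ(3))
  finally show "rowm ((F1 (D.dual W) (D.dual V) f\<^sup>T)\<^sup>T * evQ V) = rowm (evQ W * F1 V W f)" .
qed (use V f D.dual_hom[OF V f] in auto)

lemma evQ_trace:
  assumes V: "V \<in> reps D.H" and VV: "D.dual V = V" and f: "f \<in> rep_hom D.H V V"
  shows "tr ((evQ V * F1 V V f)\<^sup>T * coevQ V) = tr f"
proof -
  have "rowm (evQ V * F1 V V f) = evF V * kron (1\<^sub>m (rdim V)) (F1 V V f)"
    using V f by (simp add: rowm_kron flip: evQ(3))
  then have "rowm (evQ V * F1 V V f) * vecm (coevQ V) = tr f \<cdot>\<^sub>m 1\<^sub>m (Suc 0)"
    using V f by (simp add: evF_trace[OF V VV f] mult_assoc_dim evQ(6))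
  moreover have "rowm (evQ V * F1 V V f) * vecm (coevQ V) = tr ((evQ V * F1 V V f)\<^sup>T * coevQ V) \<cdot>\<^sub>m 1\<^sub>m (Suc 0)"
    using V f by (intro rowm_vecm) auto
  ultimately have "(tr ((evQ V * F1 V V f)\<^sup>T * coevQ V) \<cdot>\<^sub>m 1\<^sub>m (Suc 0)) $$ (0, 0) = (tr f \<cdot>\<^sub>m 1\<^sub>m (Suc 0)) $$ (0, 0)" by simp
  then show ?thesis by simp
qed

lemma evQ_hom: "V \<in> reps D.H \<Longrightarrow> (evQ V)\<^sup>T \<in> rep_hom E.H (F0 (D.dual V)) (E.dual (F0 V))"
  by (rule E.pairing_hom) (use evF_hom in \<open>auto simp: evQ\<close>)

text \<open>The transported evaluation and coevaluation, read as operators on the underlying space of \<open>V\<close>.\<close>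

definition opQ :: "(nat \<times> 'g, 'k) rep \<Rightarrow> 'k mat"
  where "opQ V = (\<theta> (D.dual V))\<^sup>T * (evQ V * \<theta> V)"

definition opB :: "(nat \<times> 'g, 'k) rep \<Rightarrow> 'k mat"
  where "opB V = \<theta>i V * (coevQ V * (\<theta>i (D.dual V))\<^sup>T)"

lemma dim_op [simp]:
  assumes "V \<in> reps D.H"
  shows "dim_row (opQ V) = rdim V" "dim_col (opQ V) = rdim V" "dim_row (opB V) = rdim V" "dim_col (opB V) = rdim V"
  using assms by (simp_all add: opQ_def opB_def)

lemma opB_opQ:
  assumes V: "V \<in> reps D.H"
  shows "opB V * opQ V = 1\<^sub>m (rdim V)" "opQ V * opB V = 1\<^sub>m (rdim V)"
proof -
  have "opB V * opQ V = \<theta>i V * (coevQ V * ((\<theta>i (D.dual V))\<^sup>T * ((\<theta> (D.dual V))\<^sup>T * (evQ V * \<theta> V))))"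
    using V by (simp add: opB_def opQ_def mult_assoc_dim)
  also have "(\<theta>i (D.dual V))\<^sup>T * ((\<theta> (D.dual V))\<^sup>T * (evQ V * \<theta> V)) = evQ V * \<theta> V"
    using V by (intro \<theta>_cancel) auto
  also have "coevQ V * (evQ V * \<theta> V) = \<theta> V"
    using V by (intro mult_cancel_left[OF coevQ_evQ]) auto
  finally show 1: "opB V * opQ V = 1\<^sub>m (rdim V)" using V by simp
  show "opQ V * opB V = 1\<^sub>m (rdim V)" by (rule square_inverse_comm[OF 1]) (use V in auto)
qed

text \<open>\<theta> converts F(f) into f, once on V and once, transposed, on the duals;
  \<open>evQ_natural\<close> links the two. By \<open>natural_op_eq\<close> the operator is then
  multiplication by an element q of H.\<close>

lemma opQ_natural: "D.natural_op opQ"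
  unfolding D.natural_op_def
proof (intro conjI ballI)
  fix V W f assume V: "V \<in> reps D.H" "W \<in> reps D.H" and f: "f \<in> rep_hom D.H V W"
  note [simp] = rep_hom_dim[OF f]
  note ft = D.dual_hom[OF V f]
  have "opQ W * f = (\<theta> (D.dual W))\<^sup>T * (evQ W * (\<theta> W * f))" using V by (simp add: opQ_def mult_assoc_dim)
  also have "\<theta> W * f = F1 V W f * \<theta> V" by (rule \<theta>_natural[OF V f])
  also have "(\<theta> (D.dual W))\<^sup>T * (evQ W * (F1 V W f * \<theta> V)) = (\<theta> (D.dual W))\<^sup>T * ((evQ W * F1 V W f) * \<theta> V)"
    using V f by (simp add: mult_assoc_dim)
  also have "evQ W * F1 V W f = (F1 (D.dual W) (D.dual V) f\<^sup>T)\<^sup>T * evQ V" by (rule evQ_natural[OF V f, symmetric])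
  also have "(\<theta> (D.dual W))\<^sup>T * ((F1 (D.dual W) (D.dual V) f\<^sup>T)\<^sup>T * evQ V * \<theta> V) =
    (F1 (D.dual W) (D.dual V) f\<^sup>T * \<theta> (D.dual W))\<^sup>T * (evQ V * \<theta> V)"
    using V ft by (simp add: transpose_mult_dim mult_assoc_dim)
  also have "F1 (D.dual W) (D.dual V) f\<^sup>T * \<theta> (D.dual W) = \<theta> (D.dual V) * f\<^sup>T"
    using V ft by (intro \<theta>_natural[symmetric]) auto
  finally show "opQ W * f = f * opQ V" using V by (simp add: opQ_def transpose_mult_dim mult_assoc_dim)
qed auto

text \<open>The inverse of a natural automorphism is natural.\<close>

lemma opB_natural: "D.natural_op opB"
  unfolding D.natural_op_def
proof (intro conjI ballI)
  fix V W f assume V: "V \<in> reps D.H" "W \<in> reps D.H" and f: "f \<in> rep_hom D.H V W"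
  note [simp] = rep_hom_dim[OF f]
  have Q: "opQ W * f = f * opQ V" using opQ_natural V f unfolding D.natural_op_def by blast
  have "opB W * f = opB W * (f * (opQ V * opB V))" using V by (simp add: opB_opQ)
  also have "\<dots> = opB W * ((opQ W * f) * opB V)" using V by (simp add: Q mult_assoc_dim)
  also have "\<dots> = f * opB V" using V by (simp add: mult_assoc_dim mult_cancel_left[OF opB_opQ(1)])
  finally show "opB W * f = f * opB V" .
qed auto

text \<open>On V = kG the operators of q and b are combinations of group elements. For right
  translation f by x, the trace of \<open>(opQ V * f)\<^sup>T * opB V\<close> is computed twice: by
  counting, and, once the factors \<theta> cancel, as tr f by \<open>evQ_trace\<close>. The
  comparison is the hypothesis of \<open>sclass_average\<close>.\<close>

lemma gcoef_sum:
  "(\<Sum>l\<in>carrier G. \<Sum>l'\<in>carrier G. D.gcoef (opB D.reg * D.u) l * D.gcoef (opQ D.reg * D.u) l' * D.sclass (inv l' \<otimes> l)) = D.sclass \<one>"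
proof (rule D.sclass_average)
  fix x assume x: "x \<in> carrier G"
  let ?V = "D.infl D.Kreg" and ?f = "D.rtrans x"
  have V: "?V \<in> reps D.H" by (rule D.infl(1)[OF D.Kreg])
  have f: "?f \<in> rep_hom D.H ?V ?V" by (rule D.infl_hom[OF D.Kreg D.Kreg D.rtrans_hom[OF x]])
  note VV = D.dual_infl_Kreg
  have Q: "opQ ?V = D.actv ?V (opQ D.reg * D.u)" by (rule D.natural_op_eq[OF opQ_natural V])
  have B: "opB ?V = D.actv ?V (opB D.reg * D.u)" by (rule D.natural_op_eq[OF opB_natural V])
  let ?D = "evQ ?V * F1 ?V ?V ?f"
  have dD: "dim_row ?D = rdim ?V" "dim_col ?D = rdim ?V" using V f by auto
  note [simp] = rep_hom_dim[OF f]
  have tl: "(A\<^sup>T * (X * A))\<^sup>T = A\<^sup>T * X\<^sup>T * A"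
    if "dim_row X = dim_row A" "dim_col X = dim_row A" for A X :: "'k mat"
    using that by (simp add: transpose_mult_dim mult_assoc_dim)
  have "opQ ?V * ?f = (\<theta> ?V)\<^sup>T * (evQ ?V * (\<theta> ?V * ?f))" using V by (simp add: opQ_def VV mult_assoc_dim)
  also have "\<dots> = (\<theta> ?V)\<^sup>T * (?D * \<theta> ?V)" using V f by (simp add: \<theta>_natural[OF V V f] mult_assoc_dim)
  finally have Qf: "opQ ?V * ?f = (\<theta> ?V)\<^sup>T * (?D * \<theta> ?V)" .
  have "(opQ ?V * ?f)\<^sup>T * opB ?V = ((\<theta> ?V)\<^sup>T * ?D\<^sup>T * \<theta> ?V) * (\<theta>i ?V * (coevQ ?V * (\<theta>i ?V)\<^sup>T))"
    unfolding Qf opB_def VV by (subst tl) (use V f in auto)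
  also have "\<dots> = (\<theta> ?V)\<^sup>T * (?D\<^sup>T * coevQ ?V * (\<theta>i ?V)\<^sup>T)"
    using V dD by (simp add: mult_assoc_dim \<theta>_cancel del: index_mult_mat(2,3)) (simp add: mult_assoc_dim \<theta>_cancel)
  finally have "tr ((opQ ?V * ?f)\<^sup>T * opB ?V) = tr ((\<theta> ?V)\<^sup>T * (?D\<^sup>T * coevQ ?V * (\<theta>i ?V)\<^sup>T))" by (rule arg_cong)
  \<comment> \<open>Cyclicity of the trace brings the remaining \<theta> next to its
    inverse.\<close>
  also have "\<dots> = tr (?D\<^sup>T * coevQ ?V * (\<theta>i ?V)\<^sup>T * (\<theta> ?V)\<^sup>T)"
    by (rule tr_mult_comm) (use V f in auto)
  also have "?D\<^sup>T * coevQ ?V * (\<theta>i ?V)\<^sup>T * (\<theta> ?V)\<^sup>T = ?D\<^sup>T * coevQ ?V * ((\<theta> ?V * \<theta>i ?V)\<^sup>T)"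
    using V f by (subst transpose_mult_dim) (auto simp: mult_assoc_dim)
  also have "\<dots> = ?D\<^sup>T * coevQ ?V" using V by simp
  also have "tr (?D\<^sup>T * coevQ ?V) = tr ?f" by (rule evQ_trace[OF V VV f])
  finally have "tr ((D.actv ?V (opQ D.reg * D.u) * ?f)\<^sup>T * D.actv ?V (opB D.reg * D.u)) = tr ?f" by (simp only: Q B)
  then show "(\<Sum>l\<in>carrier G. \<Sum>l'\<in>carrier G. D.gcoef (opB D.reg * D.u) l * D.gcoef (opQ D.reg * D.u) l' *
      (\<Sum>k\<in>carrier G. if l' \<otimes> k \<otimes> x = l \<otimes> k then 1 else 0)) = (if x = \<one> then of_nat (card (carrier G)) else 0)"
    by (simp only: D.tr_actv_Kreg[OF x] D.tr_rtrans[OF x])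
qed

text \<open>Every element of the target algebra acts on the underlying space of \<open>V\<close>, naturally in
  \<open>V\<close>; this gives a linear map of the algebras which intertwines the antipodes up to conjugation.\<close>

definition T :: "'k mat" where "T = \<theta>i D.reg * I"

lemma dim_T [simp]: "dim_row T = D.Nd" "dim_col T = D.Nd"
  by (simp_all add: T_def)

text \<open>For a basis element b of the target, the conjugates of its action on F(V) by \<theta>
  are natural in V, hence given by an element of the source algebra; evaluation at 1 in the regular
  module identifies this element as the image of b under T.\<close>

lemma actv_T:
  assumes V: "V \<in> reps D.H" and c: "c < D.Nd"
  shows "D.actv V (T * ecol D.Nd c) = \<theta>i V * (rmat (F0 V) (D.bas c) * \<theta> V)"
proof -
  let ?b = "D.bas c" and ?X = "\<lambda>V. \<theta>i V * (rmat (F0 V) (D.bas c) * \<theta> V)"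
  have b: "?b \<in> basis E.H" using E.bas(3)[OF c] by simp
  have dR: "dim_row (rmat (F0 V) ?b) = rdim V" "dim_col (rmat (F0 V) ?b) = rdim V" if "V \<in> reps D.H" for V
    using reps_dim[OF F.F0[OF that] b] that by auto
  have nat: "D.natural_op ?X"
    unfolding D.natural_op_def
  proof (intro conjI ballI)
    fix V W f assume V: "V \<in> reps D.H" "W \<in> reps D.H" and f: "f \<in> rep_hom D.H V W"
    note [simp] = rep_hom_dim[OF f]
    have "?X W * f = \<theta>i W * (rmat (F0 W) ?b * (\<theta> W * f))" using V dR by (simp add: mult_assoc_dim)
    also have "\<dots> = \<theta>i W * ((rmat (F0 W) ?b * F1 V W f) * \<theta> V)"
      using V f dR by (simp add: \<theta>_natural[OF V f] mult_assoc_dim)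
    also have "rmat (F0 W) ?b * F1 V W f = F1 V W f * rmat (F0 V) ?b"
      by (rule rep_homD[OF F.F1[OF V f] b])
    also have "\<theta>i W * (F1 V W f * rmat (F0 V) ?b * \<theta> V) = \<theta>i W * ((F1 V W f * \<theta> V) * (\<theta>i V * (rmat (F0 V) ?b * \<theta> V)))"
      using V f dR by (simp add: mult_assoc_dim \<theta>_cancel)
    also have "F1 V W f * \<theta> V = \<theta> W * f" by (rule \<theta>_natural[OF V f, symmetric])
    also have "\<theta>i W * (\<theta> W * f * (\<theta>i V * (rmat (F0 V) ?b * \<theta> V))) = f * ?X V"
      using V dR by (simp add: mult_assoc_dim \<theta>_cancel)
    finally show "?X W * f = f * ?X V" .
  qed (use dR in auto)
  have "?X D.reg * D.u = \<theta>i D.reg * (rmat (F0 D.reg) ?b * (\<theta> D.reg * D.u))" using dR[of D.reg] by (simp add: mult_assoc_dim)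
  also have "\<dots> = \<theta>i D.reg * ((rmat (F0 D.reg) ?b * I) * E.u)" using dR[of D.reg] by (simp add: \<theta>_reg mult_assoc_dim)
  also have "rmat (F0 D.reg) ?b * I = I * rmat E.reg ?b" by (rule rep_homD[OF I(1) b])
  also have "\<theta>i D.reg * (I * rmat E.reg ?b * E.u) = \<theta>i D.reg * (I * (rmat E.reg ?b * E.u))"
    using reps_dim[OF E.reg(1) b] by (simp add: mult_assoc_dim)
  also have "rmat E.reg ?b * E.u = ecol D.Nd c" using E.rmat_reg_u[OF c] by simp
  finally have "?X D.reg * D.u = T * ecol D.Nd c" by (simp add: T_def mult_assoc_dim)
  then show ?thesis using D.natural_op_eq[OF nat V] by simp
qed

abbreviation antE :: "nat \<Rightarrow> 'k mat" where "antE c \<equiv> (rmat (E.dual E.reg) (D.bas c))\<^sup>T * E.u"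

text \<open>With S and S' the antipodes of source and target, this is S(T x) q = q T(S'(x)). The
  transported pairing is a homomorphism from F of the dual to the dual of F, so it exchanges the
  actions through the two antipodes.\<close>

lemma antipode_transport:
  assumes c: "c < D.Nd"
  shows "(D.actv (D.dual D.reg) (T * ecol D.Nd c))\<^sup>T * (opQ D.reg * D.u) = opQ D.reg * (T * antE c)"
proof -
  let ?b = "D.bas c" and ?R = "D.reg" and ?S = "D.dual D.reg"
  let ?M1 = "rmat (F0 ?S) ?b" and ?M2 = "rmat (E.dual (F0 ?R)) ?b" and ?M3 = "rmat (E.dual E.reg) ?b"
  have b: "?b \<in> basis E.H" using E.bas(3)[OF c] by simp
  have dM [simp]: "dim_row ?M1 = D.Nd" "dim_col ?M1 = D.Nd" "dim_row ?M2 = D.Nd" "dim_col ?M2 = D.Nd"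
    "dim_row ?M3 = D.Nd" "dim_col ?M3 = D.Nd"
    using reps_dim[of "F0 ?S" E.H ?b] reps_dim[of "E.dual (F0 ?R)" E.H ?b] reps_dim[of "E.dual E.reg" E.H ?b] b by auto
  have "(?M2 * (evQ ?R)\<^sup>T)\<^sup>T = ((evQ ?R)\<^sup>T * ?M1)\<^sup>T" using rep_homD[OF evQ_hom b, of ?R] by simp
  then have 1: "?M1\<^sup>T * evQ ?R = evQ ?R * ?M2\<^sup>T" by (simp add: transpose_mult_dim)
  have It: "I\<^sup>T \<in> rep_hom E.H (E.dual (F0 ?R)) (E.dual E.reg)" by (rule E.dual_hom[OF E.reg(1) _ I(1)]) simp
  have "(?M3 * I\<^sup>T)\<^sup>T = (I\<^sup>T * ?M2)\<^sup>T" using rep_homD[OF It b] by simp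
  then have 2: "?M2\<^sup>T * I = I * ?M3\<^sup>T" by (simp add: transpose_mult_dim)
  have "(D.actv ?S (T * ecol D.Nd c))\<^sup>T = (\<theta> ?S)\<^sup>T * (?M1\<^sup>T * (\<theta>i ?S)\<^sup>T)"
    using c by (simp add: actv_T transpose_mult_dim mult_assoc_dim)
  then have "(D.actv ?S (T * ecol D.Nd c))\<^sup>T * (opQ ?R * D.u) = (\<theta> ?S)\<^sup>T * (?M1\<^sup>T * (evQ ?R * (\<theta> ?R * D.u)))"
    by (simp add: opQ_def mult_assoc_dim \<theta>_cancel)
  also have "\<dots> = (\<theta> ?S)\<^sup>T * ((?M1\<^sup>T * evQ ?R) * p)" by (simp add: \<theta>_reg mult_assoc_dim)
  also have "(?M1\<^sup>T * evQ ?R) * p = evQ ?R * ((?M2\<^sup>T * I) * E.u)" unfolding 1 by (simp add: mult_assoc_dim)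
  also have "(?M2\<^sup>T * I) * E.u = I * antE c" unfolding 2 by (simp add: mult_assoc_dim)
  also have "(\<theta> ?S)\<^sup>T * (evQ ?R * (I * antE c)) = opQ ?R * (T * antE c)"
    by (simp add: opQ_def T_def mult_assoc_dim \<theta>_cancel)
  finally show ?thesis .
qed

text \<open>Z is the matrix of x \<mapsto> S(x) q and W that of S'. From Z T = q T W one gets W =
  T^{-1} b Z T, so the trace of S' is that of x \<mapsto> b S(x) q, which is the trace of S by
  \<open>gcoef_sum\<close>.\<close>

lemma sclass_one_eq: "E.sclass \<one> = D.sclass \<one>"
proof -
  let ?S = "D.dual D.reg" and ?q = "opQ D.reg * D.u" and ?B = "opB D.reg" and ?N = D.Nd
  let ?f = "\<lambda>c. (rmat ?S (D.bas c))\<^sup>T * ?q"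
  define Z where "Z = colm ?N ?f"
  define W where "W = colm ?N antE"
  have Zd [simp]: "dim_row Z = ?N" "dim_col Z = ?N" "dim_row W = ?N" "dim_col W = ?N" by (simp_all add: Z_def W_def)
  have df: "dim_row (?f c) = ?N \<and> dim_col (?f c) = Suc 0" if "c < ?N" for c
    using reps_dim[of ?S D.H "D.bas c"] D.bas(3)[OF that] by simp
  have dE: "dim_row (antE c) = ?N \<and> dim_col (antE c) = Suc 0" if "c < ?N" for c
    using reps_dim[of "E.dual E.reg" E.H "D.bas c"] E.bas(3)[OF that] by simp
  have ZT: "Z * T = opQ D.reg * (T * W)"
  proof (rule mat_eqI_ecol)
    fix c assume c: "c < ?N"
    let ?x = "T * ecol ?N c"
    have "Z * ?x = Z * lincomb ?N 1 {..<?N} (\<lambda>i. ?x $$ (i, 0)) (\<lambda>i. ecol ?N i)"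
      by (rule arg_cong[of _ _ "\<lambda>A. Z * A"], rule D.col_lincomb) auto
    also have "\<dots> = lincomb ?N 1 {..<?N} (\<lambda>i. ?x $$ (i, 0)) (\<lambda>i. Z * ecol ?N i)" by (subst mult_lincomb) auto
    also have "\<dots> = lincomb ?N 1 {..<?N} (\<lambda>i. ?x $$ (i, 0)) ?f"
      using df by (intro lincomb_mat_cong) (simp add: Z_def colm_ecol)
    also have "\<dots> = (D.actv ?S ?x)\<^sup>T * ?q" using D.actv_transpose_mult[of ?S ?q ?x] by simp
    also have "\<dots> = opQ D.reg * (T * antE c)" by (rule antipode_transport[OF c])
    also have "antE c = W * ecol ?N c" using colm_ecol[of c ?N antE] c dE by (simp add: W_def)
    finally show "Z * T * ecol ?N c = opQ D.reg * (T * W) * ecol ?N c" by (simp add: mult_assoc_dim)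
  qed auto
  obtain k where k: "k \<in> rep_hom E.H (F0 D.reg) E.reg" "k * I = 1\<^sub>m ?N" "I * k = 1\<^sub>m ?N" using I(2) by blast
  note [simp] = rep_hom_dim[OF k(1)]
  define Ti where "Ti = k * \<theta> D.reg"
  have Tid [simp]: "dim_row Ti = ?N" "dim_col Ti = ?N" by (simp_all add: Ti_def)
  have Ti: "Ti * T = 1\<^sub>m ?N" by (simp add: Ti_def T_def mult_assoc_dim \<theta>_cancel k)
  have Ti': "T * Ti = 1\<^sub>m ?N" by (rule square_inverse_comm[OF Ti]) auto
  have "E.sclass \<one> = (\<Sum>c<?N. antE c $$ (c, 0))" using E.trace_antipode_one by simp
  also have "\<dots> = tr W" by (simp add: tr_def W_def colm_def)
  also have "W = Ti * (T * W)" by (simp add: mult_cancel_left[OF Ti])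
  also have "T * W = ?B * (opQ D.reg * (T * W))" by (simp add: mult_cancel_left[OF opB_opQ(1)])
  also have "opQ D.reg * (T * W) = Z * T" by (rule ZT[symmetric])
  also have "tr (Ti * (?B * (Z * T))) = tr (?B * (Z * T) * Ti)" by (rule tr_mult_comm) auto
  also have "?B * (Z * T) * Ti = ?B * Z" by (simp add: mult_assoc_dim Ti')
  also have "tr (?B * Z) = (\<Sum>c<?N. (?B * ?f c) $$ (c, 0))" unfolding Z_def using df by (intro tr_mult_colm) auto
  also have "\<dots> = (\<Sum>c<?N. (D.actv D.reg (?B * D.u) * ?f c) $$ (c, 0))"
    using D.natural_op_eq[OF opB_natural D.reg(1)] by simp
  also have "\<dots> = D.sclass \<one>"
    unfolding gcoef_sum[symmetric] by (rule D.trace_antipode) auto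
  finally show ?thesis .
qed

end

theorem not_tensor_equivalent:
  fixes G :: "('g, 'm) monoid_scheme" and \<chi> \<chi>' :: "'g \<Rightarrow> 'k::field_char_0"
  assumes D: "datum G \<chi> g n" and E: "datum G \<chi>' g n"
    and "char_lin G \<chi> (theta G g n) \<noteq> char_lin G \<chi>' (theta G g n)"
  shows "\<not> tensor_equivalent (rep_cat (datum_hopf G \<chi> g)) (rep_cat (datum_hopf G \<chi>' g))"
proof
  interpret D: datum G \<chi> g n by (rule D)
  interpret E: datum G \<chi>' g n by (rule E)
  assume "tensor_equivalent (rep_cat (datum_hopf G \<chi> g)) (rep_cat (datum_hopf G \<chi>' g))"
  then obtain F0 F1 J \<phi> where "equivalence_functor (rep_cat D.H) (rep_cat E.H) F0 F1"
    "tensor_structure (rep_cat D.H) (rep_cat E.H) F0 F1 J \<phi>" unfolding tensor_equivalent_def by blast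
  then interpret T: tensor_equiv G \<chi> \<chi>' g n F0 F1 J \<phi> by unfold_locales
  show False using T.sclass_one_eq assms(3) by (simp add: D.sclass_one_eq E.sclass_one_eq)
qed

theorem proposition4p6:
  fixes G :: "('g, 'm) monoid_scheme"
    and \<chi> \<chi>' :: "'g \<Rightarrow> 'k::{alg_closed_field, field_char_0}"
    and g :: 'g and n :: nat
    and \<delta> :: "(('g, 'k) rep set \<Rightarrow>\<^sub>0 int) set \<Rightarrow> (('g, 'k) rep set \<Rightarrow>\<^sub>0 int) set"
  assumes "nilpotent_group_datum G \<chi> g" and "nilpotent_group_datum G \<chi>' g"
    and "mult_order (\<chi> g) = n" and "mult_order (\<chi>' g) = n" and "n \<ge> 2"
    and "char_lin G \<chi> (theta G g n) \<noteq> char_lin G \<chi>' (theta G g n)"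
    and "\<delta> \<in> ring_iso (green_ring (group_algebra G)) (green_ring (group_algebra G))"
    and "\<delta> (green_class (group_algebra G) (char_rep G (\<lambda>h. inverse (\<chi> h))))
         = green_class (group_algebra G) (char_rep G (\<lambda>h. inverse (\<chi>' h)))"
  shows "\<not> tensor_equivalent (rep_cat (datum_hopf G \<chi> g)) (rep_cat (datum_hopf G \<chi>' g))
    \<and> green_ring (datum_hopf G \<chi> g) \<simeq> green_ring (datum_hopf G \<chi>' g)"
proof -
  have "group G" using assms(1) by (simp add: nilpotent_group_datum_def)
  then have D: "datum G \<chi> g n" and E: "datum G \<chi>' g n"
    using assms(1-5) by (simp_all add: datum_def datum_axioms_def)
  show ?thesis
    by (intro conjI not_tensor_equivalent[OF D E assms(6)] green_rings_iso[OF D E assms(7,8)])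
qed

end
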